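(* Let $\bar u\in U_{ad}$ be a solution of the continuous problem (P), with corresponding optimal state $\bar y=y_{\bar u}$ and adjoint state $\bar p=p_{\bar u}$. Let $\bar{\mathfrak u}_\ell\in U_{ad}$ be a solution of the semidiscrete problem (P$_\ell$) on a mesh $\mathcal T_\ell\in\mathbb T$, with corresponding discrete state $\bar y_\ell$ and discrete adjoint state $\bar p_\ell$. Assume that $\frac{\partial f}{\partial y}(\cdot,y)\in L^2(\Omega)$ for all $y\in H_0^1(\Omega)$ and that $\frac{\partial f}{\partial y}(\cdot,y)$ is globally Lipschitz with respect to $y\in\mathbb R$. Then, for every $T\in\mathcal T_\ell$, $$\begin{aligned}\eta_{st,T}^2+\eta_{adj,T}^2\le C\Big[&\|\bar y-\bar y_\ell\|_{L^2(\mathcal N_T)}^2+\|\bar p-\bar p_\ell\|_{L^\infty(\mathcal N_T)}^2+h_T^{4-d}\|\bar u-\bar{\mathfrak u}_\ell\|_{L^1(\mathcal N_T)}^2\\&+\sum_{T'\in\mathcal N_T}\Big(h_T^4\|(1-\Pi_{T'})(\bar{\mathfrak u}_\ell-f(\cdot,\bar y_\ell))\|_{L^2(T')}^2+h_T^{4-d}\|(1-\Pi_{T'})(y_\Omega+\tfrac{\partial f}{\partial y}(\cdot,\bar y_\ell)\bar p_\ell)\|_{L^2(T')}^2\Big)\Big],\end{aligned}$$ where the constant $C>0$ is independent of the continuous and discrete optimal variables, of the size of the elements in the mesh $\mathcal T_\ell$, and of the number of elements $\#\mathcal T_\ell$.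
   Context: Setting. $\Omega\subset\mathbb R^d$, $d\in\{2,3\}$, is an open, bounded, convex polygonal/polyhedral domain; $y_\Omega\in L^2(\Omega)$; $a<b$ are real numbers; $U_{ad}=\{v\in L^2(\Omega): a\le v(x)\le b \text{ for a.a. }x\in\Omega\}$. $(\cdot,\cdot)_\omega$ and $\|\cdot\|_\omega$ are the inner product and norm of $L^2(\omega)$. Standing assumption on $f$: $f:\Omega\times\mathbb R\to\mathbb R$ is a Carathéodory function, of class $C^2$ in the second variable, such that for a.e. $x\in\Omega$: $f(\cdot,0)\in L^\infty(\Omega)$ and $\frac{\partial f}{\partial y}(x,y)\ge0$ for all $y\in\mathbb R$; for every $M>0$ there is $C_{f,M}>0$ with $|\frac{\partial f}{\partial y}(x,y)|+|\frac{\partial^2 f}{\partial y^2}(x,y)|\le C_{f,M}$ for all $|y|\le M$; for every $\rho>0$ and $M>0$ there is $\epsilon>0$ with $|\frac{\partial^2 f}{\partial y^2}(x,y_2)-\frac{\partial^2 f}{\partial y^2}(x,y_1)|<\rho$ whenever $|y_1|,|y_2|\le M$, $|y_2-y_1|\le\epsilon$. Continuous problem (P): minimize $J(u)=\frac12\|y_u-y_\Omega\|_\Omega^2$ over $u\in U_{ad}$, where $y_u\in H_0^1(\Omega)$ is the unique solution of $(\nabla y_u,\nabla v)_\Omega+(f(\cdot,y_u),v)_\Omega=(u,v)_\Omega$ for all $v\in H_0^1(\Omega)$. The adjoint state $p_u\in H_0^1(\Omega)$ solves $-\Delta p_u+\frac{\partial f}{\partial y}(\cdot,y_u)p_u=y_u-y_\Omega$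 in $\Omega$, $p_u=0$ on $\partial\Omega$. Discretization. $\mathbb T$ is a collection of conforming, shape regular simplicial meshes of $\bar\Omega$ that are refinements of an initial mesh $\mathcal T_0$. For $\mathcal T_\ell\in\mathbb T$: $h_T=\mathrm{diam}(T)$; $\mathcal E_\ell$ is the set of internal $(d-1)$-dimensional interelement sides; $\mathcal E_T\subset\mathcal E_\ell$ are those that are sides of $T$; $\mathcal N_T=\{T'\in\mathcal T_\ell:\mathcal E_T\cap\mathcal E_{T'}\ne\emptyset\}$, the same symbol also denoting the union of these elements; $\mathbb V_\ell=\{v\in C(\bar\Omega): v|_T\in\mathbb P_1(T)\ \forall T\in\mathcal T_\ell\}\cap H_0^1(\Omega)$. For $e=T^+\cap T^-\in\mathcal E_\ell$, $\llbracket\nabla v_\ell\cdot\mathbf n\rrbracket=\mathbf n^+\cdot\nabla v_\ell|_{T^+}+\mathbf n^-\cdot\nabla v_\ell|_{T^-}$, with $\mathbf n^\pm$ the unit exterior normals to $T^\pm$. For an element $T$, $\Pi_Tv=\frac1{|T|}\int_Tv\,dx$ is the $L^2(T)$-orthogonal projection onto constants. Semidiscrete problem (P$_\ell$): minimize $J_\ell(\mathfrak u)=\frac12\|y_\ell(\mathfrak u)-y_\Omega\|_\Omega^2$ over $\mathfrak u\in U_{ad}$, where $y_\ell(\mathfrak u)\in\mathbb V_\ell$ solves $(\nabla y_\ell(\mathfrak u),\nabla v_\ell)_\Omega+(f(\cdot,y_\ell(\mathfrak u)),v_\ell)_\Omega=(\mathfrak u,v_\ell)_\Omega$ for all $v_\ell\in\mathbb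 V_\ell$. For a solution $\bar{\mathfrak u}_\ell$: $\bar y_\ell=y_\ell(\bar{\mathfrak u}_\ell)$, and $\bar p_\ell\in\mathbb V_\ell$ solves $(\nabla v_\ell,\nabla\bar p_\ell)_\Omega+(\frac{\partial f}{\partial y}(\cdot,\bar y_\ell)\bar p_\ell,v_\ell)_\Omega=(\bar y_\ell-y_\Omega,v_\ell)_\Omega$ for all $v_\ell\in\mathbb V_\ell$. Local indicators: $\eta_{st,T}^2=h_T^4\|\bar{\mathfrak u}_\ell-f(\cdot,\bar y_\ell)\|_T^2+\sum_{e\in\mathcal E_T}h_T^3\|\llbracket\nabla\bar y_\ell\cdot\mathbf n\rrbracket\|_e^2$ and $\eta_{adj,T}=h_T^{2-\frac d2}\|\bar y_\ell-y_\Omega-\frac{\partial f}{\partial y}(\cdot,\bar y_\ell)\bar p_\ell\|_T+h_T\max_{e\in\mathcal E_T}\|\llbracket\nabla\bar p_\ell\cdot\mathbf n\rrbracket\|_{L^\infty(e)}$.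
   Formalization: The element T is always counted as a member of N_T; this changes N_T only for a mesh consisting of a single element, where the literal N_T is empty, the right-hand side is 0 and the estimate is false in general. *)

theory Defs
  imports "HOL-Analysis.Analysis" "HOL-Probability.Essential_Supremum"
begin

section \<open>Lebesgue and Sobolev spaces\<close>

text \<open>
  Elements of \<open>L\<^sup>2\<close> and \<open>H\<^sup>1\<^sub>0\<close> are represented by functions on the whole space of which only
  the restriction to the domain, up to null sets, matters. The measure argument \<open>M\<close> below is
  \<open>lebesgue_on S\<close> or the surface measure of a mesh side.
\<close>

definition L2_space :: "'a measure \<Rightarrow> ('a \<Rightarrow> real) set" where
  "L2_space M = {g \<in> borel_measurable M. integrable M (\<lambda>x. (g x)\<^sup>2)}"

text \<open>The real-valued norms are meaningful for \<open>g\<close> in \<open>L\<^sup>2\<close>, resp. \<open>L\<^sup>1\<close>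
  (a Bochner integral that does not exist is \<open>0\<close>).\<close>

definition L2_norm :: "'a measure \<Rightarrow> ('a \<Rightarrow> real) \<Rightarrow> real" where
  "L2_norm M g = sqrt (LINT x|M. (g x)\<^sup>2)"

definition L1_norm :: "'a measure \<Rightarrow> ('a \<Rightarrow> real) \<Rightarrow> real" where
  "L1_norm M g = (LINT x|M. \<bar>g x\<bar>)"

definition Linf_norm :: "'a measure \<Rightarrow> ('a \<Rightarrow> real) \<Rightarrow> ennreal" where
  "Linf_norm M g = esssup M (\<lambda>x. ennreal \<bar>g x\<bar>)"

primrec C_k :: "nat \<Rightarrow> ('a::euclidean_space \<Rightarrow> real) \<Rightarrow> bool" where
  "C_k 0 = (\<lambda>\<phi>. continuous_on UNIV \<phi>)"
| "C_k (Suc k) = (\<lambda>\<phi>. (\<forall>x. \<phi> differentiable (at x)) \<and>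
     (\<forall>i\<in>Basis. C_k k (\<lambda>x. frechet_derivative \<phi> (at x) i)))"

definition test_functions :: "('a::euclidean_space) set \<Rightarrow> ('a \<Rightarrow> real) set" where
  "test_functions \<Omega> = {\<phi>. (\<forall>k. C_k k \<phi>) \<and>
     compact (closure {x. \<phi> x \<noteq> 0}) \<and> closure {x. \<phi> x \<noteq> 0} \<subseteq> \<Omega>}"

definition weak_gradient ::
    "('a::euclidean_space) set \<Rightarrow> ('a \<Rightarrow> real) \<Rightarrow> ('a \<Rightarrow> 'a) \<Rightarrow> bool" where
  "weak_gradient \<Omega> u g \<longleftrightarrow>
     (\<forall>i\<in>Basis. (\<lambda>x. g x \<bullet> i) \<in> L2_space (lebesgue_on \<Omega>)) \<and>
     (\<forall>\<phi>\<in>test_functions \<Omega>. \<forall>i\<in>Basis.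
        (LINT x|lebesgue_on \<Omega>. u x * frechet_derivative \<phi> (at x) i) =
        - (LINT x|lebesgue_on \<Omega>. (g x \<bullet> i) * \<phi> x))"

definition H1_space :: "('a::euclidean_space) set \<Rightarrow> ('a \<Rightarrow> real) set" where
  "H1_space \<Omega> = {u \<in> L2_space (lebesgue_on \<Omega>). \<exists>g. weak_gradient \<Omega> u g}"

text \<open>The weak gradient of an element of \<open>H\<^sup>1\<close>; it is unique up to null sets.\<close>

definition grad :: "('a::euclidean_space) set \<Rightarrow> ('a \<Rightarrow> real) \<Rightarrow> 'a \<Rightarrow> 'a" where
  "grad \<Omega> u = (SOME g. weak_gradient \<Omega> u g)"

definition H1_norm :: "('a::euclidean_space) set \<Rightarrow> ('a \<Rightarrow> real) \<Rightarrow> real" where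
  "H1_norm \<Omega> u = sqrt ((LINT x|lebesgue_on \<Omega>. (u x)\<^sup>2) + (LINT x|lebesgue_on \<Omega>. (norm (grad \<Omega> u x))\<^sup>2))"

definition H10_space :: "('a::euclidean_space) set \<Rightarrow> ('a \<Rightarrow> real) set" where
  "H10_space \<Omega> = {u \<in> H1_space \<Omega>.
     \<forall>\<epsilon>>0. \<exists>\<phi>\<in>test_functions \<Omega>. H1_norm \<Omega> (\<lambda>x. u x - \<phi> x) < \<epsilon>}"


section \<open>The nonlinearity\<close>

abbreviation dy :: "('a \<Rightarrow> real \<Rightarrow> real) \<Rightarrow> 'a \<Rightarrow> real \<Rightarrow> real" where
  "dy f x y \<equiv> deriv (f x) y"

abbreviation dyy :: "('a \<Rightarrow> real \<Rightarrow> real) \<Rightarrow> 'a \<Rightarrow> real \<Rightarrow> real" where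
  "dyy f x y \<equiv> deriv (deriv (f x)) y"

text \<open>The constants \<open>C\<close> and \<open>\<epsilon>\<close> are uniform with respect to almost every \<open>x\<close>.\<close>

definition admissible_nonlinearity ::
    "('a::euclidean_space) set \<Rightarrow> ('a \<Rightarrow> real \<Rightarrow> real) \<Rightarrow> bool" where
  "admissible_nonlinearity \<Omega> f \<longleftrightarrow>
     (\<forall>y. (\<lambda>x. f x y) \<in> borel_measurable (lebesgue_on \<Omega>)) \<and>
     (AE x in lebesgue_on \<Omega>.
        (\<forall>y. f x differentiable (at y) \<and> deriv (f x) differentiable (at y)) \<and>
        continuous_on UNIV (deriv (deriv (f x)))) \<and>
     Linf_norm (lebesgue_on \<Omega>) (\<lambda>x. f x 0) < \<infinity> \<and>
     (AE x in lebesgue_on \<Omega>. \<forall>y. dy f x y \<ge> 0) \<and>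
     (\<forall>M>0. \<exists>C>0. AE x in lebesgue_on \<Omega>. \<forall>y. \<bar>y\<bar> \<le> M \<longrightarrow> \<bar>dy f x y\<bar> + \<bar>dyy f x y\<bar> \<le> C) \<and>
     (\<forall>\<rho>>0. \<forall>M>0. \<exists>\<epsilon>>0. AE x in lebesgue_on \<Omega>. \<forall>y\<^sub>1 y\<^sub>2.
        \<bar>y\<^sub>1\<bar> \<le> M \<and> \<bar>y\<^sub>2\<bar> \<le> M \<and> \<bar>y\<^sub>2 - y\<^sub>1\<bar> \<le> \<epsilon> \<longrightarrow> \<bar>dyy f x y\<^sub>2 - dyy f x y\<^sub>1\<bar> < \<rho>)"


section \<open>The optimal control problem\<close>

text \<open>
  In what follows the trial and test space \<open>W\<close> is \<open>H\<^sup>1\<^sub>0\<close> for the continuous problem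
  and the finite element space for the semidiscrete one. The integrability requirements make sure
  that the nonlinear terms are genuine integrals.
\<close>

definition admissible_controls ::
    "('a::euclidean_space) set \<Rightarrow> real \<Rightarrow> real \<Rightarrow> ('a \<Rightarrow> real) set" where
  "admissible_controls \<Omega> a b =
     {v \<in> L2_space (lebesgue_on \<Omega>). AE x in lebesgue_on \<Omega>. a \<le> v x \<and> v x \<le> b}"

definition is_state ::
    "('a \<Rightarrow> real) set \<Rightarrow> ('a::euclidean_space) set \<Rightarrow> ('a \<Rightarrow> real \<Rightarrow> real) \<Rightarrow>
     ('a \<Rightarrow> real) \<Rightarrow> ('a \<Rightarrow> real) \<Rightarrow> bool" where
  "is_state W \<Omega> f u y \<longleftrightarrow> y \<in> W \<and>
     (\<forall>v\<in>W. integrable (lebesgue_on \<Omega>) (\<lambda>x. f x (y x) * v x) \<and>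
        (LINT x|lebesgue_on \<Omega>. grad \<Omega> y x \<bullet> grad \<Omega> v x) +
        (LINT x|lebesgue_on \<Omega>. f x (y x) * v x) = (LINT x|lebesgue_on \<Omega>. u x * v x))"

text \<open>The state is unique up to null sets, so that the cost does not depend on the chosen
  representative.\<close>

definition state ::
    "('a \<Rightarrow> real) set \<Rightarrow> ('a::euclidean_space) set \<Rightarrow> ('a \<Rightarrow> real \<Rightarrow> real) \<Rightarrow>
     ('a \<Rightarrow> real) \<Rightarrow> 'a \<Rightarrow> real" where
  "state W \<Omega> f u = (SOME y. is_state W \<Omega> f u y)"

definition cost ::
    "('a \<Rightarrow> real) set \<Rightarrow> ('a::euclidean_space) set \<Rightarrow> ('a \<Rightarrow> real \<Rightarrow> real) \<Rightarrow>
     ('a \<Rightarrow> real) \<Rightarrow> ('a \<Rightarrow> real) \<Rightarrow> real" where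
  "cost W \<Omega> f y\<^sub>\<Omega> u = 1/2 * (L2_norm (lebesgue_on \<Omega>) (\<lambda>x. state W \<Omega> f u x - y\<^sub>\<Omega> x))\<^sup>2"

definition is_optimal_control ::
    "('a \<Rightarrow> real) set \<Rightarrow> ('a::euclidean_space) set \<Rightarrow> ('a \<Rightarrow> real \<Rightarrow> real) \<Rightarrow>
     ('a \<Rightarrow> real) \<Rightarrow> real \<Rightarrow> real \<Rightarrow> ('a \<Rightarrow> real) \<Rightarrow> bool" where
  "is_optimal_control W \<Omega> f y\<^sub>\<Omega> a b u \<longleftrightarrow> u \<in> admissible_controls \<Omega> a b \<and>
     (\<forall>v\<in>admissible_controls \<Omega> a b. cost W \<Omega> f y\<^sub>\<Omega> u \<le> cost W \<Omega> f y\<^sub>\<Omega> v)"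

text \<open>Weak form of \<open>- \<Delta> p + (\<partial>f/\<partial>y)(\<cdot>, y) p = y - y\<^sub>\<Omega>\<close> with homogeneous Dirichlet condition,
  resp. its Galerkin discretization.\<close>

definition is_adjoint_state ::
    "('a \<Rightarrow> real) set \<Rightarrow> ('a::euclidean_space) set \<Rightarrow> ('a \<Rightarrow> real \<Rightarrow> real) \<Rightarrow>
     ('a \<Rightarrow> real) \<Rightarrow> ('a \<Rightarrow> real) \<Rightarrow> ('a \<Rightarrow> real) \<Rightarrow> bool" where
  "is_adjoint_state W \<Omega> f y\<^sub>\<Omega> y p \<longleftrightarrow> p \<in> W \<and>
     (\<forall>v\<in>W. integrable (lebesgue_on \<Omega>) (\<lambda>x. dy f x (y x) * p x * v x) \<and>
        (LINT x|lebesgue_on \<Omega>. grad \<Omega> v x \<bullet> grad \<Omega> p x) +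
        (LINT x|lebesgue_on \<Omega>. dy f x (y x) * p x * v x) =
        (LINT x|lebesgue_on \<Omega>. (y x - y\<^sub>\<Omega> x) * v x))"


section \<open>Meshes and finite elements\<close>

definition conforming_mesh :: "('a::euclidean_space) set \<Rightarrow> 'a set set \<Rightarrow> bool" where
  "conforming_mesh \<Omega> \<T> \<longleftrightarrow>
     triangulation \<T> \<and> (\<forall>T\<in>\<T>. int DIM('a) simplex T) \<and> \<Union>\<T> = closure \<Omega>"

definition mesh_refines :: "('a::euclidean_space) set set \<Rightarrow> 'a set set \<Rightarrow> bool" where
  "mesh_refines \<T> \<T>\<^sub>0 \<longleftrightarrow> (\<forall>T\<in>\<T>. \<exists>T\<^sub>0\<in>\<T>\<^sub>0. T \<subseteq> T\<^sub>0)"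

definition inball_diameter :: "('a::euclidean_space) set \<Rightarrow> real" where
  "inball_diameter T = Sup {2 * r |r. \<exists>x. cball x r \<subseteq> T}"

definition shape_regular :: "real \<Rightarrow> ('a::euclidean_space) set set \<Rightarrow> bool" where
  "shape_regular \<sigma> \<T> \<longleftrightarrow> (\<forall>T\<in>\<T>. diameter T \<le> \<sigma> * inball_diameter T)"

definition mesh_collection :: "('a::euclidean_space) set \<Rightarrow> 'a set set set \<Rightarrow> bool" where
  "mesh_collection \<Omega> \<TT> \<longleftrightarrow>
     (\<exists>\<T>\<^sub>0. conforming_mesh \<Omega> \<T>\<^sub>0 \<and> (\<forall>\<T>\<in>\<TT>. conforming_mesh \<Omega> \<T> \<and> mesh_refines \<T> \<T>\<^sub>0)) \<and>
     (\<exists>\<sigma>. \<forall>\<T>\<in>\<TT>. shape_regular \<sigma> \<T>)"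

definition sides :: "('a::euclidean_space) set set \<Rightarrow> 'a set set" where
  "sides \<T> = {e. \<exists>T1\<in>\<T>. \<exists>T2\<in>\<T>. T1 \<noteq> T2 \<and> e = T1 \<inter> T2 \<and> e facet_of T1 \<and> e facet_of T2}"

definition sides_of :: "('a::euclidean_space) set set \<Rightarrow> 'a set \<Rightarrow> 'a set set" where
  "sides_of \<T> T = {e \<in> sides \<T>. e facet_of T}"

text \<open>
  Inserting \<open>T\<close> matters only if the mesh consists of the single element \<open>T\<close>: in all other cases
  \<open>T\<close> has an internal side, hence shares one with itself. The convention \<open>T \<in> \<N>\<^sub>T\<close> keeps the
  neighbourhood from being empty for the one-element mesh.
\<close>

definition neighbours :: "('a::euclidean_space) set set \<Rightarrow> 'a set \<Rightarrow> 'a set set" where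
  "neighbours \<T> T = insert T {T' \<in> \<T>. sides_of \<T> T \<inter> sides_of \<T> T' \<noteq> {}}"

definition fe_space :: "('a::euclidean_space) set \<Rightarrow> 'a set set \<Rightarrow> ('a \<Rightarrow> real) set" where
  "fe_space \<Omega> \<T> = {v. continuous_on (closure \<Omega>) v \<and>
     (\<forall>T\<in>\<T>. \<exists>g c. \<forall>x\<in>T. v x = g \<bullet> x + c)} \<inter> H10_space \<Omega>"

definition element_grad :: "('a::euclidean_space) set \<Rightarrow> ('a \<Rightarrow> real) \<Rightarrow> 'a" where
  "element_grad T v = (THE g. \<exists>c. \<forall>x\<in>T. v x = g \<bullet> x + c)"

text \<open>Unit exterior normal to \<open>T\<close> on its facet \<open>e\<close>.\<close>

definition exterior_normal :: "('a::euclidean_space) set \<Rightarrow> 'a set \<Rightarrow> 'a" where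
  "exterior_normal T e = (THE n. norm n = 1 \<and>
     (\<forall>x\<in>e. \<forall>y\<in>e. n \<bullet> (x - y) = 0) \<and> (\<forall>x\<in>T. \<forall>y\<in>e. n \<bullet> (x - y) \<le> 0))"

text \<open>For an internal side \<open>e\<close> the sum has exactly two summands; the jump is constant on \<open>e\<close>.\<close>

definition normal_jump :: "('a::euclidean_space) set set \<Rightarrow> ('a \<Rightarrow> real) \<Rightarrow> 'a set \<Rightarrow> real" where
  "normal_jump \<T> v e = (\<Sum>T\<in>{T \<in> \<T>. e facet_of T}. exterior_normal T e \<bullet> element_grad T v)"

text \<open>
  The \<open>(d - 1)\<close>-dimensional surface measure of a flat side \<open>e\<close>: the volume of the right prism of
  height one over \<open>e\<close>, projected orthogonally onto the hyperplane spanned by \<open>e\<close>. The choice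
  between the two unit normals is immaterial.
\<close>

definition side_normal :: "('a::euclidean_space) set \<Rightarrow> 'a" where
  "side_normal e = (SOME n. norm n = 1 \<and> (\<forall>x\<in>e. \<forall>y\<in>e. n \<bullet> (x - y) = 0))"

definition side_measure :: "('a::euclidean_space) set \<Rightarrow> 'a measure" where
  "side_measure e = distr (lebesgue_on {x + t *\<^sub>R side_normal e |x t. x \<in> e \<and> t \<in> {0..1}})
     borel (closest_point (affine hull e))"

definition element_mean :: "('a::euclidean_space) set \<Rightarrow> ('a \<Rightarrow> real) \<Rightarrow> real" where
  "element_mean T v = 1 / measure lebesgue T * (LINT x|lebesgue_on T. v x)"

definition oscillation :: "('a::euclidean_space) set \<Rightarrow> ('a \<Rightarrow> real) \<Rightarrow> real" where
  "oscillation T v = L2_norm (lebesgue_on T) (\<lambda>x. v x - element_mean T v)"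


section \<open>Error indicators\<close>

definition eta_st ::
    "('a::euclidean_space) set set \<Rightarrow> ('a \<Rightarrow> real \<Rightarrow> real) \<Rightarrow> ('a \<Rightarrow> real) \<Rightarrow> ('a \<Rightarrow> real) \<Rightarrow>
     'a set \<Rightarrow> real" where
  "eta_st \<T> f u y T = sqrt (
     diameter T ^ 4 * (L2_norm (lebesgue_on T) (\<lambda>x. u x - f x (y x)))\<^sup>2 +
     (\<Sum>e\<in>sides_of \<T> T. diameter T ^ 3 * (L2_norm (side_measure e) (\<lambda>x. normal_jump \<T> y e))\<^sup>2))"

text \<open>The supremum in \<open>ennreal\<close> is a maximum, and \<open>0\<close> if \<open>T\<close> has no internal sides.\<close>

definition eta_adj ::
    "('a::euclidean_space) set set \<Rightarrow> ('a \<Rightarrow> real \<Rightarrow> real) \<Rightarrow> ('a \<Rightarrow> real) \<Rightarrow> ('a \<Rightarrow> real) \<Rightarrow>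
     ('a \<Rightarrow> real) \<Rightarrow> 'a set \<Rightarrow> ennreal" where
  "eta_adj \<T> f y\<^sub>\<Omega> y p T =
     ennreal (diameter T powr (2 - real DIM('a) / 2) *
       L2_norm (lebesgue_on T) (\<lambda>x. y x - y\<^sub>\<Omega> x - dy f x (y x) * p x)) +
     ennreal (diameter T) *
       (SUP e\<in>sides_of \<T> T. Linf_norm (side_measure e) (\<lambda>x. normal_jump \<T> p e))"

end

theory Submission
  imports Defs
begin

text \<open>
  The residuals are tested with rescaled smooth bumps only. A ball of radius \<open>r\<close> comparable to the
  element size \<open>h\<^sub>T\<close> lies inside every element of the patch, and another one, centered at the barycenter of
  a side, inside the union of the two elements sharing it. Integrating by parts twice against a bump
  leaves the errors of the state and of the adjoint state in \<open>L\<^sup>2\<close> and \<open>L\<^sup>\<infinity>\<close>, whereas a continuous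
  piecewise affine function, paired with the Laplacian of a bump on a side, gives the normal jump times a
  number of order \<open>r\<^sup>d\<^sup>-\<^sup>1\<close>. The adjoint residual is, up to oscillation, affine rather than constant on an
  element; its slope is found by testing with the partial derivatives of the bump.

  Lipschitz continuity of \<open>\<partial>f/\<partial>y\<close> lets \<open>f\<close> grow at most quadratically, so that uniform \<open>L\<^sup>2\<close> bounds of the
  states, i.e. energy estimates, replace \<open>L\<^sup>\<infinity>\<close> bounds. The term \<open>h\<^sub>T\<^sup>4\<^sup>-\<^sup>2\<^sup>d \<parallel>p\<^sub>l\<parallel>\<^sup>2\<close> on a ball of radius \<open>r\<close> that
  comes with the difference of \<open>\<partial>f/\<partial>y\<close> at the two states is bounded by the Hardy inequality for
  \<open>d = 3\<close> and by the Poincare inequality for \<open>d = 2\<close>.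
\<close>


subsection \<open>Smooth functions\<close>

text \<open>Test functions supported inside \<Omega> let the weak equations of \<open>yb\<close> and
  \<open>pb\<close> be compared with \<open>yl\<close> and \<open>pl\<close> without traces or
  elementwise Green formulas: for a bump \<open>v\<close>, the residual tested with \<open>v\<close>
  plus \<open>yl\<close> tested with the Laplacian of \<open>v\<close> is a sum of error terms only.
  Inside an element the second integral vanishes, as \<open>yl\<close> is affine there; around a
  side it is the jump times a quantity of known sign.

  The weights come from balls of radius \<open>r\<close> and volume of order r^d. The L^2 error of
  the state meets a Laplacian of order r^-2, which costs r^(d-4) after squaring, hence the weight
  r^(4-d). The L^infinity error of the adjoint state costs r^(2d-4), hence the weight r^(4-2d),
  which then also stands in front of the squared norm of \<open>pl\<close>. Its exponent is 0 for d
  = 2 and -2 for d = 3, exactly what the Hardy inequality tolerates.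

  Controls are bounded by \<open>a\<close> and \<open>b\<close>, and both states and the discrete
  adjoint state are bounded by testing their equations with themselves; so the constant depends on
  the data and the shape regularity only.\<close>

definition flat :: "nat \<Rightarrow> real \<Rightarrow> real" where
  "flat m t = (if t > 0 then exp (- (1 / t)) / t ^ m else 0)"

lemma flat_nonneg: "0 \<le> flat m t"
  by (simp add: flat_def)

text \<open>A single term \<open>(1 / t) ^ n / fact n\<close> of the exponential series at
  \<open>1 / t\<close> is at most the whole sum; reciprocals give decay at 0 faster than every
  power.\<close>

lemma exp_neg_inverse_le:
  fixes t :: real
  assumes "t > 0"
  shows "exp (- (1 / t)) \<le> fact n * t ^ n"
proof -
  have "(1 / t) ^ n / fact n \<le> exp (1 / t)"
  proof -
    have "(\<Sum>k\<in>{n}. (1 / t) ^ k /\<^sub>R fact k) \<le> (\<Sum>k. (1 / t) ^ k /\<^sub>R fact k)"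
      using assms by (intro sum_le_suminf summable_exp_generic) auto
    thus ?thesis by (simp add: exp_def divide_inverse mult.commute)
  qed
  hence "exp (- (1 / t)) * ((1 / t) ^ n / fact n) \<le> exp (- (1 / t)) * exp (1 / t)"
    by (intro mult_left_mono) auto
  also have "\<dots> = 1"
    by (simp flip: exp_add)
  finally have "exp (- (1 / t)) * ((1 / t) ^ n / fact n) \<le> 1" .
  thus ?thesis using assms by (simp add: power_divide field_simps)
qed

lemma flat_le: "flat m t \<le> fact (m + n) * \<bar>t\<bar> ^ n"
proof (cases "t > 0")
  case True
  then show ?thesis
    using exp_neg_inverse_le[OF True, of "m + n"] by (simp add: flat_def power_add field_simps)
qed (simp add: flat_def)

text \<open>The index \<open>m\<close> exists for this rule: the family is closed under
  differentiation, so one rule yields smoothness of every order. At 0, \<open>flat_le\<close> with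
  \<open>n = 2\<close> sends the difference quotient to 0.\<close>

lemma flat_has_real_derivative:
  "(flat m has_real_derivative flat (m + 2) t - real m * flat (m + 1) t) (at t)"
proof -
  consider "t > 0" | "t < 0" | "t = 0" by linarith
  then show ?thesis
  proof cases
    case 1
    have "((\<lambda>t. exp (- (1 / t)) / t ^ m) has_real_derivative
        flat (m + 2) t - real m * flat (m + 1) t) (at t)"
      using 1
      apply (auto intro!: derivative_eq_intros simp: flat_def)
      apply (cases m; simp add: field_simps power2_eq_square)
      done
    then show ?thesis
      by (rule DERIV_cong_ev[THEN iffD1, rotated 3])
         (use 1 in \<open>auto simp: flat_def eventually_nhds intro!: exI[of _ "{0<..}"]\<close>)
  next
    case 2
    have "((\<lambda>t. 0) has_real_derivative flat (m + 2) t - real m * flat (m + 1) t) (at t)"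
      using 2 by (auto simp: flat_def)
    then show ?thesis
      by (rule DERIV_cong_ev[THEN iffD1, rotated 3])
         (use 2 in \<open>auto simp: flat_def eventually_nhds intro!: exI[of _ "{..<0}"]\<close>)
  next
    case 3
    have "((\<lambda>h. flat m h / h) \<longlongrightarrow> 0) (at 0)"
    proof (rule Lim_null_comparison)
      show "\<forall>\<^sub>F h in at 0. norm (flat m h / h) \<le> fact (m + 2) * \<bar>h\<bar>"
      proof (intro always_eventually allI)
        fix h show "norm (flat m h / h) \<le> fact (m + 2) * \<bar>h\<bar>"
        proof (cases "h = 0")
          case False
          have "flat m h \<le> fact (m + 2) * \<bar>h\<bar> * \<bar>h\<bar>"
            using flat_le[of m h 2] by (simp add: power2_eq_square mult.assoc)
          thus ?thesis using False by (simp add: abs_divide divide_le_eq flat_nonneg)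
        qed simp
      qed
      show "((\<lambda>h. fact (m + 2) * \<bar>h\<bar>) \<longlongrightarrow> (0::real)) (at 0)"
        by (auto intro!: tendsto_eq_intros)
    qed
    then show ?thesis using 3 by (simp add: DERIV_def flat_def)
  qed
qed

lemma flat_0_le_1: "flat 0 t \<le> 1"
  by (simp add: flat_def)

lemma flat_0_mono: "s \<le> t \<Longrightarrow> flat 0 s \<le> flat 0 t"
  by (auto simp: flat_def divide_left_mono)

section \<open>Closure properties of \<open>C_k\<close>\<close>

lemma C_k_SucI:
  assumes "\<And>x. (\<phi> has_derivative \<phi>' x) (at x)" "\<And>i. i \<in> Basis \<Longrightarrow> C_k k (\<lambda>x. \<phi>' x i)"
  shows "C_k (Suc k) \<phi>"
  using assms(2) frechet_derivative_at[OF assms(1), symmetric]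
  by (auto simp: differentiable_def intro!: exI[of _ "\<phi>' _"] assms(1))

lemma C_k_has_derivative:
  "C_k (Suc k) \<phi> \<Longrightarrow> (\<phi> has_derivative frechet_derivative \<phi> (at x)) (at x)"
  using frechet_derivative_works by auto

lemma C_k_partial: "C_k (Suc k) \<phi> \<Longrightarrow> i \<in> Basis \<Longrightarrow> C_k k (\<lambda>x. frechet_derivative \<phi> (at x) i)"
  by simp

lemma C_k_continuous: "C_k k \<phi> \<Longrightarrow> continuous_on UNIV \<phi>"
proof (cases k)
  case (Suc n)
  assume "C_k k \<phi>"
  then show ?thesis using Suc
    by (auto intro!: continuous_at_imp_continuous_on differentiable_imp_continuous_within)
qed simp

lemma C_k_SucD: "C_k (Suc k) \<phi> \<Longrightarrow> C_k k \<phi>"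
proof (induction k arbitrary: \<phi>)
  case 0
  then show ?case using C_k_continuous by fastforce
next
  case (Suc k)
  show ?case
  proof (rule C_k_SucI[OF C_k_has_derivative[OF Suc.prems]])
    fix i :: 'a assume "i \<in> Basis"
    then show "C_k k (\<lambda>x. frechet_derivative \<phi> (at x) i)"
      by (rule Suc.IH[OF C_k_partial[OF Suc.prems]])
  qed
qed

lemma C_k_const: "C_k k (\<lambda>x::'a::euclidean_space. c)"
proof (induction k arbitrary: c)
  case (Suc k)
  show ?case by (rule C_k_SucI[where \<phi>' = "\<lambda>x h. 0"]) (auto simp: Suc)
qed simp

lemma C_k_inner: "C_k k (\<lambda>x::'a::euclidean_space. x \<bullet> v)"
proof (cases k)
  case (Suc n)
  show ?thesis unfolding Suc
    by (rule C_k_SucI[where \<phi>' = "\<lambda>x h. h \<bullet> v"]) (auto intro!: derivative_eq_intros C_k_const)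
qed (auto intro!: continuous_intros)

lemma C_k_add: "C_k k f \<Longrightarrow> C_k k g \<Longrightarrow> C_k k (\<lambda>x. f x + g x)"
proof (induction k arbitrary: f g)
  case (Suc k)
  show ?case
    by (rule C_k_SucI, rule has_derivative_add[OF C_k_has_derivative[OF Suc.prems(1)] C_k_has_derivative[OF Suc.prems(2)]])
       (intro Suc.IH C_k_partial[OF Suc.prems(1)] C_k_partial[OF Suc.prems(2)])
qed (auto intro!: continuous_intros)

lemma C_k_mult: "C_k k f \<Longrightarrow> C_k k g \<Longrightarrow> C_k k (\<lambda>x. f x * g x)"
proof (induction k arbitrary: f g)
  case (Suc k)
  show ?case
    by (rule C_k_SucI, rule has_derivative_mult[OF C_k_has_derivative[OF Suc.prems(1)] C_k_has_derivative[OF Suc.prems(2)]])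
       (intro Suc.IH C_k_add C_k_SucD[OF Suc.prems(1)] C_k_SucD[OF Suc.prems(2)] C_k_partial[OF Suc.prems(1)] C_k_partial[OF Suc.prems(2)])
qed (auto intro!: continuous_intros)

lemma C_k_cmult: "C_k k f \<Longrightarrow> C_k k (\<lambda>x. c * f x)"
  by (intro C_k_mult C_k_const)

lemma C_k_diff: "C_k k f \<Longrightarrow> C_k k g \<Longrightarrow> C_k k (\<lambda>x. f x - g x)"
  using C_k_add[OF _ C_k_cmult[of k g "-1"]] by simp

lemma C_k_sum: "(\<And>i. i \<in> I \<Longrightarrow> C_k k (f i)) \<Longrightarrow> C_k k (\<lambda>x. \<Sum>i\<in>I. f i x)"
  by (induction I rule: infinite_finite_induct) (auto intro: C_k_const C_k_add)

text \<open>The induction has to generalise \<open>m\<close>, because the chain rule leads from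
  \<open>flat m\<close> to \<open>flat (m + 1)\<close> and \<open>flat (m + 2)\<close>.\<close>

lemma C_k_flat: "C_k k g \<Longrightarrow> C_k k (\<lambda>x. flat m (g x))"
proof (induction k arbitrary: g m)
  case 0
  have "continuous_on UNIV (flat m)"
    by (meson DERIV_isCont continuous_at_imp_continuous_on flat_has_real_derivative)
  then show ?case using 0 by (auto intro: continuous_on_compose2)
next
  case (Suc k)
  let ?D = "\<lambda>x h. (flat (m + 2) (g x) - real m * flat (m + 1) (g x)) * frechet_derivative g (at x) h"
  show ?case
  proof (rule C_k_SucI[where \<phi>' = ?D])
    fix x show "((\<lambda>x. flat m (g x)) has_derivative ?D x) (at x)"
      using has_derivative_compose[OF C_k_has_derivative[OF Suc.prems]
          has_field_derivative_imp_has_derivative[OF flat_has_real_derivative]] by simp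
  next
    fix i :: 'a assume "i \<in> Basis"
    then show "C_k k (\<lambda>x. ?D x i)"
      by (intro C_k_mult C_k_diff C_k_const Suc.IH C_k_SucD[OF Suc.prems] C_k_partial[OF Suc.prems])
  qed
qed

text \<open>Meant for the vector field behind the Hardy inequality. The derivative is written as a
  product of inverses, so that the product rule and the induction hypothesis apply to it.\<close>

lemma C_k_inverse: "C_k k g \<Longrightarrow> (\<And>x. g x \<noteq> 0) \<Longrightarrow> C_k k (\<lambda>x. inverse (g x))"
proof (induction k arbitrary: g)
  case (Suc k)
  let ?D = "\<lambda>x h. (- 1) * (inverse (g x) * frechet_derivative g (at x) h * inverse (g x))"
  show ?case
  proof (rule C_k_SucI[where \<phi>' = ?D])
    fix x show "((\<lambda>x. inverse (g x)) has_derivative ?D x) (at x)"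
      using Deriv.has_derivative_inverse[OF Suc.prems(2) C_k_has_derivative[OF Suc.prems(1)]] by simp
  next
    fix i :: 'a assume "i \<in> Basis"
    then show "C_k k (\<lambda>x. ?D x i)"
      by (intro C_k_mult C_k_const Suc.IH C_k_SucD[OF Suc.prems(1)] C_k_partial[OF Suc.prems(1)] Suc.prems(2))
  qed
qed (auto intro!: continuous_intros)

lemma C_k_sq_norm: "C_k k (\<lambda>x::'a::euclidean_space. (norm (x - a))\<^sup>2)"
proof -
  have "(norm (x - a))\<^sup>2 = (\<Sum>i\<in>Basis. (x \<bullet> i - a \<bullet> i) * (x \<bullet> i - a \<bullet> i))" for x
    using euclidean_inner[of "x - a" "x - a"]
    by (simp only: power2_norm_eq_inner inner_diff_left)
  then show ?thesis by (auto intro!: C_k_sum C_k_mult C_k_diff C_k_inner C_k_const)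
qed

lemma has_derivative_rescale:
  fixes \<phi> :: "'a::euclidean_space \<Rightarrow> real"
  assumes "(\<phi> has_derivative D) (at ((x - a) /\<^sub>R r))"
  shows "((\<lambda>x. \<phi> ((x - a) /\<^sub>R r)) has_derivative (\<lambda>h. inverse r * D h)) (at x)"
proof -
  have "((\<lambda>x. (x - a) /\<^sub>R r) has_derivative (\<lambda>h. h /\<^sub>R r)) (at x)"
    by (auto intro!: derivative_eq_intros)
  from has_derivative_compose[OF this assms] show ?thesis
    using linear_scale[OF has_derivative_linear[OF assms]] by simp
qed

lemma C_k_rescale:
  "C_k k \<phi> \<Longrightarrow> C_k k (\<lambda>x::'a::euclidean_space. \<phi> ((x - a) /\<^sub>R r))"
proof (induction k arbitrary: \<phi>)
  case 0
  then show ?case by (auto intro!: continuous_intros intro: continuous_on_compose2)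
next
  case (Suc k)
  show ?case
    by (rule C_k_SucI, rule has_derivative_rescale[OF C_k_has_derivative[OF Suc.prems]])
       (intro C_k_cmult Suc.IH C_k_partial[OF Suc.prems])
qed


subsection \<open>Test functions\<close>

abbreviation partial :: "'a::euclidean_space \<Rightarrow> ('a \<Rightarrow> real) \<Rightarrow> 'a \<Rightarrow> real" where
  "partial v \<phi> \<equiv> (\<lambda>x. frechet_derivative \<phi> (at x) v)"

definition laplacian :: "('a::euclidean_space \<Rightarrow> real) \<Rightarrow> 'a \<Rightarrow> real" where
  "laplacian \<phi> x = (\<Sum>i\<in>Basis. partial i (partial i \<phi>) x)"

definition classical_grad :: "('a::euclidean_space \<Rightarrow> real) \<Rightarrow> 'a \<Rightarrow> 'a" where
  "classical_grad \<phi> x = (\<Sum>i\<in>Basis. partial i \<phi> x *\<^sub>R i)"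

lemma test_functionsI:
  assumes "\<And>k. C_k k \<phi>" "compact K" "K \<subseteq> \<Omega>" "\<And>x. x \<notin> K \<Longrightarrow> \<phi> x = 0"
  shows "\<phi> \<in> test_functions \<Omega>"
proof -
  have "closure {x. \<phi> x \<noteq> 0} \<subseteq> K"
    using assms by (intro closure_minimal compact_imp_closed) auto
  then show ?thesis using assms
    by (auto simp: test_functions_def intro: closed_Int_compact compact_closure[THEN iffD2]
        bounded_subset[OF compact_imp_bounded] closure_subset[THEN subset_trans])
qed

lemma test_functionsE:
  assumes "\<phi> \<in> test_functions \<Omega>"
  obtains K where "compact K" "K \<subseteq> \<Omega>" "\<And>x. x \<notin> K \<Longrightarrow> \<phi> x = 0"
  using assms closure_subset[of "{x. \<phi> x \<noteq> 0}"]
  by (intro that[of "closure {x. \<phi> x \<noteq> 0}"]) (auto simp: test_functions_def)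

lemma test_functions_C_k: "\<phi> \<in> test_functions \<Omega> \<Longrightarrow> C_k k \<phi>"
  by (simp add: test_functions_def)

lemma test_functions_mono: "\<Omega> \<subseteq> \<Omega>' \<Longrightarrow> \<phi> \<in> test_functions \<Omega> \<Longrightarrow> \<phi> \<in> test_functions \<Omega>'"
  by (auto simp: test_functions_def)

lemma test_functions_has_derivative:
  "\<phi> \<in> test_functions \<Omega> \<Longrightarrow> (\<phi> has_derivative frechet_derivative \<phi> (at x)) (at x)"
  by (rule C_k_has_derivative[OF test_functions_C_k])

lemma test_functions_continuous: "\<phi> \<in> test_functions \<Omega> \<Longrightarrow> continuous_on S \<phi>"
  using C_k_continuous[OF test_functions_C_k[of \<phi> \<Omega> 0]] continuous_on_subset by blast

lemma frechet_derivative_eq_0: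
  fixes \<phi> :: "'a::euclidean_space \<Rightarrow> real"
  assumes "open S" "x \<in> S" "\<And>y. y \<in> S \<Longrightarrow> \<phi> y = 0"
  shows "frechet_derivative \<phi> (at x) = (\<lambda>h. 0)"
proof -
  have "(\<phi> has_derivative (\<lambda>h. 0)) (at x)"
    by (rule has_derivative_transform_within_open[of "\<lambda>x. 0" _ _ _ S]) (use assms in auto)
  then show ?thesis using frechet_derivative_at by metis
qed

lemma test_functions_partial:
  assumes "\<phi> \<in> test_functions \<Omega>" "i \<in> Basis"
  shows "partial i \<phi> \<in> test_functions \<Omega>"
proof -
  obtain K where K: "compact K" "K \<subseteq> \<Omega>" "\<And>x. x \<notin> K \<Longrightarrow> \<phi> x = 0"
    by (rule test_functionsE[OF assms(1)]) blast
  show ?thesis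
  proof (rule test_functionsI[OF _ K(1,2)])
    fix k show "C_k k (partial i \<phi>)"
      by (rule C_k_partial[OF test_functions_C_k[OF assms(1)] assms(2)])
  next
    fix x assume "x \<notin> K"
    then have "frechet_derivative \<phi> (at x) = (\<lambda>h. 0)"
      using K compact_imp_closed[OF K(1)] by (intro frechet_derivative_eq_0[of "- K"]) auto
    then show "partial i \<phi> x = 0" by simp
  qed
qed

lemma test_functions_mult:
  assumes "\<phi> \<in> test_functions \<Omega>" "\<And>k. C_k k g"
  shows "(\<lambda>x. g x * \<phi> x) \<in> test_functions \<Omega>"
proof -
  obtain K where K: "compact K" "K \<subseteq> \<Omega>" "\<And>x. x \<notin> K \<Longrightarrow> \<phi> x = 0"
    by (rule test_functionsE[OF assms(1)]) blast
  then show ?thesis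
    by (intro test_functionsI[OF _ K(1,2)] C_k_mult assms test_functions_C_k[OF assms(1)]) auto
qed

lemma test_functions_zero: "(\<lambda>x. 0) \<in> test_functions \<Omega>"
  by (rule test_functionsI[of _ "{}"]) (auto intro: C_k_const)

lemma partial_expand:
  assumes "\<phi> \<in> test_functions \<Omega>"
  shows "partial v \<phi> x = v \<bullet> classical_grad \<phi> x"
proof -
  have "linear (frechet_derivative \<phi> (at x))"
    by (rule has_derivative_linear[OF test_functions_has_derivative[OF assms]])
  then have "frechet_derivative \<phi> (at x) (\<Sum>i\<in>Basis. (v \<bullet> i) *\<^sub>R i) = (\<Sum>i\<in>Basis. (v \<bullet> i) * partial i \<phi> x)"
    by (simp add: linear_sum linear_scale)
  then show ?thesis by (simp add: euclidean_representation classical_grad_def inner_sum_right mult.commute)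
qed

lemma classical_grad_inner_Basis: "i \<in> Basis \<Longrightarrow> classical_grad \<phi> x \<bullet> i = partial i \<phi> x"
  by (simp add: classical_grad_def)

lemma continuous_classical_grad:
  assumes "\<phi> \<in> test_functions \<Omega>" shows "continuous_on UNIV (classical_grad \<phi>)"
  unfolding classical_grad_def
  by (intro continuous_intros test_functions_continuous[OF test_functions_partial[OF assms]])

lemma test_functions_bounded:
  assumes "\<phi> \<in> test_functions \<Omega>"
  obtains M where "M > 0" "\<And>x. \<bar>\<phi> x\<bar> \<le> M"
proof -
  obtain K where K: "compact K" "K \<subseteq> \<Omega>" "\<And>x. x \<notin> K \<Longrightarrow> \<phi> x = 0"
    by (rule test_functionsE[OF assms]) blast
  have "bounded (\<phi> ` K)"
    by (intro compact_imp_bounded compact_continuous_image test_functions_continuous[OF assms] K)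
  then obtain M where M: "M > 0" "\<And>x. x \<in> K \<Longrightarrow> \<bar>\<phi> x\<bar> \<le> M"
    unfolding bounded_pos by auto
  show ?thesis
    by (rule that[OF M(1)]) (use K(3) M in \<open>metis abs_zero less_imp_le\<close>)
qed

lemma classical_grad_bounded:
  assumes "\<phi> \<in> test_functions \<Omega>"
  obtains M where "M > 0" "\<And>x. norm (classical_grad \<phi> x) \<le> M"
proof -
  have "\<forall>i\<in>Basis. \<exists>M>0. \<forall>x. \<bar>partial i \<phi> x\<bar> \<le> M"
  proof
    fix i :: 'a assume "i \<in> Basis"
    then show "\<exists>M>0. \<forall>x. \<bar>partial i \<phi> x\<bar> \<le> M"
      by (rule test_functions_bounded[OF test_functions_partial[OF assms]]) auto
  qed
  then obtain m where m: "\<And>i. i \<in> Basis \<Longrightarrow> m i > 0" "\<And>i x. i \<in> Basis \<Longrightarrow> \<bar>partial i \<phi> x\<bar> \<le> m i"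
    by metis
  show ?thesis
  proof
    show "(\<Sum>i\<in>Basis. m i) > 0" using m by (intro sum_pos) auto
    show "norm (classical_grad \<phi> x) \<le> (\<Sum>i\<in>Basis. m i)" for x
      unfolding classical_grad_def using m by (intro sum_norm_le) auto
  qed
qed

lemma test_functions_lipschitz:
  assumes "\<phi> \<in> test_functions \<Omega>"
  obtains L where "L-lipschitz_on UNIV \<phi>"
proof -
  obtain M where M: "M > 0" "\<And>x. norm (classical_grad \<phi> x) \<le> M"
    by (rule classical_grad_bounded[OF assms]) blast
  have "norm (\<phi> x - \<phi> y) \<le> M * norm (x - y)" for x y
  proof (rule differentiable_bound[of UNIV])
    show "(\<phi> has_derivative frechet_derivative \<phi> (at x)) (at x within UNIV)" for x
      using test_functions_has_derivative[OF assms] by simp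
    show "onorm (frechet_derivative \<phi> (at x)) \<le> M" for x
    proof (rule onorm_le)
      fix v
      show "norm (frechet_derivative \<phi> (at x) v) \<le> M * norm v"
        unfolding partial_expand[OF assms] real_norm_def
        using Cauchy_Schwarz_ineq2[of v "classical_grad \<phi> x"] mult_left_mono[OF M(2)[of x], of "norm v"]
        by (simp add: mult.commute)
    qed
  qed auto
  then show ?thesis using M(1) by (intro that[of M] lipschitz_onI) (auto simp: dist_norm)
qed


subsection \<open>Integration by parts against test functions\<close>

lemma lborel_integral_translate:
  fixes f :: "'a::euclidean_space \<Rightarrow> real"
  assumes "f \<in> borel_measurable borel"
  shows "(LINT x|lborel. f (c + x)) = (LINT x|lborel. f x)"
    and "integrable lborel (\<lambda>x. f (c + x)) \<longleftrightarrow> integrable lborel f"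
  using integral_distr[of "(+) c" lborel borel f] integrable_distr_eq[of "(+) c" lborel borel f] assms
  by (auto simp: lborel_distr_plus)

lemma integrable_continuous_compact_support:
  fixes f :: "'a::euclidean_space \<Rightarrow> real"
  assumes "continuous_on UNIV f" "compact K" "\<And>x. x \<notin> K \<Longrightarrow> f x = 0"
  shows "integrable lborel f"
proof -
  have "integrable lborel (\<lambda>x. indicator K x *\<^sub>R f x)"
    using assms by (intro borel_integrable_compact) (auto intro: continuous_on_subset)
  moreover have "(\<lambda>x. indicator K x *\<^sub>R f x) = f"
    using assms(3) by (intro ext) (auto simp: indicator_def)
  ultimately show ?thesis by simp
qed

text \<open>The difference quotients of \<open>w\<close> have mean zero by translation invariance.\<close>

lemma integral_directional_derivative_eq_0:
  fixes w :: "'a::euclidean_space \<Rightarrow> real"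
  assumes lip: "L-lipschitz_on UNIV w"
    and supp: "\<And>x. norm x > R \<Longrightarrow> w x = 0"
    and D: "AE x in lborel. ((\<lambda>t. w (x + t *\<^sub>R v)) has_real_derivative D x) (at 0)"
    and [measurable]: "D \<in> borel_measurable borel"
  shows "integrable lborel D" "(LINT x|lborel. D x) = 0"
proof -
  have cont: "continuous_on UNIV w" by (rule lipschitz_on_continuous_on[OF lip])
  then have [measurable]: "w \<in> borel_measurable borel" by (rule borel_measurable_continuous_onI)
  have intw: "integrable lborel w"
    by (rule integrable_continuous_compact_support[OF cont, of "cball 0 R"]) (auto intro: supp)
  define \<epsilon> :: "nat \<Rightarrow> real" where "\<epsilon> n = inverse (real (Suc n))" for n
  define s where "s n x = (w (\<epsilon> n *\<^sub>R v + x) - w x) / \<epsilon> n" for n x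
  have [measurable]: "s n \<in> borel_measurable borel" for n
    unfolding s_def by measurable
  have \<epsilon>: "\<epsilon> n > 0" "\<epsilon> n \<le> 1" for n by (auto simp: \<epsilon>_def inverse_le_1_iff)
  have "\<epsilon> \<longlonglongrightarrow> 0" unfolding \<epsilon>_def by (rule LIMSEQ_inverse_real_of_nat)
  then have \<epsilon>_at: "filterlim \<epsilon> (at 0) sequentially"
    using \<epsilon> by (auto simp: filterlim_at intro!: always_eventually) (metis less_irrefl)
  have lim: "AE x in lborel. (\<lambda>n. s n x) \<longlonglongrightarrow> D x"
    using D
  proof eventually_elim
    case (elim x)
    then have "((\<lambda>h. (w (x + h *\<^sub>R v) - w x) / h) \<longlongrightarrow> D x) (at 0)"
      by (simp add: DERIV_def)
    from filterlim_compose[OF this \<epsilon>_at] show ?case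
      by (simp add: s_def add.commute)
  qed
  \<comment> \<open>Integrable majorant: the quotients are at most \<open>L * norm v\<close>, and
    since \<open>\<epsilon> n \<le> 1\<close> they vanish outside the support enlarged by
    \<open>norm v\<close>.\<close>
  define b where "b x = (L * norm v) * indicator (cball 0 (R + norm v)) x" for x :: 'a
  have b: "integrable lborel b"
    unfolding b_def by (intro integrable_mult_right integrable_real_indicator)
      (use emeasure_compact_finite[OF compact_cball] in \<open>auto simp: less_top\<close>)
  have bound: "norm (s n x) \<le> b x" for n x
  proof (cases "norm x \<le> R + norm v")
    case True
    have "\<bar>w (\<epsilon> n *\<^sub>R v + x) - w x\<bar> \<le> L * (\<epsilon> n * norm v)"
      using lipschitz_onD[OF lip, of "\<epsilon> n *\<^sub>R v + x" x] \<epsilon>[of n] by (simp add: dist_norm)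
    then show ?thesis using True \<epsilon>[of n] by (simp add: s_def b_def divide_le_eq mult_ac)
  next
    case False
    have "norm (\<epsilon> n *\<^sub>R v) \<le> norm v" using \<epsilon>[of n] by (simp add: mult_left_le_one_le)
    moreover have "norm x \<le> norm (\<epsilon> n *\<^sub>R v + x) + norm (\<epsilon> n *\<^sub>R v)"
      using norm_triangle_ineq4[of "\<epsilon> n *\<^sub>R v + x" "\<epsilon> n *\<^sub>R v"] by simp
    ultimately have "norm (\<epsilon> n *\<^sub>R v + x) > R" "norm x > R"
      using False norm_ge_zero[of v] by linarith+
    then show ?thesis using supp False by (simp add: s_def b_def)
  qed
  show "integrable lborel D"
    by (rule integrable_dominated_convergence[OF _ _ b lim]) (use bound in auto)
  have "(\<lambda>n. LINT x|lborel. s n x) \<longlonglongrightarrow> (LINT x|lborel. D x)"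
    by (rule integral_dominated_convergence[OF _ _ b lim]) (use bound in auto)
  moreover have "(LINT x|lborel. s n x) = 0" for n
  proof -
    have "(LINT x|lborel. s n x) = ((LINT x|lborel. w (\<epsilon> n *\<^sub>R v + x)) - (LINT x|lborel. w x)) / \<epsilon> n"
      unfolding s_def using intw lborel_integral_translate(2)[of w "\<epsilon> n *\<^sub>R v"] by simp
    then show ?thesis by (simp add: lborel_integral_translate(1))
  qed
  ultimately show "(LINT x|lborel. D x) = 0" by (simp add: LIMSEQ_const_iff)
qed

text \<open>Products of Lipschitz functions need not be Lipschitz, as \<open>u\<close> may grow; the
  support of \<open>\<phi>\<close> confines the estimate to a ball on which \<open>u\<close> is
  bounded.\<close>

lemma lipschitz_on_mult_test_function:
  fixes u :: "'a::euclidean_space \<Rightarrow> real"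
  assumes u: "K-lipschitz_on UNIV u" and \<phi>: "\<phi> \<in> test_functions UNIV"
  obtains L R where "L-lipschitz_on UNIV (\<lambda>x. u x * \<phi> x)" "\<And>x. norm x > R \<Longrightarrow> \<phi> x = 0"
proof -
  obtain S where S: "compact S" "\<And>x. x \<notin> S \<Longrightarrow> \<phi> x = 0"
    using \<phi> by (rule test_functionsE) blast
  obtain R where R: "\<And>x. norm x > R \<Longrightarrow> \<phi> x = 0"
    using compact_imp_bounded[OF S(1)] S(2) unfolding bounded_iff by (meson not_le)
  obtain M where M: "M > 0" "\<And>x. \<bar>\<phi> x\<bar> \<le> M"
    using \<phi> by (rule test_functions_bounded) blast
  obtain K' where K': "K'-lipschitz_on UNIV \<phi>"
    using \<phi> by (rule test_functions_lipschitz) blast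
  have "bounded (u ` cball 0 R)"
    by (intro compact_imp_bounded compact_continuous_image continuous_on_subset[OF lipschitz_on_continuous_on[OF u]]) auto
  then obtain N where N: "N > 0" "\<And>x. norm x \<le> R \<Longrightarrow> \<bar>u x\<bar> \<le> N"
    unfolding bounded_pos by auto
  have K: "0 \<le> K" "0 \<le> K'" using u K' by (auto dest: lipschitz_on_nonneg)
  \<comment> \<open>The bound \<open>N\<close> on \<open>u\<close> is spent at \<open>x\<close>
    alone, so only one of the two points has to lie in the ball; the other case follows by
    symmetry.\<close>
  have *: "\<bar>u x * \<phi> x - u y * \<phi> y\<bar> \<le> (N * K' + M * K) * dist x y" if "norm x \<le> R" for x y
  proof -
    have "u x * \<phi> x - u y * \<phi> y = u x * (\<phi> x - \<phi> y) + (u x - u y) * \<phi> y" by (simp add: algebra_simps)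
    also have "\<bar>\<dots>\<bar> \<le> \<bar>u x\<bar> * \<bar>\<phi> x - \<phi> y\<bar> + \<bar>u x - u y\<bar> * \<bar>\<phi> y\<bar>"
      by (metis abs_mult abs_triangle_ineq)
    also have "\<dots> \<le> N * (K' * dist x y) + (K * dist x y) * M"
      using N(2)[OF that] lipschitz_onD[OF K', of x y] lipschitz_onD[OF u, of x y] M(2)[of y] N(1) K
      by (intro add_mono mult_mono) (auto simp: dist_real_def)
    finally show ?thesis by (simp add: algebra_simps)
  qed
  have "(N * K' + M * K)-lipschitz_on UNIV (\<lambda>x. u x * \<phi> x)"
  proof (rule lipschitz_onI)
    fix x y
    show "dist (u x * \<phi> x) (u y * \<phi> y) \<le> (N * K' + M * K) * dist x y"
    proof (cases "norm x \<le> R \<or> norm y \<le> R")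
      case True
      then show ?thesis
        using *[of x y] *[of y x] by (metis dist_commute dist_real_def)
    next
      case False
      then have z: "\<phi> x = 0" "\<phi> y = 0" using R[of x] R[of y] by auto
      have "0 \<le> (N * K' + M * K) * dist x y" using K M(1) N(1) by (intro mult_nonneg_nonneg add_nonneg_nonneg) auto
      then show ?thesis using z by simp
    qed
  qed (use K M N in auto)
  then show ?thesis using R that by blast
qed

lemma test_functions_line_derivative:
  assumes "\<phi> \<in> test_functions \<Omega>"
  shows "((\<lambda>t. \<phi> (x + t *\<^sub>R v)) has_real_derivative partial v \<phi> x) (at 0)"
proof -
  have "((\<lambda>t. x + t *\<^sub>R v) has_derivative (\<lambda>t. t *\<^sub>R v)) (at 0)"
    by (auto intro!: derivative_eq_intros)
  from has_derivative_compose[OF this, of \<phi>] test_functions_has_derivative[OF assms, of x]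
  have "((\<lambda>t. \<phi> (x + t *\<^sub>R v)) has_derivative (\<lambda>t. frechet_derivative \<phi> (at x) (t *\<^sub>R v))) (at 0)"
    by simp
  then show ?thesis
    by (simp add: has_field_derivative_def partial_expand[OF assms] mult.commute[of _ "v \<bullet> _"])
qed

text \<open>The mean-zero property applied to \<open>u * \<phi>\<close>. Stated for Lipschitz
  \<open>u\<close> with a directional derivative almost everywhere, it covers test functions, affine
  functions and the kink along a hyperplane alike.\<close>

lemma integration_by_parts_lborel:
  fixes u :: "'a::euclidean_space \<Rightarrow> real"
  assumes u: "K-lipschitz_on UNIV u" and \<phi>: "\<phi> \<in> test_functions UNIV"
    and D: "AE x in lborel. ((\<lambda>t. u (x + t *\<^sub>R v)) has_real_derivative D x) (at 0)"
    and [measurable]: "D \<in> borel_measurable borel"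
  shows "(LINT x|lborel. D x * \<phi> x) = - (LINT x|lborel. u x * partial v \<phi> x)"
proof -
  obtain L R where L: "L-lipschitz_on UNIV (\<lambda>x. u x * \<phi> x)" and R: "\<And>x. norm x > R \<Longrightarrow> \<phi> x = 0"
    using lipschitz_on_mult_test_function[OF u \<phi>] by blast
  have cont_u: "continuous_on UNIV u" by (rule lipschitz_on_continuous_on[OF u])
  have cont_p: "continuous_on UNIV (partial v \<phi>)"
    unfolding partial_expand[OF \<phi>] by (intro continuous_intros continuous_classical_grad[OF \<phi>])
  have [measurable]: "u \<in> borel_measurable borel" "\<phi> \<in> borel_measurable borel" "partial v \<phi> \<in> borel_measurable borel"
    using cont_u cont_p test_functions_continuous[OF \<phi>] by (auto intro!: borel_measurable_continuous_onI)
  have R': "partial v \<phi> x = 0" if "norm x > R" for x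
  proof -
    have "open (- cball (0::'a) R)" by (simp add: open_Compl)
    from frechet_derivative_eq_0[OF this, of x \<phi>] show ?thesis using R that by auto
  qed
  have AE: "AE x in lborel. ((\<lambda>t. u (x + t *\<^sub>R v) * \<phi> (x + t *\<^sub>R v)) has_real_derivative
      D x * \<phi> x + u x * partial v \<phi> x) (at 0)"
    using D
  proof eventually_elim
    case (elim x)
    from DERIV_mult[OF elim test_functions_line_derivative[OF \<phi>]] show ?case by (simp add: mult.commute algebra_simps)
  qed
  have s: "integrable lborel (\<lambda>x. D x * \<phi> x + u x * partial v \<phi> x)"
    by (rule integral_directional_derivative_eq_0(1)[OF L _ AE, of R]) (auto simp: R)
  have 0: "(LINT x|lborel. D x * \<phi> x + u x * partial v \<phi> x) = 0"
    by (rule integral_directional_derivative_eq_0(2)[OF L _ AE, of R]) (auto simp: R)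
  have i: "integrable lborel (\<lambda>x. u x * partial v \<phi> x)"
    by (rule integrable_continuous_compact_support[of _ "cball 0 R"])
       (auto intro!: continuous_on_mult cont_u cont_p R')
  \<comment> \<open>No bound on \<open>D\<close> is at hand; integrability is read off from the sum
    and its other summand.\<close>
  have "integrable lborel (\<lambda>x. D x * \<phi> x)"
    using Bochner_Integration.integrable_diff[OF s i] by simp
  then show ?thesis using 0 i by simp
qed

lemma lebesgue_on_integral_eq_lborel:
  fixes f :: "'a::euclidean_space \<Rightarrow> real"
  assumes "S \<in> sets lebesgue" "f \<in> borel_measurable borel" "\<And>x. x \<notin> S \<Longrightarrow> f x = 0"
  shows "(LINT x|lebesgue_on S. f x) = (LINT x|lborel. f x)"
proof -
  have "(LINT x|lebesgue_on S. f x) = (LINT x|lebesgue. indicator S x *\<^sub>R f x)"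
    using assms(1) by (simp add: integral_restrict_space)
  also have "(\<lambda>x. indicator S x *\<^sub>R f x) = f"
    using assms(3) by (intro ext) (auto simp: indicator_def)
  also have "(LINT x|lebesgue. f x) = (LINT x|lborel. f x)"
    using assms(2) by (simp add: integral_completion)
  finally show ?thesis .
qed

lemma integration_by_parts:
  fixes u :: "'a::euclidean_space \<Rightarrow> real"
  assumes u: "K-lipschitz_on UNIV u" and \<phi>: "\<phi> \<in> test_functions \<Omega>" and \<Omega>: "\<Omega> \<in> sets lebesgue"
    and D: "AE x in lborel. ((\<lambda>t. u (x + t *\<^sub>R v)) has_real_derivative D x) (at 0)"
    and [measurable]: "D \<in> borel_measurable borel"
  shows "(LINT x|lebesgue_on \<Omega>. D x * \<phi> x) = - (LINT x|lebesgue_on \<Omega>. u x * partial v \<phi> x)"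
proof -
  have \<phi>': "\<phi> \<in> test_functions UNIV" using test_functions_mono[OF _ \<phi>] by simp
  obtain K where K: "compact K" "K \<subseteq> \<Omega>" "\<And>x. x \<notin> K \<Longrightarrow> \<phi> x = 0"
    by (rule test_functionsE[OF \<phi>]) blast
  have K': "partial v \<phi> x = 0" if "x \<notin> K" for x
    using frechet_derivative_eq_0[of "- K" x \<phi>] K that by (auto simp: compact_imp_closed open_Compl)
  have cont_u: "continuous_on UNIV u" by (rule lipschitz_on_continuous_on[OF u])
  have cont_p: "continuous_on UNIV (partial v \<phi>)"
    unfolding partial_expand[OF \<phi>] by (intro continuous_intros continuous_classical_grad[OF \<phi>])
  have [measurable]: "u \<in> borel_measurable borel" "\<phi> \<in> borel_measurable borel" "partial v \<phi> \<in> borel_measurable borel"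
    using cont_u cont_p test_functions_continuous[OF \<phi>] by (auto intro!: borel_measurable_continuous_onI)
  have "(LINT x|lebesgue_on \<Omega>. D x * \<phi> x) = (LINT x|lborel. D x * \<phi> x)"
    using K by (intro lebesgue_on_integral_eq_lborel \<Omega>) auto
  moreover have "(LINT x|lebesgue_on \<Omega>. u x * partial v \<phi> x) = (LINT x|lborel. u x * partial v \<phi> x)"
    using K K' by (intro lebesgue_on_integral_eq_lborel \<Omega>) auto
  ultimately show ?thesis using integration_by_parts_lborel[OF u \<phi>' D] by simp
qed


subsection \<open>The fundamental lemma of the calculus of variations\<close>

text \<open>By the Lindelof property countably many balls, whose closures lie in \<open>V\<close>,
  exhaust \<open>V\<close>; each carries a smooth bump that is positive exactly inside it.\<close>

lemma indicator_open_limit_test_functions: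
  fixes V :: "'a::euclidean_space set"
  assumes "open V"
  obtains \<phi> where "\<And>n. \<phi> n \<in> test_functions V" "\<And>n x. 0 \<le> \<phi> n x \<and> \<phi> n x \<le> 1"
    "\<And>x. (\<lambda>n::nat. \<phi> n x) \<longlonglongrightarrow> indicator V x"
proof (cases "V = {}")
  case True
  show ?thesis by (rule that[of "\<lambda>n x. 0"]) (auto simp: True test_functions_zero)
next
  case False
  define \<F> where "\<F> = {ball c r |c r. r > 0 \<and> cball c r \<subseteq> V}"
  have "V = \<Union>\<F>"
  proof
    show "V \<subseteq> \<Union>\<F>"
    proof
      fix x assume "x \<in> V"
      then obtain r where "r > 0" "cball x r \<subseteq> V" using assms open_contains_cball by blast
      then show "x \<in> \<Union>\<F>" unfolding \<F>_def by (intro UnionI[of "ball x r"]) auto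
    qed
    show "\<Union>\<F> \<subseteq> V" using ball_subset_cball by (fastforce simp: \<F>_def)
  qed
  have "openin (top_of_set UNIV) S" if "S \<in> \<F>" for S
    using that by (auto simp: \<F>_def)
  then obtain \<F>' where \<F>': "\<F>' \<subseteq> \<F>" "countable \<F>'" "\<Union>\<F>' = \<Union>\<F>"
    by (rule Lindelof_openin) blast+
  have ne: "\<F>' \<noteq> {}" using False \<open>V = \<Union>\<F>\<close> \<F>'(3) by auto
  have "\<forall>n. \<exists>c r. from_nat_into \<F>' n = ball c r \<and> r > 0 \<and> cball c r \<subseteq> V"
    using from_nat_into[OF ne] \<F>'(1) unfolding \<F>_def by blast
  then obtain c r where cr: "\<And>n. from_nat_into \<F>' n = ball (c n) (r n)" "\<And>n. r n > 0" "\<And>n. cball (c n) (r n) \<subseteq> V"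
    by metis
  define b where "b n x = flat 0 ((r n)\<^sup>2 - (norm (x - c n))\<^sup>2)" for n x
  have b0: "b n x \<ge> 0" for n x by (simp add: b_def flat_nonneg)
  have bz: "b n x = 0" if "x \<notin> cball (c n) (r n)" for n x
  proof -
    have "r n \<le> norm (x - c n)" using that by (simp add: dist_norm norm_minus_commute)
    then have "(r n)\<^sup>2 \<le> (norm (x - c n))\<^sup>2" using cr(2)[of n] by (intro power_mono) auto
    then show ?thesis by (simp add: b_def flat_def)
  qed
  have bp: "b n x > 0" if "x \<in> ball (c n) (r n)" for n x
  proof -
    have "(norm (x - c n))\<^sup>2 < (r n)\<^sup>2"
      using that by (intro power_strict_mono) (auto simp: dist_norm norm_minus_commute)
    then show ?thesis by (simp add: b_def flat_def)
  qed
  \<comment> \<open>The outer \<open>flat 0\<close> vanishes at 0, stays below 1 and tends to 1 at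
    infinity. The factor \<open>n\<close> thus drives the values to 1 wherever some bump is
    positive, while the finite sum keeps the support compact.\<close>
  define \<phi> where "\<phi> n x = flat 0 (real n * (\<Sum>j<n. b j x))" for n x
  show ?thesis
  proof (rule that[of \<phi>])
    fix n
    show "\<phi> n \<in> test_functions V"
    proof (rule test_functionsI[of _ "\<Union>j<n. cball (c j) (r j)"])
      show "C_k k (\<phi> n)" for k
        unfolding \<phi>_def b_def by (intro C_k_flat C_k_mult C_k_const C_k_sum C_k_diff C_k_sq_norm)
      show "\<phi> n x = 0" if "x \<notin> (\<Union>j<n. cball (c j) (r j))" for x
        using that bz by (auto simp: \<phi>_def flat_def)
    qed (use cr(3) in \<open>auto simp: subset_iff intro!: compact_UN\<close>)
  next
    show "0 \<le> \<phi> n x \<and> \<phi> n x \<le> 1" for n x by (simp add: \<phi>_def flat_nonneg flat_0_le_1)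
  next
    fix x
    show "(\<lambda>n. \<phi> n x) \<longlonglongrightarrow> indicator V x"
    proof (cases "x \<in> V")
      case True
      then obtain B where "B \<in> \<F>'" "x \<in> B" using \<open>V = \<Union>\<F>\<close> \<F>'(3) by blast
      then obtain j where "from_nat_into \<F>' j = B" using from_nat_into_surj[OF \<F>'(2)] by blast
      then have j: "x \<in> ball (c j) (r j)" using \<open>x \<in> B\<close> cr(1)[of j] by simp
      have "((\<lambda>n. flat 0 (real n * b j x)) \<longlonglongrightarrow> 1)"
      proof (rule Lim_transform_eventually)
        have "(\<lambda>n. - (1 / b j x) * inverse (real n)) \<longlonglongrightarrow> - (1 / b j x) * 0"
          by (intro tendsto_intros lim_inverse_n)
        from tendsto_exp[OF this] show "(\<lambda>n. exp (- (1 / b j x) * inverse (real n))) \<longlonglongrightarrow> 1" by simp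
        show "\<forall>\<^sub>F n in sequentially. exp (- (1 / b j x) * inverse (real n)) = flat 0 (real n * b j x)"
          using eventually_gt_at_top[of 0] by eventually_elim (use bp[OF j] in \<open>simp add: flat_def divide_inverse mult_ac\<close>)
      qed
      then have "(\<lambda>n. \<phi> n x) \<longlonglongrightarrow> 1"
      proof (rule tendsto_sandwich[rotated 2])
        show "\<forall>\<^sub>F n in sequentially. flat 0 (real n * b j x) \<le> \<phi> n x"
          using eventually_gt_at_top[of j]
        proof eventually_elim
          case (elim n)
          have "b j x \<le> (\<Sum>i<n. b i x)" using elim b0 by (intro member_le_sum[of j "{..<n}" "\<lambda>i. b i x"]) auto
          then show ?case unfolding \<phi>_def by (intro flat_0_mono mult_left_mono) auto
        qed
        show "\<forall>\<^sub>F n in sequentially. \<phi> n x \<le> 1"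
          by (simp add: \<phi>_def flat_0_le_1)
      qed (rule tendsto_const)
      then show ?thesis using True by simp
    next
      case False
      then have "b n x = 0" for n using bz cr(3) by blast
      then show ?thesis using False by (simp add: \<phi>_def flat_def)
    qed
  qed
qed

text \<open>Dominated convergence along the cutoffs makes the integral of \<open>g\<close> over
  every open set vanish. Open sets form an intersection-stable generator, which gives all Borel
  sets, and a Lebesgue set differs from a Borel set by a null set only.\<close>

lemma AE_eq_0_if_orthogonal_to_test_functions:
  fixes g :: "'a::euclidean_space \<Rightarrow> real"
  assumes "open \<Omega>" and g: "integrable (lebesgue_on \<Omega>) g"
    and orth: "\<And>\<phi>. \<phi> \<in> test_functions \<Omega> \<Longrightarrow> (LINT x|lebesgue_on \<Omega>. g x * \<phi> x) = 0"
  shows "AE x in lebesgue_on \<Omega>. g x = 0"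
proof -
  let ?M = "lebesgue_on \<Omega>"
  have \<Omega>: "\<Omega> \<in> sets lebesgue" using assms(1) by auto
  have [measurable]: "g \<in> borel_measurable ?M" using g by auto
  have set_int: "set_integrable ?M B g" if "B \<in> sets ?M" for B
    unfolding set_integrable_def using integrable_mult_indicator[OF that g] by simp
  have "open B \<Longrightarrow> (LINT x:(B \<inter> \<Omega>)|?M. g x) = 0" for B
  proof -
    assume "open B"
    then obtain \<phi> where \<phi>: "\<And>n. \<phi> n \<in> test_functions (B \<inter> \<Omega>)" "\<And>n x. 0 \<le> \<phi> n x \<and> \<phi> n x \<le> 1"
      "\<And>x. (\<lambda>n::nat. \<phi> n x) \<longlonglongrightarrow> indicator (B \<inter> \<Omega>) x"
      using indicator_open_limit_test_functions[of "B \<inter> \<Omega>"] assms(1) by blast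
    have [measurable]: "\<phi> n \<in> borel_measurable ?M" for n
      using borel_measurable_continuous_onI[OF test_functions_continuous[OF \<phi>(1)]]
      by (intro measurable_restrict_space1 measurable_completion) simp
    have [measurable]: "B \<inter> \<Omega> \<in> sets ?M"
      using \<open>open B\<close> \<Omega> by (auto simp: sets_restrict_space_iff)
    have "(\<lambda>n. LINT x|?M. g x * \<phi> n x) \<longlonglongrightarrow> (LINT x|?M. g x * indicator (B \<inter> \<Omega>) x)"
    proof (rule integral_dominated_convergence[where w = "\<lambda>x. \<bar>g x\<bar>"])
      show "AE x in ?M. (\<lambda>n. g x * \<phi> n x) \<longlonglongrightarrow> g x * indicator (B \<inter> \<Omega>) x"
        by (intro AE_I2 tendsto_intros \<phi>(3))
      show "AE x in ?M. norm (g x * \<phi> n x) \<le> \<bar>g x\<bar>" for n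
        using \<phi>(2) by (intro AE_I2) (simp add: abs_mult mult_left_le)
      show "(\<lambda>x. g x * indicator (B \<inter> \<Omega>) x) \<in> borel_measurable ?M" by measurable
    qed (use g in auto)
    moreover have "(LINT x|?M. g x * \<phi> n x) = 0" for n
      using orth test_functions_mono[OF _ \<phi>(1)[of n]] by auto
    ultimately show ?thesis
      by (simp add: LIMSEQ_const_iff set_lebesgue_integral_def mult.commute)
  qed
  note op = this
  have borel: "(LINT x:(B \<inter> \<Omega>)|?M. g x) = 0" if "B \<in> sets borel" for B
  proof -
    have "Int_stable {S::'a set. open S}" by (auto simp: Int_stable_def)
    moreover have "{S::'a set. open S} \<subseteq> Pow UNIV" by auto
    moreover have "B \<in> sigma_sets UNIV {S. open S}" using that by (simp add: borel_def)
    ultimately show ?thesis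
    proof (induction rule: sigma_sets_induct_disjoint)
      case (basic A)
      then show ?case using op by auto
    next
      case empty
      then show ?case by (simp add: set_lebesgue_integral_def)
    next
      case (compl A)
      then have A: "A \<in> sets borel" by (simp add: borel_def)
      then have 1: "A \<inter> \<Omega> \<in> sets ?M" "(UNIV - A) \<inter> \<Omega> \<in> sets ?M"
        using \<Omega> by (auto simp: sets_restrict_space_iff)
      have "(LINT x:((A \<inter> \<Omega>) \<union> ((UNIV - A) \<inter> \<Omega>))|?M. g x)
          = (LINT x:(A \<inter> \<Omega>)|?M. g x) + (LINT x:((UNIV - A) \<inter> \<Omega>)|?M. g x)"
        by (intro set_integral_Un set_int 1) auto
      moreover have "(A \<inter> \<Omega>) \<union> ((UNIV - A) \<inter> \<Omega>) = UNIV \<inter> \<Omega>" by auto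
      ultimately show ?case using compl op[of UNIV] by simp
    next
      case (union A)
      then have 1: "A i \<inter> \<Omega> \<in> sets ?M" for i
      proof -
        have "A i \<in> sets borel" using union(2) by (auto simp: borel_def)
        then show ?thesis using \<Omega> by (auto simp: sets_restrict_space_iff)
      qed
      have "(LINT x:(\<Union>i. A i \<inter> \<Omega>)|?M. g x) = (\<Sum>i. LINT x:(A i \<inter> \<Omega>)|?M. g x)"
      proof (rule lebesgue_integral_countable_add[OF 1])
        show "(A i \<inter> \<Omega>) \<inter> (A j \<inter> \<Omega>) = {}" if "i \<noteq> j" for i j
          using union(1) that by (auto simp: disjoint_family_on_def)
        show "set_integrable ?M (\<Union>i. A i \<inter> \<Omega>) g" by (intro set_int sets.countable_UN) (use 1 in auto)
      qed
      then show ?case using union by simp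
    qed
  qed
  have "AE x in ?M. g x = (\<lambda>x. 0) x"
  proof (rule density_unique_real[OF g])
    fix A assume A: "A \<in> sets ?M"
    then have "A \<in> sets lebesgue" "A \<subseteq> \<Omega>" using \<Omega> by (auto simp: sets_restrict_space_iff)
    then obtain S N N' where S: "A = S \<union> N" "N \<subseteq> N'" "N' \<in> null_sets lborel" "S \<in> sets lborel"
      using sets_completionE by metis
    then have "N \<in> null_sets lebesgue"
      by (meson completion.complete2 null_sets_completionI)
    then have "AE x in lebesgue. x \<notin> N" by (rule AE_not_in)
    then have N: "AE x in ?M. x \<notin> N"
      using \<Omega> by (subst AE_restrict_space_iff) auto
    have "(LINT x:A|?M. g x) = (LINT x:(S \<inter> \<Omega>)|?M. g x)"
      unfolding set_lebesgue_integral_def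
    proof (intro integral_cong_AE)
      have "S \<inter> \<Omega> \<in> sets ?M" using S \<Omega> by (auto simp: sets_restrict_space_iff)
      then show "(\<lambda>x. indicator A x *\<^sub>R g x) \<in> borel_measurable ?M" "(\<lambda>x. indicator (S \<inter> \<Omega>) x *\<^sub>R g x) \<in> borel_measurable ?M"
        using A by measurable
      show "AE x in ?M. indicator A x *\<^sub>R g x = indicator (S \<inter> \<Omega>) x *\<^sub>R g x"
        using N AE_space by eventually_elim (auto simp: indicator_def S(1))
    qed
    then show "(LINT x:A|?M. g x) = (LINT x:A|?M. 0)" using borel S by simp
  qed auto
  then show ?thesis by simp
qed


subsection \<open>Square integrable functions\<close>

lemma L2_spaceD:
  assumes "g \<in> L2_space M"
  shows "g \<in> borel_measurable M" "integrable M (\<lambda>x. (g x)\<^sup>2)"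
  using assms by (auto simp: L2_space_def)

lemma L2_space_mult_integrable:
  assumes "f \<in> L2_space M" "g \<in> L2_space M"
  shows "integrable M (\<lambda>x. f x * g x)"
proof (rule Bochner_Integration.integrable_bound)
  show "integrable M (\<lambda>x. (f x)\<^sup>2 + (g x)\<^sup>2)"
    by (intro Bochner_Integration.integrable_add L2_spaceD assms)
  show "(\<lambda>x. f x * g x) \<in> borel_measurable M"
    by (intro borel_measurable_times L2_spaceD(1) assms)
  have "\<bar>a * b\<bar> \<le> a\<^sup>2 + b\<^sup>2" for a b :: real
  proof -
    have "2 * (\<bar>a\<bar> * \<bar>b\<bar>) \<le> a\<^sup>2 + b\<^sup>2" using sum_squares_bound[of "\<bar>a\<bar>" "\<bar>b\<bar>"] by (simp add: mult.assoc)
    moreover have "0 \<le> \<bar>a\<bar> * \<bar>b\<bar>" by simp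
    ultimately show ?thesis unfolding abs_mult by linarith
  qed
  then show "AE x in M. norm (f x * g x) \<le> norm ((f x)\<^sup>2 + (g x)\<^sup>2)" by auto
qed

lemma L2_space_add:
  assumes "f \<in> L2_space M" "g \<in> L2_space M"
  shows "(\<lambda>x. f x + g x) \<in> L2_space M"
proof -
  have "integrable M (\<lambda>x. (f x)\<^sup>2 + (g x)\<^sup>2 + 2 * (f x * g x))"
    by (intro Bochner_Integration.integrable_add integrable_mult_right L2_space_mult_integrable L2_spaceD assms)
  then show ?thesis using assms by (auto simp: L2_space_def power2_sum mult.assoc)
qed

lemma L2_space_cmult:
  assumes "f \<in> L2_space M" shows "(\<lambda>x. c * f x) \<in> L2_space M"
  using assms by (auto simp: L2_space_def power_mult_distrib)

lemma L2_space_diff: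
  assumes "f \<in> L2_space M" "g \<in> L2_space M"
  shows "(\<lambda>x. f x - g x) \<in> L2_space M"
  using L2_space_add[OF assms(1) L2_space_cmult[OF assms(2), of "- 1"]] by simp

lemma L2_space_abs: "f \<in> L2_space M \<Longrightarrow> (\<lambda>x. \<bar>f x\<bar>) \<in> L2_space M"
  by (auto simp: L2_space_def)

lemma L2_space_bounded_mult:
  assumes f: "f \<in> L2_space M" and g: "g \<in> borel_measurable M" and b: "AE x in M. \<bar>g x\<bar> \<le> B"
  shows "(\<lambda>x. g x * f x) \<in> L2_space M"
proof -
  have "integrable M (\<lambda>x. (g x * f x)\<^sup>2)"
  proof (rule Bochner_Integration.integrable_bound)
    show "integrable M (\<lambda>x. B\<^sup>2 * (f x)\<^sup>2)" by (intro integrable_mult_right L2_spaceD f)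
    show "(\<lambda>x. (g x * f x)\<^sup>2) \<in> borel_measurable M" using g f by (auto dest: L2_spaceD)
    show "AE x in M. norm ((g x * f x)\<^sup>2) \<le> norm (B\<^sup>2 * (f x)\<^sup>2)"
      using b by eventually_elim (auto simp: power_mult_distrib intro!: mult_right_mono abs_le_square_iff[THEN iffD1])
  qed
  then show ?thesis using f g by (auto simp: L2_space_def)
qed

lemma L2_space_const:
  assumes "finite_measure M" shows "(\<lambda>x. c) \<in> L2_space M"
  using finite_measure.integrable_const[OF assms] by (auto simp: L2_space_def)

lemma L2_space_bounded:
  assumes "finite_measure M" "g \<in> borel_measurable M" "AE x in M. \<bar>g x\<bar> \<le> B"
  shows "g \<in> L2_space M"
  using L2_space_bounded_mult[OF L2_space_const[OF assms(1), of 1] assms(2,3)] by simp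

lemma L2_space_integrable:
  assumes "finite_measure M" "f \<in> L2_space M"
  shows "integrable M f"
  using L2_space_mult_integrable[OF assms(2) L2_space_const[OF assms(1), of 1]] by simp

text \<open>Discriminant of the nonnegative quadratic polynomial given by the integral of
  \<open>(t * \<bar>f\<bar> - \<bar>g\<bar>)^2\<close>; the absolute values inside make it bound the
  integral of the modulus of the product.\<close>

lemma Cauchy_Schwarz_integral:
  assumes "f \<in> L2_space M" "g \<in> L2_space M"
  shows "(LINT x|M. \<bar>f x * g x\<bar>)\<^sup>2 \<le> (LINT x|M. (f x)\<^sup>2) * (LINT x|M. (g x)\<^sup>2)"
proof -
  define A B C where "A = (LINT x|M. (f x)\<^sup>2)" "B = (LINT x|M. \<bar>f x * g x\<bar>)" "C = (LINT x|M. (g x)\<^sup>2)"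
  note [simp] = L2_spaceD[OF assms(1)] L2_spaceD[OF assms(2)]
  have i: "integrable M (\<lambda>x. \<bar>f x * g x\<bar>)" using L2_space_mult_integrable[OF assms] by simp
  have q: "0 \<le> t\<^sup>2 * A - 2 * t * B + C" for t
  proof -
    have "0 \<le> (LINT x|M. (t * \<bar>f x\<bar> - \<bar>g x\<bar>)\<^sup>2)" by (intro integral_nonneg_AE) auto
    also have "(LINT x|M. (t * \<bar>f x\<bar> - \<bar>g x\<bar>)\<^sup>2)
        = (LINT x|M. t\<^sup>2 * (f x)\<^sup>2 - 2 * t * \<bar>f x * g x\<bar> + (g x)\<^sup>2)"
      by (intro Bochner_Integration.integral_cong) (auto simp: power2_diff power_mult_distrib abs_mult algebra_simps)
    also have "\<dots> = t\<^sup>2 * A - 2 * t * B + C"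
      using i by (simp add: A_B_C_def)
    finally show ?thesis .
  qed
  have "A \<ge> 0" "B \<ge> 0" by (auto simp: A_B_C_def intro!: integral_nonneg_AE)
  have "B\<^sup>2 \<le> A * C"
  proof (cases "A = 0")
    case True
    \<comment> \<open>With \<open>A = 0\<close> the polynomial is affine in \<open>t\<close>; at
      \<open>t = (C + 1) / B\<close> its value is \<open>- C - 2\<close>, which is negative.\<close>
    have "B = 0"
    proof (rule ccontr)
      assume "B \<noteq> 0"
      then have "2 * ((C + 1) / B) * B = 2 * (C + 1)" by simp
      moreover have "C \<ge> 0" by (auto simp: A_B_C_def intro!: integral_nonneg_AE)
      ultimately show False using q[of "(C + 1) / B"] True by simp
    qed
    then show ?thesis using True by simp
  next
    case False
    then have "A > 0" using \<open>A \<ge> 0\<close> by simp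
    have "0 \<le> A * ((B / A)\<^sup>2 * A - 2 * (B / A) * B + C)"
      using q[of "B / A"] \<open>A > 0\<close> by (intro mult_nonneg_nonneg) auto
    also have "\<dots> = A * C - B\<^sup>2" using False by (simp add: field_simps power2_eq_square)
    finally show ?thesis by simp
  qed
  then show ?thesis by (simp add: A_B_C_def)
qed


subsection \<open>Weak gradients\<close>

lemma continuous_measurable_lebesgue_on:
  fixes f :: "'a::euclidean_space \<Rightarrow> real"
  assumes "continuous_on UNIV f" shows "f \<in> borel_measurable (lebesgue_on S)"
  using borel_measurable_continuous_onI[OF assms]
  by (intro measurable_restrict_space1 measurable_completion) simp

lemma test_functions_measurable: "\<phi> \<in> test_functions \<Omega> \<Longrightarrow> \<phi> \<in> borel_measurable (lebesgue_on S)"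
  by (intro continuous_measurable_lebesgue_on test_functions_continuous)

lemma integrable_lebesgue_on_continuous:
  fixes f :: "'a::euclidean_space \<Rightarrow> real"
  assumes "continuous_on UNIV f" "compact K" "\<And>x. x \<notin> K \<Longrightarrow> f x = 0" "S \<in> sets lebesgue"
  shows "integrable (lebesgue_on S) f"
proof -
  have "integrable lebesgue f"
    using integrable_continuous_compact_support[OF assms(1-3)]
      borel_measurable_continuous_onI[OF assms(1)] by (simp add: integrable_completion)
  from integrable_mult_indicator[OF assms(4) this] show ?thesis
    using assms(4) by (simp add: integrable_restrict_space)
qed

lemma test_functions_mult_integrable:
  assumes "\<phi> \<in> test_functions \<Omega>'" "continuous_on UNIV g" "S \<in> sets lebesgue"
  shows "integrable (lebesgue_on S) (\<lambda>x. g x * \<phi> x)"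
proof -
  obtain K where "compact K" "\<And>x. x \<notin> K \<Longrightarrow> \<phi> x = 0" by (rule test_functionsE[OF assms(1)]) blast
  then show ?thesis
    by (intro integrable_lebesgue_on_continuous[of _ K] continuous_on_mult assms test_functions_continuous[OF assms(1)]) auto
qed

lemma test_functions_L2:
  assumes "\<phi> \<in> test_functions \<Omega>'" "S \<in> sets lebesgue"
  shows "\<phi> \<in> L2_space (lebesgue_on S)"
  using test_functions_mult_integrable[OF assms(1) test_functions_continuous[OF assms(1)] assms(2)]
    test_functions_measurable[OF assms(1)] by (simp add: L2_space_def power2_eq_square)

lemma weak_gradient_test_function:
  assumes \<phi>: "\<phi> \<in> test_functions \<Omega>" and \<Omega>: "\<Omega> \<in> sets lebesgue"
  shows "weak_gradient \<Omega> \<phi> (classical_grad \<phi>)"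
  unfolding weak_gradient_def
proof (intro conjI ballI)
  fix i :: 'a assume i: "i \<in> Basis"
  show "(\<lambda>x. classical_grad \<phi> x \<bullet> i) \<in> L2_space (lebesgue_on \<Omega>)"
    using test_functions_L2[OF test_functions_partial[OF \<phi> i] \<Omega>] i by (simp add: classical_grad_inner_Basis)
  fix \<eta> assume \<eta>: "\<eta> \<in> test_functions \<Omega>"
  obtain L where L: "L-lipschitz_on UNIV \<phi>" using \<phi> by (rule test_functions_lipschitz) blast
  have "partial i \<phi> \<in> borel_measurable borel"
    by (rule borel_measurable_continuous_onI[OF test_functions_continuous[OF test_functions_partial[OF \<phi> i]]])
  from integration_by_parts[OF L \<eta> \<Omega> AE_I2[OF test_functions_line_derivative[OF \<phi>]] this]
  show "(LINT x|lebesgue_on \<Omega>. \<phi> x * partial i \<eta> x) = - (LINT x|lebesgue_on \<Omega>. classical_grad \<phi> x \<bullet> i * \<eta> x)"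
    using i by (simp add: classical_grad_inner_Basis)
qed

lemma integral_partial_test_function:
  assumes \<phi>: "\<phi> \<in> test_functions \<Omega>" and \<Omega>: "\<Omega> \<in> sets lebesgue"
  shows "(LINT x|lebesgue_on \<Omega>. partial v \<phi> x) = 0"
proof -
  have "0-lipschitz_on UNIV (\<lambda>x::'a. 1::real)" by (simp add: lipschitz_on_def)
  from integration_by_parts[OF this \<phi> \<Omega>, where v = v and D = "\<lambda>x. 0"] show ?thesis by simp
qed

lemma norm_sq_sum: "(norm (v::'a::euclidean_space))\<^sup>2 = (\<Sum>i\<in>Basis. (v \<bullet> i)\<^sup>2)"
  unfolding power2_norm_eq_inner by (subst euclidean_inner) (simp add: power2_eq_square)

section \<open>Weak gradients and \<open>H10_space\<close> over a bounded open set\<close>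

locale bounded_domain =
  fixes \<Omega> :: "'a::euclidean_space set"
  assumes open_domain: "open \<Omega>" and bounded_domain: "bounded \<Omega>"
begin

abbreviation "M\<Omega> \<equiv> lebesgue_on \<Omega>"

lemma domain_sets [measurable, simp]: "\<Omega> \<in> sets lebesgue"
  using open_domain by auto

lemma domain_lmeasurable: "\<Omega> \<in> lmeasurable"
  by (simp add: bounded_domain bounded_set_imp_lmeasurable)

lemma finite_measure_domain: "finite_measure M\<Omega>"
  by (rule finite_measure_lebesgue_on[OF domain_lmeasurable])

lemma L2_integrable: "g \<in> L2_space M\<Omega> \<Longrightarrow> integrable M\<Omega> g"
  by (rule L2_space_integrable[OF finite_measure_domain])

text \<open>\<open>grad\<close> is a choice, so its values can be computed only through this
  uniqueness, which is the fundamental lemma applied to each coordinate.\<close>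

lemma weak_gradient_unique:
  assumes "weak_gradient \<Omega> u g" "weak_gradient \<Omega> u g'"
  shows "AE x in M\<Omega>. g x = g' x"
proof -
  have "AE x in M\<Omega>. g x \<bullet> i - g' x \<bullet> i = 0" if i: "i \<in> Basis" for i
  proof (rule AE_eq_0_if_orthogonal_to_test_functions[OF open_domain])
    have L2: "(\<lambda>x. g x \<bullet> i) \<in> L2_space M\<Omega>" "(\<lambda>x. g' x \<bullet> i) \<in> L2_space M\<Omega>"
      using assms i by (auto simp: weak_gradient_def)
    then show "integrable M\<Omega> (\<lambda>x. g x \<bullet> i - g' x \<bullet> i)"
      by (intro L2_integrable L2_space_diff)
    fix \<phi> assume \<phi>: "\<phi> \<in> test_functions \<Omega>"
    note L2' = L2[THEN L2_space_mult_integrable, OF test_functions_L2[OF \<phi> domain_sets]]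
    have "(LINT x|M\<Omega>. (g x \<bullet> i) * \<phi> x) = (LINT x|M\<Omega>. (g' x \<bullet> i) * \<phi> x)"
      using assms i \<phi> by (auto simp: weak_gradient_def)
    then show "(LINT x|M\<Omega>. (g x \<bullet> i - g' x \<bullet> i) * \<phi> x) = 0"
      using L2' by (simp add: left_diff_distrib)
  qed
  then have "AE x in M\<Omega>. \<forall>i\<in>Basis. g x \<bullet> i - g' x \<bullet> i = 0"
    by (intro AE_finite_allI) auto
  then show ?thesis by eventually_elim (auto intro: euclidean_eqI)
qed

lemma weak_gradient_grad: "u \<in> H1_space \<Omega> \<Longrightarrow> weak_gradient \<Omega> u (grad \<Omega> u)"
  unfolding grad_def H1_space_def by (auto intro: someI[of "weak_gradient \<Omega> u"])

lemma grad_eq_weak_gradient: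
  assumes "weak_gradient \<Omega> u g" shows "AE x in M\<Omega>. grad \<Omega> u x = g x"
  by (rule weak_gradient_unique[OF _ assms]) (unfold grad_def, rule someI[of "weak_gradient \<Omega> u", OF assms])

lemma H1_L2: "u \<in> H1_space \<Omega> \<Longrightarrow> u \<in> L2_space M\<Omega>"
  by (simp add: H1_space_def)

lemma H10_H1: "u \<in> H10_space \<Omega> \<Longrightarrow> u \<in> H1_space \<Omega>"
  by (simp add: H10_space_def)

lemma H10_L2: "u \<in> H10_space \<Omega> \<Longrightarrow> u \<in> L2_space M\<Omega>"
  by (simp add: H1_L2 H10_H1)

lemma grad_L2: "u \<in> H1_space \<Omega> \<Longrightarrow> i \<in> Basis \<Longrightarrow> (\<lambda>x. grad \<Omega> u x \<bullet> i) \<in> L2_space M\<Omega>"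
  using weak_gradient_grad by (auto simp: weak_gradient_def)

lemma grad_inner_integrable:
  assumes "u \<in> H1_space \<Omega>" "v \<in> H1_space \<Omega>"
  shows "integrable M\<Omega> (\<lambda>x. grad \<Omega> u x \<bullet> grad \<Omega> v x)"
proof -
  have "grad \<Omega> u x \<bullet> grad \<Omega> v x = (\<Sum>i\<in>Basis. (grad \<Omega> u x \<bullet> i) * (grad \<Omega> v x \<bullet> i))" for x
    by (rule euclidean_inner)
  then show ?thesis
    by (auto intro!: Bochner_Integration.integrable_sum L2_space_mult_integrable grad_L2 assms)
qed

lemma grad_norm_integrable:
  "u \<in> H1_space \<Omega> \<Longrightarrow> integrable M\<Omega> (\<lambda>x. (norm (grad \<Omega> u x))\<^sup>2)"
  using grad_inner_integrable[of u u] by (simp add: power2_norm_eq_inner)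

lemma weak_gradient_diff:
  assumes "weak_gradient \<Omega> u g" "weak_gradient \<Omega> v g'" "u \<in> L2_space M\<Omega>" "v \<in> L2_space M\<Omega>"
  shows "weak_gradient \<Omega> (\<lambda>x. u x - v x) (\<lambda>x. g x - g' x)"
  unfolding weak_gradient_def
proof (intro conjI ballI)
  fix i :: 'a assume i: "i \<in> Basis"
  have L2: "(\<lambda>x. g x \<bullet> i) \<in> L2_space M\<Omega>" "(\<lambda>x. g' x \<bullet> i) \<in> L2_space M\<Omega>"
    using assms i by (auto simp: weak_gradient_def)
  then show "(\<lambda>x. (g x - g' x) \<bullet> i) \<in> L2_space M\<Omega>"
    by (auto simp: inner_diff_left intro: L2_space_diff)
  fix \<phi> assume \<phi>: "\<phi> \<in> test_functions \<Omega>"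
  note t = test_functions_L2[OF \<phi> domain_sets] test_functions_L2[OF test_functions_partial[OF \<phi> i] domain_sets]
  have "(LINT x|M\<Omega>. (u x - v x) * partial i \<phi> x) = (LINT x|M\<Omega>. u x * partial i \<phi> x) - (LINT x|M\<Omega>. v x * partial i \<phi> x)"
    using L2_space_mult_integrable[OF assms(3) t(2)] L2_space_mult_integrable[OF assms(4) t(2)]
    by (simp add: left_diff_distrib)
  also have "\<dots> = - (LINT x|M\<Omega>. (g x \<bullet> i) * \<phi> x) + (LINT x|M\<Omega>. (g' x \<bullet> i) * \<phi> x)"
    using assms(1,2) i \<phi> by (simp add: weak_gradient_def)
  also have "\<dots> = - (LINT x|M\<Omega>. ((g x - g' x) \<bullet> i) * \<phi> x)"
    using L2_space_mult_integrable[OF L2(1) t(1)] L2_space_mult_integrable[OF L2(2) t(1)]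
    by (simp add: left_diff_distrib inner_diff_left)
  finally show "(LINT x|M\<Omega>. (u x - v x) * partial i \<phi> x) = - (LINT x|M\<Omega>. ((g x - g' x) \<bullet> i) * \<phi> x)" .
qed

lemma grad_test_function: "\<phi> \<in> test_functions \<Omega> \<Longrightarrow> AE x in M\<Omega>. grad \<Omega> \<phi> x = classical_grad \<phi> x"
  by (intro grad_eq_weak_gradient weak_gradient_test_function domain_sets)

lemma test_function_H1: "\<phi> \<in> test_functions \<Omega> \<Longrightarrow> \<phi> \<in> H1_space \<Omega>"
  unfolding H1_space_def using test_functions_L2[OF _ domain_sets] weak_gradient_test_function[OF _ domain_sets] by blast

lemma test_function_H10:
  assumes "\<phi> \<in> test_functions \<Omega>" shows "\<phi> \<in> H10_space \<Omega>"
proof -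
  have z: "(\<lambda>x. 0) \<in> test_functions \<Omega>" by (rule test_functions_zero)
  have "classical_grad (\<lambda>x. 0) = (\<lambda>x. 0::'a)" by (simp add: classical_grad_def fun_eq_iff)
  \<comment> \<open>The approximating test function is \<open>\<phi>\<close> itself; still,
    \<open>grad\<close> of the zero function is a chosen representative and vanishes only almost
    everywhere.\<close>
  then have "AE x in M\<Omega>. grad \<Omega> (\<lambda>x. 0) x = 0" using grad_test_function[OF z] by simp
  then have "(LINT x|M\<Omega>. (norm (grad \<Omega> (\<lambda>x. 0) x))\<^sup>2) = 0"
    by (intro integral_eq_zero_AE) auto
  then have "H1_norm \<Omega> (\<lambda>x. \<phi> x - \<phi> x) = 0" by (simp add: H1_norm_def)
  then have "\<exists>\<phi>'\<in>test_functions \<Omega>. H1_norm \<Omega> (\<lambda>x. \<phi> x - \<phi>' x) < \<epsilon>" if "\<epsilon> > 0" for \<epsilon>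
    using that assms by (intro bexI[of _ \<phi>]) auto
  then show ?thesis using test_function_H1[OF assms] by (simp add: H10_space_def)
qed

text \<open>The definition of the weak gradient, applied with the test functions
  \<open>partial i \<phi>\<close>, puts both derivatives on \<open>\<phi>\<close>. The formula is
  therefore available for the continuous state and adjoint state, of which no second derivatives are
  known.\<close>

lemma integral_grad_test_function:
  assumes u: "u \<in> H1_space \<Omega>" and \<phi>: "\<phi> \<in> test_functions \<Omega>"
  shows "(LINT x|M\<Omega>. grad \<Omega> u x \<bullet> grad \<Omega> \<phi> x) = - (LINT x|M\<Omega>. u x * laplacian \<phi> x)"
proof -
  note p = test_functions_partial[OF \<phi>]
  have m: "(\<lambda>x. grad \<Omega> u x \<bullet> classical_grad \<phi> x) = (\<lambda>x. \<Sum>i\<in>Basis. (grad \<Omega> u x \<bullet> i) * partial i \<phi> x)"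
    by (simp add: classical_grad_def inner_sum_right mult.commute)
  have i: "integrable M\<Omega> (\<lambda>x. (grad \<Omega> u x \<bullet> i) * partial i \<phi> x)" if "i \<in> Basis" for i
    using that by (intro L2_space_mult_integrable grad_L2 u test_functions_L2[OF p]) auto
  have "integrable M\<Omega> (\<lambda>x. grad \<Omega> u x \<bullet> classical_grad \<phi> x)"
    unfolding m by (intro Bochner_Integration.integrable_sum i)
  then have "(LINT x|M\<Omega>. grad \<Omega> u x \<bullet> grad \<Omega> \<phi> x) = (LINT x|M\<Omega>. grad \<Omega> u x \<bullet> classical_grad \<phi> x)"
    using grad_test_function[OF \<phi>] grad_inner_integrable[OF u test_function_H1[OF \<phi>]]
    by (intro integral_cong_AE) (auto elim!: eventually_mono)
  also have "\<dots> = (\<Sum>i\<in>Basis. LINT x|M\<Omega>. (grad \<Omega> u x \<bullet> i) * partial i \<phi> x)"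
    unfolding m by (intro Bochner_Integration.integral_sum i)
  also have "\<dots> = (\<Sum>i\<in>Basis. - (LINT x|M\<Omega>. u x * partial i (partial i \<phi>) x))"
    using weak_gradient_grad[OF u] p by (intro sum.cong) (auto simp: weak_gradient_def)
  also have "\<dots> = - (LINT x|M\<Omega>. (\<Sum>i\<in>Basis. u x * partial i (partial i \<phi>) x))"
    by (subst Bochner_Integration.integral_sum)
       (auto simp: sum_negf intro!: L2_space_mult_integrable H1_L2[OF u] test_functions_L2[OF test_functions_partial[OF p]])
  finally show ?thesis by (simp add: laplacian_def sum_distrib_left)
qed


subsection \<open>Poincare and Hardy inequalities\<close>

text \<open>Integrating the divergence of \<open>\<phi>\<^sup>2 F\<close> gives both inequalities, by the choice of the field \<open>F\<close>.\<close>

lemma weighted_inequality_test_function: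
  assumes \<phi>: "\<phi> \<in> test_functions \<Omega>"
    and F: "\<And>i k. i \<in> Basis \<Longrightarrow> C_k k (\<lambda>x. F x \<bullet> i)"
    and div: "\<And>x. x \<in> \<Omega> \<Longrightarrow> \<rho> x \<le> (\<Sum>i\<in>Basis. partial i (\<lambda>x. F x \<bullet> i) x)"
    and FB: "\<And>x. x \<in> \<Omega> \<Longrightarrow> (norm (F x))\<^sup>2 \<le> B * \<rho> x"
    and \<rho>: "continuous_on UNIV \<rho>" "\<And>x. \<rho> x \<ge> 0" and B: "B \<ge> 0"
  shows "(LINT x|M\<Omega>. \<rho> x * (\<phi> x)\<^sup>2) \<le> 4 * B * (LINT x|M\<Omega>. (norm (classical_grad \<phi> x))\<^sup>2)"
proof -
  define w where "w i x = F x \<bullet> i * \<phi> x * \<phi> x" for i x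
  have w: "w i \<in> test_functions \<Omega>" if "i \<in> Basis" for i
    unfolding w_def using that by (intro test_functions_mult[OF \<phi>] C_k_mult F test_functions_C_k[OF \<phi>])
  have dw: "partial i (w i) x = partial i (\<lambda>x. F x \<bullet> i) x * (\<phi> x)\<^sup>2 + 2 * \<phi> x * ((F x \<bullet> i) * partial i \<phi> x)"
    if i: "i \<in> Basis" for i x
  proof -
    have "(w i has_derivative (\<lambda>h. F x \<bullet> i * \<phi> x * frechet_derivative \<phi> (at x) h + (F x \<bullet> i * frechet_derivative \<phi> (at x) h
        + frechet_derivative (\<lambda>x. F x \<bullet> i) (at x) h * \<phi> x) * \<phi> x)) (at x)"
      unfolding w_def by (intro has_derivative_mult C_k_has_derivative[OF F[OF i]] test_functions_has_derivative[OF \<phi>])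
    from frechet_derivative_at[OF this, symmetric] show ?thesis
      by (simp add: algebra_simps power2_eq_square)
  qed
  let ?D = "\<lambda>x. \<Sum>i\<in>Basis. partial i (w i) x"
  have "(LINT x|M\<Omega>. ?D x) = (\<Sum>i\<in>Basis. LINT x|M\<Omega>. partial i (w i) x)"
    by (intro Bochner_Integration.integral_sum L2_integrable test_functions_L2[OF test_functions_partial[OF w]]) auto
  then have D0: "(LINT x|M\<Omega>. ?D x) = 0"
    using integral_partial_test_function[OF w domain_sets] by simp
  have Di: "integrable M\<Omega> ?D"
    by (intro Bochner_Integration.integrable_sum L2_integrable test_functions_L2[OF test_functions_partial[OF w]]) auto
  have i1: "integrable M\<Omega> (\<lambda>x. \<rho> x * (\<phi> x)\<^sup>2)"
    using test_functions_mult_integrable[OF \<phi> continuous_on_mult[OF \<rho>(1) test_functions_continuous[OF \<phi>]] domain_sets]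
    by (simp add: power2_eq_square mult.assoc)
  have i2: "integrable M\<Omega> (\<lambda>x. (norm (classical_grad \<phi> x))\<^sup>2)"
    unfolding norm_sq_sum
    by (intro Bochner_Integration.integrable_sum L2_spaceD(2))
       (auto simp: classical_grad_inner_Basis intro!: test_functions_L2[OF test_functions_partial[OF \<phi>]])
  have "(LINT x|M\<Omega>. \<rho> x * (\<phi> x)\<^sup>2 / 2 - 2 * B * (norm (classical_grad \<phi> x))\<^sup>2) \<le> (LINT x|M\<Omega>. ?D x)"
  proof (intro integral_mono Di)
    show "integrable M\<Omega> (\<lambda>x. \<rho> x * (\<phi> x)\<^sup>2 / 2 - 2 * B * (norm (classical_grad \<phi> x))\<^sup>2)"
      using i1 i2 by simp
    fix x assume "x \<in> space M\<Omega>"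
    then have x: "x \<in> \<Omega>" by simp
    define n where "n = norm (classical_grad \<phi> x)"
    have "?D x = (\<Sum>i\<in>Basis. partial i (\<lambda>x. F x \<bullet> i) x) * (\<phi> x)\<^sup>2 + 2 * \<phi> x * (F x \<bullet> classical_grad \<phi> x)"
      by (simp add: dw sum.distrib sum_distrib_left sum_distrib_right classical_grad_def inner_sum_right mult_ac)
    moreover have "(\<Sum>i\<in>Basis. partial i (\<lambda>x. F x \<bullet> i) x) * (\<phi> x)\<^sup>2 \<ge> \<rho> x * (\<phi> x)\<^sup>2"
      by (intro mult_right_mono div x) auto
    \<comment> \<open>Young's inequality with weights 1/2 and 2: half of
      \<open>\<rho> * \<phi>^2\<close> absorbs the cross term, and the remaining half yields the
      factor \<open>4 * B\<close> after integration.\<close>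
    moreover have "- (2 * \<phi> x * (F x \<bullet> classical_grad \<phi> x)) \<le> \<rho> x * (\<phi> x)\<^sup>2 / 2 + 2 * B * n\<^sup>2"
    proof -
      have "\<bar>2 * \<phi> x * (F x \<bullet> classical_grad \<phi> x)\<bar> = 2 * \<bar>\<phi> x\<bar> * \<bar>F x \<bullet> classical_grad \<phi> x\<bar>"
        by (simp add: abs_mult)
      also have "\<dots> \<le> 2 * \<bar>\<phi> x\<bar> * (norm (F x) * n)"
        unfolding n_def by (intro mult_left_mono Cauchy_Schwarz_ineq2) auto
      also have "\<dots> \<le> 2 * \<bar>\<phi> x\<bar> * (sqrt (B * \<rho> x) * n)"
        using FB[OF x] by (intro mult_left_mono mult_right_mono) (auto simp: n_def real_le_rsqrt)
      also have "\<dots> = 2 * ((sqrt (\<rho> x) * \<bar>\<phi> x\<bar>) * (sqrt B * n))" by (simp add: real_sqrt_mult)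
      also have "\<dots> \<le> (sqrt (\<rho> x) * \<bar>\<phi> x\<bar>)\<^sup>2 / 2 + 2 * (sqrt B * n)\<^sup>2"
      proof -
        have "2 * (s * t) \<le> s\<^sup>2 / 2 + 2 * t\<^sup>2" for s t :: real
          using sum_squares_ge_zero[of "s - 2 * t" 0] by (simp add: power2_eq_square algebra_simps)
        then show ?thesis .
      qed
      also have "\<dots> = \<rho> x * (\<phi> x)\<^sup>2 / 2 + 2 * B * n\<^sup>2" using \<rho>(2) B by (simp add: power_mult_distrib)
      finally show ?thesis by linarith
    qed
    ultimately show "\<rho> x * (\<phi> x)\<^sup>2 / 2 - 2 * B * (norm (classical_grad \<phi> x))\<^sup>2 \<le> ?D x"
      unfolding n_def by linarith
  qed
  then show ?thesis using i1 i2 D0 by simp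
qed

text \<open>Density of test functions; passing from \<open>u\<close> to \<open>\<phi>\<close> and
  back costs a factor 2 each, which turns \<open>4 * B\<close> into \<open>16 * B\<close>. The bound
  \<open>R\<close> on the weight makes the weighted approximation error small but does not enter the
  constant, so weights with a large supremum do no harm.\<close>

lemma weighted_inequality:
  assumes u: "u \<in> H10_space \<Omega>"
    and F: "\<And>i k. i \<in> Basis \<Longrightarrow> C_k k (\<lambda>x. F x \<bullet> i)"
    and div: "\<And>x. x \<in> \<Omega> \<Longrightarrow> \<rho> x \<le> (\<Sum>i\<in>Basis. partial i (\<lambda>x. F x \<bullet> i) x)"
    and FB: "\<And>x. x \<in> \<Omega> \<Longrightarrow> (norm (F x))\<^sup>2 \<le> B * \<rho> x"
    and \<rho>: "continuous_on UNIV \<rho>" "\<And>x. \<rho> x \<ge> 0" "\<And>x. \<rho> x \<le> R" and B: "B \<ge> 0"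
  shows "(LINT x|M\<Omega>. \<rho> x * (u x)\<^sup>2) \<le> 16 * B * (LINT x|M\<Omega>. (norm (grad \<Omega> u x))\<^sup>2)"
proof (rule field_le_epsilon)
  fix e :: real assume e: "e > 0"
  have R: "R \<ge> 0" using \<rho>(2,3) order_trans by blast
  \<comment> \<open>The approximation error will enter as \<open>2 * R * a + 16 * B * b\<close> with
    \<open>a + b \<le> \<epsilon>^2\<close>, and this must not exceed \<open>e\<close>.\<close>
  define \<epsilon> where "\<epsilon> = sqrt (e / (2 * R + 16 * B + 1))"
  have den: "2 * R + 16 * B + 1 > 0" using R B by simp
  then have \<epsilon>: "\<epsilon> > 0" "(2 * R + 16 * B) * \<epsilon>\<^sup>2 \<le> e"
    using e R B by (auto simp: \<epsilon>_def field_simps)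
  then obtain \<phi> where \<phi>: "\<phi> \<in> test_functions \<Omega>" and small: "H1_norm \<Omega> (\<lambda>x. u x - \<phi> x) < \<epsilon>"
    using u unfolding H10_space_def by blast
  have u1: "u \<in> H1_space \<Omega>" by (rule H10_H1[OF u])
  have g: "AE x in M\<Omega>. grad \<Omega> (\<lambda>x. u x - \<phi> x) x = grad \<Omega> u x - classical_grad \<phi> x"
    by (intro grad_eq_weak_gradient weak_gradient_diff weak_gradient_grad u1
        weak_gradient_test_function \<phi> H1_L2 test_function_H1 domain_sets)
  have d1: "(\<lambda>x. u x - \<phi> x) \<in> H1_space \<Omega>"
    unfolding H1_space_def using weak_gradient_diff[OF weak_gradient_grad[OF u1] weak_gradient_test_function[OF \<phi> domain_sets]]
      L2_space_diff[OF H1_L2[OF u1] H1_L2[OF test_function_H1[OF \<phi>]]] H1_L2[OF u1] H1_L2[OF test_function_H1[OF \<phi>]] by blast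
  define a b where "a = (LINT x|M\<Omega>. (u x - \<phi> x)\<^sup>2)" "b = (LINT x|M\<Omega>. (norm (grad \<Omega> (\<lambda>x. u x - \<phi> x) x))\<^sup>2)"
  have ab: "a \<ge> 0" "b \<ge> 0" by (auto simp: a_b_def intro!: integral_nonneg_AE)
  have "sqrt (a + b) < \<epsilon>" using small by (simp add: H1_norm_def a_b_def)
  then have "(sqrt (a + b))\<^sup>2 \<le> \<epsilon>\<^sup>2" using ab by (intro power_mono) auto
  then have ab_le: "a + b \<le> \<epsilon>\<^sup>2" using ab by simp
  note [simp] = L2_spaceD(2)[OF L2_space_diff[OF H1_L2[OF u1] H1_L2[OF test_function_H1[OF \<phi>]]]]
    L2_spaceD(2)[OF H1_L2[OF u1]] L2_spaceD(2)[OF H1_L2[OF test_function_H1[OF \<phi>]]]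
    grad_norm_integrable[OF d1] grad_norm_integrable[OF u1]
  have \<rho>m: "\<rho> \<in> borel_measurable M\<Omega>" by (rule continuous_measurable_lebesgue_on[OF \<rho>(1)])
  have \<rho>i: "integrable M\<Omega> (\<lambda>x. \<rho> x * h x)" if "integrable M\<Omega> h" for h
    using that \<rho> \<rho>m by (intro Bochner_Integration.integrable_bound[OF integrable_mult_right[OF that, of R]])
      (auto simp: abs_mult intro!: mult_right_mono order_trans[OF \<rho>(3) abs_ge_self])
  have "(LINT x|M\<Omega>. \<rho> x * (u x)\<^sup>2) \<le> (LINT x|M\<Omega>. 2 * R * (u x - \<phi> x)\<^sup>2 + 2 * (\<rho> x * (\<phi> x)\<^sup>2))"
  proof (intro integral_mono)
    fix x
    have "(u x)\<^sup>2 \<le> 2 * (u x - \<phi> x)\<^sup>2 + 2 * (\<phi> x)\<^sup>2"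
      using sum_squares_ge_zero[of "u x - 2 * \<phi> x" 0] by (simp add: power2_eq_square algebra_simps)
    then have "\<rho> x * (u x)\<^sup>2 \<le> \<rho> x * (2 * (u x - \<phi> x)\<^sup>2 + 2 * (\<phi> x)\<^sup>2)"
      by (intro mult_left_mono \<rho>)
    also have "\<dots> = \<rho> x * (2 * (u x - \<phi> x)\<^sup>2) + 2 * (\<rho> x * (\<phi> x)\<^sup>2)" by (simp add: algebra_simps)
    also have "\<dots> \<le> R * (2 * (u x - \<phi> x)\<^sup>2) + 2 * (\<rho> x * (\<phi> x)\<^sup>2)"
      by (intro add_right_mono mult_right_mono \<rho>) auto
    finally show "\<rho> x * (u x)\<^sup>2 \<le> 2 * R * (u x - \<phi> x)\<^sup>2 + 2 * (\<rho> x * (\<phi> x)\<^sup>2)" by simp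
  qed (auto intro!: \<rho>i Bochner_Integration.integrable_add integrable_mult_right)
  also have "\<dots> = 2 * R * a + 2 * (LINT x|M\<Omega>. \<rho> x * (\<phi> x)\<^sup>2)"
    using \<rho>i[of "\<lambda>x. (\<phi> x)\<^sup>2"] by (simp add: a_b_def)
  also have "(LINT x|M\<Omega>. \<rho> x * (\<phi> x)\<^sup>2) \<le> 4 * B * (LINT x|M\<Omega>. (norm (classical_grad \<phi> x))\<^sup>2)"
    by (rule weighted_inequality_test_function[OF \<phi> F div FB \<rho>(1,2) B])
  also have "(LINT x|M\<Omega>. (norm (classical_grad \<phi> x))\<^sup>2)
      \<le> (LINT x|M\<Omega>. 2 * (norm (grad \<Omega> u x))\<^sup>2 + 2 * (norm (grad \<Omega> (\<lambda>x. u x - \<phi> x) x))\<^sup>2)"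
  proof (intro integral_mono_AE)
    show "integrable M\<Omega> (\<lambda>x. (norm (classical_grad \<phi> x))\<^sup>2)"
      unfolding norm_sq_sum
      by (intro Bochner_Integration.integrable_sum L2_spaceD(2))
         (auto simp: classical_grad_inner_Basis intro!: test_functions_L2[OF test_functions_partial[OF \<phi>]])
    show "AE x in M\<Omega>. (norm (classical_grad \<phi> x))\<^sup>2 \<le> 2 * (norm (grad \<Omega> u x))\<^sup>2 + 2 * (norm (grad \<Omega> (\<lambda>x. u x - \<phi> x) x))\<^sup>2"
      using g
    proof eventually_elim
      case (elim x)
      define p q where "p = norm (grad \<Omega> u x)" "q = norm (grad \<Omega> (\<lambda>x. u x - \<phi> x) x)"
      have "norm (classical_grad \<phi> x) \<le> p + q"
        using norm_triangle_ineq4[of "grad \<Omega> u x" "grad \<Omega> (\<lambda>x. u x - \<phi> x) x"] elim by (simp add: p_q_def)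
      then have "(norm (classical_grad \<phi> x))\<^sup>2 \<le> (p + q)\<^sup>2" by (intro power_mono) auto
      also have "\<dots> \<le> 2 * p\<^sup>2 + 2 * q\<^sup>2"
        using sum_squares_ge_zero[of "p - q" 0] by (simp add: power2_eq_square algebra_simps)
      finally show ?case by (simp add: p_q_def)
    qed
  qed auto
  also have "\<dots> = 2 * (LINT x|M\<Omega>. (norm (grad \<Omega> u x))\<^sup>2) + 2 * b" by (simp add: a_b_def)
  finally have "(LINT x|M\<Omega>. \<rho> x * (u x)\<^sup>2)
      \<le> 2 * R * a + 2 * (4 * B * (2 * (LINT x|M\<Omega>. (norm (grad \<Omega> u x))\<^sup>2) + 2 * b))"
    using B by (auto simp: mult_left_mono)
  also have "\<dots> = 16 * B * (LINT x|M\<Omega>. (norm (grad \<Omega> u x))\<^sup>2) + (2 * R * a + 16 * B * b)" by (simp add: algebra_simps)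
  also have "2 * R * a + 16 * B * b \<le> 2 * R * \<epsilon>\<^sup>2 + 16 * B * \<epsilon>\<^sup>2"
    using ab ab_le R B by (intro add_mono mult_left_mono) auto
  also have "\<dots> \<le> e" using \<epsilon>(2) by (simp add: algebra_simps)
  finally show "(LINT x|M\<Omega>. \<rho> x * (u x)\<^sup>2) \<le> 16 * B * (LINT x|M\<Omega>. (norm (grad \<Omega> u x))\<^sup>2) + e" by simp
qed

text \<open>The field \<open>F x = x\<close> with weight 1: its divergence is the dimension, and its
  norm is bounded on the bounded domain.\<close>

lemma Poincare_inequality:
  obtains C where "C > 0"
    "\<And>u. u \<in> H10_space \<Omega> \<Longrightarrow> (LINT x|M\<Omega>. (u x)\<^sup>2) \<le> C * (LINT x|M\<Omega>. (norm (grad \<Omega> u x))\<^sup>2)"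
proof -
  obtain R where R: "R > 0" "\<And>x. x \<in> \<Omega> \<Longrightarrow> norm x \<le> R"
    using bounded_domain unfolding bounded_pos by blast
  have p: "partial i (\<lambda>x. x \<bullet> i) x = 1" if "i \<in> Basis" for i x :: 'a
  proof -
    have "((\<lambda>x. x \<bullet> i) has_derivative (\<lambda>h. h \<bullet> i)) (at x)" by (auto intro!: derivative_eq_intros)
    from frechet_derivative_at[OF this, symmetric] show ?thesis using that by simp
  qed
  show ?thesis
  proof (rule that[of "16 * R\<^sup>2"])
    fix u assume u: "u \<in> H10_space \<Omega>"
    have "(LINT x|M\<Omega>. 1 * (u x)\<^sup>2) \<le> 16 * R\<^sup>2 * (LINT x|M\<Omega>. (norm (grad \<Omega> u x))\<^sup>2)"
    proof (rule weighted_inequality[OF u, where F = "\<lambda>x. x" and R = 1])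
      show "1 \<le> (\<Sum>i\<in>Basis. partial i (\<lambda>x. x \<bullet> i) x)" for x :: 'a
        by (simp add: p DIM_ge_Suc0[unfolded One_nat_def[symmetric]] Suc_leI)
      show "(norm x)\<^sup>2 \<le> R\<^sup>2 * 1" if "x \<in> \<Omega>" for x using R(2)[OF that] by (simp add: power_mono)
    qed (auto intro: C_k_inner)
    then show "(LINT x|M\<Omega>. (u x)\<^sup>2) \<le> 16 * R\<^sup>2 * (LINT x|M\<Omega>. (norm (grad \<Omega> u x))\<^sup>2)" by simp
  qed (use R in simp)
qed

text \<open>The field \<open>(x - x0) / q\<close> with
  \<open>q = norm (x - x0)^2 + \<epsilon>\<close> has divergence at least
  \<open>(d - 2) / q\<close>, and its squared norm is at most \<open>1 / q\<close>. In dimension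
  three or more the constant of the weighted inequality is thus free of \<open>\<epsilon>\<close>,
  which only removes the singularity.\<close>

lemma Hardy_inequality:
  assumes u: "u \<in> H10_space \<Omega>" and dim: "DIM('a) \<ge> 3" and \<epsilon>: "\<epsilon> > 0"
  shows "(LINT x|M\<Omega>. inverse ((norm (x - x0))\<^sup>2 + \<epsilon>) * (u x)\<^sup>2) \<le> 16 * (LINT x|M\<Omega>. (norm (grad \<Omega> u x))\<^sup>2)"
proof -
  define q where "q x = (norm (x - x0))\<^sup>2 + \<epsilon>" for x :: 'a
  have q: "q x \<ge> \<epsilon>" "q x > 0" for x using \<epsilon> by (auto simp: q_def add_nonneg_pos)
  have Cq: "C_k k q" for k unfolding q_def by (intro C_k_add C_k_const C_k_sq_norm)
  have dF: "((\<lambda>x. (inverse (q x) *\<^sub>R (x - x0)) \<bullet> i) has_derivative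
      (\<lambda>h. inverse (q x) * (h \<bullet> i) - (2 * ((x - x0) \<bullet> h)) * inverse (q x) * inverse (q x) * ((x - x0) \<bullet> i))) (at x)"
    for x i
    unfolding q_def power2_norm_eq_inner
    using q(2)[of x] unfolding q_def power2_norm_eq_inner
    by (auto intro!: derivative_eq_intros simp: inner_diff_left inner_diff_right inner_commute algebra_simps)
  have p: "partial i (\<lambda>x. (inverse (q x) *\<^sub>R (x - x0)) \<bullet> i) x =
      inverse (q x) - 2 * inverse (q x) * inverse (q x) * ((x - x0) \<bullet> i)\<^sup>2" if "i \<in> Basis" for i x
    using frechet_derivative_at[OF dF[of i x], symmetric] that by (simp add: power2_eq_square)
  have "(LINT x|M\<Omega>. inverse (q x) * (u x)\<^sup>2) \<le> 16 * 1 * (LINT x|M\<Omega>. (norm (grad \<Omega> u x))\<^sup>2)"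
  proof (rule weighted_inequality[OF u, where F = "\<lambda>x. inverse (q x) *\<^sub>R (x - x0)" and R = "inverse \<epsilon>"])
    show "C_k k (\<lambda>x. (inverse (q x) *\<^sub>R (x - x0)) \<bullet> i)" for k i
      using q(2) by (auto simp: inner_diff_left less_imp_neq[symmetric] intro!: C_k_mult C_k_inverse Cq C_k_diff C_k_inner C_k_const)
    show "inverse (q x) \<le> (\<Sum>i\<in>Basis. partial i (\<lambda>x. (inverse (q x) *\<^sub>R (x - x0)) \<bullet> i) x)" for x
    proof -
      have "(\<Sum>i\<in>Basis. partial i (\<lambda>x. (inverse (q x) *\<^sub>R (x - x0)) \<bullet> i) x)
          = DIM('a) * inverse (q x) - 2 * inverse (q x) * (inverse (q x) * (norm (x - x0))\<^sup>2)"
        by (simp only: p sum_subtractf norm_sq_sum[of "x - x0"] sum_distrib_left mult.assoc sum_constant cong: sum.cong)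
      moreover have "inverse (q x) * (norm (x - x0))\<^sup>2 \<le> 1"
        using q(2)[of x] \<epsilon> by (simp add: q_def field_simps)
      then have "2 * inverse (q x) * (inverse (q x) * (norm (x - x0))\<^sup>2) \<le> 2 * inverse (q x) * 1"
        using q(2)[of x] by (intro mult_left_mono) auto
      moreover have "DIM('a) * inverse (q x) \<ge> 3 * inverse (q x)"
        using dim q(2)[of x] by (intro mult_right_mono) auto
      ultimately show ?thesis by linarith
    qed
    show "(norm (inverse (q x) *\<^sub>R (x - x0)))\<^sup>2 \<le> 1 * inverse (q x)" for x
    proof -
      have "(norm (x - x0))\<^sup>2 \<le> q x" using \<epsilon> by (simp add: q_def)
      then have "(inverse (q x))\<^sup>2 * (norm (x - x0))\<^sup>2 \<le> (inverse (q x))\<^sup>2 * q x" by (intro mult_left_mono) auto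
      then show ?thesis using q(2)[of x] by (simp add: power_mult_distrib power2_eq_square mult_ac)
    qed
    show "continuous_on UNIV (\<lambda>x. inverse (q x))"
      using q(2) by (intro continuous_on_inverse C_k_continuous[OF Cq]) (metis less_irrefl)
    show "inverse (q x) \<le> inverse \<epsilon>" for x using q(1)[of x] \<epsilon> by (simp add: le_imp_inverse_le)
  qed (use q(2) in \<open>auto intro: less_imp_le\<close>)
  then show ?thesis by (simp add: q_def)
qed

end


subsection \<open>Restriction to subsets of the closed domain\<close>

lemma measurable_lebesgue_on_AE_cong:
  fixes f g :: "'a::euclidean_space \<Rightarrow> real"
  assumes S: "S \<in> sets lebesgue" and f: "f \<in> borel_measurable (lebesgue_on S)"
    and eq: "AE x in lebesgue_on S. f x = g x"
  shows "g \<in> borel_measurable (lebesgue_on S)"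
proof -
  obtain N where N: "N \<in> null_sets (lebesgue_on S)" "{x \<in> space (lebesgue_on S). f x \<noteq> g x} \<subseteq> N"
    using eq unfolding eventually_ae_filter by blast
  have "f \<in> borel_measurable (lebesgue_on (S - N))"
    by (rule borel_measurable_diff_null[OF N(1) S, THEN iffD2, OF f])
  moreover have "f x = g x" if "x \<in> space (lebesgue_on (S - N))" for x
    using N(2) that by (auto simp: space_restrict_space)
  ultimately have "g \<in> borel_measurable (lebesgue_on (S - N))"
    by (subst measurable_cong[where f = g and g = f]) auto
  then show ?thesis by (rule borel_measurable_diff_null[OF N(1) S, THEN iffD1])
qed

lemma integral_lebesgue_on_support:
  fixes h :: "'a::euclidean_space \<Rightarrow> real"
  assumes "B \<subseteq> S" "B \<in> sets lebesgue" "S \<in> sets lebesgue" "\<And>x. x \<in> S - B \<Longrightarrow> h x = 0"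
  shows "(LINT x|lebesgue_on S. h x) = (LINT x|lebesgue_on B. h x)"
proof -
  have "(\<lambda>x. indicator S x *\<^sub>R h x) = (\<lambda>x. indicator B x *\<^sub>R h x)"
    using assms(1,4) by (intro ext) (auto simp: indicator_def)
  then have "(LINT x|lebesgue. indicator S x *\<^sub>R h x) = (LINT x|lebesgue. indicator B x *\<^sub>R h x)"
    by (simp only:)
  then show ?thesis
    using integral_restrict_space[of S lebesgue h] integral_restrict_space[of B lebesgue h] assms(2,3) by simp
qed

lemma lebesgue_on_subset_mono:
  fixes h :: "'a::euclidean_space \<Rightarrow> real"
  assumes "S \<subseteq> T" "S \<in> sets lebesgue" "T \<in> sets lebesgue" "integrable (lebesgue_on T) h"
  shows "integrable (lebesgue_on S) h"
    and "(\<And>x. 0 \<le> h x) \<Longrightarrow> (LINT x|lebesgue_on S. h x) \<le> (LINT x|lebesgue_on T. h x)"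
proof -
  have T: "integrable lebesgue (\<lambda>x. indicator T x *\<^sub>R h x)"
    using assms by (simp add: integrable_restrict_space)
  have eq: "indicator S x *\<^sub>R (indicator T x *\<^sub>R h x) = indicator S x *\<^sub>R h x" for x
    using assms(1) by (auto simp: indicator_def)
  have S: "integrable lebesgue (\<lambda>x. indicator S x *\<^sub>R h x)"
    using integrable_mult_indicator[OF assms(2) T] by (simp only: eq)
  then show "integrable (lebesgue_on S) h" using assms by (simp add: integrable_restrict_space)
  assume "\<And>x. 0 \<le> h x"
  then have "(LINT x|lebesgue. indicator S x *\<^sub>R h x) \<le> (LINT x|lebesgue. indicator T x *\<^sub>R h x)"
    using assms(1) by (intro integral_mono[OF S T]) (auto simp: indicator_def)
  then show "(LINT x|lebesgue_on S. h x) \<le> (LINT x|lebesgue_on T. h x)"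
    using assms by (simp add: integral_restrict_space)
qed

lemma L2_space_subset:
  fixes h :: "'a::euclidean_space \<Rightarrow> real"
  assumes "S \<subseteq> T" "S \<in> sets lebesgue" "T \<in> sets lebesgue" "h \<in> L2_space (lebesgue_on T)"
  shows "h \<in> L2_space (lebesgue_on S)"
    and "L2_norm (lebesgue_on S) h \<le> L2_norm (lebesgue_on T) h"
proof -
  note h = L2_spaceD[OF assms(4)]
  show "h \<in> L2_space (lebesgue_on S)"
    using lebesgue_on_subset_mono(1)[OF assms(1-3) h(2)] measurable_restrict_mono[OF h(1) assms(1)]
    by (simp add: L2_space_def)
  show "L2_norm (lebesgue_on S) h \<le> L2_norm (lebesgue_on T) h"
    unfolding L2_norm_def using lebesgue_on_subset_mono(2)[OF assms(1-3) h(2)] by simp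
qed

lemma L2_norm_nonneg: "0 \<le> L2_norm M g"
  by (auto simp: L2_norm_def intro!: integral_nonneg_AE)

lemma L2_norm_sq: "(L2_norm M g)\<^sup>2 = (LINT x|M. (g x)\<^sup>2)"
  by (simp add: L2_norm_def integral_nonneg_AE)

lemma Cauchy_Schwarz_L2_norm:
  assumes "f \<in> L2_space M" "g \<in> L2_space M"
  shows "(LINT x|M. \<bar>f x * g x\<bar>) \<le> L2_norm M f * L2_norm M g"
proof (rule power2_le_imp_le)
  show "(LINT x|M. \<bar>f x * g x\<bar>)\<^sup>2 \<le> (L2_norm M f * L2_norm M g)\<^sup>2"
    unfolding power_mult_distrib L2_norm_sq by (rule Cauchy_Schwarz_integral[OF assms])
  show "0 \<le> L2_norm M f * L2_norm M g" by (intro mult_nonneg_nonneg L2_norm_nonneg)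
qed

lemma Cauchy_Schwarz_L1:
  fixes S :: "'a::euclidean_space set"
  assumes S: "S \<in> lmeasurable" and f: "f \<in> L2_space (lebesgue_on S)"
  shows "(LINT x|lebesgue_on S. \<bar>f x\<bar>) \<le> sqrt (measure lebesgue S) * L2_norm (lebesgue_on S) f"
proof -
  interpret finite_measure "lebesgue_on S" by (rule finite_measure_lebesgue_on[OF S])
  have "measure (lebesgue_on S) S = measure lebesgue S"
    using S by (simp add: measure_restrict_space)
  then have "L2_norm (lebesgue_on S) (\<lambda>x. 1) = sqrt (measure lebesgue S)"
    by (simp add: L2_norm_def)
  then show ?thesis
    using Cauchy_Schwarz_L2_norm[OF L2_space_const[OF finite_measure_axioms, of 1] f] by simp
qed

lemma integral_mult_bounded_support_le:
  fixes g v :: "'a::euclidean_space \<Rightarrow> real"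
  assumes "B \<subseteq> S" "B \<in> sets lebesgue" "S \<in> sets lebesgue" "\<And>x. x \<notin> B \<Longrightarrow> v x = 0"
    and v: "\<And>x. \<bar>v x\<bar> \<le> m" "v \<in> borel_measurable (lebesgue_on B)" and g: "integrable (lebesgue_on B) g"
  shows "\<bar>LINT x|lebesgue_on S. g x * v x\<bar> \<le> m * (LINT x|lebesgue_on B. \<bar>g x\<bar>)"
proof -
  have "(LINT x|lebesgue_on S. g x * v x) = (LINT x|lebesgue_on B. g x * v x)"
    using assms by (intro integral_lebesgue_on_support) auto
  also have "\<bar>\<dots>\<bar> \<le> (LINT x|lebesgue_on B. \<bar>g x * v x\<bar>)"
    using integral_norm_bound[of "lebesgue_on B" "\<lambda>x. g x * v x"] by simp
  also have "\<dots> \<le> (LINT x|lebesgue_on B. m * \<bar>g x\<bar>)"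
  proof (intro integral_mono)
    show i: "integrable (lebesgue_on B) (\<lambda>x. m * \<bar>g x\<bar>)" using g by simp
    have b: "\<bar>g x * v x\<bar> \<le> m * \<bar>g x\<bar>" for x
      using mult_left_mono[OF v(1)[of x], of "\<bar>g x\<bar>"] by (simp add: abs_mult mult.commute)
    then show "\<And>x. \<bar>g x * v x\<bar> \<le> m * \<bar>g x\<bar>" .
    have "0 \<le> m" using v(1) abs_ge_zero order_trans by blast
    then show "integrable (lebesgue_on B) (\<lambda>x. \<bar>g x * v x\<bar>)"
      using b g v(2) by (intro Bochner_Integration.integrable_bound[OF i]) (auto simp: abs_mult)
  qed
  finally show ?thesis by simp
qed

context bounded_domain
begin

text \<open>Mesh elements are closed and may reach the boundary of \<Omega>, but the frontier of a
  convex set is a null set.\<close>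

lemma AE_in_domain:
  assumes "convex \<Omega>" "S \<subseteq> closure \<Omega>" "S \<in> sets lebesgue"
  shows "AE x in lebesgue_on S. x \<in> \<Omega>"
proof -
  have "frontier \<Omega> \<in> null_sets lebesgue"
    using negligible_convex_frontier[OF assms(1)] by (simp add: negligible_iff_null_sets)
  then have "AE x in lebesgue. x \<notin> frontier \<Omega>" by (rule AE_not_in)
  then have "AE x in lebesgue. x \<in> S \<longrightarrow> x \<in> \<Omega>"
    by eventually_elim (use assms(2) open_domain in \<open>auto simp: frontier_def interior_open\<close>)
  then show ?thesis using assms(3) by (simp add: AE_restrict_space_iff)
qed

lemma AE_transfer:
  assumes "convex \<Omega>" "S \<subseteq> closure \<Omega>" "S \<in> sets lebesgue" "AE x in M\<Omega>. P x"
  shows "AE x in lebesgue_on S. P x"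
proof -
  have "AE x in lebesgue. x \<in> \<Omega> \<longrightarrow> P x" using assms(4) by (simp add: AE_restrict_space_iff)
  then have "AE x in lebesgue. x \<in> S \<longrightarrow> x \<in> \<Omega> \<longrightarrow> P x" by eventually_elim simp
  then have "AE x in lebesgue_on S. x \<in> \<Omega> \<longrightarrow> P x"
    using assms(3) by (simp add: AE_restrict_space_iff)
  with AE_in_domain[OF assms(1-3)] show ?thesis by eventually_elim auto
qed

text \<open>Outside \<Omega> the values of \<open>h\<close> are arbitrary, so \<open>h\<close> is
  replaced by its extension by zero, which is measurable on the whole space and agrees with
  \<open>h\<close> almost everywhere on \<open>S\<close>.\<close>

lemma L2_transfer:
  assumes "convex \<Omega>" "S \<subseteq> closure \<Omega>" "S \<in> sets lebesgue" "h \<in> L2_space M\<Omega>"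
  shows "h \<in> L2_space (lebesgue_on S)"
proof -
  define h' where "h' x = (if x \<in> \<Omega> then h x else 0)" for x
  have "h' \<in> borel_measurable lebesgue"
    unfolding h'_def using L2_spaceD(1)[OF assms(4)] by (subst borel_measurable_if) auto
  then have m: "h' \<in> borel_measurable (lebesgue_on S)" by (rule measurable_restrict_space1)
  have AE: "AE x in lebesgue_on S. h' x = h x"
    using AE_in_domain[OF assms(1-3)] by eventually_elim (simp add: h'_def)
  have hm: "h \<in> borel_measurable (lebesgue_on S)"
    by (rule measurable_lebesgue_on_AE_cong[OF assms(3) m AE])
  have "integrable lebesgue (\<lambda>x. indicator \<Omega> x *\<^sub>R (h x)\<^sup>2)"
    using L2_spaceD(2)[OF assms(4)] by (simp add: integrable_restrict_space)
  also have "(\<lambda>x. indicator \<Omega> x *\<^sub>R (h x)\<^sup>2) = (\<lambda>x. (h' x)\<^sup>2)" by (auto simp: h'_def indicator_def)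
  finally have "integrable lebesgue (\<lambda>x. indicator S x *\<^sub>R (h' x)\<^sup>2)"
    by (rule integrable_mult_indicator[OF assms(3)])
  then have "integrable (lebesgue_on S) (\<lambda>x. (h' x)\<^sup>2)" using assms(3) by (simp add: integrable_restrict_space)
  moreover have "integrable (lebesgue_on S) (\<lambda>x. (h' x)\<^sup>2) = integrable (lebesgue_on S) (\<lambda>x. (h x)\<^sup>2)"
    using AE hm m by (intro integrable_cong_AE) (auto elim!: eventually_mono)
  ultimately show ?thesis using hm by (simp add: L2_space_def)
qed

end


subsection \<open>The nonlinearity and a priori bounds\<close>

text \<open>The global Lipschitz condition on \<open>\<partial>f/\<partial>y\<close> makes \<open>f\<close> grow at most quadratically.\<close>

definition growth_constant :: "('a::euclidean_space) set \<Rightarrow> ('a \<Rightarrow> real \<Rightarrow> real) \<Rightarrow> real \<Rightarrow> bool" where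
  "growth_constant \<Omega> f K \<longleftrightarrow> K > 0 \<and> (AE x in lebesgue_on \<Omega>.
     (\<forall>s. 0 \<le> dy f x s \<and> dy f x s \<le> K * (1 + \<bar>s\<bar>)) \<and>
     (\<forall>s t. \<bar>dy f x s - dy f x t\<bar> \<le> K * \<bar>s - t\<bar>) \<and>
     (\<forall>s t. \<bar>f x s - f x t\<bar> \<le> K * (1 + \<bar>s\<bar> + \<bar>t\<bar>) * \<bar>s - t\<bar>) \<and>
     (\<forall>s. - K * \<bar>s\<bar> \<le> f x s * s) \<and> \<bar>f x 0\<bar> \<le> K)"

lemma MVT_between:
  fixes g :: "real \<Rightarrow> real"
  assumes "\<And>y. (g has_real_derivative g' y) (at y)"
  obtains z where "\<bar>z\<bar> \<le> \<bar>s\<bar> + \<bar>t\<bar>" "g s - g t = (s - t) * g' z"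
proof -
  consider "s < t" | "s = t" | "t < s" by linarith
  then show ?thesis
  proof cases
    case 1
    from MVT2[OF this, of g g'] assms obtain z where "s < z" "z < t" "g t - g s = (t - s) * g' z" by blast
    then show ?thesis by (intro that[of z]) (auto simp: algebra_simps abs_if)
  next
    case 3
    from MVT2[OF this, of g g'] assms obtain z where "t < z" "z < s" "g s - g t = (s - t) * g' z" by blast
    then show ?thesis by (intro that[of z]) (auto simp: algebra_simps abs_if)
  qed (use that[of s] in auto)
qed

text \<open>The local bound controls \<open>dy f x\<close> at 0, the Lipschitz condition carries it
  to linear growth, and the mean value theorem turns this into the estimate for \<open>f\<close>.
  Monotonicity gives \<open>f x s * s \<ge> f x 0 * s\<close>, hence the lower bound.\<close>

lemma growth_constant_exists:
  assumes nl: "admissible_nonlinearity \<Omega> f"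
    and lip: "\<exists>L. AE x in lebesgue_on \<Omega>. L-lipschitz_on UNIV (dy f x)"
  obtains K where "growth_constant \<Omega> f K"
proof -
  obtain L where L: "AE x in lebesgue_on \<Omega>. L-lipschitz_on UNIV (dy f x)" using lip by blast
  have "\<exists>C>0. AE x in lebesgue_on \<Omega>. \<forall>y. \<bar>y\<bar> \<le> 1 \<longrightarrow> \<bar>dy f x y\<bar> + \<bar>dyy f x y\<bar> \<le> C"
    using nl by (auto simp: admissible_nonlinearity_def)
  then obtain C where C: "C > 0" "AE x in lebesgue_on \<Omega>. \<forall>y. \<bar>y\<bar> \<le> 1 \<longrightarrow> \<bar>dy f x y\<bar> + \<bar>dyy f x y\<bar> \<le> C"
    by blast
  have reg: "AE x in lebesgue_on \<Omega>. (\<forall>y. f x differentiable (at y) \<and> deriv (f x) differentiable (at y)) \<and>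
        continuous_on UNIV (deriv (deriv (f x)))"
    and pos: "AE x in lebesgue_on \<Omega>. \<forall>y. dy f x y \<ge> 0"
    and fin: "Linf_norm (lebesgue_on \<Omega>) (\<lambda>x. f x 0) < \<infinity>"
    using nl by (simp_all add: admissible_nonlinearity_def)
  obtain F where F: "F \<ge> 0" "Linf_norm (lebesgue_on \<Omega>) (\<lambda>x. f x 0) = ennreal F"
    using fin by (cases "Linf_norm (lebesgue_on \<Omega>) (\<lambda>x. f x 0)") auto
  have F0: "AE x in lebesgue_on \<Omega>. \<bar>f x 0\<bar> \<le> F"
    using esssup_AE[of "\<lambda>x. ennreal \<bar>f x 0\<bar>" "lebesgue_on \<Omega>"] F by (simp add: Linf_norm_def)
  \<comment> \<open>The sign of \<open>L\<close> is known only inside the almost-everywhere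
    statement, hence the absolute value.\<close>
  define K where "K = C + \<bar>L\<bar> + F"
  have K: "C \<le> K" "L \<le> K" "F \<le> K" "C + L \<le> K" "K > 0" using C F by (auto simp: K_def)
  have "AE x in lebesgue_on \<Omega>.
     (\<forall>s. 0 \<le> dy f x s \<and> dy f x s \<le> K * (1 + \<bar>s\<bar>)) \<and>
     (\<forall>s t. \<bar>dy f x s - dy f x t\<bar> \<le> K * \<bar>s - t\<bar>) \<and>
     (\<forall>s t. \<bar>f x s - f x t\<bar> \<le> K * (1 + \<bar>s\<bar> + \<bar>t\<bar>) * \<bar>s - t\<bar>) \<and>
     (\<forall>s. - K * \<bar>s\<bar> \<le> f x s * s) \<and> \<bar>f x 0\<bar> \<le> K"
    using L C(2) reg pos F0
  proof eventually_elim
    case (elim x)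
    have D: "(f x has_real_derivative dy f x y) (at y)" for y
      using elim(3) DERIV_deriv_iff_real_differentiable by blast
    have lipL: "\<bar>dy f x s - dy f x t\<bar> \<le> L * \<bar>s - t\<bar>" for s t
      using lipschitz_onD[OF elim(1), of s t] by (simp add: dist_real_def)
    have lipK: "\<bar>dy f x s - dy f x t\<bar> \<le> K * \<bar>s - t\<bar>" for s t
      using lipL[of s t] mult_right_mono[OF K(2), of "\<bar>s - t\<bar>"] by simp
    have C0: "\<bar>dy f x 0\<bar> \<le> C" using elim(2)[rule_format, of 0] by simp
    have g: "dy f x s \<le> K * (1 + \<bar>s\<bar>)" for s
    proof -
      have "dy f x s \<le> C + L * \<bar>s\<bar>" using lipL[of s 0] C0 by simp
      also have "\<dots> \<le> K + K * \<bar>s\<bar>" using K by (intro add_mono mult_right_mono) auto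
      finally show ?thesis by (simp add: algebra_simps)
    qed
    have 1: "\<bar>f x s - f x t\<bar> \<le> K * (1 + \<bar>s\<bar> + \<bar>t\<bar>) * \<bar>s - t\<bar>" for s t
    proof -
      obtain z where z: "\<bar>z\<bar> \<le> \<bar>s\<bar> + \<bar>t\<bar>" "f x s - f x t = (s - t) * dy f x z"
        by (rule MVT_between[of "f x" "dy f x" s t, OF D])
      have "dy f x z \<le> K * (1 + \<bar>s\<bar> + \<bar>t\<bar>)"
        using g[of z] z(1) K(5) mult_left_mono[of "1 + \<bar>z\<bar>" "1 + \<bar>s\<bar> + \<bar>t\<bar>" K] by linarith
      then show ?thesis unfolding z(2) using elim(4)[rule_format, of z]
        by (simp add: abs_mult mult.commute[of "\<bar>s - t\<bar>"] mult_right_mono)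
    qed
    have 2: "- K * \<bar>s\<bar> \<le> f x s * s" for s
    proof -
      obtain z where z: "f x s - f x 0 = (s - 0) * dy f x z"
        by (rule MVT_between[of "f x" "dy f x" s 0, OF D])
      have "f x s * s = f x 0 * s + s\<^sup>2 * dy f x z" using z by (simp add: power2_eq_square algebra_simps)
      moreover have "s\<^sup>2 * dy f x z \<ge> 0" using elim(4) by simp
      moreover have "\<bar>f x 0 * s\<bar> \<le> K * \<bar>s\<bar>" using elim(5) K by (simp add: abs_mult mult_right_mono)
      ultimately show ?thesis by linarith
    qed
    show ?case using elim(4,5) K g lipK 1 2 by auto
  qed
  then show ?thesis using K(5) that by (simp add: growth_constant_def)
qed

lemma le_square_if_le_mult_sqrt:
  assumes "0 \<le> (G::real)" "G \<le> c * sqrt G" "0 \<le> c" shows "G \<le> c\<^sup>2"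
proof (cases "G = 0")
  case False
  then have "sqrt G * sqrt G \<le> c * sqrt G" "sqrt G > 0" using assms by auto
  then have "sqrt G \<le> c" by (rule mult_right_le_imp_le)
  then have "(sqrt G)\<^sup>2 \<le> c\<^sup>2" using assms by (intro power_mono) auto
  then show ?thesis using assms by simp
qed simp

section \<open>Measurability of the nonlinearity and energy estimates\<close>

locale semilinear = bounded_domain \<Omega> for \<Omega> :: "'a::euclidean_space set" +
  fixes f :: "'a \<Rightarrow> real \<Rightarrow> real" and y\<^sub>\<Omega> :: "'a \<Rightarrow> real" and K :: real
  assumes convex_domain: "convex \<Omega>"
    and f_measurable: "\<And>y. (\<lambda>x. f x y) \<in> borel_measurable (lebesgue_on \<Omega>)"
    and growth: "growth_constant \<Omega> f K"
    and dy_in_L2: "\<And>y. y \<in> H10_space \<Omega> \<Longrightarrow> (\<lambda>x. dy f x (y x)) \<in> L2_space (lebesgue_on \<Omega>)"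
    and desired_in_L2: "y\<^sub>\<Omega> \<in> L2_space (lebesgue_on \<Omega>)"
begin

lemma K_pos: "K > 0"
  using growth by (simp add: growth_constant_def)

lemma growth_AE:
  "AE x in M\<Omega>.
     (\<forall>s. 0 \<le> dy f x s \<and> dy f x s \<le> K * (1 + \<bar>s\<bar>)) \<and>
     (\<forall>s t. \<bar>dy f x s - dy f x t\<bar> \<le> K * \<bar>s - t\<bar>) \<and>
     (\<forall>s t. \<bar>f x s - f x t\<bar> \<le> K * (1 + \<bar>s\<bar> + \<bar>t\<bar>) * \<bar>s - t\<bar>) \<and>
     (\<forall>s. - K * \<bar>s\<bar> \<le> f x s * s) \<and> \<bar>f x 0\<bar> \<le> K"
  using growth by (simp add: growth_constant_def)

text \<open>Approximate \<open>y\<close> by functions with countably many values.\<close>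

lemma nonlinearity_measurable:
  assumes y: "y \<in> borel_measurable M\<Omega>"
  shows "(\<lambda>x. f x (y x)) \<in> borel_measurable M\<Omega>"
proof -
  define s where "s n x = of_int \<lfloor>real (Suc n) * y x\<rfloor> / real (Suc n)" for n x
  have sm: "(\<lambda>x. f x (s n x)) \<in> borel_measurable M\<Omega>" for n
  proof -
    have [measurable]: "y \<in> borel_measurable M\<Omega>" by (rule y)
    have "(\<lambda>x. \<lfloor>real (Suc n) * y x\<rfloor>) \<in> M\<Omega> \<rightarrow>\<^sub>M count_space UNIV" by measurable
    from measurable_compose_countable[OF f_measurable[of "of_int _ / real (Suc n)"] this]
    show ?thesis by (simp only: s_def)
  qed
  have dist: "\<bar>s n x - y x\<bar> \<le> inverse (real (Suc n))" for n x
  proof -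
    have "\<bar>of_int \<lfloor>real (Suc n) * y x\<rfloor> - real (Suc n) * y x\<bar> \<le> 1" by linarith
    then have "\<bar>(of_int \<lfloor>real (Suc n) * y x\<rfloor> - real (Suc n) * y x) / real (Suc n)\<bar> \<le> 1 / real (Suc n)"
      unfolding abs_divide abs_of_nat by (intro divide_right_mono) auto
    then show ?thesis by (simp add: s_def diff_divide_distrib inverse_eq_divide)
  qed
  have "AE x in M\<Omega>. (\<lambda>n. f x (s n x)) \<longlonglongrightarrow> f x (y x)"
    using growth_AE
  proof eventually_elim
    case (elim x)
    have "(\<lambda>n. f x (s n x) - f x (y x)) \<longlonglongrightarrow> 0"
    proof (rule Lim_null_comparison)
      show "\<forall>\<^sub>F n in sequentially. norm (f x (s n x) - f x (y x)) \<le> K * (2 + 2 * \<bar>y x\<bar>) * inverse (real (Suc n))"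
      proof (intro always_eventually allI)
        fix n
        have "inverse (real (Suc n)) \<le> 1" by (simp add: inverse_le_1_iff)
        then have "\<bar>s n x\<bar> \<le> \<bar>y x\<bar> + 1" using dist[of n x] by linarith
        have "\<bar>f x (s n x) - f x (y x)\<bar> \<le> K * (1 + \<bar>s n x\<bar> + \<bar>y x\<bar>) * \<bar>s n x - y x\<bar>" using elim by blast
        also have "\<dots> \<le> K * (2 + 2 * \<bar>y x\<bar>) * inverse (real (Suc n))"
          using K_pos \<open>\<bar>s n x\<bar> \<le> \<bar>y x\<bar> + 1\<close> dist[of n x] by (intro mult_mono) auto
        finally show "norm (f x (s n x) - f x (y x)) \<le> K * (2 + 2 * \<bar>y x\<bar>) * inverse (real (Suc n))" by simp
      qed
      show "(\<lambda>n. K * (2 + 2 * \<bar>y x\<bar>) * inverse (real (Suc n))) \<longlonglongrightarrow> 0"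
        by (intro tendsto_mult_right_zero LIMSEQ_inverse_real_of_nat)
    qed
    then show ?case by (simp add: LIM_zero_iff)
  qed
  then have eq: "AE x in M\<Omega>. lim (\<lambda>n. f x (s n x)) = f x (y x)"
    by eventually_elim (rule limI)
  have "(\<lambda>x. lim (\<lambda>n. f x (s n x))) \<in> borel_measurable M\<Omega>"
    by (intro borel_measurable_lim_metric sm)
  from measurable_lebesgue_on_AE_cong[OF domain_sets this eq] show ?thesis .
qed

lemma nonlinearity_L2:
  assumes y: "y \<in> borel_measurable M\<Omega>" and b: "\<And>x. x \<in> \<Omega> \<Longrightarrow> \<bar>y x\<bar> \<le> B"
  shows "(\<lambda>x. f x (y x)) \<in> L2_space M\<Omega>"
proof (rule L2_space_bounded[OF finite_measure_domain nonlinearity_measurable[OF y]])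
  show "AE x in M\<Omega>. \<bar>f x (y x)\<bar> \<le> K + K * (1 + B) * B"
    using growth_AE AE_space
  proof eventually_elim
    case (elim x)
    then have x: "\<bar>y x\<bar> \<le> B" using b by simp
    have "\<bar>f x (y x) - f x 0\<bar> \<le> K * (1 + \<bar>y x\<bar> + \<bar>0\<bar>) * \<bar>y x - 0\<bar>" using elim by blast
    also have "\<dots> \<le> K * (1 + B) * B" using x K_pos by (intro mult_mono) auto
    finally show ?case using elim by auto
  qed
qed

text \<open>Test with \<open>y\<close> itself: monotonicity bounds \<open>f x (y x) * y x\<close>
  from below by a multiple of \<open>- \<bar>y x\<bar>\<close>, the control is bounded by
  \<open>\<bar>a\<bar> + \<bar>b\<bar>\<close>, and the Poincare inequality closes the estimate. As
  the test function lies in \<open>W\<close>, Galerkin states are covered with the same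
  \<open>E\<close>.\<close>

lemma state_bound:
  obtains E where "E > 0" "\<And>W u y. W \<subseteq> H10_space \<Omega> \<Longrightarrow> u \<in> admissible_controls \<Omega> a b \<Longrightarrow>
    is_state W \<Omega> f u y \<Longrightarrow> (LINT x|M\<Omega>. (y x)\<^sup>2) \<le> E"
proof -
  obtain C where C: "C > 0"
    "\<And>u. u \<in> H10_space \<Omega> \<Longrightarrow> (LINT x|M\<Omega>. (u x)\<^sup>2) \<le> C * (LINT x|M\<Omega>. (norm (grad \<Omega> u x))\<^sup>2)"
    by (rule Poincare_inequality) blast
  define A where "A = \<bar>a\<bar> + \<bar>b\<bar> + K"
  define c where "c = A * sqrt (measure lebesgue \<Omega>) * sqrt C"
  have A: "A > 0" using K_pos by (simp add: A_def)
  have c: "c \<ge> 0" using A C by (simp add: c_def)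
  show ?thesis
  proof (rule that[of "C * c\<^sup>2 + 1"])
    show "C * c\<^sup>2 + 1 > 0" using C c by (simp add: add_nonneg_pos)
    fix W u y assume W: "W \<subseteq> H10_space \<Omega>" and u: "u \<in> admissible_controls \<Omega> a b" and s: "is_state W \<Omega> f u y"
    have y: "y \<in> H10_space \<Omega>" "y \<in> W" using s W by (auto simp: is_state_def)
    have uL: "u \<in> L2_space M\<Omega>" and ub: "AE x in M\<Omega>. \<bar>u x\<bar> \<le> \<bar>a\<bar> + \<bar>b\<bar>"
    proof -
      have "AE x in M\<Omega>. a \<le> u x \<and> u x \<le> b" using u by (simp add: admissible_controls_def)
      then show "AE x in M\<Omega>. \<bar>u x\<bar> \<le> \<bar>a\<bar> + \<bar>b\<bar>" by eventually_elim auto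
    qed (use u in \<open>simp add: admissible_controls_def\<close>)
    define G where "G = (LINT x|M\<Omega>. (norm (grad \<Omega> y x))\<^sup>2)"
    have G0: "G \<ge> 0" by (auto simp: G_def intro!: integral_nonneg_AE)
    have i: "integrable M\<Omega> (\<lambda>x. f x (y x) * y x)"
      and eq: "G + (LINT x|M\<Omega>. f x (y x) * y x) = (LINT x|M\<Omega>. u x * y x)"
      using s y(2) by (auto simp: is_state_def G_def power2_norm_eq_inner)
    have iu: "integrable M\<Omega> (\<lambda>x. u x * y x)" by (intro L2_space_mult_integrable uL H10_L2 y)
    have iy: "integrable M\<Omega> (\<lambda>x. A * \<bar>y x\<bar>)" using L2_integrable[OF H10_L2[OF y(1)]] by simp
    have "G = (LINT x|M\<Omega>. u x * y x - f x (y x) * y x)" using eq i iu by simp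
    also have "\<dots> \<le> (LINT x|M\<Omega>. A * \<bar>y x\<bar>)"
    proof (intro integral_mono_AE iy)
      show "AE x in M\<Omega>. u x * y x - f x (y x) * y x \<le> A * \<bar>y x\<bar>"
        using growth_AE ub
      proof eventually_elim
        case (elim x)
        have "u x * y x \<le> \<bar>u x\<bar> * \<bar>y x\<bar>" by (metis abs_ge_self abs_mult)
        also have "\<dots> \<le> (\<bar>a\<bar> + \<bar>b\<bar>) * \<bar>y x\<bar>" using elim by (intro mult_right_mono) auto
        finally have "u x * y x \<le> (\<bar>a\<bar> + \<bar>b\<bar>) * \<bar>y x\<bar>" .
        moreover have "- K * \<bar>y x\<bar> \<le> f x (y x) * y x" using elim by blast
        ultimately show ?case by (simp add: A_def algebra_simps)
      qed
    qed (use i iu in auto)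
    also have "\<dots> = A * (LINT x|M\<Omega>. \<bar>y x\<bar>)" by simp
    also have "\<dots> \<le> A * (sqrt (measure lebesgue \<Omega>) * L2_norm M\<Omega> y)"
      using A by (intro mult_left_mono Cauchy_Schwarz_L1 domain_lmeasurable H10_L2 y) auto
    also have "\<dots> \<le> A * (sqrt (measure lebesgue \<Omega>) * (sqrt C * sqrt G))"
    proof -
      have "L2_norm M\<Omega> y \<le> sqrt C * sqrt G"
        using C(2)[OF y(1)] by (simp add: L2_norm_def G_def real_sqrt_mult[symmetric])
      then show ?thesis using A by (intro mult_left_mono) auto
    qed
    finally have "G \<le> c * sqrt G" by (simp add: c_def mult.assoc)
    then have "G \<le> c\<^sup>2" using G0 c by (intro le_square_if_le_mult_sqrt)
    then have "C * G \<le> C * c\<^sup>2" using C by simp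
    then show "(LINT x|M\<Omega>. (y x)\<^sup>2) \<le> C * c\<^sup>2 + 1" using C(2)[OF y(1)] by (simp add: G_def)
  qed
qed

lemma adjoint_bound:
  obtains E' where "E' > 0" "\<And>W y p. W \<subseteq> H10_space \<Omega> \<Longrightarrow> y \<in> L2_space M\<Omega> \<Longrightarrow> (LINT x|M\<Omega>. (y x)\<^sup>2) \<le> E \<Longrightarrow>
    is_adjoint_state W \<Omega> f y\<^sub>\<Omega> y p \<Longrightarrow> (LINT x|M\<Omega>. (norm (grad \<Omega> p x))\<^sup>2) \<le> E'"
proof -
  obtain C where C: "C > 0"
    "\<And>u. u \<in> H10_space \<Omega> \<Longrightarrow> (LINT x|M\<Omega>. (u x)\<^sup>2) \<le> C * (LINT x|M\<Omega>. (norm (grad \<Omega> u x))\<^sup>2)"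
    by (rule Poincare_inequality) blast
  define A where "A = sqrt (2 * \<bar>E\<bar> + 2 * (LINT x|M\<Omega>. (y\<^sub>\<Omega> x)\<^sup>2))"
  define c where "c = A * sqrt C"
  have A: "A \<ge> 0" by (auto simp: A_def intro!: add_nonneg_nonneg integral_nonneg_AE)
  have c: "c \<ge> 0" using A C by (simp add: c_def)
  show ?thesis
  proof (rule that[of "c\<^sup>2 + 1"])
    show "c\<^sup>2 + 1 > 0" by (simp add: add_nonneg_pos)
    fix W y p assume W: "W \<subseteq> H10_space \<Omega>" and y: "y \<in> L2_space M\<Omega>" "(LINT x|M\<Omega>. (y x)\<^sup>2) \<le> E"
      and s: "is_adjoint_state W \<Omega> f y\<^sub>\<Omega> y p"
    have p: "p \<in> H10_space \<Omega>" "p \<in> W" using s W by (auto simp: is_adjoint_state_def)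
    define G where "G = (LINT x|M\<Omega>. (norm (grad \<Omega> p x))\<^sup>2)"
    have G0: "G \<ge> 0" by (auto simp: G_def intro!: integral_nonneg_AE)
    have eq: "G + (LINT x|M\<Omega>. dy f x (y x) * p x * p x) = (LINT x|M\<Omega>. (y x - y\<^sub>\<Omega> x) * p x)"
      using s p(2) by (auto simp: is_adjoint_state_def G_def power2_norm_eq_inner)
    have "0 \<le> (LINT x|M\<Omega>. dy f x (y x) * p x * p x)"
    proof (rule integral_nonneg_AE)
      show "AE x in M\<Omega>. 0 \<le> dy f x (y x) * p x * p x"
        using growth_AE by eventually_elim (simp add: mult.assoc)
    qed
    then have "G \<le> (LINT x|M\<Omega>. (y x - y\<^sub>\<Omega> x) * p x)" using eq by simp
    also have "\<dots> \<le> (LINT x|M\<Omega>. \<bar>(y x - y\<^sub>\<Omega> x) * p x\<bar>)"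
      using integral_norm_bound[of M\<Omega> "\<lambda>x. (y x - y\<^sub>\<Omega> x) * p x"] unfolding real_norm_def by linarith
    also have "\<dots> \<le> L2_norm M\<Omega> (\<lambda>x. y x - y\<^sub>\<Omega> x) * L2_norm M\<Omega> p"
      by (intro Cauchy_Schwarz_L2_norm L2_space_diff y desired_in_L2 H10_L2 p)
    also have "\<dots> \<le> A * (sqrt C * sqrt G)"
    proof (intro mult_mono)
      show "L2_norm M\<Omega> p \<le> sqrt C * sqrt G"
        using C(2)[OF p(1)] by (simp add: L2_norm_def G_def real_sqrt_mult[symmetric])
      have "(LINT x|M\<Omega>. (y x - y\<^sub>\<Omega> x)\<^sup>2) \<le> (LINT x|M\<Omega>. 2 * (y x)\<^sup>2 + 2 * (y\<^sub>\<Omega> x)\<^sup>2)"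
      proof (intro integral_mono)
        fix x show "(y x - y\<^sub>\<Omega> x)\<^sup>2 \<le> 2 * (y x)\<^sup>2 + 2 * (y\<^sub>\<Omega> x)\<^sup>2"
          using sum_squares_ge_zero[of "y x + y\<^sub>\<Omega> x" 0] by (simp add: power2_eq_square algebra_simps)
      qed (use L2_spaceD(2)[OF y(1)] L2_spaceD(2)[OF desired_in_L2] L2_spaceD(2)[OF L2_space_diff[OF y(1) desired_in_L2]] in auto)
      also have "\<dots> = 2 * (LINT x|M\<Omega>. (y x)\<^sup>2) + 2 * (LINT x|M\<Omega>. (y\<^sub>\<Omega> x)\<^sup>2)"
        using L2_spaceD(2)[OF y(1)] L2_spaceD(2)[OF desired_in_L2] by simp
      also have "\<dots> \<le> 2 * \<bar>E\<bar> + 2 * (LINT x|M\<Omega>. (y\<^sub>\<Omega> x)\<^sup>2)" using y(2) by simp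
      finally show "L2_norm M\<Omega> (\<lambda>x. y x - y\<^sub>\<Omega> x) \<le> A" by (simp add: L2_norm_def A_def)
    qed (use A C G0 in \<open>auto simp: L2_norm_nonneg\<close>)
    finally have "G \<le> c * sqrt G" by (simp add: c_def mult.assoc)
    then have "G \<le> c\<^sup>2" using G0 c by (intro le_square_if_le_mult_sqrt)
    then show "(LINT x|M\<Omega>. (norm (grad \<Omega> p x))\<^sup>2) \<le> c\<^sup>2 + 1" by (simp add: G_def)
  qed
qed

end


subsection \<open>Residuals tested with localised functions\<close>

lemma laplacian_continuous:
  assumes "v \<in> test_functions \<Omega>" shows "continuous_on UNIV (laplacian v)"
  unfolding laplacian_def
  by (intro continuous_on_sum test_functions_continuous[OF test_functions_partial[OF test_functions_partial[OF assms]]])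

lemma laplacian_eq_0:
  assumes "\<And>x. x \<notin> cball x0 r \<Longrightarrow> v x = 0" "x \<notin> cball x0 r"
  shows "laplacian v x = 0"
proof -
  have o: "open (- cball x0 r)" by (simp add: open_Compl)
  have "partial i v y = 0" if "y \<in> - cball x0 r" for i y
    using frechet_derivative_eq_0[OF o that] assms(1) by auto
  then have "partial i (partial i v) x = 0" for i
    using frechet_derivative_eq_0[OF o, of x "partial i v"] assms(2) by auto
  then show ?thesis by (simp add: laplacian_def)
qed

text \<open>The bounds are those of a fixed profile rescaled to radius \<open>r\<close>, two
  derivatives costing \<open>1 / r^2\<close>. The ball lies inside \<Omega>, whereas
  \<open>\<omega>\<close>, where errors are measured, may reach the boundary.\<close>

locale local_test = bounded_domain \<Omega> for \<Omega> :: "'a::euclidean_space set" +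
  fixes v :: "'a \<Rightarrow> real" and x0 :: 'a and r m :: real and \<omega> :: "'a set"
  assumes v_test: "v \<in> test_functions \<Omega>" and r_pos: "r > 0"
    and ball_domain: "cball x0 r \<subseteq> \<Omega>"
    and v_support: "\<And>x. x \<notin> cball x0 r \<Longrightarrow> v x = 0"
    and v_le: "\<And>x. \<bar>v x\<bar> \<le> m" and lap_le: "\<And>x. \<bar>laplacian v x\<bar> \<le> m / r\<^sup>2"
    and ball_patch: "cball x0 r \<subseteq> \<omega>" and patch: "\<omega> \<subseteq> closure \<Omega>" "\<omega> \<in> sets lebesgue"
begin

abbreviation "B \<equiv> cball x0 r"

lemma m_nonneg: "m \<ge> 0"
  using v_le[of x0] by simp

lemma ball_closure: "B \<subseteq> closure \<Omega>" "B \<in> sets lebesgue"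
  using ball_patch patch by auto

lemma L2_ball: "g \<in> L2_space M\<Omega> \<Longrightarrow> g \<in> L2_space (lebesgue_on B)"
  by (rule L2_space_subset(1)[OF ball_domain]) auto

lemma integrable_ball: "g \<in> L2_space M\<Omega> \<Longrightarrow> integrable (lebesgue_on B) g"
  by (intro L2_space_integrable finite_measure_lebesgue_on L2_ball) auto

lemma v_L2: "v \<in> L2_space M\<Omega>" "laplacian v \<in> L2_space M\<Omega>"
  "integrable M\<Omega> v"
proof -
  show "v \<in> L2_space M\<Omega>" by (rule test_functions_L2[OF v_test domain_sets])
  then show "integrable M\<Omega> v" by (rule L2_integrable)
  show "laplacian v \<in> L2_space M\<Omega>"
    by (rule L2_space_bounded[OF finite_measure_domain continuous_measurable_lebesgue_on[OF laplacian_continuous[OF v_test]]])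
       (use lap_le in auto)
qed

lemma test_integral_le:
  "integrable (lebesgue_on B) g \<Longrightarrow> \<bar>LINT x|M\<Omega>. g x * v x\<bar> \<le> m * (LINT x|lebesgue_on B. \<bar>g x\<bar>)"
  by (rule integral_mult_bounded_support_le[OF ball_domain _ domain_sets v_support v_le test_functions_measurable[OF v_test]]) auto

lemma laplacian_integral_le:
  "integrable (lebesgue_on B) g \<Longrightarrow>
    \<bar>LINT x|M\<Omega>. g x * laplacian v x\<bar> \<le> m / r\<^sup>2 * (LINT x|lebesgue_on B. \<bar>g x\<bar>)"
  by (rule integral_mult_bounded_support_le[OF ball_domain _ domain_sets laplacian_eq_0[OF v_support] lap_le
        continuous_measurable_lebesgue_on[OF laplacian_continuous[OF v_test]]]) auto

text \<open>For factors \<open>g\<close> that are only known to be integrable after multiplication with \<open>v\<close>.\<close>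

lemma test_integral_dominated:
  assumes g: "integrable M\<Omega> (\<lambda>x. g x * v x)" and h: "integrable (lebesgue_on B) h"
    and le: "AE x in lebesgue_on B. \<bar>g x\<bar> \<le> h x"
  shows "\<bar>LINT x|M\<Omega>. g x * v x\<bar> \<le> m * (LINT x|lebesgue_on B. h x)"
proof -
  have "(LINT x|M\<Omega>. g x * v x) = (LINT x|lebesgue_on B. g x * v x)"
    using v_support by (intro integral_lebesgue_on_support ball_domain) auto
  also have "\<bar>\<dots>\<bar> \<le> (LINT x|lebesgue_on B. \<bar>g x * v x\<bar>)"
    using integral_norm_bound[of "lebesgue_on B" "\<lambda>x. g x * v x"] unfolding real_norm_def by linarith
  also have "\<dots> \<le> (LINT x|lebesgue_on B. m * h x)"
  proof (intro integral_mono_AE)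
    show "integrable (lebesgue_on B) (\<lambda>x. \<bar>g x * v x\<bar>)"
      by (intro integrable_abs lebesgue_on_subset_mono(1)[OF ball_domain _ _ g]) auto
    show "AE x in lebesgue_on B. \<bar>g x * v x\<bar> \<le> m * h x"
      using le
    proof eventually_elim
      case (elim x)
      have "\<bar>g x\<bar> * \<bar>v x\<bar> \<le> h x * m"
        using elim v_le[of x] by (intro mult_mono) auto
      then show ?case by (simp add: abs_mult mult.commute)
    qed
  qed (use h in simp)
  finally show ?thesis by simp
qed

lemma ball_L1_le:
  assumes "g \<in> L2_space M\<Omega>"
  shows "(LINT x|lebesgue_on B. \<bar>g x\<bar>) \<le> sqrt (measure lebesgue B) * L2_norm (lebesgue_on B) g"
  by (rule Cauchy_Schwarz_L1[OF _ L2_ball[OF assms]]) auto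

lemma AE_ball:
  assumes "AE x in lebesgue_on \<omega>. P x" shows "AE x in lebesgue_on B. P x"
proof -
  have "AE x in lebesgue. x \<in> \<omega> \<longrightarrow> P x" using assms patch by (simp add: AE_restrict_space_iff)
  then have "AE x in lebesgue. x \<in> B \<longrightarrow> P x" using ball_patch by (auto elim!: eventually_mono)
  then show ?thesis by (simp add: AE_restrict_space_iff)
qed

end

section \<open>Residual identities for a discrete approximation\<close>

locale discrete_approximation = semilinear \<Omega> f y\<^sub>\<Omega> K
  for \<Omega> :: "'a::euclidean_space set" and f y\<^sub>\<Omega> K +
  fixes ub yb pb ul yl pl :: "'a \<Rightarrow> real" and W :: real
  assumes controls: "ub \<in> L2_space (lebesgue_on \<Omega>)" "ul \<in> L2_space (lebesgue_on \<Omega>)"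
    and state: "is_state (H10_space \<Omega>) \<Omega> f ub yb"
    and adjoint: "is_adjoint_state (H10_space \<Omega>) \<Omega> f y\<^sub>\<Omega> yb pb"
    and discrete_H10: "yl \<in> H10_space \<Omega>" "pl \<in> H10_space \<Omega>"
    and discrete_bounded: "\<exists>M. \<forall>x\<in>\<Omega>. \<bar>yl x\<bar> \<le> M" "\<exists>M. \<forall>x\<in>\<Omega>. \<bar>pl x\<bar> \<le> M"
    and W: "L2_norm (lebesgue_on \<Omega>) (\<lambda>x. 1 + \<bar>yb x\<bar> + \<bar>yl x\<bar>) \<le> W"
begin

lemma yb_H10: "yb \<in> H10_space \<Omega>" using state by (simp add: is_state_def)
lemma pb_H10: "pb \<in> H10_space \<Omega>" using adjoint by (simp add: is_adjoint_state_def)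

lemmas L2_facts = H10_L2[OF yb_H10] H10_L2[OF pb_H10] H10_L2[OF discrete_H10(1)] H10_L2[OF discrete_H10(2)] controls

lemma one_L2: "(\<lambda>x. 1) \<in> L2_space M\<Omega>"
  by (rule L2_space_const[OF finite_measure_domain])

lemma weight_L2: "(\<lambda>x. 1 + \<bar>yb x\<bar> + \<bar>yl x\<bar>) \<in> L2_space M\<Omega>"
  by (intro L2_space_add one_L2 L2_space_abs L2_facts)

lemma state_residual_L2: "(\<lambda>x. ul x - f x (yl x)) \<in> L2_space M\<Omega>"
proof -
  obtain M where "\<forall>x\<in>\<Omega>. \<bar>yl x\<bar> \<le> M" using discrete_bounded by blast
  then have "(\<lambda>x. f x (yl x)) \<in> L2_space M\<Omega>"
    by (intro nonlinearity_L2[of _ M] L2_spaceD(1)[OF L2_facts(3)]) auto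
  then show ?thesis by (intro L2_space_diff L2_facts)
qed

lemma potential_L2: "(\<lambda>x. dy f x (yl x) * pl x) \<in> L2_space M\<Omega>"
proof -
  obtain M where "\<forall>x\<in>\<Omega>. \<bar>pl x\<bar> \<le> M" using discrete_bounded by blast
  then have "AE x in M\<Omega>. \<bar>pl x\<bar> \<le> M" by (intro AE_I2) simp
  from L2_space_bounded_mult[OF dy_in_L2[OF discrete_H10(1)] L2_spaceD(1)[OF L2_facts(4)] this]
  show ?thesis by (simp add: mult.commute)
qed

lemma data_L2: "(\<lambda>x. y\<^sub>\<Omega> x + dy f x (yl x) * pl x) \<in> L2_space M\<Omega>"
  by (intro L2_space_add desired_in_L2 potential_L2)

end

locale discrete_test = discrete_approximation \<Omega> f y\<^sub>\<Omega> K ub yb pb ul yl pl W +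
    local_test \<Omega> v x0 r m \<omega>
  for \<Omega> :: "'a::euclidean_space set" and f y\<^sub>\<Omega> K ub yb pb ul yl pl W v x0 r m \<omega>
begin

definition "Y = L2_norm (lebesgue_on \<omega>) (\<lambda>x. yb x - yl x)"

definition "U = L1_norm (lebesgue_on \<omega>) (\<lambda>x. ub x - ul x)"

lemma Y_nonneg: "Y \<ge> 0" by (simp add: Y_def L2_norm_nonneg)

lemma diff_L2: "(\<lambda>x. yb x - yl x) \<in> L2_space M\<Omega>"
  by (intro L2_space_diff L2_facts)

lemma Y_ball: "L2_norm (lebesgue_on B) (\<lambda>x. yb x - yl x) \<le> Y"
  unfolding Y_def
  by (rule L2_space_subset(2)[OF ball_patch _ patch(2) L2_transfer[OF convex_domain patch diff_L2]]) auto

lemma U_ball: "(LINT x|lebesgue_on B. \<bar>ul x - ub x\<bar>) \<le> U"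
proof -
  have "finite_measure (lebesgue_on \<omega>)"
    using patch bounded_domain bounded_subset[OF bounded_closure[OF bounded_domain] patch(1)]
    by (intro finite_measure_lebesgue_on bounded_set_imp_lmeasurable) auto
  then have "integrable (lebesgue_on \<omega>) (\<lambda>x. \<bar>ub x - ul x\<bar>)"
    by (intro integrable_abs L2_space_integrable L2_transfer[OF convex_domain patch] L2_space_diff L2_facts)
  from lebesgue_on_subset_mono(2)[OF ball_patch _ patch(2) this]
  show ?thesis by (simp add: U_def L1_norm_def abs_minus_commute)
qed

lemma weight_ball: "L2_norm (lebesgue_on B) (\<lambda>x. 1 + \<bar>yb x\<bar> + \<bar>yl x\<bar>) \<le> W"
  using L2_space_subset(2)[OF ball_domain _ _ weight_L2] W by auto

text \<open>Subtracting the equation of \<open>yb\<close>, tested with \<open>v\<close>, leaves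
  three errors: of the control, of the nonlinearity, and of the state against the Laplacian. The
  growth condition bounds the second by the state error times the weight
  \<open>1 + \<bar>yb\<bar> + \<bar>yl\<bar>\<close>, whose norm is at most
  \<open>W\<close>.\<close>

lemma state_residual_le:
  "\<bar>(LINT x|M\<Omega>. (ul x - f x (yl x)) * v x) + (LINT x|M\<Omega>. yl x * laplacian v x)\<bar>
    \<le> m * (U + (K * W + sqrt (measure lebesgue B) / r\<^sup>2) * Y)"
proof -
  have v10: "v \<in> H10_space \<Omega>" by (rule test_function_H10[OF v_test])
  have i1: "integrable M\<Omega> (\<lambda>x. f x (yb x) * v x)"
    and "(LINT x|M\<Omega>. grad \<Omega> yb x \<bullet> grad \<Omega> v x) + (LINT x|M\<Omega>. f x (yb x) * v x) = (LINT x|M\<Omega>. ub x * v x)"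
    using state v10 by (auto simp: is_state_def)
  then have eq: "(LINT x|M\<Omega>. f x (yb x) * v x) = (LINT x|M\<Omega>. ub x * v x) + (LINT x|M\<Omega>. yb x * laplacian v x)"
    using integral_grad_test_function[OF H10_H1[OF yb_H10] v_test] by simp
  have i2: "integrable M\<Omega> (\<lambda>x. f x (yl x) * v x)"
    using L2_space_mult_integrable[OF L2_space_diff[OF controls(2) state_residual_L2] v_L2(1)] by simp
  have i3: "integrable M\<Omega> (\<lambda>x. ul x * v x)" "integrable M\<Omega> (\<lambda>x. ub x * v x)"
    "integrable M\<Omega> (\<lambda>x. yb x * laplacian v x)" "integrable M\<Omega> (\<lambda>x. yl x * laplacian v x)"
    by (intro L2_space_mult_integrable v_L2 L2_facts)+
  have split: "(LINT x|M\<Omega>. (ul x - f x (yl x)) * v x) + (LINT x|M\<Omega>. yl x * laplacian v x)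
      = (LINT x|M\<Omega>. (ul x - ub x) * v x) + (LINT x|M\<Omega>. (f x (yb x) - f x (yl x)) * v x)
        - (LINT x|M\<Omega>. (yb x - yl x) * laplacian v x)"
    using i1 i2 i3 eq by (simp add: left_diff_distrib)
  have 1: "\<bar>LINT x|M\<Omega>. (ul x - ub x) * v x\<bar> \<le> m * U"
    using test_integral_le[OF integrable_ball[OF L2_space_diff[OF controls(2,1)]]]
      mult_left_mono[OF U_ball m_nonneg] by linarith
  have 2: "\<bar>LINT x|M\<Omega>. (f x (yb x) - f x (yl x)) * v x\<bar> \<le> m * (K * (Y * W))"
  proof -
    let ?h = "\<lambda>x. K * \<bar>(yb x - yl x) * (1 + \<bar>yb x\<bar> + \<bar>yl x\<bar>)\<bar>"
    have "\<bar>LINT x|M\<Omega>. (f x (yb x) - f x (yl x)) * v x\<bar> \<le> m * (LINT x|lebesgue_on B. ?h x)"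
    proof (rule test_integral_dominated)
      show "integrable M\<Omega> (\<lambda>x. (f x (yb x) - f x (yl x)) * v x)"
        using i1 i2 by (simp add: left_diff_distrib)
      show "integrable (lebesgue_on B) ?h"
        by (intro integrable_mult_right integrable_abs L2_space_mult_integrable L2_ball diff_L2 weight_L2)
      have "AE x in M\<Omega>. \<bar>f x (yb x) - f x (yl x)\<bar> \<le> ?h x"
        using growth_AE
      proof eventually_elim
        case (elim x)
        then have "\<bar>f x (yb x) - f x (yl x)\<bar> \<le> K * (1 + \<bar>yb x\<bar> + \<bar>yl x\<bar>) * \<bar>yb x - yl x\<bar>" by blast
        also have "\<dots> = ?h x" by (simp add: abs_mult)
        finally show ?case .
      qed
      then show "AE x in lebesgue_on B. \<bar>f x (yb x) - f x (yl x)\<bar> \<le> ?h x"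
        by (rule AE_transfer[OF convex_domain ball_closure])
    qed
    also have "(LINT x|lebesgue_on B. ?h x) \<le> K * (Y * W)"
    proof -
      have "(LINT x|lebesgue_on B. \<bar>(yb x - yl x) * (1 + \<bar>yb x\<bar> + \<bar>yl x\<bar>)\<bar>)
          \<le> L2_norm (lebesgue_on B) (\<lambda>x. yb x - yl x) * L2_norm (lebesgue_on B) (\<lambda>x. 1 + \<bar>yb x\<bar> + \<bar>yl x\<bar>)"
        by (intro Cauchy_Schwarz_L2_norm L2_ball diff_L2 weight_L2)
      also have "\<dots> \<le> Y * W" by (intro mult_mono Y_ball weight_ball Y_nonneg L2_norm_nonneg)
      finally show ?thesis using K_pos by simp
    qed
    finally show ?thesis using m_nonneg by (simp add: mult_left_mono)
  qed
  have 3: "\<bar>LINT x|M\<Omega>. (yb x - yl x) * laplacian v x\<bar> \<le> m / r\<^sup>2 * (sqrt (measure lebesgue B) * Y)"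
  proof -
    have a: "\<bar>LINT x|M\<Omega>. (yb x - yl x) * laplacian v x\<bar> \<le> m / r\<^sup>2 * (LINT x|lebesgue_on B. \<bar>yb x - yl x\<bar>)"
      by (rule laplacian_integral_le[OF integrable_ball[OF diff_L2]])
    have "(LINT x|lebesgue_on B. \<bar>yb x - yl x\<bar>) \<le> sqrt (measure lebesgue B) * Y"
      using ball_L1_le[OF diff_L2] mult_left_mono[OF Y_ball, of "sqrt (measure lebesgue B)"] by simp
    then have "m / r\<^sup>2 * (LINT x|lebesgue_on B. \<bar>yb x - yl x\<bar>) \<le> m / r\<^sup>2 * (sqrt (measure lebesgue B) * Y)"
      using m_nonneg by (intro mult_left_mono) auto
    with a show ?thesis by (rule order_trans)
  qed
  have "m * (U + (K * W + sqrt (measure lebesgue B) / r\<^sup>2) * Y)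
      = m * U + m * (K * (Y * W)) + m / r\<^sup>2 * (sqrt (measure lebesgue B) * Y)"
    by (simp add: algebra_simps)
  then show ?thesis unfolding split using 1 2 3 by linarith
qed

text \<open>As for the state, with the difference of the potential terms split into
  \<open>dy f x (yb x) * (pb x - pl x)\<close> and
  \<open>(dy f x (yb x) - dy f x (yl x)) * pl x\<close>. Lipschitz continuity turns the second part
  into \<open>Y\<close> times the norm of \<open>pl\<close> on the ball, the term that later calls
  for Poincare or Hardy.\<close>

lemma adjoint_residual_le:
  assumes P: "AE x in lebesgue_on \<omega>. \<bar>pb x - pl x\<bar> \<le> P" and P0: "P \<ge> 0"
  shows "\<bar>(LINT x|M\<Omega>. (yl x - y\<^sub>\<Omega> x - dy f x (yl x) * pl x) * v x) + (LINT x|M\<Omega>. pl x * laplacian v x)\<bar>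
    \<le> m * (sqrt (measure lebesgue B) * Y + P * measure lebesgue B / r\<^sup>2
        + K * P * (sqrt (measure lebesgue B) * W) + K * (Y * L2_norm (lebesgue_on B) pl))"
proof -
  have v10: "v \<in> H10_space \<Omega>" by (rule test_function_H10[OF v_test])
  have i1: "integrable M\<Omega> (\<lambda>x. dy f x (yb x) * pb x * v x)"
    and "(LINT x|M\<Omega>. grad \<Omega> v x \<bullet> grad \<Omega> pb x) + (LINT x|M\<Omega>. dy f x (yb x) * pb x * v x)
      = (LINT x|M\<Omega>. (yb x - y\<^sub>\<Omega> x) * v x)"
    using adjoint v10 by (auto simp: is_adjoint_state_def)
  then have eq: "(LINT x|M\<Omega>. dy f x (yb x) * pb x * v x)
      = (LINT x|M\<Omega>. (yb x - y\<^sub>\<Omega> x) * v x) + (LINT x|M\<Omega>. pb x * laplacian v x)"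
    using integral_grad_test_function[OF H10_H1[OF pb_H10] v_test] by (simp add: inner_commute)
  have i2: "integrable M\<Omega> (\<lambda>x. dy f x (yl x) * pl x * v x)"
    by (intro L2_space_mult_integrable v_L2 potential_L2)
  have i3: "integrable M\<Omega> (\<lambda>x. yl x * v x)" "integrable M\<Omega> (\<lambda>x. yb x * v x)" "integrable M\<Omega> (\<lambda>x. y\<^sub>\<Omega> x * v x)"
    "integrable M\<Omega> (\<lambda>x. pb x * laplacian v x)" "integrable M\<Omega> (\<lambda>x. pl x * laplacian v x)"
    by (intro L2_space_mult_integrable v_L2 L2_facts desired_in_L2)+
  have pd: "(\<lambda>x. pb x - pl x) \<in> L2_space M\<Omega>" by (intro L2_space_diff L2_facts)
  have split: "(LINT x|M\<Omega>. (yl x - y\<^sub>\<Omega> x - dy f x (yl x) * pl x) * v x) + (LINT x|M\<Omega>. pl x * laplacian v x)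
      = - (LINT x|M\<Omega>. (yb x - yl x) * v x) - (LINT x|M\<Omega>. (pb x - pl x) * laplacian v x)
        + (LINT x|M\<Omega>. (dy f x (yb x) * pb x - dy f x (yl x) * pl x) * v x)"
    using i1 i2 i3 eq by (simp add: left_diff_distrib)
  have PB: "AE x in lebesgue_on B. \<bar>pb x - pl x\<bar> \<le> P" by (rule AE_ball[OF P])
  interpret fin: finite_measure "lebesgue_on B" by (rule finite_measure_lebesgue_on) auto
  have mB: "measure (lebesgue_on B) B = measure lebesgue B" by (simp add: measure_restrict_space)
  have 1: "\<bar>LINT x|M\<Omega>. (yb x - yl x) * v x\<bar> \<le> m * (sqrt (measure lebesgue B) * Y)"
  proof -
    have "\<bar>LINT x|M\<Omega>. (yb x - yl x) * v x\<bar> \<le> m * (LINT x|lebesgue_on B. \<bar>yb x - yl x\<bar>)"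
      by (rule test_integral_le[OF integrable_ball[OF diff_L2]])
    also have "(LINT x|lebesgue_on B. \<bar>yb x - yl x\<bar>) \<le> sqrt (measure lebesgue B) * Y"
      using ball_L1_le[OF diff_L2] mult_left_mono[OF Y_ball, of "sqrt (measure lebesgue B)"] by simp
    finally show ?thesis using m_nonneg by (simp add: mult_left_mono)
  qed
  have 2: "\<bar>LINT x|M\<Omega>. (pb x - pl x) * laplacian v x\<bar> \<le> m / r\<^sup>2 * (P * measure lebesgue B)"
  proof -
    have a: "\<bar>LINT x|M\<Omega>. (pb x - pl x) * laplacian v x\<bar> \<le> m / r\<^sup>2 * (LINT x|lebesgue_on B. \<bar>pb x - pl x\<bar>)"
      by (rule laplacian_integral_le[OF integrable_ball[OF pd]])
    have "(LINT x|lebesgue_on B. \<bar>pb x - pl x\<bar>) \<le> (LINT x|lebesgue_on B. P)"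
      using PB by (intro integral_mono_AE integrable_abs integrable_ball[OF pd]) auto
    also have "\<dots> = P * measure lebesgue B" using mB by simp
    finally have "m / r\<^sup>2 * (LINT x|lebesgue_on B. \<bar>pb x - pl x\<bar>) \<le> m / r\<^sup>2 * (P * measure lebesgue B)"
      using m_nonneg by (intro mult_left_mono) auto
    with a show ?thesis by (rule order_trans)
  qed
  have 3: "\<bar>LINT x|M\<Omega>. (dy f x (yb x) * pb x - dy f x (yl x) * pl x) * v x\<bar>
      \<le> m * (K * P * (sqrt (measure lebesgue B) * W) + K * (Y * L2_norm (lebesgue_on B) pl))"
  proof -
    let ?w = "\<lambda>x. 1 + \<bar>yb x\<bar> + \<bar>yl x\<bar>"
    let ?h = "\<lambda>x. K * P * \<bar>?w x\<bar> + K * \<bar>(yb x - yl x) * pl x\<bar>"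
    have "\<bar>LINT x|M\<Omega>. (dy f x (yb x) * pb x - dy f x (yl x) * pl x) * v x\<bar> \<le> m * (LINT x|lebesgue_on B. ?h x)"
    proof (rule test_integral_dominated)
      show "integrable M\<Omega> (\<lambda>x. (dy f x (yb x) * pb x - dy f x (yl x) * pl x) * v x)"
        using i1 i2 by (simp add: left_diff_distrib)
      show "integrable (lebesgue_on B) ?h"
        by (intro Bochner_Integration.integrable_add integrable_mult_right integrable_abs L2_space_mult_integrable
            L2_ball diff_L2 L2_facts integrable_ball[OF weight_L2])
      have "AE x in M\<Omega>. (\<forall>s. 0 \<le> dy f x s \<and> dy f x s \<le> K * (1 + \<bar>s\<bar>)) \<and>
          (\<forall>s t. \<bar>dy f x s - dy f x t\<bar> \<le> K * \<bar>s - t\<bar>)"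
        using growth_AE by eventually_elim blast
      then have "AE x in lebesgue_on B. (\<forall>s. 0 \<le> dy f x s \<and> dy f x s \<le> K * (1 + \<bar>s\<bar>)) \<and>
          (\<forall>s t. \<bar>dy f x s - dy f x t\<bar> \<le> K * \<bar>s - t\<bar>)"
        by (rule AE_transfer[OF convex_domain ball_closure])
      then show "AE x in lebesgue_on B. \<bar>dy f x (yb x) * pb x - dy f x (yl x) * pl x\<bar> \<le> ?h x"
        using PB
      proof eventually_elim
        case (elim x)
        have "dy f x (yb x) * pb x - dy f x (yl x) * pl x
            = dy f x (yb x) * (pb x - pl x) + (dy f x (yb x) - dy f x (yl x)) * pl x" by (simp add: algebra_simps)
        also have "\<bar>\<dots>\<bar> \<le> \<bar>dy f x (yb x)\<bar> * \<bar>pb x - pl x\<bar> + \<bar>dy f x (yb x) - dy f x (yl x)\<bar> * \<bar>pl x\<bar>"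
          by (metis abs_mult abs_triangle_ineq)
        also have "\<dots> \<le> (K * ?w x) * P + (K * \<bar>yb x - yl x\<bar>) * \<bar>pl x\<bar>"
        proof (intro add_mono mult_mono)
          have "dy f x (yb x) \<le> K * (1 + \<bar>yb x\<bar>)" "0 \<le> dy f x (yb x)" using elim by blast+
          moreover have "K * (1 + \<bar>yb x\<bar>) \<le> K * ?w x" using K_pos by (intro mult_left_mono) auto
          ultimately show "\<bar>dy f x (yb x)\<bar> \<le> K * ?w x" by linarith
        qed (use elim K_pos in auto)
        also have "\<dots> = ?h x" by (simp add: abs_mult)
        finally show ?case .
      qed
    qed
    also have "(LINT x|lebesgue_on B. ?h x)
        = K * P * (LINT x|lebesgue_on B. \<bar>?w x\<bar>) + K * (LINT x|lebesgue_on B. \<bar>(yb x - yl x) * pl x\<bar>)"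
      using integrable_ball[OF weight_L2] L2_space_mult_integrable[OF L2_ball[OF diff_L2] L2_ball[OF L2_facts(4)]]
      by (subst Bochner_Integration.integral_add) (auto simp del: abs_mult)
    also have "\<dots> \<le> K * P * (sqrt (measure lebesgue B) * W) + K * (Y * L2_norm (lebesgue_on B) pl)"
    proof (intro add_mono mult_left_mono)
      show "(LINT x|lebesgue_on B. \<bar>?w x\<bar>) \<le> sqrt (measure lebesgue B) * W"
        using ball_L1_le[OF weight_L2] mult_left_mono[OF weight_ball, of "sqrt (measure lebesgue B)"] by simp
      have "(LINT x|lebesgue_on B. \<bar>(yb x - yl x) * pl x\<bar>)
          \<le> L2_norm (lebesgue_on B) (\<lambda>x. yb x - yl x) * L2_norm (lebesgue_on B) pl"
        by (intro Cauchy_Schwarz_L2_norm L2_ball diff_L2 L2_facts)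
      also have "\<dots> \<le> Y * L2_norm (lebesgue_on B) pl" by (intro mult_right_mono Y_ball L2_norm_nonneg)
      finally show "(LINT x|lebesgue_on B. \<bar>(yb x - yl x) * pl x\<bar>) \<le> Y * L2_norm (lebesgue_on B) pl" .
    qed (use K_pos P0 in auto)
    finally show ?thesis using m_nonneg by (simp add: mult_left_mono)
  qed
  have "m * (sqrt (measure lebesgue B) * Y + P * measure lebesgue B / r\<^sup>2
        + K * P * (sqrt (measure lebesgue B) * W) + K * (Y * L2_norm (lebesgue_on B) pl))
      = m * (sqrt (measure lebesgue B) * Y) + m / r\<^sup>2 * (P * measure lebesgue B)
        + m * (K * P * (sqrt (measure lebesgue B) * W) + K * (Y * L2_norm (lebesgue_on B) pl))"
    by (simp add: algebra_simps)
  then show ?thesis unfolding split using 1 2 3 by linarith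
qed

end


subsection \<open>Simplices and their facets\<close>

text \<open>A linear functional may be prescribed on the independent vectors \<open>w - b\<close>.
  The base point \<open>b\<close> differs from \<open>v\<close>, so the required value at
  \<open>b\<close> is 0, as a linear functional has it.\<close>

lemma affine_barycentric_function:
  fixes C :: "'a::euclidean_space set"
  assumes ind: "\<not> affine_dependent C" and v: "v \<in> C" and b: "b \<in> C" "b \<noteq> v"
  obtains g :: 'a and c :: real where "\<And>w. w \<in> C \<Longrightarrow> g \<bullet> w + c = (if w = v then 1 else 0)"
proof -
  have "independent ((\<lambda>x. - b + x) ` (C - {b}))"
    using ind affine_dependent_iff_dependent[of b "C - {b}"] b(1) by (simp add: insert_absorb)
  then obtain G :: "'a \<Rightarrow> real" where G: "linear G"
    "\<And>x. x \<in> (\<lambda>x. - b + x) ` (C - {b}) \<Longrightarrow> G x = (if x = - b + v then 1 else 0)"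
    using linear_independent_extend[of "(\<lambda>x. - b + x) ` (C - {b})" "\<lambda>x. if x = - b + v then 1 else 0"] by blast
  have inner: "G x = adjoint G 1 \<bullet> x" for x
    using adjoint_works[OF G(1), of x 1] by (simp add: inner_commute)
  show ?thesis
  proof (rule that[of "adjoint G 1" "- G b"])
    fix w assume w: "w \<in> C"
    have "adjoint G 1 \<bullet> w + - G b = G (- b + w)"
      using linear_add[OF G(1), of "- b" w] linear_neg[OF G(1), of b] by (simp add: inner)
    also have "\<dots> = (if w = v then 1 else 0)"
    proof (cases "w = b")
      case True
      then show ?thesis using b(2) linear_0[OF G(1)] by simp
    next
      case False
      then show ?thesis using G(2)[of "- b + w"] w by auto
    qed
    finally show "adjoint G 1 \<bullet> w + - G b = (if w = v then 1 else 0)" .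
  qed
qed

locale full_simplex =
  fixes C :: "'a::euclidean_space set"
  assumes independent: "\<not> affine_dependent C" and card_C: "card C = Suc DIM('a)"
begin

lemma finite_C: "finite C"
  using card_C card.infinite by fastforce

lemma ex_other: "\<exists>b\<in>C. b \<noteq> v"
proof (rule ccontr)
  assume "\<not> ?thesis"
  then have "C \<subseteq> {v}" by auto
  then have "card C \<le> 1" using card_mono[of "{v}" C] by simp
  then show False using card_C DIM_positive[where 'a='a] by simp
qed

definition bary_spec :: "('a \<Rightarrow> 'a) \<times> ('a \<Rightarrow> real) \<Rightarrow> bool" where
  "bary_spec = (\<lambda>(g, c). \<forall>v\<in>C. \<forall>w\<in>C. g v \<bullet> w + c v = (if w = v then 1 else 0))"

definition "bary_coeffs = (SOME p. bary_spec p)"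

text \<open>Gradients of the barycentric coordinates; the norm at \<open>v\<close> is the reciprocal
  of the height of the simplex over the facet opposite to \<open>v\<close>.\<close>

definition "bgrad = fst bary_coeffs"

definition bary :: "'a \<Rightarrow> 'a \<Rightarrow> real" where
  "bary v x = bgrad v \<bullet> x + snd bary_coeffs v"

lemma bary_vertex: "v \<in> C \<Longrightarrow> w \<in> C \<Longrightarrow> bary v w = (if w = v then 1 else 0)"
proof -
  assume vw: "v \<in> C" "w \<in> C"
  have "\<forall>v\<in>C. \<exists>g c. \<forall>w\<in>C. g \<bullet> w + c = (if w = v then 1 else 0)"
    using affine_barycentric_function[OF independent] ex_other by metis
  then obtain g c where "\<forall>v\<in>C. \<forall>w\<in>C. g v \<bullet> w + c v = (if w = v then 1 else 0)" by metis
  then have "bary_spec (g, c)" by (simp add: bary_spec_def)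
  then have "bary_spec bary_coeffs" unfolding bary_coeffs_def by (rule someI)
  then show ?thesis using vw by (cases bary_coeffs) (simp add: bary_spec_def bary_def bgrad_def)
qed

lemma bary_diff: "bary v x - bary v y = bgrad v \<bullet> (x - y)"
  by (simp add: bary_def inner_diff_right)

lemma affine_hull_UNIV: "affine hull C = UNIV"
proof -
  have "aff_dim C = int DIM('a)"
    using aff_dim_affine_independent[OF independent] card_C by simp
  then show ?thesis by (simp add: aff_dim_eq_full)
qed

lemma affine_combination:
  assumes "sum u C = 1"
  shows "g \<bullet> (\<Sum>v\<in>C. u v *\<^sub>R v) + c = (\<Sum>v\<in>C. u v * (g \<bullet> v + c))"
proof -
  have "(\<Sum>v\<in>C. u v * (g \<bullet> v + c)) = (\<Sum>v\<in>C. u v * (g \<bullet> v)) + (\<Sum>v\<in>C. u v) * c"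
    by (simp add: algebra_simps sum.distrib sum_distrib_left)
  then show ?thesis using assms by (simp add: inner_sum_right)
qed

lemma bary_of_combination:
  assumes "sum u C = 1" "w \<in> C"
  shows "bary w (\<Sum>v\<in>C. u v *\<^sub>R v) = u w"
proof -
  have "bary w (\<Sum>v\<in>C. u v *\<^sub>R v) = (\<Sum>v\<in>C. u v * bary w v)"
    unfolding bary_def by (rule affine_combination[OF assms(1)])
  also have "\<dots> = (\<Sum>v\<in>C. if v = w then u w else 0)"
    using assms(2) by (intro sum.cong) (auto simp: bary_vertex)
  finally show ?thesis using assms(2) finite_C by simp
qed

lemma bary_sum: "(\<Sum>v\<in>C. bary v x) = 1" and bary_repr: "(\<Sum>v\<in>C. bary v x *\<^sub>R v) = x"
proof -
  have "x \<in> affine hull C" by (simp add: affine_hull_UNIV)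
  then obtain u where u: "sum u C = 1" "(\<Sum>v\<in>C. u v *\<^sub>R v) = x"
    unfolding affine_hull_finite[OF finite_C] by blast
  have "bary v x = u v" if "v \<in> C" for v using bary_of_combination[OF u(1) that] u(2) by simp
  then show "(\<Sum>v\<in>C. bary v x) = 1" "(\<Sum>v\<in>C. bary v x *\<^sub>R v) = x" using u by auto
qed

lemma affine_bary: "g \<bullet> x + c = (\<Sum>v\<in>C. bary v x * (g \<bullet> v + c))"
  using affine_combination[OF bary_sum, of g x c] by (simp add: bary_repr)

lemma hull_eq: "convex hull C = {x. \<forall>v\<in>C. 0 \<le> bary v x}"
proof (intro set_eqI iffI)
  fix x assume "x \<in> convex hull C"
  then obtain u where u: "\<forall>v\<in>C. 0 \<le> u v" "sum u C = 1" "(\<Sum>v\<in>C. u v *\<^sub>R v) = x"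
    unfolding convex_hull_finite[OF finite_C] by blast
  then show "x \<in> {x. \<forall>v\<in>C. 0 \<le> bary v x}" using bary_of_combination[OF u(2)] by auto
next
  fix x assume "x \<in> {x. \<forall>v\<in>C. 0 \<le> bary v x}"
  then show "x \<in> convex hull C"
    unfolding convex_hull_finite[OF finite_C] using bary_sum[of x] bary_repr[of x] by (auto intro!: exI[of _ "\<lambda>v. bary v x"])
qed

lemma bary_le_1: "x \<in> convex hull C \<Longrightarrow> v \<in> C \<Longrightarrow> bary v x \<le> 1"
  using member_le_sum[of v C "\<lambda>v. bary v x"] finite_C by (auto simp: hull_eq bary_sum)

lemma bgrad_nonzero: "v \<in> C \<Longrightarrow> bgrad v \<noteq> 0"
proof
  assume v: "v \<in> C" and 0: "bgrad v = 0"
  obtain b where "b \<in> C" "b \<noteq> v" using ex_other by blast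
  then show False using bary_diff[of v v b] v 0 by (simp add: bary_vertex)
qed

text \<open>A barycentric coordinate stays in \<open>[0, 1]\<close> on the simplex but varies by
  \<open>2 * \<rho> * norm (bgrad v)\<close> along the diameter of the ball in the direction of its
  gradient.\<close>

lemma ball_radius_le:
  assumes "cball p \<rho> \<subseteq> convex hull C" "v \<in> C"
  shows "2 * \<rho> \<le> 1 / norm (bgrad v)"
proof (cases "\<rho> \<ge> 0")
  case True
  let ?d = "(\<rho> / norm (bgrad v)) *\<^sub>R bgrad v"
  have nz: "norm (bgrad v) > 0" using bgrad_nonzero[OF assms(2)] by simp
  have "norm ?d = \<rho>" using nz True by simp
  then have "p + ?d \<in> convex hull C" "p - ?d \<in> convex hull C"
    using assms(1) by (auto simp: subset_iff dist_norm)
  then have "bary v (p + ?d) - bary v (p - ?d) \<le> 1"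
  proof -
    have "bary v (p - ?d) \<ge> 0" using \<open>p - ?d \<in> convex hull C\<close> assms(2) unfolding hull_eq by blast
    then show ?thesis using bary_le_1[OF \<open>p + ?d \<in> convex hull C\<close> assms(2)] by linarith
  qed
  moreover have "bary v (p + ?d) - bary v (p - ?d) = 2 * \<rho> * norm (bgrad v)"
    unfolding bary_diff using nz
    by (simp add: inner_add_right power2_norm_eq_inner[symmetric] power2_eq_square)
  ultimately show ?thesis using nz by (simp add: field_simps)
next
  case False
  \<comment> \<open>Negative radii count in \<open>inball_diameter\<close>, since their balls are
    empty.\<close>
  then have "2 * \<rho> < 0" by simp
  also have "0 \<le> 1 / norm (bgrad v)" by simp
  finally show ?thesis by simp
qed

lemma inball_diameter_le: "v \<in> C \<Longrightarrow> inball_diameter (convex hull C) \<le> 1 / norm (bgrad v)"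
  unfolding inball_diameter_def
proof (rule cSup_least)
  have "cball (0::'a) (- 1) \<subseteq> convex hull C" by simp
  then show "{2 * r |r. \<exists>x. cball x r \<subseteq> convex hull C} \<noteq> {}" by blast
qed (use ball_radius_le in blast)

lemma bgrad_inball: "v \<in> C \<Longrightarrow> norm (bgrad v) * inball_diameter (convex hull C) \<le> 1"
  using inball_diameter_le[of v] bgrad_nonzero[of v] by (simp add: field_simps)

lemma bdd_inball: "bdd_above {2 * r |r. \<exists>x. cball x r \<subseteq> convex hull C}"
proof -
  obtain v where "v \<in> C" using ex_other by blast
  then show ?thesis using ball_radius_le by (intro bdd_aboveI[of _ "1 / norm (bgrad v)"]) blast
qed

lemma interior_nonempty: "interior (convex hull C) \<noteq> {}"
proof -
  have "affine hull (convex hull C) = UNIV" by (simp add: affine_hull_UNIV)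
  then have "interior (convex hull C) = rel_interior (convex hull C)" by (simp add: rel_interior_interior)
  moreover have "convex hull C \<noteq> {}" using ex_other by auto
  ultimately show ?thesis using rel_interior_eq_empty[OF convex_convex_hull] by metis
qed

lemma inball_diameter_pos: "inball_diameter (convex hull C) > 0"
proof -
  obtain p e where "e > 0" "cball p e \<subseteq> convex hull C"
    using interior_nonempty mem_interior_cball by blast
  then have "2 * e \<le> inball_diameter (convex hull C)"
    unfolding inball_diameter_def by (intro cSup_upper bdd_inball) blast
  then show ?thesis using \<open>e > 0\<close> by linarith
qed

text \<open>The radius is half the inradius, strictly below the supremum in
  \<open>inball_diameter\<close>, so that its attainment need not be discussed.\<close>

lemma ex_inball:
  obtains p where "cball p (inball_diameter (convex hull C) / 4) \<subseteq> convex hull C"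
proof -
  have "inball_diameter (convex hull C) / 2 < Sup {2 * r |r. \<exists>x. cball x r \<subseteq> convex hull C}"
    using inball_diameter_pos by (simp add: inball_diameter_def)
  moreover have "cball (0::'a) (- 1) \<subseteq> convex hull C" by simp
  then have "{2 * r |r. \<exists>x. cball x r \<subseteq> convex hull C} \<noteq> {}" by blast
  ultimately obtain r p where "inball_diameter (convex hull C) / 2 < 2 * r" "cball p r \<subseteq> convex hull C"
    using less_cSup_iff[OF _ bdd_inball] by blast
  then have "cball p (inball_diameter (convex hull C) / 4) \<subseteq> cball p r" by (intro subset_cball) simp
  then show ?thesis using that \<open>cball p r \<subseteq> convex hull C\<close> by blast
qed

text \<open>Along the edge the barycentric coordinate of \<open>v\<close> drops from 1 to 0, while
  its slope is at most the reciprocal of \<open>inball_diameter\<close>. This lower bound for edges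
  is what makes sizes of adjacent elements comparable.\<close>

lemma inball_le_edge:
  assumes "v \<in> C" "w \<in> C" "v \<noteq> w" shows "inball_diameter (convex hull C) \<le> dist v w"
proof -
  have "1 = bgrad v \<bullet> (v - w)" using bary_diff[of v v w] assms by (simp add: bary_vertex)
  also have "\<dots> \<le> norm (bgrad v) * dist v w" by (simp add: dist_norm norm_cauchy_schwarz)
  finally have "1 / norm (bgrad v) \<le> dist v w" using bgrad_nonzero[OF assms(1)] by (simp add: field_simps)
  with inball_diameter_le[OF assms(1)] show ?thesis by simp
qed

end

section \<open>Facets and their inner normals\<close>

lemma simplex_vertices:
  fixes T :: "'a::euclidean_space set"
  assumes "int DIM('a) simplex T"
  obtains C where "full_simplex C" "T = convex hull C"
proof -
  obtain C where "\<not> affine_dependent C" "int (card C) = int DIM('a) + 1" "T = convex hull C"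
    using assms by (auto simp: simplex_def)
  then show ?thesis by (intro that[of C]) (auto simp: full_simplex_def)
qed

text \<open>The barycenter of \<open>e\<close> if \<open>e\<close> is a facet of a full-dimensional simplex, which has \<open>DIM('a)\<close>
  vertices.\<close>

definition facet_center :: "'a::euclidean_space set \<Rightarrow> 'a" where
  "facet_center e = (\<Sum>v\<in>{v. v extreme_point_of e}. v) /\<^sub>R real DIM('a)"

text \<open>Gathers what is needed of a facet, so that barycentric coordinates need not reappear: a
  half ball around the barycenter inside \<open>T\<close>, the fact that only multiples of
  \<open>n\<close> are orthogonal to \<open>e\<close>, and the value of the definite description in
  \<open>exterior_normal\<close>.\<close>

definition inner_normal :: "'a::euclidean_space set \<Rightarrow> 'a set \<Rightarrow> 'a \<Rightarrow> bool" where
  "inner_normal T e n \<longleftrightarrow> norm n = 1 \<and> facet_center e \<in> e \<and>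
     (\<forall>x\<in>e. n \<bullet> (x - facet_center e) = 0) \<and> (\<forall>x\<in>T. n \<bullet> (x - facet_center e) \<ge> 0) \<and>
     (\<forall>x. norm (x - facet_center e) \<le> inball_diameter T / DIM('a) \<and> n \<bullet> (x - facet_center e) \<ge> 0 \<longrightarrow> x \<in> T) \<and>
     (\<forall>G. (\<forall>x\<in>e. \<forall>y\<in>e. G \<bullet> (x - y) = 0) \<longrightarrow> (\<exists>s. G = s *\<^sub>R n)) \<and>
     exterior_normal T e = - n"

lemma inner_normalD:
  assumes "inner_normal T e n"
  shows "norm n = 1" "n \<bullet> n = 1" "facet_center e \<in> e"
    and "x \<in> e \<Longrightarrow> n \<bullet> (x - facet_center e) = 0"
    and "norm (x - facet_center e) \<le> inball_diameter T / DIM('a::euclidean_space) \<Longrightarrow>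
      n \<bullet> (x - facet_center e) \<ge> 0 \<Longrightarrow> (x::'a) \<in> T"
    and "(\<And>x y. x \<in> e \<Longrightarrow> y \<in> e \<Longrightarrow> G \<bullet> (x - y) = 0) \<Longrightarrow> \<exists>s. G = s *\<^sub>R n"
    and "exterior_normal T e = - n"
proof -
  note a = assms[unfolded inner_normal_def]
  show "norm n = 1" using a by blast
  then show "n \<bullet> n = 1" by (simp add: norm_eq_1)
  show "facet_center e \<in> e" using a by blast
  show "x \<in> e \<Longrightarrow> n \<bullet> (x - facet_center e) = 0" using a by blast
  show "norm (x - facet_center e) \<le> inball_diameter T / DIM('a) \<Longrightarrow> n \<bullet> (x - facet_center e) \<ge> 0 \<Longrightarrow> x \<in> T"
    using a by blast
  show "(\<And>x y. x \<in> e \<Longrightarrow> y \<in> e \<Longrightarrow> G \<bullet> (x - y) = 0) \<Longrightarrow> \<exists>s. G = s *\<^sub>R n" using a by blast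
  show "exterior_normal T e = - n" using a by blast
qed

text \<open>With \<open>u\<close> the vertex opposite to \<open>e\<close>, the normal is the
  normalised gradient of \<open>bary u\<close>, and the distance from the hyperplane of
  \<open>e\<close> is \<open>bary u\<close> divided by the norm of that gradient.\<close>

lemma inner_normal_exists:
  fixes T e :: "'a::euclidean_space set"
  assumes T: "int DIM('a) simplex T" and e: "e facet_of T"
  obtains n where "inner_normal T e n"
proof -
  obtain C where C: "full_simplex C" "T = convex hull C" by (rule simplex_vertices[OF T])
  interpret full_simplex C by (rule C(1))
  obtain u where u: "u \<in> C" "e = convex hull (C - {u})"
    using e facet_of_convex_hull_affine_independent[OF independent] unfolding C(2) by blast
  let ?d = "real DIM('a)"
  have d: "?d > 0" using DIM_positive[where 'a='a] by simp
  have "\<not> affine_dependent (C - {u})" using independent affine_independent_subset by blast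
  then have ext: "{v. v extreme_point_of e} = C - {u}"
    unfolding u(2) by (auto simp: extreme_point_of_convex_hull_affine_independent)
  have card: "card (C - {u}) = DIM('a)" using card_C u(1) finite_C by simp
  define x0 where "x0 = facet_center e"
  define w where "w v = (if v = u then 0 else 1 / ?d)" for v
  have w1: "sum w C = 1"
    using finite_C u(1) card d by (simp add: w_def sum.remove[of C u])
  have "(\<Sum>v\<in>C. w v *\<^sub>R v) = (\<Sum>v\<in>C - {u}. (1 / ?d) *\<^sub>R v)"
    using finite_C u(1) by (simp add: w_def sum.remove[of C u])
  also have "\<dots> = x0" by (simp add: x0_def facet_center_def ext scaleR_sum_right inverse_eq_divide)
  finally have x0w: "(\<Sum>v\<in>C. w v *\<^sub>R v) = x0" .
  have bx0: "bary v x0 = w v" if "v \<in> C" for v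
    using bary_of_combination[OF w1 that] x0w by simp
  have face: "bary u x = 0" if "x \<in> e" for x
  proof -
    have "x \<in> convex hull (C - {u})" using that u(2) by simp
    then obtain c where c: "sum c (C - {u}) = 1" "(\<Sum>v\<in>C - {u}. c v *\<^sub>R v) = x"
      unfolding convex_hull_finite[OF finite_Diff[OF finite_C]] by blast
    let ?c = "\<lambda>v. if v = u then 0 else c v"
    have "sum ?c C = 1" "(\<Sum>v\<in>C. ?c v *\<^sub>R v) = x"
      using c finite_C u(1) by (simp_all add: sum.remove[of C u])
    then show ?thesis using bary_of_combination[of ?c u] u(1) by simp
  qed
  have x0e: "x0 \<in> e"
    unfolding u(2) convex_hull_finite[OF finite_Diff[OF finite_C]]
  proof (intro CollectI exI[of _ w] conjI)
    show "\<forall>v\<in>C - {u}. 0 \<le> w v" by (simp add: w_def)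
    show "sum w (C - {u}) = 1" 
      using w1 sum.remove[OF finite_C u(1), of w] by (simp only: w_def[of u] if_True add_0 refl)
    show "(\<Sum>v\<in>C - {u}. w v *\<^sub>R v) = x0" 
      using x0w sum.remove[OF finite_C u(1), of "\<lambda>v. w v *\<^sub>R v"] by (simp only: w_def[of u] if_True scaleR_zero_left add_0 refl)
  qed
  define N where "N = norm (bgrad u)"
  have N: "N > 0" using bgrad_nonzero[OF u(1)] by (simp add: N_def)
  define n where "n = bgrad u /\<^sub>R N"
  have nb: "n \<bullet> (x - x0) = bary u x / N" for x
  proof -
    have "bgrad u \<bullet> (x - x0) = bary u x" using bary_diff[of u x x0] bx0[OF u(1)] by (simp add: w_def)
    then show ?thesis by (simp add: n_def divide_inverse mult.commute)
  qed
  have n1: "norm n = 1" using N by (simp add: n_def N_def)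
  have ne: "n \<bullet> (x - x0) = 0" if "x \<in> e" for x using face[OF that] by (simp add: nb)
  have nT: "n \<bullet> (x - x0) \<ge> 0" if "x \<in> T" for x
    using that C(2) hull_eq u(1) N by (simp add: nb)
  \<comment> \<open>At the barycenter every coordinate other than that of \<open>u\<close> equals
    \<open>1 / d\<close>, and its slope is at most the reciprocal of \<open>inball_diameter\<close>,
    so none of them turns negative within this radius.\<close>
  have half: "x \<in> T" if x: "norm (x - x0) \<le> inball_diameter T / ?d" "n \<bullet> (x - x0) \<ge> 0" for x
  proof -
    have "0 \<le> bary v x" if v: "v \<in> C" for v
    proof (cases "v = u")
      case True
      then show ?thesis using x(2) N by (simp add: nb zero_le_divide_iff)
    next
      case False
      have "\<bar>bgrad v \<bullet> (x - x0)\<bar> \<le> norm (bgrad v) * norm (x - x0)" by (rule Cauchy_Schwarz_ineq2)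
      also have "\<dots> \<le> norm (bgrad v) * (inball_diameter T / ?d)" by (intro mult_left_mono x) auto
      also have "\<dots> \<le> 1 / ?d"
        using divide_right_mono[OF bgrad_inball[OF v], of ?d] d C(2) by simp
      finally show ?thesis using bary_diff[of v x x0] bx0[OF v] False by (simp add: w_def)
    qed
    then show ?thesis by (simp add: C(2) hull_eq)
  qed
  \<comment> \<open>An affine function that vanishes at all vertices of \<open>e\<close> is a
    multiple of \<open>bary u\<close>; compare gradients.\<close>
  have par: "\<exists>s. G = s *\<^sub>R n" if G: "\<forall>x\<in>e. \<forall>y\<in>e. G \<bullet> (x - y) = 0" for G
  proof -
    have v0: "G \<bullet> v + (- (G \<bullet> x0)) = 0" if "v \<in> C - {u}" for v
    proof -
      have "v \<in> e" using that u(2) hull_inc by metis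
      then have "G \<bullet> (v - x0) = 0" using G x0e by blast
      then show ?thesis by (simp add: inner_diff_right)
    qed
    define t where "t = G \<bullet> u - G \<bullet> x0"
    have "G \<bullet> x - G \<bullet> x0 = bary u x * t" for x
    proof -
      have "G \<bullet> x + (- (G \<bullet> x0)) = (\<Sum>v\<in>C. bary v x * (G \<bullet> v + (- (G \<bullet> x0))))" by (rule affine_bary)
      also have "\<dots> = bary u x * t + (\<Sum>v\<in>C - {u}. bary v x * (G \<bullet> v + (- (G \<bullet> x0))))"
        unfolding sum.remove[OF finite_C u(1)] by (simp add: t_def)
      also have "(\<Sum>v\<in>C - {u}. bary v x * (G \<bullet> v + (- (G \<bullet> x0)))) = 0"
        using v0 by (intro sum.neutral) auto
      finally show ?thesis by simp
    qed
    then have *: "G \<bullet> (x - x0) = (t * N) * (n \<bullet> (x - x0))" for x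
      unfolding nb using N by (simp add: inner_diff_right)
    have "z \<bullet> G = z \<bullet> ((t * N) *\<^sub>R n)" for z
      using *[of "x0 + z"] by (simp add: inner_commute)
    then have "G = (t * N) *\<^sub>R n" using vector_eq_ldot by blast
    then show ?thesis by blast
  qed
  have ext_n: "exterior_normal T e = - n"
    unfolding exterior_normal_def
  proof (rule the_equality)
    have "n \<bullet> x = n \<bullet> x0" if "x \<in> e" for x using ne[OF that] by (simp add: inner_diff_right)
    moreover have "n \<bullet> x \<ge> n \<bullet> x0" if "x \<in> T" for x using nT[OF that] by (simp add: inner_diff_right)
    ultimately show "norm (- n) = 1 \<and> (\<forall>x\<in>e. \<forall>y\<in>e. - n \<bullet> (x - y) = 0) \<and> (\<forall>x\<in>T. \<forall>y\<in>e. - n \<bullet> (x - y) \<le> 0)"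
      using n1 by (simp add: inner_diff_right)
  next
    fix k assume k: "norm k = 1 \<and> (\<forall>x\<in>e. \<forall>y\<in>e. k \<bullet> (x - y) = 0) \<and> (\<forall>x\<in>T. \<forall>y\<in>e. k \<bullet> (x - y) \<le> 0)"
    then obtain s where s: "k = s *\<^sub>R n" using par by blast
    then have "\<bar>s\<bar> = 1" using k n1 by simp
    moreover have "s * (n \<bullet> (u - x0)) \<le> 0"
    proof -
      have "u \<in> T" using u(1) C(2) hull_inc by metis
      then have "k \<bullet> (u - x0) \<le> 0" using k x0e by blast
      then show ?thesis by (simp add: s)
    qed
    moreover have "n \<bullet> (u - x0) > 0" using N u(1) by (simp add: nb bary_vertex)
    ultimately have "s = - 1" by (simp add: mult_le_0_iff abs_if split: if_splits)
    then show "k = - n" using s by simp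
  qed
  have "inner_normal T e n"
    unfolding inner_normal_def using n1 x0e ne nT half par ext_n by (simp add: x0_def)
  then show ?thesis by (rule that)
qed


lemma simplex_inball_pos: "int DIM('a) simplex (T::'a::euclidean_space set) \<Longrightarrow> inball_diameter T > 0"
  by (erule simplex_vertices) (simp add: full_simplex.inball_diameter_pos)

lemma simplex_interior_nonempty: "int DIM('a) simplex (T::'a::euclidean_space set) \<Longrightarrow> interior T \<noteq> {}"
  by (erule simplex_vertices) (simp add: full_simplex.interior_nonempty)

lemma simplex_compact: "n simplex (T::'a::euclidean_space set) \<Longrightarrow> compact T"
  by (auto simp: simplex_def intro!: finite_imp_compact_convex_hull aff_independent_finite)

lemma simplex_ex_inball:
  fixes T :: "'a::euclidean_space set"
  assumes "int DIM('a) simplex T"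
  obtains p where "cball p (inball_diameter T / 4) \<subseteq> T"
proof -
  obtain C where C: "full_simplex C" "T = convex hull C" by (rule simplex_vertices[OF assms])
  show ?thesis using full_simplex.ex_inball[OF C(1)] that C(2) by blast
qed

lemma facet_of_simplex:
  fixes T :: "'a::euclidean_space set"
  assumes "int DIM('a) simplex T"
  obtains C where "full_simplex C" "T = convex hull C"
    "\<And>e. e facet_of T \<longleftrightarrow> e \<noteq> {} \<and> (\<exists>u\<in>C. e = convex hull (C - {u}))"
proof -
  obtain C where C: "full_simplex C" "T = convex hull C" by (rule simplex_vertices[OF assms])
  show ?thesis
    using facet_of_convex_hull_affine_independent[OF full_simplex.independent[OF C(1)]] C by (intro that) auto
qed

lemma facet_compact:
  fixes T :: "'a::euclidean_space set"
  assumes "int DIM('a) simplex T" "e facet_of T" shows "compact e" "convex e" "e \<noteq> {}"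
proof -
  obtain C where C: "full_simplex C" "T = convex hull C"
    "\<And>e. e facet_of T \<longleftrightarrow> e \<noteq> {} \<and> (\<exists>u\<in>C. e = convex hull (C - {u}))"
    by (rule facet_of_simplex[OF assms(1)]) blast
  then obtain u where "e = convex hull (C - {u})" "e \<noteq> {}" using assms(2) by blast
  then show "compact e" "convex e" "e \<noteq> {}"
    using full_simplex.finite_C[OF C(1)] by (auto intro: finite_imp_compact_convex_hull)
qed

text \<open>A facet has \<open>DIM('a)\<close> vertices, so in dimension two or more it contains an
  edge.\<close>

lemma inball_le_diameter_facet:
  fixes T :: "'a::euclidean_space set"
  assumes T: "int DIM('a) simplex T" "e facet_of T" and dim: "DIM('a) \<ge> 2"
  shows "inball_diameter T \<le> diameter e"
proof -
  obtain C where C: "full_simplex C" "T = convex hull C"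
    "\<And>e. e facet_of T \<longleftrightarrow> e \<noteq> {} \<and> (\<exists>u\<in>C. e = convex hull (C - {u}))"
    by (rule facet_of_simplex[OF assms(1)]) blast
  then obtain u where u: "u \<in> C" "e = convex hull (C - {u})" using T(2) by blast
  have "card (C - {u}) \<ge> 2"
    using full_simplex.card_C[OF C(1)] full_simplex.finite_C[OF C(1)] u(1) dim by simp
  then obtain v w where vw: "v \<in> C - {u}" "w \<in> C - {u}" "v \<noteq> w"
    using card_le_Suc0_iff_eq[of "C - {u}"] full_simplex.finite_C[OF C(1)] by auto
  then have "v \<in> e" "w \<in> e" unfolding u(2) by (auto intro: hull_inc)
  then have "dist v w \<le> diameter e"
    using facet_compact[OF T] by (intro diameter_bounded_bound compact_imp_bounded)
  with full_simplex.inball_le_edge[OF C(1)] vw C(2) show ?thesis by fastforce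
qed

lemma finite_card_facets:
  fixes T :: "'a::euclidean_space set"
  assumes "int DIM('a) simplex T"
  shows "finite {e. e facet_of T}" "card {e. e facet_of T} \<le> Suc DIM('a)"
proof -
  obtain C where C: "full_simplex C" "T = convex hull C"
    "\<And>e. e facet_of T \<longleftrightarrow> e \<noteq> {} \<and> (\<exists>u\<in>C. e = convex hull (C - {u}))"
    by (rule facet_of_simplex[OF assms(1)]) blast
  have sub: "{e. e facet_of T} \<subseteq> (\<lambda>u. convex hull (C - {u})) ` C" using C(3) by auto
  have fin: "finite C" by (rule full_simplex.finite_C[OF C(1)])
  then show "finite {e. e facet_of T}" using sub finite_subset by blast
  have "card {e. e facet_of T} \<le> card C"
    using card_mono[OF _ sub] card_image_le[OF fin, of "\<lambda>u. convex hull (C - {u})"] fin by fastforce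
  then show "card {e. e facet_of T} \<le> Suc DIM('a)" using full_simplex.card_C[OF C(1)] by simp
qed

lemma element_grad_eq:
  fixes T :: "'a::euclidean_space set"
  assumes T: "interior T \<noteq> {}" and v: "\<forall>x\<in>T. v x = g \<bullet> x + c"
  shows "element_grad T v = g"
  unfolding element_grad_def
proof (rule the_equality)
  show "\<exists>c. \<forall>x\<in>T. v x = g \<bullet> x + c" using v by blast
next
  fix g' assume "\<exists>c. \<forall>x\<in>T. v x = g' \<bullet> x + c"
  then obtain c' where c': "\<forall>x\<in>T. v x = g' \<bullet> x + c'" by blast
  obtain p \<epsilon> where p: "\<epsilon> > 0" "cball p \<epsilon> \<subseteq> T" using T mem_interior_cball by blast
  define z where "z = g' - g"
  show "g' = g"
  proof (rule ccontr)
    assume "g' \<noteq> g"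
    then have z: "norm z > 0" by (simp add: z_def)
    define x where "x = p + (\<epsilon> / norm z) *\<^sub>R z"
    have "x \<in> T" "p \<in> T" using p z by (auto simp: x_def dist_norm subset_iff)
    then have "g' \<bullet> x + c' = g \<bullet> x + c" "g' \<bullet> p + c' = g \<bullet> p + c" using v c' by metis+
    then have "z \<bullet> (x - p) = 0" by (simp add: z_def inner_diff_left inner_diff_right)
    then have "\<epsilon> * norm z = 0" using z by (simp add: x_def power2_norm_eq_inner[symmetric] power2_eq_square)
    then show False using p z by simp
  qed
qed


subsection \<open>Meshes\<close>

text \<open>The intersection is a face of either simplex, and a face that meets the relative
  interior is the whole simplex.\<close>

lemma triangulation_eq_if_overlap:
  assumes "triangulation \<T>" "T \<in> \<T>" "T' \<in> \<T>" and V: "open V" "V \<noteq> {}" "V \<subseteq> T \<inter> T'"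
  shows "T = T'"
proof -
  have *: "S \<subseteq> S'" if "S \<in> \<T>" "S' \<in> \<T>" "V \<subseteq> S \<inter> S'" for S S'
  proof -
    have f: "S \<inter> S' face_of S" using assms(1) that by (auto simp: triangulation_def)
    have "V \<subseteq> rel_interior S"
      using V(1) that(3) interior_maximal[of V S] interior_subset_rel_interior[of S] by auto
    then have "(S \<inter> S') \<inter> rel_interior S \<noteq> {}" using V(2) that(3) by auto
    then have "S \<subseteq> S \<inter> S'" by (rule subset_of_face_of[OF f order_refl])
    then show ?thesis by blast
  qed
  show ?thesis
  proof
    show "T \<subseteq> T'" by (rule *[OF assms(2,3) V(3)])
    show "T' \<subseteq> T" by (rule *[OF assms(3,2)]) (use V(3) in blast)
  qed
qed

lemma inner_normal_cases:
  assumes n: "inner_normal T e n" and n': "inner_normal T' e n'"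
  shows "n' = n \<or> n' = - n"
proof -
  have "n' \<bullet> (x - y) = 0" if "x \<in> e" "y \<in> e" for x y
    using inner_normalD(4)[OF n', of x] inner_normalD(4)[OF n', of y] that by (simp add: inner_diff_right)
  then obtain s where "n' = s *\<^sub>R n" using inner_normalD(6)[OF n] by blast
  moreover have "norm n = 1" "norm n' = 1" by (simp_all add: inner_normalD(1)[OF n] inner_normalD(1)[OF n'])
  ultimately have "\<bar>s\<bar> = 1" by simp
  then have "s = 1 \<or> s = - 1" by linarith
  then show ?thesis using \<open>n' = s *\<^sub>R n\<close> by auto
qed

text \<open>Both simplices contain a half ball around the center of \<open>e\<close> on the same
  side of the hyperplane, so they overlap in an open set.\<close>

lemma same_inner_normal_imp_eq:
  fixes T T' :: "'a::euclidean_space set"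
  assumes tri: "triangulation \<T>" "T \<in> \<T>" "T' \<in> \<T>"
    and simplex: "int DIM('a) simplex T" "int DIM('a) simplex T'"
    and n: "inner_normal T e n" "inner_normal T' e n"
  shows "T = T'"
proof (rule triangulation_eq_if_overlap[OF tri])
  let ?x0 = "facet_center e"
  define R where "R = min (inball_diameter T) (inball_diameter T') / DIM('a)"
  have d: "real DIM('a) > 0" using DIM_positive[where 'a='a] by simp
  have R: "R > 0" using simplex_inball_pos[OF simplex(1)] simplex_inball_pos[OF simplex(2)] d by (simp add: R_def)
  have RT: "R \<le> inball_diameter T / DIM('a)" "R \<le> inball_diameter T' / DIM('a)"
    unfolding R_def using d by (auto intro!: divide_right_mono)
  let ?O = "ball ?x0 R \<inter> {x. n \<bullet> ?x0 < n \<bullet> x}"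
  show "open ?O" by (intro open_Int open_ball open_halfspace_gt)
  have "?x0 + (R / 2) *\<^sub>R n \<in> ?O"
    using R inner_normalD(1,2)[OF n(1)] by (simp add: inner_add_right dist_norm)
  then show "?O \<noteq> {}" by blast
  show "?O \<subseteq> T \<inter> T'"
  proof
    fix x assume "x \<in> ?O"
    then have x: "norm (x - ?x0) \<le> R" "n \<bullet> (x - ?x0) \<ge> 0"
      by (auto simp: dist_norm norm_minus_commute inner_diff_right)
    then show "x \<in> T \<inter> T'" using inner_normalD(5)[OF n(1)] inner_normalD(5)[OF n(2)] RT by (meson IntI order_trans)
  qed
qed

lemma conforming_mesh_simplex: "conforming_mesh \<Omega> \<T> \<Longrightarrow> T \<in> \<T> \<Longrightarrow> int DIM('a) simplex (T::'a::euclidean_space set)"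
  by (simp add: conforming_mesh_def)

text \<open>Inner normals at \<open>e\<close> agree up to sign, and elements with equal ones
  coincide. Hence exactly two elements meet at an internal side, from opposite sides, and the sum in
  \<open>normal_jump\<close> has two summands.\<close>

lemma side_neighbour:
  fixes \<Omega> :: "'a::euclidean_space set"
  assumes mesh: "conforming_mesh \<Omega> \<T>" and T: "T \<in> \<T>" and e: "e \<in> sides_of \<T> T"
  obtains T' n where "T' \<in> \<T>" "T' \<noteq> T" "e facet_of T" "e facet_of T'" "T' \<in> neighbours \<T> T"
    "inner_normal T e n" "inner_normal T' e (- n)"
    "{S \<in> \<T>. e facet_of S} = {T, T'}"
proof -
  have tri: "triangulation \<T>" using mesh by (simp add: conforming_mesh_def)
  have eT: "e facet_of T" "e \<in> sides \<T>" using e by (auto simp: sides_of_def)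
  then obtain T1 T2 where T12: "T1 \<in> \<T>" "T2 \<in> \<T>" "T1 \<noteq> T2" "e facet_of T1" "e facet_of T2"
    by (auto simp: sides_def)
  obtain T' where T': "T' \<in> \<T>" "T' \<noteq> T" "e facet_of T'" using T12 by metis
  note sx = conforming_mesh_simplex[OF mesh]
  obtain n where n: "inner_normal T e n" by (rule inner_normal_exists[OF sx[OF T] eT(1)])
  have opp: "inner_normal S e (- n)" if S: "S \<in> \<T>" "S \<noteq> T" "e facet_of S" for S
  proof -
    obtain k where k: "inner_normal S e k" by (rule inner_normal_exists[OF sx[OF S(1)] S(3)])
    then show ?thesis
      using inner_normal_cases[OF n k] same_inner_normal_imp_eq[OF tri S(1) T sx[OF S(1)] sx[OF T] _ n] S(2) by auto
  qed
  have "S = T'" if S: "S \<in> \<T>" "S \<noteq> T" "e facet_of S" for S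
    using same_inner_normal_imp_eq[OF tri S(1) T'(1) sx[OF S(1)] sx[OF T'(1)] opp[OF S] opp[OF T']] .
  then have "{S \<in> \<T>. e facet_of S} = {T, T'}" using T T' eT by blast
  moreover have "T' \<in> neighbours \<T> T"
    using T' e eT by (auto simp: neighbours_def sides_of_def)
  ultimately show ?thesis using that T' eT n opp by blast
qed

lemma neighbour_common_facet:
  assumes "T' \<in> neighbours \<T> T" "T' \<noteq> T"
  obtains e where "e facet_of T" "e facet_of T'"
  using assms by (auto simp: neighbours_def sides_of_def)

lemma neighbours_subset: "T \<in> \<T> \<Longrightarrow> neighbours \<T> T \<subseteq> \<T>"
  by (auto simp: neighbours_def)

lemma simplex_diameter_pos:
  fixes T :: "'a::euclidean_space set"
  assumes "int DIM('a) simplex T" shows "diameter T > 0"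
proof -
  obtain p where p: "cball p (inball_diameter T / 4) \<subseteq> T" by (rule simplex_ex_inball[OF assms])
  have r: "inball_diameter T > 0" by (rule simplex_inball_pos[OF assms])
  have "diameter (cball p (inball_diameter T / 4)) \<le> diameter T"
    using p compact_imp_bounded[OF simplex_compact[OF assms]] by (rule diameter_subset)
  then show ?thesis using r by (simp add: diameter_cball split: if_splits)
qed

text \<open>The radius, relative to the diameter of the element, of balls inside the elements of its
  patch and around the centers of its sides.\<close>

definition mesh_ratio :: "'a::euclidean_space itself \<Rightarrow> real \<Rightarrow> real" where
  "mesh_ratio _ \<sigma> = 1 / (8 * real DIM('a) * \<sigma>\<^sup>2)"

section \<open>Geometry of patches in a shape regular mesh\<close>

locale regular_mesh =
  fixes \<Omega> :: "'a::euclidean_space set" and \<T> :: "'a set set" and \<sigma> :: real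
  assumes open_mesh_domain: "open \<Omega>" and convex_mesh_domain: "convex \<Omega>"
    and mesh: "conforming_mesh \<Omega> \<T>" and regular: "shape_regular \<sigma> \<T>" and \<sigma>: "\<sigma> \<ge> 1"
    and dim2: "DIM('a) \<ge> 2"
begin

lemma ball_ratio_pos: "mesh_ratio TYPE('a) \<sigma> > 0"
  using \<sigma> dim2 by (simp add: mesh_ratio_def)

lemmas element_simplex = conforming_mesh_simplex[OF mesh]

lemma element_subset: "T \<in> \<T> \<Longrightarrow> T \<subseteq> closure \<Omega>"
  using mesh by (auto simp: conforming_mesh_def)

lemma diameter_le_inball: "T \<in> \<T> \<Longrightarrow> diameter T \<le> \<sigma> * inball_diameter T"
  using regular by (simp add: shape_regular_def)

lemma element_bounded: "T \<in> \<T> \<Longrightarrow> bounded T"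
  by (intro compact_imp_bounded simplex_compact[OF element_simplex])

text \<open>The common facet mediates: its diameter is at least the inball diameter of
  \<open>T'\<close> and at most the diameter of \<open>T\<close>.\<close>

lemma diameter_neighbour:
  assumes "T \<in> \<T>" "T' \<in> \<T>" "e facet_of T" "e facet_of T'"
  shows "diameter T' \<le> \<sigma> * diameter T"
proof -
  have "diameter T' \<le> \<sigma> * inball_diameter T'" by (rule diameter_le_inball[OF assms(2)])
  also have "\<dots> \<le> \<sigma> * diameter e"
    using \<sigma> by (intro mult_left_mono inball_le_diameter_facet[OF element_simplex[OF assms(2)] assms(4) dim2]) auto
  also have "diameter e \<le> diameter T"
    using assms(3) by (intro diameter_subset element_bounded[OF assms(1)] facet_of_imp_subset)
  then have "\<sigma> * diameter e \<le> \<sigma> * diameter T" using \<sigma> by (intro mult_left_mono) auto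
  finally show ?thesis .
qed

lemma inball_neighbour:
  assumes "T \<in> \<T>" "T' \<in> \<T>" "e facet_of T" "e facet_of T'"
  shows "diameter T \<le> \<sigma>\<^sup>2 * inball_diameter T'"
proof -
  have "diameter T \<le> \<sigma> * diameter T'" using diameter_neighbour[of T' T e] assms by simp
  also have "\<dots> \<le> \<sigma> * (\<sigma> * inball_diameter T')" using \<sigma> diameter_le_inball[OF assms(2)] by (intro mult_left_mono) auto
  finally show ?thesis by (simp add: power2_eq_square)
qed

lemma inball_self:
  assumes "T \<in> \<T>" shows "diameter T \<le> \<sigma>\<^sup>2 * inball_diameter T"
proof -
  have "\<sigma> * inball_diameter T \<le> \<sigma>\<^sup>2 * inball_diameter T"
    using \<sigma> simplex_inball_pos[OF element_simplex[OF assms]] by (intro mult_right_mono) (auto simp: power2_eq_square)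
  then show ?thesis using diameter_le_inball[OF assms] by simp
qed

lemma patch_diameter:
  assumes "T \<in> \<T>" "T' \<in> neighbours \<T> T" shows "diameter T' \<le> \<sigma> * diameter T"
proof (cases "T' = T")
  case True
  have "diameter T \<ge> 0" by (intro diameter_ge_0 element_bounded assms)
  then show ?thesis using True mult_right_mono[OF \<sigma>, of "diameter T"] by simp
next
  case False
  then show ?thesis
    using neighbour_common_facet[OF assms(2)] diameter_neighbour assms neighbours_subset[OF assms(1)] by (metis subsetD)
qed

lemma patch_inball:
  assumes "T \<in> \<T>" "T' \<in> neighbours \<T> T" shows "diameter T \<le> \<sigma>\<^sup>2 * inball_diameter T'"
proof (cases "T' = T")
  case True
  then show ?thesis using inball_self[OF assms(1)] by simp
next
  case False
  then show ?thesis
    using neighbour_common_facet[OF assms(2)] inball_neighbour assms neighbours_subset[OF assms(1)] by (metis subsetD)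
qed

text \<open>A convex open set is the interior of its closure. Elements are known to lie only in the
  closure, so some room, \<open>r < s\<close>, is spent to get the closed ball into
  \<Omega>.\<close>

lemma ball_in_domain:
  assumes "ball p s \<subseteq> closure \<Omega>" "r < s" shows "cball p r \<subseteq> \<Omega>"
proof -
  have "ball p s \<subseteq> interior (closure \<Omega>)" using assms(1) by (intro interior_maximal) auto
  then have "ball p s \<subseteq> \<Omega>"
    using open_mesh_domain convex_mesh_domain by (simp add: convex_interior_closure interior_open)
  then show ?thesis using assms(2) by auto
qed

lemma element_ball:
  assumes T: "T \<in> \<T>" "T' \<in> neighbours \<T> T"
  obtains p where "cball p (mesh_ratio TYPE('a) \<sigma> * diameter T) \<subseteq> T'" "cball p (mesh_ratio TYPE('a) \<sigma> * diameter T) \<subseteq> \<Omega>"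
proof -
  have T': "T' \<in> \<T>" using neighbours_subset T by blast
  obtain p where p: "cball p (inball_diameter T' / 4) \<subseteq> T'" by (rule simplex_ex_inball[OF element_simplex[OF T']])
  have pos: "inball_diameter T' > 0" by (rule simplex_inball_pos[OF element_simplex[OF T']])
  have "mesh_ratio TYPE('a) \<sigma> * diameter T \<le> mesh_ratio TYPE('a) \<sigma> * (\<sigma>\<^sup>2 * inball_diameter T')"
    using ball_ratio_pos patch_inball[OF T] by (intro mult_left_mono) auto
  also have "\<dots> = inball_diameter T' / (8 * DIM('a))" using \<sigma> by (simp add: mesh_ratio_def)
  \<comment> \<open>The factor \<open>8 * d\<close> in the ratio serves sides and elements at once;
    here 8 in place of 4 leaves the strict inequality that \<open>ball_in_domain\<close> asks
    for.\<close>
  also have "\<dots> \<le> inball_diameter T' / 8" using pos dim2 by (intro divide_left_mono) auto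
  also have "\<dots> < inball_diameter T' / 4" using pos by simp
  finally have less: "mesh_ratio TYPE('a) \<sigma> * diameter T < inball_diameter T' / 4" .
  have "cball p (mesh_ratio TYPE('a) \<sigma> * diameter T) \<subseteq> T'" using p less subset_cball[of "mesh_ratio TYPE('a) \<sigma> * diameter T"] by (meson less_imp_le order_trans)
  moreover have "ball p (inball_diameter T' / 4) \<subseteq> closure \<Omega>"
    using p element_subset[OF T'] ball_subset_cball by blast
  then have "cball p (mesh_ratio TYPE('a) \<sigma> * diameter T) \<subseteq> \<Omega>" using less by (rule ball_in_domain)
  ultimately show ?thesis by (rule that)
qed

text \<open>The radius is small enough that even the ball of radius \<open>2 * r\<close> is made of
  the half balls of the two inner normals; the spare factor 2 places the closed ball of radius
  \<open>r\<close> inside \<Omega>.\<close>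

lemma facet_ball:
  assumes T: "T \<in> \<T>" "T' \<in> \<T>" "e facet_of T" "e facet_of T'"
    and n: "inner_normal T e n" "inner_normal T' e (- n)"
  defines "x0 \<equiv> facet_center e" and "r \<equiv> mesh_ratio TYPE('a) \<sigma> * diameter T"
  shows "\<And>x. x \<in> cball x0 r \<Longrightarrow> n \<bullet> (x - x0) \<ge> 0 \<Longrightarrow> x \<in> T"
    and "\<And>x. x \<in> cball x0 r \<Longrightarrow> n \<bullet> (x - x0) \<le> 0 \<Longrightarrow> x \<in> T'"
    and "cball x0 r \<subseteq> \<Omega>" and "cball x0 r \<subseteq> T \<union> T'"
proof -
  let ?d = "real DIM('a)"
  have d: "?d > 0" using dim2 by simp
  have D: "diameter T > 0" by (rule simplex_diameter_pos[OF element_simplex[OF T(1)]])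
  have "2 * r = diameter T / \<sigma>\<^sup>2 / (4 * ?d)" by (simp add: r_def mesh_ratio_def field_simps)
  have aux: "2 * r \<le> inball_diameter S / ?d" if "diameter T \<le> \<sigma>\<^sup>2 * inball_diameter S" for S :: "'a set"
  proof -
    have "diameter T / \<sigma>\<^sup>2 \<le> inball_diameter S" using that \<sigma> by (simp add: divide_le_eq mult.commute)
    then have "diameter T / \<sigma>\<^sup>2 / ?d \<le> inball_diameter S / ?d" using d by (intro divide_right_mono) auto
    moreover have "diameter T / \<sigma>\<^sup>2 / (4 * ?d) \<le> diameter T / \<sigma>\<^sup>2 / ?d" using D d \<sigma> by (intro divide_left_mono) auto
    ultimately show ?thesis unfolding \<open>2 * r = diameter T / \<sigma>\<^sup>2 / (4 * ?d)\<close> by (rule order_trans[rotated])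
  qed
  have r1: "2 * r \<le> inball_diameter T / ?d" by (rule aux[OF inball_self[OF T(1)]])
  have r2: "2 * r \<le> inball_diameter T' / ?d" by (rule aux[OF inball_neighbour[OF T]])
  have r: "r > 0" using ball_ratio_pos D by (simp add: r_def)
  have 1: "x \<in> T" if "norm (x - x0) \<le> 2 * r" "n \<bullet> (x - x0) \<ge> 0" for x
    using inner_normalD(5)[OF n(1), of x] that r1 unfolding x0_def by linarith
  have 2: "x \<in> T'" if "norm (x - x0) \<le> 2 * r" "n \<bullet> (x - x0) \<le> 0" for x
  proof -
    have "norm (x - x0) \<le> inball_diameter T' / ?d" "- n \<bullet> (x - x0) \<ge> 0" using that r2 by auto
    then show ?thesis using inner_normalD(5)[OF n(2), of x] unfolding x0_def by blast
  qed
  have 3: "x \<in> T \<union> T'" if "norm (x - x0) \<le> 2 * r" for x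
    using 1[OF that] 2[OF that] by (cases "n \<bullet> (x - x0) \<ge> 0") auto
  show "x \<in> T" if "x \<in> cball x0 r" "n \<bullet> (x - x0) \<ge> 0" for x
    using that r by (intro 1) (auto simp: dist_norm norm_minus_commute)
  show "x \<in> T'" if "x \<in> cball x0 r" "n \<bullet> (x - x0) \<le> 0" for x
    using that r by (intro 2) (auto simp: dist_norm norm_minus_commute)
  show "cball x0 r \<subseteq> T \<union> T'"
  proof
    fix x assume "x \<in> cball x0 r"
    then show "x \<in> T \<union> T'" using r by (intro 3) (auto simp: dist_norm norm_minus_commute)
  qed
  have "ball x0 (2 * r) \<subseteq> T \<union> T'"
  proof
    fix x assume "x \<in> ball x0 (2 * r)"
    then show "x \<in> T \<union> T'" by (intro 3) (auto simp: dist_norm norm_minus_commute)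
  qed
  then have "ball x0 (2 * r) \<subseteq> closure \<Omega>" using element_subset T by blast
  then show "cball x0 r \<subseteq> \<Omega>" using r by (intro ball_in_domain) auto
qed

text \<open>The two affine pieces agree on \<open>e\<close>, so their gradients differ by a multiple
  of \<open>n\<close>, and this multiple is the normal jump. The result is the form for which
  pairing with the Laplacian of a bump is understood: an affine function minus a kink that is active
  in \<open>T'\<close>.\<close>

lemma piecewise_affine_across_side:
  assumes T: "T \<in> \<T>" "T' \<in> \<T>" "T' \<noteq> T" "e facet_of T" "e facet_of T'" "{S \<in> \<T>. e facet_of S} = {T, T'}"
    and n: "inner_normal T e n" "inner_normal T' e (- n)"
    and z: "\<forall>x\<in>T. z x = G \<bullet> x + c" "\<forall>x\<in>T'. z x = G' \<bullet> x + c'"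
    and x: "x \<in> cball (facet_center e) (mesh_ratio TYPE('a) \<sigma> * diameter T)"
  shows "z x = G \<bullet> x + c - normal_jump \<T> z e * max 0 (- n \<bullet> (x - facet_center e))"
proof -
  let ?x0 = "facet_center e"
  have e: "e \<subseteq> T" "e \<subseteq> T'" by (rule facet_of_imp_subset[OF T(4)], rule facet_of_imp_subset[OF T(5)])
  have eq: "(G' - G) \<bullet> x + (c' - c) = 0" if "x \<in> e" for x
  proof -
    have "x \<in> T" "x \<in> T'" using that e by auto
    then have "z x = G \<bullet> x + c" "z x = G' \<bullet> x + c'" using z by blast+
    then show ?thesis by (simp add: inner_diff_left)
  qed
  have "(G' - G) \<bullet> (x - y) = 0" if "x \<in> e" "y \<in> e" for x y
    using eq[OF that(1)] eq[OF that(2)] unfolding inner_diff_right by linarith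
  then obtain s where s: "G' - G = s *\<^sub>R n" using inner_normalD(6)[OF n(1)] by blast
  have "n \<bullet> n = 1" by (rule inner_normalD(2)[OF n(1)])
  have "element_grad T z = G" "element_grad T' z = G'"
    using z simplex_interior_nonempty[OF element_simplex] T by (auto intro: element_grad_eq)
  then have "normal_jump \<T> z e = (- n) \<bullet> G + n \<bullet> G'"
    using T(3) inner_normalD(7)[OF n(1)] inner_normalD(7)[OF n(2)] by (simp add: normal_jump_def T(6))
  also have "\<dots> = n \<bullet> (G' - G)" by (simp add: inner_diff_right)
  finally have J: "normal_jump \<T> z e = s" using \<open>n \<bullet> n = 1\<close> by (simp add: s)
  have "(G' - G) \<bullet> ?x0 + (c' - c) = 0" by (rule eq[OF inner_normalD(3)[OF n(1)]])
  then have diff: "G' \<bullet> x + c' = G \<bullet> x + c + s * (n \<bullet> (x - ?x0))"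
    using arg_cong[OF s, of "\<lambda>v. v \<bullet> (x - ?x0)"] by (simp add: inner_diff_left inner_diff_right algebra_simps)
  show ?thesis
  proof (cases "n \<bullet> (x - ?x0) \<ge> 0")
    case True
    then have "x \<in> T" using facet_ball(1)[OF T(1,2,4,5) n] x by blast
    then show ?thesis using z(1) True by simp
  next
    case False
    then have "x \<in> T'" using facet_ball(2)[OF T(1,2,4,5) n] x by simp
    then show ?thesis using z(2) False diff J by (simp add: max_def)
  qed
qed

end


subsection \<open>Bump functions\<close>

definition std_bump :: "'a::euclidean_space \<Rightarrow> real" where
  "std_bump z = flat 0 (1 - (norm z)\<^sup>2)"

definition rescale :: "'a::euclidean_space \<Rightarrow> real \<Rightarrow> ('a \<Rightarrow> real) \<Rightarrow> 'a \<Rightarrow> real" where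
  "rescale x0 r \<psi> x = \<psi> ((x - x0) /\<^sub>R r)"

definition profiles :: "('a::euclidean_space \<Rightarrow> real) set" where
  "profiles = insert std_bump ((\<lambda>i. partial i std_bump) ` Basis)"

lemma std_bump_profile: "std_bump \<in> profiles"
  by (simp add: profiles_def)

lemma std_bump_support: "z \<notin> cball 0 1 \<Longrightarrow> std_bump z = 0"
proof -
  assume "z \<notin> cball 0 1"
  then have "1 < norm z" by simp
  then have "1 < (norm z)\<^sup>2" by (simp add: one_less_power)
  then show "std_bump z = 0" by (simp add: std_bump_def flat_def)
qed

lemma std_bump_test: "std_bump \<in> test_functions (UNIV::'a::euclidean_space set)"
proof (rule test_functionsI[of _ "cball 0 1"])
  show "C_k k (std_bump :: 'a \<Rightarrow> real)" for k
  proof -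
    have "C_k k (\<lambda>x::'a. flat 0 (1 - (norm (x - 0))\<^sup>2))"
      by (intro C_k_flat C_k_diff C_k_const C_k_sq_norm)
    moreover have "(\<lambda>x::'a. flat 0 (1 - (norm (x - 0))\<^sup>2)) = std_bump" by (simp add: std_bump_def fun_eq_iff)
    ultimately show ?thesis by simp
  qed
qed (auto intro: std_bump_support)

text \<open>Explicit, since the kink estimate relies on the sign: the bump decreases
  radially.\<close>

lemma std_bump_partial:
  "partial v std_bump z = - (2 * flat 2 (1 - (norm z)\<^sup>2) * (z \<bullet> v))"
proof -
  have bump: "std_bump = (\<lambda>z::'a. flat 0 (1 - z \<bullet> z))"
    by (simp add: fun_eq_iff std_bump_def power2_norm_eq_inner)
  have "((\<lambda>z::'a. 1 - z \<bullet> z) has_derivative (\<lambda>h. - (2 * (z \<bullet> h)))) (at z)"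
    by (auto intro!: derivative_eq_intros simp: inner_commute)
  from has_derivative_compose[OF this has_field_derivative_imp_has_derivative[OF flat_has_real_derivative[of 0]]]
  have "(std_bump has_derivative (\<lambda>h. flat 2 (1 - z \<bullet> z) * (- (2 * (z \<bullet> h))))) (at z)"
    unfolding bump by (simp add: numeral_2_eq_2)
  from frechet_derivative_at[OF this, symmetric] show ?thesis by (simp add: power2_norm_eq_inner)
qed

lemma profiles_test: "\<psi> \<in> profiles \<Longrightarrow> \<psi> \<in> test_functions UNIV"
  unfolding profiles_def using std_bump_test test_functions_partial[OF std_bump_test] by auto

lemma profiles_support:
  assumes "\<psi> \<in> profiles" "z \<notin> cball 0 1" shows "\<psi> z = 0"
proof -
  have "open (- cball (0::'a) 1)" by (simp add: open_Compl)
  from frechet_derivative_eq_0[OF this, of z std_bump] assms(2)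
  have "partial i std_bump z = 0" for i by (simp add: std_bump_support)
  then show ?thesis using assms std_bump_support[OF assms(2)] by (auto simp: profiles_def)
qed

lemma finite_profiles: "finite profiles"
  by (simp add: profiles_def)

definition bump_bound :: "'a::euclidean_space itself \<Rightarrow> real \<Rightarrow> bool" where
  "bump_bound _ m \<longleftrightarrow> m > 0 \<and> (\<forall>\<psi>\<in>(profiles::('a \<Rightarrow> real) set). \<forall>z. \<bar>\<psi> z\<bar> \<le> m \<and> \<bar>laplacian \<psi> z\<bar> \<le> m)"

lemma ex_bump_bound: "\<exists>m. bump_bound TYPE('a::euclidean_space) m"
proof -
  have "\<exists>m>0. \<forall>z. \<bar>\<psi> z\<bar> \<le> m \<and> \<bar>laplacian \<psi> z\<bar> \<le> m" if \<psi>: "\<psi> \<in> (profiles::('a \<Rightarrow> real) set)" for \<psi>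
  proof -
    note t = profiles_test[OF \<psi>]
    obtain m1 where m1: "m1 > 0" "\<And>z. \<bar>\<psi> z\<bar> \<le> m1" by (rule test_functions_bounded[OF t]) blast
    have "bounded (laplacian \<psi> ` cball 0 1)"
      by (intro compact_imp_bounded compact_continuous_image continuous_on_subset[OF laplacian_continuous[OF t]]) auto
    then obtain m2 where m2: "m2 > 0" "\<And>z. z \<in> cball 0 1 \<Longrightarrow> \<bar>laplacian \<psi> z\<bar> \<le> m2"
      unfolding bounded_pos by auto
    have "\<bar>laplacian \<psi> z\<bar> \<le> m2" for z
      using m2 laplacian_eq_0[of 0 1 \<psi> z] profiles_support[OF \<psi>] by (cases "z \<in> cball 0 1") auto
    then show ?thesis using m1 m2(1) by (intro exI[of _ "max m1 m2"]) (auto simp: le_max_iff_disj)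
  qed
  then obtain m where m: "\<And>\<psi>. \<psi> \<in> (profiles::('a \<Rightarrow> real) set) \<Longrightarrow> m \<psi> > 0 \<and> (\<forall>z. \<bar>\<psi> z\<bar> \<le> m \<psi> \<and> \<bar>laplacian \<psi> z\<bar> \<le> m \<psi>)"
    by metis
  have "bump_bound TYPE('a) (\<Sum>\<psi>\<in>profiles. m (\<psi> :: 'a \<Rightarrow> real))"
    unfolding bump_bound_def
  proof (intro conjI ballI allI)
    show "0 < (\<Sum>\<psi>\<in>profiles. m (\<psi> :: 'a \<Rightarrow> real))"
      using m finite_profiles by (intro sum_pos) (auto simp: profiles_def)
    fix \<psi> :: "'a \<Rightarrow> real" and z assume \<psi>: "\<psi> \<in> profiles"
    have "m \<psi> \<le> (\<Sum>\<psi>\<in>profiles. m (\<psi> :: 'a \<Rightarrow> real))"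
      using m finite_profiles \<psi> by (intro member_le_sum) (auto intro: less_imp_le)
    then show "\<bar>\<psi> z\<bar> \<le> (\<Sum>\<psi>\<in>profiles. m (\<psi> :: 'a \<Rightarrow> real))" "\<bar>laplacian \<psi> z\<bar> \<le> (\<Sum>\<psi>\<in>profiles. m (\<psi> :: 'a \<Rightarrow> real))"
      using m[OF \<psi>] order_trans by blast+
  qed
  then show ?thesis by blast
qed

lemma norm_rescale: "r > 0 \<Longrightarrow> norm ((x - x0) /\<^sub>R r) = norm (x - x0) / r"
  by (simp add: divide_inverse_commute)

lemma rescale_support:
  assumes "\<psi> \<in> profiles" "r > 0" "x \<notin> cball x0 r" shows "rescale x0 r \<psi> x = 0"
proof -
  have "norm (x - x0) > r" using assms(3) by (simp add: dist_norm norm_minus_commute)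
  then have "(x - x0) /\<^sub>R r \<notin> cball 0 1" using assms(2) norm_rescale[OF assms(2), of x x0] by (simp del: norm_scaleR)
  then show ?thesis using profiles_support[OF assms(1)] by (simp add: rescale_def)
qed

lemma rescale_test:
  assumes "\<psi> \<in> profiles" "r > 0" "cball x0 r \<subseteq> \<Omega>" shows "rescale x0 r \<psi> \<in> test_functions \<Omega>"
proof (rule test_functionsI[of _ "cball x0 r"])
  show "C_k k (rescale x0 r \<psi>)" for k
    unfolding rescale_def[abs_def] by (rule C_k_rescale[OF test_functions_C_k[OF profiles_test[OF assms(1)]]])
qed (use assms rescale_support in auto)

lemma rescale_partial:
  assumes "\<psi> \<in> test_functions \<Omega>"
  shows "partial v (rescale x0 r \<psi>) = (\<lambda>x. inverse r * rescale x0 r (partial v \<psi>) x)"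
proof
  fix x
  have "(rescale x0 r \<psi> has_derivative (\<lambda>h. inverse r * frechet_derivative \<psi> (at ((x - x0) /\<^sub>R r)) h)) (at x)"
    unfolding rescale_def by (rule has_derivative_rescale[OF test_functions_has_derivative[OF assms]])
  from frechet_derivative_at[OF this, symmetric] show "partial v (rescale x0 r \<psi>) x = inverse r * rescale x0 r (partial v \<psi>) x"
    by (simp add: rescale_def[abs_def])
qed

lemma rescale_laplacian:
  assumes "\<psi> \<in> test_functions \<Omega>"
  shows "laplacian (rescale x0 r \<psi>) x = laplacian \<psi> ((x - x0) /\<^sub>R r) / r\<^sup>2"
proof -
  have "partial i (partial i (rescale x0 r \<psi>)) x = inverse r * (inverse r * partial i (partial i \<psi>) ((x - x0) /\<^sub>R r))"
    if i: "i \<in> Basis" for i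
  proof -
    note t = test_functions_partial[OF assms i]
    have "((\<lambda>x. inverse r * rescale x0 r (partial i \<psi>) x) has_derivative
        (\<lambda>h. inverse r * (inverse r * frechet_derivative (partial i \<psi>) (at ((x - x0) /\<^sub>R r)) h))) (at x)"
      unfolding rescale_def by (intro has_derivative_mult_right has_derivative_rescale test_functions_has_derivative[OF t])
    from frechet_derivative_at[OF this, symmetric] show ?thesis
      unfolding rescale_partial[OF assms] by simp
  qed
  then show ?thesis
    by (simp add: laplacian_def sum_distrib_left[symmetric] divide_inverse power2_eq_square mult.commute)
qed

section \<open>Bumps paired with constants, affine functions and kinks\<close>

definition unit_volume :: "'a::euclidean_space itself \<Rightarrow> real" where
  "unit_volume _ = unit_ball_vol (real DIM('a))"

lemma unit_volume_pos: "unit_volume TYPE('a::euclidean_space) > 0"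
  by (simp add: unit_volume_def)

lemma measure_cball: "0 \<le> r \<Longrightarrow> measure lebesgue (cball (c::'a::euclidean_space) r) = unit_volume TYPE('a) * r ^ DIM('a)"
  by (simp add: content_cball unit_volume_def)

lemma integral_ge_on_cball:
  fixes h :: "'a::euclidean_space \<Rightarrow> real"
  assumes "integrable (lebesgue_on S) h" "S \<in> sets lebesgue" "cball p s \<subseteq> S" "s \<ge> 0"
    "\<And>x. x \<in> S \<Longrightarrow> h x \<ge> 0" "\<And>x. x \<in> cball p s \<Longrightarrow> h x \<ge> c"
  shows "c * (unit_volume TYPE('a) * s ^ DIM('a)) \<le> (LINT x|lebesgue_on S. h x)"
proof -
  \<comment> \<open>Nonnegativity of \<open>h\<close> is known on \<open>S\<close> only, whereas
    monotonicity in the domain of integration asks for it everywhere.\<close>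
  let ?h = "\<lambda>x. if x \<in> S then h x else 0"
  have fin: "finite_measure (lebesgue_on (cball p s))" by (rule finite_measure_lebesgue_on) auto
  have i: "integrable (lebesgue_on S) ?h"
    using assms(1) by (rule Bochner_Integration.integrable_cong[THEN iffD1, rotated 2]) auto
  have "measure (lebesgue_on (cball p s)) (cball p s) = unit_volume TYPE('a) * s ^ DIM('a)"
    using measure_cball[OF assms(4), of p] by (simp add: measure_restrict_space)
  then have "c * (unit_volume TYPE('a) * s ^ DIM('a)) = (LINT x|lebesgue_on (cball p s). c)"
    by simp
  also have "\<dots> \<le> (LINT x|lebesgue_on (cball p s). ?h x)"
  proof (rule integral_mono)
    show "integrable (lebesgue_on (cball p s)) (\<lambda>x. c)" by (rule finite_measure.integrable_const[OF fin])
    show "integrable (lebesgue_on (cball p s)) ?h" by (rule lebesgue_on_subset_mono(1)[OF assms(3) _ assms(2) i]) auto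
  qed (use assms in auto)
  also have "\<dots> \<le> (LINT x|lebesgue_on S. ?h x)"
    by (rule lebesgue_on_subset_mono(2)[OF assms(3) _ assms(2) i]) (use assms(5) in auto)
  also have "\<dots> = (LINT x|lebesgue_on S. h x)" by (intro Bochner_Integration.integral_cong) auto
  finally show ?thesis .
qed

lemma affine_lipschitz:
  fixes g :: "'a::euclidean_space" shows "(norm g)-lipschitz_on UNIV (\<lambda>x. g \<bullet> x + c)"
proof (rule lipschitz_onI)
  fix x y
  show "dist (g \<bullet> x + c) (g \<bullet> y + c) \<le> norm g * dist x y"
    using Cauchy_Schwarz_ineq2[of g "x - y"] by (simp add: dist_real_def dist_norm inner_diff_right)
qed simp

context bounded_domain
begin

text \<open>On the ball of half the radius the argument of \<open>flat 0\<close> is at least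
  \<open>1 - (1 / 2)^2 = 3 / 4\<close>.\<close>

lemma bump_mass:
  assumes r: "r > 0" "cball x0 r \<subseteq> \<Omega>"
  shows "flat 0 (3 / 4) * (unit_volume TYPE('a) * (r / 2) ^ DIM('a)) \<le> (LINT x|M\<Omega>. rescale x0 r std_bump x)"
proof (rule integral_ge_on_cball)
  show "integrable M\<Omega> (rescale x0 r std_bump)"
    by (rule L2_integrable[OF test_functions_L2[OF rescale_test[OF std_bump_profile r] domain_sets]])
  have "cball x0 (r / 2) \<subseteq> cball x0 r" using r by (intro subset_cball) simp
  then show "cball x0 (r / 2) \<subseteq> \<Omega>" using r(2) by blast
  show "rescale x0 r std_bump x \<ge> 0" for x by (simp add: rescale_def std_bump_def flat_nonneg)
  fix x assume "x \<in> cball x0 (r / 2)"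
  then have "norm ((x - x0) /\<^sub>R r) \<le> 1 / 2" using r unfolding norm_rescale[OF r(1)] by (simp add: dist_norm norm_minus_commute divide_le_eq)
  then have "(norm ((x - x0) /\<^sub>R r))\<^sup>2 \<le> (1 / 2)\<^sup>2" by (intro power_mono) auto
  then show "flat 0 (3 / 4) \<le> rescale x0 r std_bump x"
    unfolding rescale_def std_bump_def by (intro flat_0_mono) (simp add: power2_eq_square)
qed (use r in auto)

lemma affine_partial_integral:
  assumes v: "v \<in> test_functions \<Omega>"
  shows "(LINT x|M\<Omega>. (g \<bullet> x + c) * partial i v x) = - ((g \<bullet> i) * (LINT x|M\<Omega>. v x))"
proof -
  have "((\<lambda>t. g \<bullet> (x + t *\<^sub>R i) + c) has_real_derivative g \<bullet> i) (at 0)" for x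
    by (auto intro!: derivative_eq_intros simp: inner_add_right)
  then have "(LINT x|M\<Omega>. (g \<bullet> i) * v x) = - (LINT x|M\<Omega>. (g \<bullet> x + c) * partial i v x)"
    by (intro integration_by_parts[OF affine_lipschitz v domain_sets]) auto
  then show ?thesis by simp
qed

text \<open>One integration by parts leaves a constant times the integral of a partial derivative.
  This removes the discrete function from the residual identity on balls inside one element.\<close>

lemma affine_laplacian_integral:
  assumes v: "v \<in> test_functions \<Omega>"
  shows "(LINT x|M\<Omega>. (g \<bullet> x + c) * laplacian v x) = 0"
proof -
  note p = test_functions_partial[OF v]
  have i: "integrable M\<Omega> (\<lambda>x. (g \<bullet> x + c) * partial i (partial i v) x)" if "i \<in> Basis" for i
    using that by (intro test_functions_mult_integrable[OF test_functions_partial[OF p]] continuous_intros domain_sets) auto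
  have "(LINT x|M\<Omega>. (g \<bullet> x + c) * laplacian v x) = (\<Sum>i\<in>Basis. LINT x|M\<Omega>. (g \<bullet> x + c) * partial i (partial i v) x)"
    using i by (simp add: laplacian_def sum_distrib_left Bochner_Integration.integral_sum)
  also have "\<dots> = 0"
    by (simp add: affine_partial_integral[OF p] integral_partial_test_function[OF v domain_sets])
  finally show ?thesis .
qed

text \<open>Testing the kink \<open>max 0 (n \<bullet> (x - x0))\<close> with the Laplacian of a bump amounts to integrating
  the bump over the hyperplane; integrating by parts only once avoids surface integrals.\<close>

lemma kink_laplacian_integral:
  assumes r: "r > 0" "cball x0 r \<subseteq> \<Omega>" and n: "norm n = 1"
  shows "flat 0 (7 / 16) / (2 * r) * (unit_volume TYPE('a) * (r / 4) ^ DIM('a))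
    \<le> (LINT x|M\<Omega>. max 0 (n \<bullet> (x - x0)) * laplacian (rescale x0 r std_bump) x)"
proof -
  define v where "v = rescale x0 r std_bump"
  define u where "u x = max 0 (n \<bullet> (x - x0))" for x
  define D where "D i x = (if n \<bullet> (x - x0) > 0 then n \<bullet> i else 0)" for i x
  have v: "v \<in> test_functions \<Omega>" unfolding v_def by (intro rescale_test r) (simp add: profiles_def)
  note p = test_functions_partial[OF v]
  have lip: "1-lipschitz_on UNIV u"
  proof (rule lipschitz_onI)
    fix x y
    have "\<bar>u x - u y\<bar> \<le> \<bar>n \<bullet> (x - x0) - n \<bullet> (y - x0)\<bar>" unfolding u_def by linarith
    also have "\<dots> = \<bar>n \<bullet> (x - y)\<bar>" by (simp add: inner_diff_right)
    also have "\<dots> \<le> 1 * dist x y" using Cauchy_Schwarz_ineq2[of n "x - y"] n by (simp add: dist_norm)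
    finally show "dist (u x) (u y) \<le> 1 * dist x y" by (simp add: dist_real_def)
  qed simp
  have cont_u: "continuous_on UNIV u" by (rule lipschitz_on_continuous_on[OF lip])
  have n0: "n \<noteq> 0" using n by auto
  \<comment> \<open>The function \<open>u\<close> fails to be differentiable on this hyperplane
    only, so integration by parts for Lipschitz functions applies.\<close>
  have "negligible {x. n \<bullet> x = n \<bullet> x0}" using n0 by (intro negligible_hyperplane) simp
  then have "AE x in lebesgue. x \<notin> {x. n \<bullet> x = n \<bullet> x0}"
    unfolding negligible_iff_null_sets by (rule AE_not_in)
  then have off: "AE x in lborel. x \<notin> {x. n \<bullet> x = n \<bullet> x0}" unfolding AE_completion_iff .
  have deriv: "AE x in lborel. ((\<lambda>t. u (x + t *\<^sub>R i)) has_real_derivative D i x) (at 0)" for i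
    using off
  proof eventually_elim
    case (elim x)
    have lin: "((\<lambda>t. n \<bullet> (x + t *\<^sub>R i - x0)) has_real_derivative n \<bullet> i) (at 0)"
      by (auto intro!: derivative_eq_intros simp: inner_add_right inner_diff_right)
    have cont: "((\<lambda>t. n \<bullet> (x + t *\<^sub>R i - x0)) \<longlongrightarrow> n \<bullet> (x - x0)) (nhds 0)"
    proof -
      have "((\<lambda>t. n \<bullet> (x + t *\<^sub>R i - x0)) \<longlongrightarrow> n \<bullet> (x + 0 *\<^sub>R i - x0)) (nhds 0)"
        using DERIV_isCont[OF lin] unfolding isCont_def
        by (rule tendsto_at_iff_tendsto_nhds[where g = "\<lambda>t. n \<bullet> (x + t *\<^sub>R i - x0)" and l = 0, THEN iffD1])
      then show ?thesis by simp
    qed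
    show ?case
    proof (cases "n \<bullet> (x - x0) > 0")
      case True
      have "\<forall>\<^sub>F t in nhds 0. n \<bullet> (x + t *\<^sub>R i - x0) > 0" using order_tendstoD(1)[OF cont True] .
      then have "\<forall>\<^sub>F t in nhds 0. u (x + t *\<^sub>R i) = n \<bullet> (x + t *\<^sub>R i - x0)"
        by eventually_elim (simp add: u_def)
      from DERIV_cong_ev[OF refl this refl] lin show ?thesis using True by (simp add: D_def)
    next
      case False
      then have neg: "n \<bullet> (x - x0) < 0" using elim by (simp add: inner_diff_right)
      have "\<forall>\<^sub>F t in nhds 0. n \<bullet> (x + t *\<^sub>R i - x0) < 0" using order_tendstoD(2)[OF cont neg] .
      then have "\<forall>\<^sub>F t in nhds 0. u (x + t *\<^sub>R i) = 0"
        by eventually_elim (simp add: u_def)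
      from DERIV_cong_ev[OF refl this refl] show ?thesis using False by (simp add: D_def)
    qed
  qed
  have Dm: "D i \<in> borel_measurable borel" for i unfolding D_def by measurable
  have Dm': "D i \<in> borel_measurable M\<Omega>" for i
    using Dm[of i] by (intro measurable_restrict_space1 measurable_completion) simp
  have iu: "integrable M\<Omega> (\<lambda>x. u x * partial i (partial i v) x)" if "i \<in> Basis" for i
    using that by (intro test_functions_mult_integrable[OF test_functions_partial[OF p]] cont_u domain_sets)
  have iD: "integrable M\<Omega> (\<lambda>x. D i x * partial i v x)" if i: "i \<in> Basis" for i
  proof -
    have "AE x in M\<Omega>. \<bar>D i x\<bar> \<le> \<bar>n \<bullet> i\<bar>" by (simp add: D_def)
    from L2_integrable[OF L2_space_bounded_mult[OF test_functions_L2[OF p[OF i] domain_sets] Dm' this]] show ?thesis .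
  qed
  \<comment> \<open>Minus the inner product of the gradients of \<open>u\<close> and of the bump. It
    is nonnegative because the bump decreases radially, so its integral may be estimated from below
    on a smaller ball.\<close>
  define k where "k x = (if n \<bullet> (x - x0) > 0 then 2 * (n \<bullet> (x - x0)) / r\<^sup>2 * flat 2 (1 - (norm ((x - x0) /\<^sub>R r))\<^sup>2) else 0)" for x
  have pv: "partial i v x = - (2 * ((x - x0) \<bullet> i) / r\<^sup>2 * flat 2 (1 - (norm ((x - x0) /\<^sub>R r))\<^sup>2))" for i x
  proof -
    have "partial i v x = inverse r * partial i std_bump ((x - x0) /\<^sub>R r)"
      unfolding v_def fun_cong[OF rescale_partial[OF std_bump_test]] by (simp add: rescale_def)
    also have "\<dots> = - (2 * ((x - x0) \<bullet> i) * (inverse r * inverse r) * flat 2 (1 - (norm ((x - x0) /\<^sub>R r))\<^sup>2))"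
      unfolding std_bump_partial inner_scaleR_left by (simp only: mult_ac mult_minus_left mult_minus_right)
    finally show ?thesis by (simp only: divide_inverse power2_eq_square[of r] inverse_mult_distrib)
  qed
  have k: "k x = - (\<Sum>i\<in>Basis. D i x * partial i v x)" for x
  proof (cases "n \<bullet> (x - x0) > 0")
    case True
    have "(\<Sum>i\<in>Basis. D i x * partial i v x)
        = - ((\<Sum>i\<in>Basis. (n \<bullet> i) * ((x - x0) \<bullet> i)) * (2 / r\<^sup>2 * flat 2 (1 - (norm ((x - x0) /\<^sub>R r))\<^sup>2)))"
      unfolding sum_distrib_right sum_negf[symmetric]
      using True by (intro sum.cong) (auto simp: D_def pv)
    also have "(\<Sum>i\<in>Basis. (n \<bullet> i) * ((x - x0) \<bullet> i)) = n \<bullet> (x - x0)" by (rule euclidean_inner[symmetric])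
    finally show ?thesis using True by (simp add: k_def)
  qed (simp add: k_def D_def)
  have ik: "integrable M\<Omega> k"
    unfolding k by (intro integrable_minus Bochner_Integration.integrable_sum iD)
  have "(LINT x|M\<Omega>. u x * laplacian v x) = (\<Sum>i\<in>Basis. LINT x|M\<Omega>. u x * partial i (partial i v) x)"
    using iu by (simp add: laplacian_def sum_distrib_left Bochner_Integration.integral_sum)
  also have "\<dots> = (\<Sum>i\<in>Basis. - (LINT x|M\<Omega>. D i x * partial i v x))"
  proof (intro sum.cong refl)
    fix i :: 'a assume i: "i \<in> Basis"
    have "(LINT x|M\<Omega>. D i x * partial i v x) = - (LINT x|M\<Omega>. u x * partial i (partial i v) x)"
      by (rule integration_by_parts[OF lip p[OF i] domain_sets deriv Dm])
    then show "(LINT x|M\<Omega>. u x * partial i (partial i v) x) = - (LINT x|M\<Omega>. D i x * partial i v x)" by simp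
  qed
  also have "\<dots> = (LINT x|M\<Omega>. k x)"
    unfolding k using iD by (simp add: sum_negf Bochner_Integration.integral_sum)
  finally have eq: "(LINT x|M\<Omega>. u x * laplacian v x) = (LINT x|M\<Omega>. k x)" .
  have "flat 0 (7 / 16) / (2 * r) * (unit_volume TYPE('a) * (r / 4) ^ DIM('a)) \<le> (LINT x|M\<Omega>. k x)"
  proof (rule integral_ge_on_cball[OF ik domain_sets])
    \<comment> \<open>On the ball of radius \<open>r / 4\<close> around this point
      \<open>n \<bullet> (x - x0)\<close> is at least \<open>r / 4\<close>, and
      \<open>norm (x - x0)\<close> is at most \<open>3 / 4 * r\<close>, so the argument of
      \<open>flat\<close> is at least \<open>1 - 9 / 16 = 7 / 16\<close>.\<close>
    let ?p = "x0 + (r / 2) *\<^sub>R n"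
    have ball: "norm (x - x0) \<le> 3 / 4 * r" if "x \<in> cball ?p (r / 4)" for x
    proof -
      have "norm (x - ?p) \<le> r / 4" using that by (simp add: dist_norm norm_minus_commute)
      moreover have "x - x0 = (x - ?p) + (r / 2) *\<^sub>R n" by simp
      then have "norm (x - x0) \<le> norm (x - ?p) + norm ((r / 2) *\<^sub>R n)" by (metis norm_triangle_ineq)
      ultimately show ?thesis using n r by simp
    qed
    show "cball ?p (r / 4) \<subseteq> \<Omega>"
    proof
      fix x assume "x \<in> cball ?p (r / 4)"
      then have "norm (x - x0) \<le> r" using ball[of x] r by simp
      then show "x \<in> \<Omega>" using r(2) by (auto simp: subset_iff dist_norm norm_minus_commute)
    qed
    show "k x \<ge> 0" for x by (simp add: k_def flat_nonneg)
    fix x assume x: "x \<in> cball ?p (r / 4)"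
    have "n \<bullet> n = 1" using n by (simp add: norm_eq_1)
    then have "n \<bullet> (x - x0) = r / 2 + n \<bullet> (x - ?p)" by (simp add: inner_diff_right inner_add_right)
    moreover have "\<bar>n \<bullet> (x - ?p)\<bar> \<le> r / 4"
      using Cauchy_Schwarz_ineq2[of n "x - ?p"] x n by (simp add: dist_norm norm_minus_commute)
    ultimately have s: "n \<bullet> (x - x0) \<ge> r / 4" by linarith
    define t where "t = 1 - (norm ((x - x0) /\<^sub>R r))\<^sup>2"
    have "norm ((x - x0) /\<^sub>R r) \<le> 3 / 4" using ball[OF x] r unfolding norm_rescale[OF r(1)] by (simp add: divide_le_eq)
    then have "(norm ((x - x0) /\<^sub>R r))\<^sup>2 \<le> (3 / 4)\<^sup>2" by (intro power_mono) auto
    then have t: "7 / 16 \<le> t" "t \<le> 1" by (auto simp: t_def power2_eq_square)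
    have "flat 0 (7 / 16) \<le> flat 0 t" by (rule flat_0_mono[OF t(1)])
    also have "\<dots> \<le> flat 2 t"
    proof -
      have "t\<^sup>2 \<le> 1" using t by (simp add: power_le_one)
      then show ?thesis using t by (simp add: flat_def le_divide_eq mult_left_le)
    qed
    finally have f: "flat 0 (7 / 16) \<le> flat 2 t" .
    have "flat 0 (7 / 16) / (2 * r) = 2 * (r / 4) / r\<^sup>2 * flat 0 (7 / 16)" using r by (simp add: power2_eq_square)
    also have "\<dots> \<le> 2 * (n \<bullet> (x - x0)) / r\<^sup>2 * flat 2 t"
      using s f r flat_nonneg[of 0 "7 / 16"] by (intro mult_mono divide_right_mono) auto
    also have "\<dots> = k x" using s r by (simp add: k_def t_def)
    finally show "flat 0 (7 / 16) / (2 * r) \<le> k x" .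
  qed (use r in auto)
  then show ?thesis using eq by (simp add: u_def v_def)
qed

end


subsection \<open>Lower bounds from bump functions\<close>

lemma square_add_le: "((a::real) + b)\<^sup>2 \<le> 2 * a\<^sup>2 + 2 * b\<^sup>2"
  using sum_squares_ge_zero[of "a - b" 0] by (simp add: power2_eq_square algebra_simps)

lemma square_add4_le: "((a::real) + b + (c + d))\<^sup>2 \<le> 4 * (a\<^sup>2 + b\<^sup>2 + c\<^sup>2 + d\<^sup>2)"
proof -
  have "(a + b + (c + d))\<^sup>2 \<le> 2 * (a + b)\<^sup>2 + 2 * (c + d)\<^sup>2" by (rule square_add_le)
  also have "\<dots> \<le> 2 * (2 * a\<^sup>2 + 2 * b\<^sup>2) + 2 * (2 * c\<^sup>2 + 2 * d\<^sup>2)"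
    by (intro add_mono mult_left_mono square_add_le) auto
  finally show ?thesis by simp
qed

context bounded_domain
begin

lemma affine_L2: "(\<lambda>x. g \<bullet> x + c) \<in> L2_space M\<Omega>"
proof -
  obtain R where R: "\<And>x. x \<in> \<Omega> \<Longrightarrow> norm x \<le> R"
    using bounded_domain unfolding bounded_iff by blast
  have m: "(\<lambda>x. g \<bullet> x + c) \<in> borel_measurable M\<Omega>"
    by (intro continuous_measurable_lebesgue_on continuous_intros)
  show ?thesis
  proof (rule L2_space_bounded[OF finite_measure_domain m])
    show "AE x in M\<Omega>. \<bar>g \<bullet> x + c\<bar> \<le> norm g * R + \<bar>c\<bar>"
    proof (rule AE_I2)
      fix x assume "x \<in> space M\<Omega>"
      then have "norm x \<le> R" using R by simp
      then have "\<bar>g \<bullet> x\<bar> \<le> norm g * R"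
        by (intro order_trans[OF Cauchy_Schwarz_ineq2[of g x]] mult_left_mono) auto
      then show "\<bar>g \<bullet> x + c\<bar> \<le> norm g * R + \<bar>c\<bar>" by linarith
    qed
  qed
qed

lemma bump_test_le:
  assumes m: "bump_bound TYPE('a) m" and \<psi>: "\<psi> \<in> profiles" and r: "r > 0" "cball p r \<subseteq> \<Omega>"
    and h: "h \<in> L2_space M\<Omega>"
  shows "\<bar>LINT x|M\<Omega>. h x * rescale p r \<psi> x\<bar>
    \<le> m * (sqrt (unit_volume TYPE('a) * r ^ DIM('a)) * L2_norm (lebesgue_on (cball p r)) h)"
proof -
  have hB: "h \<in> L2_space (lebesgue_on (cball p r))" by (rule L2_space_subset(1)[OF r(2) _ domain_sets h]) auto
  have mp: "m > 0" "\<And>z. \<bar>\<psi> z\<bar> \<le> m" using m \<psi> by (auto simp: bump_bound_def)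
  have "\<bar>LINT x|M\<Omega>. h x * rescale p r \<psi> x\<bar> \<le> m * (LINT x|lebesgue_on (cball p r). \<bar>h x\<bar>)"
  proof (rule integral_mult_bounded_support_le[OF r(2) _ domain_sets])
    show "rescale p r \<psi> x = 0" if "x \<notin> cball p r" for x by (rule rescale_support[OF \<psi> r(1) that])
    show "\<bar>rescale p r \<psi> x\<bar> \<le> m" for x unfolding rescale_def by (rule mp(2))
    show "rescale p r \<psi> \<in> borel_measurable (lebesgue_on (cball p r))"
      by (rule test_functions_measurable[OF rescale_test[OF \<psi> r]])
    show "integrable (lebesgue_on (cball p r)) h"
      by (intro L2_space_integrable finite_measure_lebesgue_on hB) auto
  qed auto
  also have "\<dots> \<le> m * (sqrt (measure lebesgue (cball p r)) * L2_norm (lebesgue_on (cball p r)) h)"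
    using mp(1) by (intro mult_left_mono Cauchy_Schwarz_L1 hB) auto
  finally show ?thesis using measure_cball[of r p] r(1) by simp
qed

text \<open>An affine function is recovered from its tests: the partial derivatives of the bump see
  the slope, the bump itself sees the value at \<open>p\<close>. So for any affine \<open>q\<close>
  the tests of \<open>R\<close> and the size of \<open>R - q\<close> bound \<open>q\<close> on the
  ball, and then on all of \<open>S\<close>, which lies within the distance
  \<open>\<Lambda> * r\<close>.\<close>

lemma element_residual_bound:
  assumes m: "bump_bound TYPE('a) m" and conv: "convex \<Omega>" and \<Lambda>: "\<Lambda> \<ge> 0"
  obtains C where "C > 0"
    "\<And>p r S R E g c. r > 0 \<Longrightarrow> cball p r \<subseteq> \<Omega> \<Longrightarrow> cball p r \<subseteq> S \<Longrightarrow> S \<subseteq> closure \<Omega> \<Longrightarrow> S \<in> sets lebesgue \<Longrightarrow>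
      S \<subseteq> cball p (\<Lambda> * r) \<Longrightarrow> R \<in> L2_space M\<Omega> \<Longrightarrow>
      (\<And>\<psi>. \<psi> \<in> profiles \<Longrightarrow> \<bar>LINT x|M\<Omega>. R x * rescale p r \<psi> x\<bar> \<le> E) \<Longrightarrow>
      r ^ DIM('a) * (LINT x|lebesgue_on S. (R x)\<^sup>2)
        \<le> C * (E\<^sup>2 + r ^ DIM('a) * (LINT x|lebesgue_on S. (R x - (g \<bullet> x + c))\<^sup>2))"
proof -
  define d where "d = DIM('a)"
  define V where "V = unit_volume TYPE('a)"
  define \<kappa> where "\<kappa> = flat 0 (3 / 4) * (V * (1 / 2) ^ d)"
  \<comment> \<open>With \<open>a\<close> bounding \<open>r\<close> times each component of the
    slope, the value at \<open>p\<close> contributes \<open>(1 + d) * a\<close> and the slope across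
    \<open>cball p (\<Lambda> * r)\<close> contributes \<open>d * \<Lambda> * a\<close>.\<close>
  define A where "A = 1 + real d + real d * \<Lambda>"
  define N where "N = 2 * A\<^sup>2 * V * \<Lambda> ^ d / \<kappa>\<^sup>2"
  have V: "V > 0" unfolding V_def by (rule unit_volume_pos)
  have \<kappa>: "\<kappa> > 0" using V by (simp add: \<kappa>_def flat_def)
  have A: "A > 0" using \<Lambda> by (simp add: A_def add_pos_nonneg)
  have N: "N \<ge> 0" using V \<kappa> \<Lambda> by (simp add: N_def)
  have mp: "m > 0" using m by (simp add: bump_bound_def)
  show ?thesis
  proof (rule that[of "2 * N * (1 + m\<^sup>2 * V) + 2"])
    show "2 * N * (1 + m\<^sup>2 * V) + 2 > 0" using N V by (intro add_nonneg_pos mult_nonneg_nonneg add_nonneg_nonneg) auto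
    fix p :: 'a and r :: real and S R E and g :: 'a and c :: real
    assume r: "r > 0" "cball p r \<subseteq> \<Omega>" and BS: "cball p r \<subseteq> S" and S: "S \<subseteq> closure \<Omega>" "S \<in> sets lebesgue"
      and SB: "S \<subseteq> cball p (\<Lambda> * r)" and R: "R \<in> L2_space M\<Omega>"
      and E: "\<And>\<psi>. \<psi> \<in> profiles \<Longrightarrow> \<bar>LINT x|M\<Omega>. R x * rescale p r \<psi> x\<bar> \<le> E"
    define q where "q x = g \<bullet> x + c" for x
    define w where "w x = R x - q x" for x
    have qL: "q \<in> L2_space M\<Omega>" unfolding q_def[abs_def] by (rule affine_L2)
    have wL: "w \<in> L2_space M\<Omega>" unfolding w_def[abs_def] by (rule L2_space_diff[OF R qL])
    note LS = L2_transfer[OF conv S]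
    define \<omega> where "\<omega> = L2_norm (lebesgue_on S) w"
    have \<omega>: "\<omega> \<ge> 0" by (simp add: \<omega>_def L2_norm_nonneg)
    define F where "F = E + m * (sqrt (V * r ^ d) * \<omega>)"
    have qF: "\<bar>LINT x|M\<Omega>. q x * rescale p r \<psi> x\<bar> \<le> F" if \<psi>: "\<psi> \<in> profiles" for \<psi>
    proof -
      have vL: "rescale p r \<psi> \<in> L2_space M\<Omega>" by (rule test_functions_L2[OF rescale_test[OF \<psi> r] domain_sets])
      have "(LINT x|M\<Omega>. q x * rescale p r \<psi> x) = (LINT x|M\<Omega>. R x * rescale p r \<psi> x) - (LINT x|M\<Omega>. w x * rescale p r \<psi> x)"
        using L2_space_mult_integrable[OF R vL] L2_space_mult_integrable[OF qL vL] by (simp add: w_def left_diff_distrib)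
      moreover have "\<bar>LINT x|M\<Omega>. w x * rescale p r \<psi> x\<bar> \<le> m * (sqrt (V * r ^ d) * \<omega>)"
      proof -
        have "L2_norm (lebesgue_on (cball p r)) w \<le> \<omega>"
          unfolding \<omega>_def by (rule L2_space_subset(2)[OF BS _ S(2) LS[OF wL]]) auto
        then have "m * (sqrt (V * r ^ d) * L2_norm (lebesgue_on (cball p r)) w) \<le> m * (sqrt (V * r ^ d) * \<omega>)"
          using mp V r by (intro mult_left_mono) auto
        then show ?thesis using bump_test_le[OF m \<psi> r wL] unfolding V_def d_def by (rule order_trans[rotated])
      qed
      ultimately show ?thesis using E[OF \<psi>] unfolding F_def by linarith
    qed
    define v where "v = rescale p r (std_bump :: 'a \<Rightarrow> real)"
    have v: "v \<in> test_functions \<Omega>" unfolding v_def by (rule rescale_test[OF std_bump_profile r])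
    define \<mu> where "\<mu> = (LINT x|M\<Omega>. v x)"
    have \<mu>: "\<mu> \<ge> \<kappa> * r ^ d"
      using bump_mass[OF r] by (simp add: \<mu>_def v_def \<kappa>_def V_def d_def power_divide)
    have \<kappa>r: "\<kappa> * r ^ d > 0" using \<kappa> r by simp
    then have \<mu>0: "\<mu> > 0" using \<mu> by linarith
    define a where "a = F / (\<kappa> * r ^ d)"
    have F0: "F \<ge> 0" using qF[OF std_bump_profile] by linarith
    have a0: "a \<ge> 0" using F0 \<kappa>r by (simp add: a_def)
    have Fa: "F / \<mu> \<le> a" unfolding a_def by (rule divide_left_mono[OF \<mu> F0 mult_pos_pos[OF \<mu>0 \<kappa>r]])
    \<comment> \<open>Testing with the rescaled partial derivative of the profile is
      \<open>r\<close> times testing with the derivative of \<open>v\<close>; by parts this becomes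
      \<open>r\<close> times the slope component times the mass \<open>\<mu>\<close>.\<close>
    have gi: "r * \<bar>g \<bullet> i\<bar> \<le> a" if i: "i \<in> Basis" for i
    proof -
      have "rescale p r (partial i std_bump) x = r * partial i v x" for x
        unfolding v_def fun_cong[OF rescale_partial[OF std_bump_test]] using r by simp
      then have "(LINT x|M\<Omega>. q x * rescale p r (partial i std_bump) x) = (LINT x|M\<Omega>. r * (q x * partial i v x))"
        by (simp add: mult_ac)
      also have "\<dots> = r * (- ((g \<bullet> i) * \<mu>))"
        unfolding q_def \<mu>_def by (simp add: affine_partial_integral[OF v])
      finally have "\<bar>r * (- ((g \<bullet> i) * \<mu>))\<bar> \<le> F" using qF[of "partial i std_bump"] i by (simp add: profiles_def)
      then have "(r * \<bar>g \<bullet> i\<bar>) * \<mu> \<le> F" using r \<mu>0 by (simp add: abs_mult mult_ac)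
      then have "r * \<bar>g \<bullet> i\<bar> \<le> F / \<mu>" using \<mu>0 by (simp add: le_divide_eq)
      with Fa show ?thesis by linarith
    qed
    have ng: "norm g * r \<le> real d * a"
    proof -
      have "norm g * r \<le> (\<Sum>i\<in>Basis. \<bar>g \<bullet> i\<bar>) * r" using norm_le_l1[of g] r by (intro mult_right_mono) auto
      also have "\<dots> = (\<Sum>i\<in>Basis. r * \<bar>g \<bullet> i\<bar>)" by (simp add: sum_distrib_right sum_distrib_left mult.commute)
      also have "\<dots> \<le> (\<Sum>i\<in>(Basis::'a set). a)" by (intro sum_mono gi)
      finally show ?thesis by (simp add: d_def)
    qed
    have q0: "\<bar>q p\<bar> \<le> a + real d * a"
    proof -
      have vL: "v \<in> L2_space M\<Omega>" by (rule test_functions_L2[OF v domain_sets])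
      have gL: "(\<lambda>x. g \<bullet> x + - (g \<bullet> p)) \<in> L2_space M\<Omega>" by (rule affine_L2)
      have i: "integrable M\<Omega> (\<lambda>x. (g \<bullet> x + - (g \<bullet> p)) * v x)" by (rule L2_space_mult_integrable[OF gL vL])
      have split: "q x * v x = q p * v x + (g \<bullet> x + - (g \<bullet> p)) * v x" for x by (simp add: q_def algebra_simps)
      have "(LINT x|M\<Omega>. q x * v x) = q p * \<mu> + (LINT x|M\<Omega>. (g \<bullet> x + - (g \<bullet> p)) * v x)"
        unfolding split \<mu>_def using i L2_integrable[OF vL] by simp
      moreover have "\<bar>LINT x|M\<Omega>. (g \<bullet> x + - (g \<bullet> p)) * v x\<bar> \<le> real d * a * \<mu>"
      proof -
        have "\<bar>LINT x|M\<Omega>. (g \<bullet> x + - (g \<bullet> p)) * v x\<bar> \<le> (LINT x|M\<Omega>. \<bar>(g \<bullet> x + - (g \<bullet> p)) * v x\<bar>)"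
          using integral_norm_bound[of M\<Omega> "\<lambda>x. (g \<bullet> x + - (g \<bullet> p)) * v x"] unfolding real_norm_def by linarith
        also have "\<dots> \<le> (LINT x|M\<Omega>. real d * a * v x)"
        proof (rule integral_mono)
          show "integrable M\<Omega> (\<lambda>x. \<bar>(g \<bullet> x + - (g \<bullet> p)) * v x\<bar>)" using i by (rule integrable_abs)
          show "integrable M\<Omega> (\<lambda>x. real d * a * v x)" using L2_integrable[OF vL] by simp
          fix x
          have v0: "v x \<ge> 0" by (simp add: v_def rescale_def std_bump_def flat_nonneg)
          show "\<bar>(g \<bullet> x + - (g \<bullet> p)) * v x\<bar> \<le> real d * a * v x"
          proof (cases "x \<in> cball p r")
            case True
            have "\<bar>g \<bullet> (x - p)\<bar> \<le> norm g * norm (x - p)" by (rule Cauchy_Schwarz_ineq2)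
            also have "\<dots> \<le> norm g * r" using True by (intro mult_left_mono) (auto simp: dist_norm norm_minus_commute)
            finally have "\<bar>g \<bullet> x + - (g \<bullet> p)\<bar> \<le> real d * a" using ng by (simp add: inner_diff_right)
            then show ?thesis using v0 unfolding abs_mult abs_of_nonneg[OF v0] by (intro mult_right_mono)
          next
            case False
            then have "v x = 0" unfolding v_def by (rule rescale_support[OF std_bump_profile r(1)])
            then show ?thesis by simp
          qed
        qed
        finally show ?thesis by (simp add: \<mu>_def)
      qed
      ultimately have "\<bar>q p * \<mu>\<bar> \<le> F + real d * a * \<mu>" using qF[OF std_bump_profile] unfolding v_def by linarith
      then have "\<bar>q p\<bar> * \<mu> \<le> F + real d * a * \<mu>" using \<mu>0 by (simp add: abs_mult)
      then have "\<bar>q p\<bar> \<le> (F + real d * a * \<mu>) / \<mu>" using \<mu>0 by (simp add: le_divide_eq)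
      also have "\<dots> = F / \<mu> + real d * a" using \<mu>0 by (simp add: add_divide_distrib)
      finally show ?thesis using Fa by linarith
    qed
    have qS: "\<bar>q x\<bar> \<le> A * a" if "x \<in> S" for x
    proof -
      have "norm (x - p) \<le> \<Lambda> * r" using that SB by (auto simp: dist_norm norm_minus_commute)
      have "\<bar>g \<bullet> (x - p)\<bar> \<le> norm g * norm (x - p)" by (rule Cauchy_Schwarz_ineq2)
      also have "\<dots> \<le> norm g * (\<Lambda> * r)" by (intro mult_left_mono \<open>norm (x - p) \<le> \<Lambda> * r\<close>) auto
      also have "\<dots> = \<Lambda> * (norm g * r)" by simp
      also have "\<dots> \<le> \<Lambda> * (real d * a)" by (intro mult_left_mono ng \<Lambda>)
      finally have 1: "\<bar>g \<bullet> (x - p)\<bar> \<le> \<Lambda> * (real d * a)" .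
      have 2: "q x = q p + g \<bullet> (x - p)" by (simp add: q_def inner_diff_right)
      have "A * a = a + real d * a + \<Lambda> * (real d * a)" by (simp add: A_def algebra_simps)
      then show ?thesis using 1 q0 unfolding 2 by linarith
    qed
    have Sm: "S \<in> lmeasurable"
      by (rule fmeasurableI2[OF lmeasurable_cball SB S(2)])
    have mS: "measure lebesgue S \<le> V * (\<Lambda> * r) ^ d"
      using measure_mono_fmeasurable[OF SB S(2) lmeasurable_cball] measure_cball[of "\<Lambda> * r" p] \<Lambda> r
      by (simp add: V_def d_def)
    interpret fin: finite_measure "lebesgue_on S" by (rule finite_measure_lebesgue_on[OF Sm])
    have mSS: "measure (lebesgue_on S) S = measure lebesgue S" using S(2) by (simp add: measure_restrict_space)
    have iw: "integrable (lebesgue_on S) (\<lambda>x. (w x)\<^sup>2)" by (rule L2_spaceD(2)[OF LS[OF wL]])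
    have "(LINT x|lebesgue_on S. (R x)\<^sup>2) \<le> (LINT x|lebesgue_on S. 2 * (A * a)\<^sup>2 + 2 * (w x)\<^sup>2)"
    proof (rule integral_mono)
      show "integrable (lebesgue_on S) (\<lambda>x. (R x)\<^sup>2)" by (rule L2_spaceD(2)[OF LS[OF R]])
      show "integrable (lebesgue_on S) (\<lambda>x. 2 * (A * a)\<^sup>2 + 2 * (w x)\<^sup>2)"
        by (intro Bochner_Integration.integrable_add integrable_mult_right iw fin.integrable_const)
      fix x assume "x \<in> space (lebesgue_on S)"
      then have "\<bar>q x\<bar> \<le> A * a" by (intro qS) simp
      then have "(q x)\<^sup>2 \<le> (A * a)\<^sup>2" by (metis abs_ge_zero power2_abs power_mono)
      moreover have "R x = q x + w x" by (simp add: w_def)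
      ultimately show "(R x)\<^sup>2 \<le> 2 * (A * a)\<^sup>2 + 2 * (w x)\<^sup>2" using square_add_le[of "q x" "w x"] by simp
    qed
    also have "\<dots> = 2 * (A * a)\<^sup>2 * measure lebesgue S + 2 * \<omega>\<^sup>2"
      using iw mSS by (simp add: \<omega>_def L2_norm_sq mult.commute)
    also have "\<dots> \<le> 2 * (A * a)\<^sup>2 * (V * (\<Lambda> * r) ^ d) + 2 * \<omega>\<^sup>2"
      by (intro add_right_mono mult_left_mono mS) auto
    finally have "r ^ d * (LINT x|lebesgue_on S. (R x)\<^sup>2) \<le> r ^ d * (2 * (A * a)\<^sup>2 * (V * (\<Lambda> * r) ^ d) + 2 * \<omega>\<^sup>2)"
      using r by (intro mult_left_mono) auto
    \<comment> \<open>Here \<open>r ^ d\<close> occurs once as the leading factor, once from the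
      volume of \<open>S\<close>, and twice in the denominator of \<open>a^2\<close>, so it cancels
      in front of \<open>F^2\<close>.\<close>
    also have "\<dots> = N * F\<^sup>2 + 2 * (r ^ d * \<omega>\<^sup>2)"
      using r \<kappa> by (simp add: N_def a_def power_mult_distrib power_divide field_simps power2_eq_square)
    also have "\<dots> \<le> N * (2 * E\<^sup>2 + 2 * (m\<^sup>2 * V * (r ^ d * \<omega>\<^sup>2))) + 2 * (r ^ d * \<omega>\<^sup>2)"
    proof -
      have "F\<^sup>2 \<le> 2 * E\<^sup>2 + 2 * (m * (sqrt (V * r ^ d) * \<omega>))\<^sup>2" unfolding F_def by (rule square_add_le)
      also have "(m * (sqrt (V * r ^ d) * \<omega>))\<^sup>2 = m\<^sup>2 * V * (r ^ d * \<omega>\<^sup>2)"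
        using V r by (simp add: power_mult_distrib)
      finally show ?thesis using N by (intro add_right_mono mult_left_mono)
    qed
    also have "\<dots> \<le> (2 * N * (1 + m\<^sup>2 * V) + 2) * (E\<^sup>2 + r ^ d * \<omega>\<^sup>2)"
    proof -
      have "0 \<le> N * (m\<^sup>2 * V) * E\<^sup>2" "0 \<le> N * (r ^ d * \<omega>\<^sup>2)" "0 \<le> E\<^sup>2"
        using N V r by (auto intro!: mult_nonneg_nonneg)
      then show ?thesis by (simp add: algebra_simps)
    qed
    finally show "r ^ DIM('a) * (LINT x|lebesgue_on S. (R x)\<^sup>2)
        \<le> (2 * N * (1 + m\<^sup>2 * V) + 2) * (E\<^sup>2 + r ^ DIM('a) * (LINT x|lebesgue_on S. (R x - (g \<bullet> x + c))\<^sup>2))"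
      by (simp add: d_def \<omega>_def L2_norm_sq w_def q_def)
  qed
qed

text \<open>Paired with the Laplacian of the bump, the affine part of \<open>z\<close> drops out and
  the kink gives at least a multiple of r^(d-1). So the tested sum, together with \<open>R\<close>
  on the two sets covering the ball, bounds the jump; the missing power of \<open>r\<close> is the
  factor \<open>r^2\<close> on the right.\<close>

lemma side_residual_bound:
  assumes m: "bump_bound TYPE('a) m" and conv: "convex \<Omega>"
  obtains C where "C > 0"
    "\<And>p r S S' R E z A c J n. r > 0 \<Longrightarrow> cball p r \<subseteq> \<Omega> \<Longrightarrow> cball p r \<subseteq> S \<union> S' \<Longrightarrow>
      S \<subseteq> closure \<Omega> \<Longrightarrow> S' \<subseteq> closure \<Omega> \<Longrightarrow> S \<in> sets lebesgue \<Longrightarrow> S' \<in> sets lebesgue \<Longrightarrow>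
      R \<in> L2_space M\<Omega> \<Longrightarrow> norm n = 1 \<Longrightarrow>
      (\<And>x. x \<in> cball p r \<Longrightarrow> z x = A \<bullet> x + c - J * max 0 (n \<bullet> (x - p))) \<Longrightarrow>
      \<bar>(LINT x|M\<Omega>. R x * rescale p r std_bump x) + (LINT x|M\<Omega>. z x * laplacian (rescale p r std_bump) x)\<bar> \<le> E \<Longrightarrow>
      J\<^sup>2 * (r ^ DIM('a))\<^sup>2 \<le> C * (r\<^sup>2 * (E\<^sup>2 + r ^ DIM('a) * (LINT x|lebesgue_on S. (R x)\<^sup>2)
        + r ^ DIM('a) * (LINT x|lebesgue_on S'. (R x)\<^sup>2)))"
proof -
  define d where "d = DIM('a)"
  define V where "V = unit_volume TYPE('a)"
  define \<kappa> where "\<kappa> = flat 0 (7 / 16) / 2 * (V * (1 / 4) ^ d)"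
  have V: "V > 0" unfolding V_def by (rule unit_volume_pos)
  have \<kappa>: "\<kappa> > 0" using V by (simp add: \<kappa>_def flat_def)
  have mp: "m > 0" using m by (simp add: bump_bound_def)
  show ?thesis
  proof (rule that[of "(2 + 2 * m\<^sup>2 * V) / \<kappa>\<^sup>2"])
    show "(2 + 2 * m\<^sup>2 * V) / \<kappa>\<^sup>2 > 0" using V \<kappa> by (intro divide_pos_pos add_pos_nonneg) auto
    fix p :: 'a and r :: real and S S' R E z and A :: 'a and c J :: real and n :: 'a
    assume r: "r > 0" "cball p r \<subseteq> \<Omega>" and BS: "cball p r \<subseteq> S \<union> S'" and S: "S \<subseteq> closure \<Omega>" "S' \<subseteq> closure \<Omega>"
      "S \<in> sets lebesgue" "S' \<in> sets lebesgue" and R: "R \<in> L2_space M\<Omega>" and n: "norm n = 1"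
      and z: "\<And>x. x \<in> cball p r \<Longrightarrow> z x = A \<bullet> x + c - J * max 0 (n \<bullet> (x - p))"
      and E: "\<bar>(LINT x|M\<Omega>. R x * rescale p r std_bump x) + (LINT x|M\<Omega>. z x * laplacian (rescale p r std_bump) x)\<bar> \<le> E"
    define v where "v = rescale p r (std_bump :: 'a \<Rightarrow> real)"
    have v: "v \<in> test_functions \<Omega>" unfolding v_def by (rule rescale_test[OF std_bump_profile r])
    define I I' where "I = (LINT x|lebesgue_on S. (R x)\<^sup>2)" "I' = (LINT x|lebesgue_on S'. (R x)\<^sup>2)"
    have I0: "I \<ge> 0" "I' \<ge> 0" by (auto simp: I_I'_def intro!: integral_nonneg_AE)
    have lap0: "laplacian v x = 0" if "x \<notin> cball p r" for x
      using rescale_support[OF std_bump_profile r(1)] that unfolding v_def by (rule laplacian_eq_0)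
    have lapL: "laplacian v \<in> L2_space M\<Omega>"
    proof -
      have "\<bar>laplacian v x\<bar> \<le> m / r\<^sup>2" for x
        using m std_bump_profile r unfolding v_def rescale_laplacian[OF std_bump_test]
        by (auto simp: bump_bound_def abs_divide intro!: divide_right_mono)
      then show ?thesis
        by (intro L2_space_bounded[OF finite_measure_domain continuous_measurable_lebesgue_on[OF laplacian_continuous[OF v]], of "m / r\<^sup>2"]) auto
    qed
    define k where "k x = max 0 (n \<bullet> x + - (n \<bullet> p))" for x
    have kL: "k \<in> L2_space M\<Omega>"
    proof -
      have "(\<lambda>x. n \<bullet> x + - (n \<bullet> p)) \<in> L2_space M\<Omega>" by (rule affine_L2)
      then have "(\<lambda>x. 1 / 2 * ((n \<bullet> x + - (n \<bullet> p)) + \<bar>n \<bullet> x + - (n \<bullet> p)\<bar>)) \<in> L2_space M\<Omega>"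
        by (intro L2_space_cmult L2_space_add[where f = "\<lambda>x. n \<bullet> x + - (n \<bullet> p)"] L2_space_abs)
      moreover have "(\<lambda>x. 1 / 2 * ((n \<bullet> x + - (n \<bullet> p)) + \<bar>n \<bullet> x + - (n \<bullet> p)\<bar>)) = k"
        by (auto simp: k_def fun_eq_iff max_def)
      ultimately show ?thesis by simp
    qed
    have zk: "z x * laplacian v x = (A \<bullet> x + c) * laplacian v x - J * (k x * laplacian v x)" for x
    proof (cases "x \<in> cball p r")
      case True
      then show ?thesis by (simp add: z k_def inner_diff_right algebra_simps)
    qed (simp add: lap0)
    have "(LINT x|M\<Omega>. z x * laplacian v x) = (LINT x|M\<Omega>. (A \<bullet> x + c) * laplacian v x) - J * (LINT x|M\<Omega>. k x * laplacian v x)"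
      unfolding zk using L2_space_mult_integrable[OF affine_L2 lapL] L2_space_mult_integrable[OF kL lapL] by simp
    then have zJ: "(LINT x|M\<Omega>. z x * laplacian v x) = - (J * (LINT x|M\<Omega>. k x * laplacian v x))"
      by (simp add: affine_laplacian_integral[OF v])
    have "flat 0 (7 / 16) / (2 * r) * (V * (r / 4) ^ d) \<le> (LINT x|M\<Omega>. k x * laplacian v x)"
      using kink_laplacian_integral[OF r n] by (simp add: V_def d_def v_def k_def inner_diff_right)
    moreover have "flat 0 (7 / 16) / (2 * r) * (V * (r / 4) ^ d) = \<kappa> * r ^ d / r"
      using r by (simp add: \<kappa>_def power_divide mult_ac)
    ultimately have kk: "\<kappa> * r ^ d / r \<le> (LINT x|M\<Omega>. k x * laplacian v x)" by simp
    have "\<kappa> * r ^ d / r > 0" using \<kappa> r by simp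
    then have "\<bar>J\<bar> * (\<kappa> * r ^ d / r) \<le> \<bar>J * (LINT x|M\<Omega>. k x * laplacian v x)\<bar>"
      using kk unfolding abs_mult by (intro mult_left_mono) auto
    also have "\<dots> \<le> E + \<bar>LINT x|M\<Omega>. R x * v x\<bar>" using E zJ unfolding v_def[symmetric] by linarith
    also have "\<bar>LINT x|M\<Omega>. R x * v x\<bar> \<le> m * (sqrt (V * r ^ d) * L2_norm (lebesgue_on (cball p r)) R)"
      unfolding v_def V_def d_def by (rule bump_test_le[OF m std_bump_profile r R])
    also have "L2_norm (lebesgue_on (cball p r)) R \<le> sqrt (I + I')"
    proof -
      have "integrable lebesgue (\<lambda>x. indicator S x *\<^sub>R (R x)\<^sup>2)" "integrable lebesgue (\<lambda>x. indicator S' x *\<^sub>R (R x)\<^sup>2)"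
        using L2_spaceD(2)[OF L2_transfer[OF conv S(1,3) R]] L2_spaceD(2)[OF L2_transfer[OF conv S(2,4) R]] S(3,4)
        by (simp_all add: integrable_restrict_space)
      moreover have "integrable lebesgue (\<lambda>x. indicator (cball p r) x *\<^sub>R (R x)\<^sup>2)"
        using L2_spaceD(2)[OF L2_space_subset(1)[OF r(2) _ domain_sets R]] by (simp add: integrable_restrict_space)
      ultimately have "(LINT x|lebesgue. indicator (cball p r) x *\<^sub>R (R x)\<^sup>2)
          \<le> (LINT x|lebesgue. indicator S x *\<^sub>R (R x)\<^sup>2 + indicator S' x *\<^sub>R (R x)\<^sup>2)"
        using BS by (intro integral_mono Bochner_Integration.integrable_add) (auto simp: indicator_def)
      also have "\<dots> = (LINT x|lebesgue. indicator S x *\<^sub>R (R x)\<^sup>2) + (LINT x|lebesgue. indicator S' x *\<^sub>R (R x)\<^sup>2)"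
        by (rule Bochner_Integration.integral_add) fact+
      finally show ?thesis
        unfolding L2_norm_def I_I'_def using S(3,4) by (simp add: integral_restrict_space)
    qed
    finally have "\<bar>J\<bar> * (\<kappa> * r ^ d / r) \<le> E + m * (sqrt (V * r ^ d) * sqrt (I + I'))"
      using mp V r by (simp add: mult_left_mono)
    then have "\<bar>J\<bar> * \<kappa> * r ^ d \<le> r * (E + m * (sqrt (V * r ^ d) * sqrt (I + I')))"
      using r by (simp add: field_simps)
    then have "(\<bar>J\<bar> * \<kappa> * r ^ d)\<^sup>2 \<le> (r * (E + m * (sqrt (V * r ^ d) * sqrt (I + I'))))\<^sup>2"
      using \<kappa> r by (intro power_mono) auto
    also have "\<dots> = r\<^sup>2 * (E + m * (sqrt (V * r ^ d) * sqrt (I + I')))\<^sup>2" by (simp add: power_mult_distrib)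
    also have "\<dots> \<le> r\<^sup>2 * (2 * E\<^sup>2 + 2 * (m * (sqrt (V * r ^ d) * sqrt (I + I')))\<^sup>2)"
      by (intro mult_left_mono square_add_le) auto
    also have "(m * (sqrt (V * r ^ d) * sqrt (I + I')))\<^sup>2 = m\<^sup>2 * V * (r ^ d * (I + I'))"
      using V r I0 by (simp add: power_mult_distrib)
    also have "r\<^sup>2 * (2 * E\<^sup>2 + 2 * (m\<^sup>2 * V * (r ^ d * (I + I')))) \<le> (2 + 2 * m\<^sup>2 * V) * (r\<^sup>2 * (E\<^sup>2 + r ^ d * I + r ^ d * I'))"
    proof -
      have "2 * E\<^sup>2 + 2 * (m\<^sup>2 * V * (r ^ d * (I + I'))) \<le> (2 + 2 * m\<^sup>2 * V) * (E\<^sup>2 + r ^ d * I + r ^ d * I')"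
      proof -
        have "0 \<le> m\<^sup>2 * V * E\<^sup>2" "0 \<le> r ^ d * I" "0 \<le> r ^ d * I'" using V r I0 by auto
        then show ?thesis by (simp add: algebra_simps)
      qed
      then have "r\<^sup>2 * (2 * E\<^sup>2 + 2 * (m\<^sup>2 * V * (r ^ d * (I + I')))) \<le> r\<^sup>2 * ((2 + 2 * m\<^sup>2 * V) * (E\<^sup>2 + r ^ d * I + r ^ d * I'))"
        by (intro mult_left_mono) auto
      then show ?thesis by (simp only: mult.left_commute)
    qed
    finally have "\<kappa>\<^sup>2 * (J\<^sup>2 * (r ^ d)\<^sup>2) \<le> (2 + 2 * m\<^sup>2 * V) * (r\<^sup>2 * (E\<^sup>2 + r ^ d * I + r ^ d * I'))"
      by (simp add: power_mult_distrib mult_ac)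
    then have "J\<^sup>2 * (r ^ d)\<^sup>2 \<le> (2 + 2 * m\<^sup>2 * V) * (r\<^sup>2 * (E\<^sup>2 + r ^ d * I + r ^ d * I')) / \<kappa>\<^sup>2"
      using \<kappa> by (simp add: le_divide_eq mult.commute)
    then show "J\<^sup>2 * (r ^ DIM('a))\<^sup>2 \<le> (2 + 2 * m\<^sup>2 * V) / \<kappa>\<^sup>2 * (r\<^sup>2 * (E\<^sup>2
        + r ^ DIM('a) * (LINT x|lebesgue_on S. (R x)\<^sup>2) + r ^ DIM('a) * (LINT x|lebesgue_on S'. (R x)\<^sup>2)))"
      by (simp add: d_def I_I'_def)
  qed
qed

end


subsection \<open>Surface measure of a side\<close>

text \<open>\<open>side_normal\<close> is a choice, and the inner normal witnesses that its
  specification can be met.\<close>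

lemma side_normal_norm:
  assumes "inner_normal T e n" shows "norm (side_normal e) = 1"
proof -
  have "n \<bullet> (x - y) = 0" if "x \<in> e" "y \<in> e" for x y
    using inner_normalD(4)[OF assms, of x] inner_normalD(4)[OF assms, of y] that by (simp add: inner_diff_right)
  then have "norm n = 1 \<and> (\<forall>x\<in>e. \<forall>y\<in>e. n \<bullet> (x - y) = 0)"
    using inner_normalD(1)[OF assms] by blast
  then show ?thesis unfolding side_normal_def by (rule someI2) blast
qed

text \<open>The prism over \<open>e\<close> is covered by about \<open>1 / h\<close> translates of a ball of radius \<open>2 h\<close>.\<close>

lemma side_measure_le:
  fixes e :: "'a::euclidean_space set"
  assumes e: "compact e" "convex e" "e \<noteq> {}" "e \<subseteq> cball x0 h" and h: "h > 0" and n: "norm (side_normal e) = 1"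
  shows "measure (side_measure e) (space (side_measure e))
    \<le> (1 / h + 1) * (unit_volume TYPE('a) * (2 * h) ^ DIM('a))"
proof -
  define n where "n = side_normal e"
  define A where "A = {x + t *\<^sub>R n |x t. x \<in> e \<and> t \<in> {0..1}}"
  \<comment> \<open>The prism has height one for every \<open>h\<close>; the heights
    \<open>k * h\<close> with \<open>k \<le> N\<close> come within \<open>h\<close> of every height
    in \<open>[0, 1]\<close>, and the cross-section accounts for another \<open>h\<close>.\<close>
  define N where "N = nat \<lfloor>1 / h\<rfloor>"
  define B where "B k = cball (x0 + (real k * h) *\<^sub>R n) (2 * h)" for k :: nat
  have "A = (\<lambda>(x, t). x + t *\<^sub>R n) ` (e \<times> {0..1})" unfolding A_def by (force simp: image_iff)
  also have "compact \<dots>"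
    by (intro compact_continuous_image compact_Times e) (auto simp: case_prod_unfold intro!: continuous_intros)
  finally have "compact A" .
  then have Am: "A \<in> lmeasurable" by (rule lmeasurable_compact)
  have cover: "A \<subseteq> (\<Union>k\<le>N. B k)"
  proof
    fix y assume "y \<in> A"
    then obtain x t where y: "y = x + t *\<^sub>R n" "x \<in> e" "0 \<le> t" "t \<le> 1" by (auto simp: A_def)
    define k where "k = nat \<lfloor>t / h\<rfloor>"
    have "t / h \<le> 1 / h" using y h by (intro divide_right_mono) auto
    then have "k \<le> N" unfolding k_def N_def by (intro nat_mono floor_mono)
    have "0 \<le> t / h" using y h by simp
    then have "real k = of_int \<lfloor>t / h\<rfloor>" by (simp add: k_def)
    then have k: "real k \<le> t / h" "t / h < real k + 1" by linarith+
    then have t: "real k * h \<le> t" "t < real k * h + h" using h by (simp_all add: field_simps)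
    have "dist (x0 + (real k * h) *\<^sub>R n) y = norm ((x0 - x) + (real k * h - t) *\<^sub>R n)"
      by (simp add: y dist_norm algebra_simps)
    also have "\<dots> \<le> norm (x0 - x) + norm ((real k * h - t) *\<^sub>R n)" by (rule norm_triangle_ineq)
    also have "norm ((real k * h - t) *\<^sub>R n) \<le> h" using t n by (simp add: n_def)
    also have "norm (x0 - x) \<le> h" using y(2) e(4) by (auto simp: dist_norm)
    finally have "y \<in> B k" by (simp add: B_def)
    then show "y \<in> (\<Union>k\<le>N. B k)" using \<open>k \<le> N\<close> by blast
  qed
  have "measure lebesgue A \<le> measure lebesgue (\<Union>k\<le>N. B k)"
    using cover Am by (intro measure_mono_fmeasurable fmeasurable.finite_UN) (auto simp: B_def)
  also have "\<dots> \<le> (\<Sum>k\<le>N. measure lebesgue (B k))"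
    by (intro measure_UNION_le) (auto simp: B_def)
  also have "\<dots> = (real N + 1) * (unit_volume TYPE('a) * (2 * h) ^ DIM('a))"
    unfolding B_def using h by (subst measure_cball) auto
  also have "\<dots> \<le> (1 / h + 1) * (unit_volume TYPE('a) * (2 * h) ^ DIM('a))"
  proof (intro mult_right_mono mult_nonneg_nonneg)
    have "0 \<le> 1 / h" using h by simp
    then show "real N + 1 \<le> 1 / h + 1" by (simp add: N_def)
  qed (use h unit_volume_pos[where 'a='a] in auto)
  finally have mA: "measure lebesgue A \<le> (1 / h + 1) * (unit_volume TYPE('a) * (2 * h) ^ DIM('a))" .
  have cl: "convex (affine hull e)" "closed (affine hull e)" "affine hull e \<noteq> {}"
    using e(3) by (auto simp: affine_imp_convex)
  have "continuous_on UNIV (closest_point (affine hull e))"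
    using continuous_on_closest_point[OF cl] .
  then have "closest_point (affine hull e) \<in> borel_measurable borel"
    by (rule borel_measurable_continuous_onI)
  then have cm: "closest_point (affine hull e) \<in> lebesgue_on A \<rightarrow>\<^sub>M borel"
    by (intro measurable_restrict_space1 measurable_completion) simp
  have "measure (side_measure e) UNIV = measure (lebesgue_on A) A"
    unfolding side_measure_def n_def[symmetric] A_def[symmetric]
    using measure_distr[OF cm, of UNIV] by simp
  also have "\<dots> = measure lebesgue A" using Am by (simp add: measure_restrict_space)
  finally show ?thesis using mA by (simp add: side_measure_def)
qed

lemma L2_norm_const_sq: "(L2_norm M (\<lambda>x. c))\<^sup>2 = c\<^sup>2 * measure M (space M)"
  by (simp add: L2_norm_sq mult.commute)

lemma Linf_norm_const_le: "Linf_norm M (\<lambda>x. c) \<le> ennreal \<bar>c\<bar>"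
  unfolding Linf_norm_def by (rule esssup_I) auto


subsection \<open>From tested residuals to indicators\<close>

context bounded_domain
begin

text \<open>The scaling factor \<open>\<tau>\<close> covers the state and the adjoint indicator at once.\<close>

lemma indicator_bound:
  assumes conv: "convex \<Omega>"
  obtains C where "C > 0"
    "\<And>\<T> T R z \<tau> e0 g c r osc. regular_mesh \<Omega> \<T> \<sigma> \<Longrightarrow> T \<in> \<T> \<Longrightarrow> R \<in> L2_space M\<Omega> \<Longrightarrow> \<tau> > 0 \<Longrightarrow> e0 \<ge> 0 \<Longrightarrow>
      (\<And>S. S \<in> \<T> \<Longrightarrow> \<exists>A b. \<forall>x\<in>S. z x = A \<bullet> x + b) \<Longrightarrow>
      r = mesh_ratio TYPE('a) \<sigma> * diameter T \<Longrightarrow>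
      osc = (\<Sum>S\<in>neighbours \<T> T. LINT x|lebesgue_on S. (R x - (g S \<bullet> x + c S))\<^sup>2) \<Longrightarrow>
      (\<And>p \<psi>. \<psi> \<in> profiles \<Longrightarrow> cball p r \<subseteq> \<Omega> \<Longrightarrow> cball p r \<subseteq> \<Union>(neighbours \<T> T) \<Longrightarrow>
        \<tau> * ((LINT x|M\<Omega>. R x * rescale p r \<psi> x) + (LINT x|M\<Omega>. z x * laplacian (rescale p r \<psi>) x))\<^sup>2 \<le> e0) \<Longrightarrow>
      \<tau> * (r ^ DIM('a) * (LINT x|lebesgue_on T. (R x)\<^sup>2)) \<le> C * (e0 + \<tau> * (r ^ DIM('a) * osc)) \<and>
      (\<forall>e\<in>sides_of \<T> T. \<tau> * ((normal_jump \<T> z e)\<^sup>2 * (r ^ DIM('a))\<^sup>2) \<le> C * (r\<^sup>2 * (e0 + \<tau> * (r ^ DIM('a) * osc))))"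
proof -
  obtain m where m: "bump_bound TYPE('a) m" using ex_bump_bound by blast
  \<comment> \<open>Elements of the patch have diameter at most
    \<open>\<sigma> * diameter T\<close>, which is \<open>\<Lambda> * r\<close>. The absolute value
    secures \<open>\<Lambda> \<ge> 0\<close> before a mesh, and with it
    \<open>\<sigma> \<ge> 1\<close>, is fixed.\<close>
  define \<Lambda> where "\<Lambda> = \<bar>\<sigma>\<bar> / mesh_ratio TYPE('a) \<sigma>"
  have "\<Lambda> \<ge> 0" by (simp add: \<Lambda>_def mesh_ratio_def)
  obtain C1 where C1: "C1 > 0"
    "\<And>p r S R E g c. r > 0 \<Longrightarrow> cball p r \<subseteq> \<Omega> \<Longrightarrow> cball p r \<subseteq> S \<Longrightarrow> S \<subseteq> closure \<Omega> \<Longrightarrow> S \<in> sets lebesgue \<Longrightarrow>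
      S \<subseteq> cball p (\<Lambda> * r) \<Longrightarrow> R \<in> L2_space M\<Omega> \<Longrightarrow>
      (\<And>\<psi>. \<psi> \<in> profiles \<Longrightarrow> \<bar>LINT x|M\<Omega>. R x * rescale p r \<psi> x\<bar> \<le> E) \<Longrightarrow>
      r ^ DIM('a) * (LINT x|lebesgue_on S. (R x)\<^sup>2)
        \<le> C1 * (E\<^sup>2 + r ^ DIM('a) * (LINT x|lebesgue_on S. (R x - (g \<bullet> x + c))\<^sup>2))"
    using element_residual_bound[OF m conv \<open>\<Lambda> \<ge> 0\<close>] by blast
  obtain C2 where C2: "C2 > 0"
    "\<And>p r S S' R E z A c J n. r > 0 \<Longrightarrow> cball p r \<subseteq> \<Omega> \<Longrightarrow> cball p r \<subseteq> S \<union> S' \<Longrightarrow>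
      S \<subseteq> closure \<Omega> \<Longrightarrow> S' \<subseteq> closure \<Omega> \<Longrightarrow> S \<in> sets lebesgue \<Longrightarrow> S' \<in> sets lebesgue \<Longrightarrow>
      R \<in> L2_space M\<Omega> \<Longrightarrow> norm n = 1 \<Longrightarrow>
      (\<And>x. x \<in> cball p r \<Longrightarrow> z x = A \<bullet> x + c - J * max 0 (n \<bullet> (x - p))) \<Longrightarrow>
      \<bar>(LINT x|M\<Omega>. R x * rescale p r std_bump x) + (LINT x|M\<Omega>. z x * laplacian (rescale p r std_bump) x)\<bar> \<le> E \<Longrightarrow>
      J\<^sup>2 * (r ^ DIM('a))\<^sup>2 \<le> C2 * (r\<^sup>2 * (E\<^sup>2 + r ^ DIM('a) * (LINT x|lebesgue_on S. (R x)\<^sup>2)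
        + r ^ DIM('a) * (LINT x|lebesgue_on S'. (R x)\<^sup>2)))"
    using side_residual_bound[OF m conv] by blast
  show ?thesis
  proof (rule that[of "C1 + C2 * (1 + 2 * C1)"])
    show "C1 + C2 * (1 + 2 * C1) > 0" using C1(1) C2(1) by (intro add_pos_nonneg) auto
    fix \<T> T R z and \<tau> e0 r osc :: real and g c
    assume mesh: "regular_mesh \<Omega> \<T> \<sigma>" and T: "T \<in> \<T>" and R: "R \<in> L2_space M\<Omega>" and \<tau>: "\<tau> > 0" and e0: "e0 \<ge> 0"
      and z: "\<And>S. S \<in> \<T> \<Longrightarrow> \<exists>A b. \<forall>x\<in>S. z x = A \<bullet> x + b"
      and r_def: "r = mesh_ratio TYPE('a) \<sigma> * diameter T"
      and osc_def: "osc = (\<Sum>S\<in>neighbours \<T> T. LINT x|lebesgue_on S. (R x - (g S \<bullet> x + c S))\<^sup>2)"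
      and test: "\<And>p \<psi>. \<psi> \<in> profiles \<Longrightarrow> cball p r \<subseteq> \<Omega> \<Longrightarrow> cball p r \<subseteq> \<Union>(neighbours \<T> T) \<Longrightarrow>
        \<tau> * ((LINT x|M\<Omega>. R x * rescale p r \<psi> x) + (LINT x|M\<Omega>. z x * laplacian (rescale p r \<psi>) x))\<^sup>2 \<le> e0"
    interpret regular_mesh \<Omega> \<T> \<sigma> by (rule mesh)
    have conforming: "conforming_mesh \<Omega> \<T>" using mesh by (simp add: regular_mesh_def)
    define d where "d = DIM('a)"
    have r: "r > 0" unfolding r_def
      using ball_ratio_pos simplex_diameter_pos[OF element_simplex[OF T]] by simp
    have NT: "neighbours \<T> T \<subseteq> \<T>" by (rule neighbours_subset[OF T])
    have fin: "finite (neighbours \<T> T)"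
      using NT mesh by (auto simp: regular_mesh_def conforming_mesh_def triangulation_def intro: finite_subset)
    define E where "E = sqrt (e0 / \<tau>)"
    have E2: "E\<^sup>2 = e0 / \<tau>" using e0 \<tau> by (simp add: E_def)
    have tE: "\<bar>(LINT x|M\<Omega>. R x * rescale p r \<psi> x) + (LINT x|M\<Omega>. z x * laplacian (rescale p r \<psi>) x)\<bar> \<le> E"
      if "\<psi> \<in> profiles" "cball p r \<subseteq> \<Omega>" "cball p r \<subseteq> \<Union>(neighbours \<T> T)" for p \<psi>
    proof -
      have "((LINT x|M\<Omega>. R x * rescale p r \<psi> x) + (LINT x|M\<Omega>. z x * laplacian (rescale p r \<psi>) x))\<^sup>2 \<le> e0 / \<tau>"
        using test[OF that] \<tau> by (simp add: le_divide_eq mult.commute)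
      then show ?thesis unfolding E_def by (rule real_le_rsqrt[of "\<bar>_\<bar>", unfolded power2_abs])
    qed
    have meas: "S \<in> sets lebesgue" if "S \<in> \<T>" for S
      using simplex_compact[OF element_simplex[OF that]] by (simp add: lmeasurable_compact fmeasurableD)
    define I where "I S = (LINT x|lebesgue_on S. (R x)\<^sup>2)" for S
    have osc_le: "(LINT x|lebesgue_on S. (R x - (g S \<bullet> x + c S))\<^sup>2) \<le> osc" if "S \<in> neighbours \<T> T" for S
      unfolding osc_def
      by (rule member_le_sum[OF that _ fin, of "\<lambda>S. LINT x|lebesgue_on S. (R x - (g S \<bullet> x + c S))\<^sup>2"]) (auto intro!: integral_nonneg_AE)
    have elem: "r ^ d * I S \<le> C1 * (E\<^sup>2 + r ^ d * osc)" if S: "S \<in> neighbours \<T> T" for S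
    proof -
      have ST: "S \<in> \<T>" using NT S by blast
      obtain p where p: "cball p r \<subseteq> S" "cball p r \<subseteq> \<Omega>" unfolding r_def by (rule element_ball[OF T S])
      have "p \<in> S" using p(1) r by auto
      have ball: "S \<subseteq> cball p (\<Lambda> * r)"
      proof
        fix x assume "x \<in> S"
        then have "dist p x \<le> diameter S" using \<open>p \<in> S\<close> by (intro diameter_bounded_bound element_bounded[OF ST])
        also have "\<dots> \<le> \<sigma> * diameter T" by (rule patch_diameter[OF T S])
        also have "\<dots> = \<Lambda> * r" using ball_ratio_pos \<sigma> by (simp add: \<Lambda>_def r_def)
        finally show "x \<in> cball p (\<Lambda> * r)" by simp
      qed
      obtain A b where Ab: "\<forall>x\<in>S. z x = A \<bullet> x + b" using z[OF ST] by blast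
      \<comment> \<open>On this ball \<open>z\<close> is affine, so its pairing with the Laplacian
        vanishes and the hypothesis on the tested sum concerns \<open>R\<close> alone.\<close>
      have "\<bar>LINT x|M\<Omega>. R x * rescale p r \<psi> x\<bar> \<le> E" if \<psi>: "\<psi> \<in> profiles" for \<psi>
      proof -
        have eq: "z x * laplacian (rescale p r \<psi>) x = (A \<bullet> x + b) * laplacian (rescale p r \<psi>) x" for x
        proof (cases "x \<in> cball p r")
          case True
          then show ?thesis using Ab p(1) by auto
        next
          case False
          have "laplacian (rescale p r \<psi>) x = 0" using rescale_support[OF \<psi> r] False by (rule laplacian_eq_0)
          then show ?thesis by simp
        qed
        have "(LINT x|M\<Omega>. z x * laplacian (rescale p r \<psi>) x) = 0"
          unfolding eq by (rule affine_laplacian_integral[OF rescale_test[OF \<psi> r p(2)]])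
        moreover have "cball p r \<subseteq> \<Union>(neighbours \<T> T)" using p(1) S by blast
        ultimately show ?thesis using tE[OF \<psi> p(2)] by simp
      qed
      then have "r ^ d * I S \<le> C1 * (E\<^sup>2 + r ^ d * (LINT x|lebesgue_on S. (R x - (g S \<bullet> x + c S))\<^sup>2))"
        unfolding d_def I_def by (rule C1(2)[OF r p(2,1) element_subset[OF ST] meas[OF ST] ball R])
      also have "\<dots> \<le> C1 * (E\<^sup>2 + r ^ d * osc)"
        using C1(1) r osc_le[OF S] by (intro mult_left_mono add_left_mono) auto
      finally show ?thesis .
    qed
    have osc0: "0 \<le> osc" unfolding osc_def by (intro sum_nonneg) (auto intro!: integral_nonneg_AE)
    define X where "X = E\<^sup>2 + r ^ d * osc"
    have X0: "X \<ge> 0" using r osc0 by (simp add: X_def)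
    have \<tau>X: "\<tau> * X = e0 + \<tau> * (r ^ d * osc)" using \<tau> by (simp add: X_def E2 distrib_left)
    have side: "(normal_jump \<T> z e)\<^sup>2 * (r ^ d)\<^sup>2 \<le> C2 * (1 + 2 * C1) * (r\<^sup>2 * X)" if e: "e \<in> sides_of \<T> T" for e
    proof -
      obtain T' n where T': "T' \<in> \<T>" "T' \<noteq> T" "e facet_of T" "e facet_of T'" "T' \<in> neighbours \<T> T"
        and n: "inner_normal T e n" "inner_normal T' e (- n)" and two: "{S \<in> \<T>. e facet_of S} = {T, T'}"
        by (rule side_neighbour[OF conforming T e]) blast
      obtain A b where Ab: "\<forall>x\<in>T. z x = A \<bullet> x + b" using z[OF T] by blast
      obtain A' b' where Ab': "\<forall>x\<in>T'. z x = A' \<bullet> x + b'" using z[OF T'(1)] by blast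
      note fb = facet_ball[OF T T'(1,3,4) n, folded r_def]
      have TN: "T \<in> neighbours \<T> T" by (simp add: neighbours_def)
      have sub: "cball (facet_center e) r \<subseteq> \<Union>(neighbours \<T> T)" using fb(4) TN T'(5) by blast
      have zx: "z x = A \<bullet> x + b - normal_jump \<T> z e * max 0 (- n \<bullet> (x - facet_center e))"
        if "x \<in> cball (facet_center e) r" for x
        by (rule piecewise_affine_across_side[OF T T'(1,2,3,4) two n Ab Ab' that[unfolded r_def]])
      have nn: "norm (- n) = 1" using inner_normalD(1)[OF n(1)] by simp
      have "(normal_jump \<T> z e)\<^sup>2 * (r ^ d)\<^sup>2 \<le> C2 * (r\<^sup>2 * (E\<^sup>2 + r ^ d * I T + r ^ d * I T'))"
        using C2(2)[OF r fb(3,4) element_subset[OF T] element_subset[OF T'(1)] meas[OF T] meas[OF T'(1)] R nn zx tE[OF std_bump_profile fb(3) sub]]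
        by (simp add: d_def I_def)
      also have "\<dots> \<le> C2 * (r\<^sup>2 * (X + C1 * X + C1 * X))"
      proof (intro mult_left_mono add_mono)
        show "E\<^sup>2 \<le> X" using r osc0 by (simp add: X_def)
        show "r ^ d * I T \<le> C1 * X" unfolding X_def by (rule elem[OF TN])
        show "r ^ d * I T' \<le> C1 * X" unfolding X_def by (rule elem[OF T'(5)])
      qed (use C2(1) in auto)
      also have "\<dots> = C2 * (1 + 2 * C1) * (r\<^sup>2 * X)" by (simp add: algebra_simps)
      finally show ?thesis .
    qed
    have c: "C1 \<le> C1 + C2 * (1 + 2 * C1)" "C2 * (1 + 2 * C1) \<le> C1 + C2 * (1 + 2 * C1)" using C1(1) C2(1) by auto
    have "T \<in> neighbours \<T> T" by (simp add: neighbours_def)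
    then have "\<tau> * (r ^ d * I T) \<le> \<tau> * (C1 * X)" using \<tau> elem unfolding X_def by (intro mult_left_mono) auto
    also have "\<dots> = C1 * (\<tau> * X)" by simp
    also have "\<dots> \<le> (C1 + C2 * (1 + 2 * C1)) * (\<tau> * X)" using c \<tau> X0 by (intro mult_right_mono) auto
    finally have 1: "\<tau> * (r ^ d * I T) \<le> (C1 + C2 * (1 + 2 * C1)) * (\<tau> * X)" .
    have 2: "\<tau> * ((normal_jump \<T> z e)\<^sup>2 * (r ^ d)\<^sup>2) \<le> (C1 + C2 * (1 + 2 * C1)) * (r\<^sup>2 * (\<tau> * X))"
      if "e \<in> sides_of \<T> T" for e
    proof -
      have "\<tau> * ((normal_jump \<T> z e)\<^sup>2 * (r ^ d)\<^sup>2) \<le> \<tau> * (C2 * (1 + 2 * C1) * (r\<^sup>2 * X))"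
        using side[OF that] \<tau> by (intro mult_left_mono) auto
      also have "\<dots> = C2 * (1 + 2 * C1) * (r\<^sup>2 * (\<tau> * X))" by simp
      also have "\<dots> \<le> (C1 + C2 * (1 + 2 * C1)) * (r\<^sup>2 * (\<tau> * X))" using c \<tau> X0 by (intro mult_right_mono) auto
      finally show ?thesis .
    qed
    show "\<tau> * (r ^ DIM('a) * (LINT x|lebesgue_on T. (R x)\<^sup>2)) \<le> (C1 + C2 * (1 + 2 * C1)) * (e0 + \<tau> * (r ^ DIM('a) * osc)) \<and>
      (\<forall>e\<in>sides_of \<T> T. \<tau> * ((normal_jump \<T> z e)\<^sup>2 * (r ^ DIM('a))\<^sup>2)
        \<le> (C1 + C2 * (1 + 2 * C1)) * (r\<^sup>2 * (e0 + \<tau> * (r ^ DIM('a) * osc))))"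
      using 1 2 unfolding \<tau>X d_def I_def by blast
  qed
qed

end


subsection \<open>Scaling of the tested residuals\<close>

context discrete_test
begin

lemma measure_ball: "measure lebesgue B = unit_volume TYPE('a) * r ^ DIM('a)"
  using measure_cball[of r x0] r_pos by simp

text \<open>The weight \<open>r ^ (4 - d)\<close> cancels \<open>measure lebesgue B / r ^ 4\<close>,
  the square of the factor with which the Laplacian meets the state error. For the nonlinear term
  \<open>r ^ (4 - d) \<le> D ^ 4\<close> is enough.\<close>

lemma state_residual_scaled:
  assumes dim: "DIM('a) \<le> 4" and D: "r \<le> D" "1 \<le> D"
  shows "r ^ (4 - DIM('a)) * ((LINT x|M\<Omega>. (ul x - f x (yl x)) * v x) + (LINT x|M\<Omega>. yl x * laplacian v x))\<^sup>2
    \<le> 2 * m\<^sup>2 * (1 + 2 * K\<^sup>2 * W\<^sup>2 * D ^ 4 + 2 * unit_volume TYPE('a)) * (r ^ (4 - DIM('a)) * U\<^sup>2 + Y\<^sup>2)"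
proof -
  define d where "d = DIM('a)"
  define V where "V = unit_volume TYPE('a)"
  define \<tau> where "\<tau> = r ^ (4 - d)"
  have V: "V > 0" unfolding V_def by (rule unit_volume_pos)
  have \<tau>0: "\<tau> > 0" using r_pos by (simp add: \<tau>_def)
  have "\<tau> \<le> D ^ (4 - d)" unfolding \<tau>_def using r_pos D by (intro power_mono) auto
  also have "\<dots> \<le> D ^ 4" using D by (intro power_increasing) auto
  finally have \<tau>D: "\<tau> \<le> D ^ 4" .
  have \<tau>r: "\<tau> * r ^ d = r ^ 4" using dim by (simp add: \<tau>_def d_def flip: power_add)
  define I where "I = (LINT x|M\<Omega>. (ul x - f x (yl x)) * v x) + (LINT x|M\<Omega>. yl x * laplacian v x)"
  define k where "k = K * W + sqrt (V * r ^ d) / r\<^sup>2"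
  have "\<bar>I\<bar> \<le> m * (U + k * Y)"
    using state_residual_le unfolding measure_ball I_def k_def V_def d_def .
  then have "I\<^sup>2 \<le> (m * (U + k * Y))\<^sup>2" by (metis abs_ge_zero power2_abs power_mono)
  also have "\<dots> = m\<^sup>2 * (U + k * Y)\<^sup>2" by (simp add: power_mult_distrib)
  also have "\<dots> \<le> m\<^sup>2 * (2 * U\<^sup>2 + 2 * (k * Y)\<^sup>2)" by (intro mult_left_mono square_add_le) auto
  finally have "\<tau> * I\<^sup>2 \<le> \<tau> * (m\<^sup>2 * (2 * U\<^sup>2 + 2 * (k * Y)\<^sup>2))" using \<tau>0 by (intro mult_left_mono) auto
  also have "\<dots> = 2 * m\<^sup>2 * (\<tau> * U\<^sup>2 + (\<tau> * k\<^sup>2) * Y\<^sup>2)" by (simp add: power_mult_distrib algebra_simps)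
  also have "\<dots> \<le> 2 * m\<^sup>2 * (\<tau> * U\<^sup>2 + (2 * K\<^sup>2 * W\<^sup>2 * D ^ 4 + 2 * V) * Y\<^sup>2)"
  proof (intro mult_left_mono add_left_mono mult_right_mono)
    have "\<tau> * k\<^sup>2 \<le> \<tau> * (2 * (K * W)\<^sup>2 + 2 * (sqrt (V * r ^ d) / r\<^sup>2)\<^sup>2)"
      unfolding k_def using \<tau>0 by (intro mult_left_mono square_add_le) auto
    also have "(sqrt (V * r ^ d) / r\<^sup>2)\<^sup>2 = V * r ^ d / r ^ 4"
      using V r_pos by (simp add: power_divide flip: power_mult)
    also have "\<tau> * (2 * (K * W)\<^sup>2 + 2 * (V * r ^ d / r ^ 4)) = 2 * (K * W)\<^sup>2 * \<tau> + 2 * V * (\<tau> * r ^ d) / r ^ 4"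
      by (simp add: algebra_simps)
    also have "\<dots> = 2 * (K * W)\<^sup>2 * \<tau> + 2 * V" using r_pos by (simp add: \<tau>r)
    also have "\<dots> \<le> 2 * (K * W)\<^sup>2 * D ^ 4 + 2 * V" by (intro add_right_mono mult_left_mono \<tau>D) auto
    finally show "\<tau> * k\<^sup>2 \<le> 2 * K\<^sup>2 * W\<^sup>2 * D ^ 4 + 2 * V" by (simp add: power_mult_distrib)
  qed auto
  also have "\<dots> \<le> 2 * m\<^sup>2 * ((1 + 2 * K\<^sup>2 * W\<^sup>2 * D ^ 4 + 2 * V) * (\<tau> * U\<^sup>2 + Y\<^sup>2))"
  proof (intro mult_left_mono)
    have "0 \<le> (2 * K\<^sup>2 * W\<^sup>2 * D ^ 4 + 2 * V) * (\<tau> * U\<^sup>2)" using V \<tau>0 D by (intro mult_nonneg_nonneg add_nonneg_nonneg) auto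
    then show "\<tau> * U\<^sup>2 + (2 * K\<^sup>2 * W\<^sup>2 * D ^ 4 + 2 * V) * Y\<^sup>2 \<le> (1 + 2 * K\<^sup>2 * W\<^sup>2 * D ^ 4 + 2 * V) * (\<tau> * U\<^sup>2 + Y\<^sup>2)"
      by (simp add: algebra_simps)
  qed auto
  finally show ?thesis by (simp add: I_def \<tau>_def V_def d_def mult.assoc)
qed

text \<open>The weight cancels the square of \<open>measure lebesgue B / r^2\<close>, the factor of
  \<open>P\<close>. Terms with the square root of the volume retain \<open>r ^ (4 - d)\<close>,
  which is bounded. The term with the norm of \<open>pl\<close> has no power of the volume to spare,
  hence the assumption \<open>Q\<close> at exactly this weight.\<close>

lemma adjoint_residual_scaled:
  assumes dim: "DIM('a) \<le> 4" and D: "r \<le> D" "1 \<le> D"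
    and P: "AE x in lebesgue_on \<omega>. \<bar>pb x - pl x\<bar> \<le> P" "P \<ge> 0"
    and Q: "r ^ 4 / (r ^ DIM('a))\<^sup>2 * (LINT x|lebesgue_on B. (pl x)\<^sup>2) \<le> Q"
  defines "V \<equiv> unit_volume TYPE('a)"
  shows "r ^ 4 / (r ^ DIM('a))\<^sup>2 *
      ((LINT x|M\<Omega>. (yl x - y\<^sub>\<Omega> x - dy f x (yl x) * pl x) * v x) + (LINT x|M\<Omega>. pl x * laplacian v x))\<^sup>2
    \<le> 4 * m\<^sup>2 * (V * D ^ 4 + V\<^sup>2 + K\<^sup>2 * W\<^sup>2 * V * D ^ 4 + K\<^sup>2 * Q) * (Y\<^sup>2 + P\<^sup>2)"
proof -
  define d where "d = DIM('a)"
  define \<tau> where "\<tau> = r ^ 4 / (r ^ d)\<^sup>2"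
  define L where "L = L2_norm (lebesgue_on B) pl"
  have V: "V > 0" unfolding V_def by (rule unit_volume_pos)
  have \<tau>0: "\<tau> > 0" using r_pos by (simp add: \<tau>_def)
  have "r ^ (4 - d) \<le> D ^ (4 - d)" using r_pos D by (intro power_mono) auto
  also have "\<dots> \<le> D ^ 4" using D by (intro power_increasing) auto
  finally have rD: "r ^ (4 - d) \<le> D ^ 4" .
  have "r ^ 4 = r ^ (4 - d) * r ^ d" using dim by (simp add: d_def flip: power_add)
  then have \<tau>r: "\<tau> * r ^ d = r ^ (4 - d)" using r_pos by (simp add: \<tau>_def power2_eq_square)
  have QL: "\<tau> * L\<^sup>2 \<le> Q" using Q by (simp add: \<tau>_def L_def L2_norm_sq d_def)
  have "0 \<le> \<tau> * L\<^sup>2" using \<tau>0 by (intro mult_nonneg_nonneg) auto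
  then have Q0: "Q \<ge> 0" using QL by linarith
  define I where "I = (LINT x|M\<Omega>. (yl x - y\<^sub>\<Omega> x - dy f x (yl x) * pl x) * v x) + (LINT x|M\<Omega>. pl x * laplacian v x)"
  define s where "s = sqrt (V * r ^ d)"
  have s2: "s\<^sup>2 = V * r ^ d" using V r_pos by (simp add: s_def)
  define a1 a2 a3 a4 where "a1 = s * Y" and "a2 = P * (V * r ^ d) / r\<^sup>2" and "a3 = K * P * (s * W)" and "a4 = K * (Y * L)"
  have "\<bar>I\<bar> \<le> m * (a1 + a2 + a3 + a4)"
    using adjoint_residual_le[OF P] unfolding measure_ball I_def a1_def a2_def a3_def a4_def s_def V_def d_def L_def .
  then have "I\<^sup>2 \<le> (m * (a1 + a2 + a3 + a4))\<^sup>2" by (metis abs_ge_zero power2_abs power_mono)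
  also have "\<dots> = m\<^sup>2 * ((a1 + a2) + (a3 + a4))\<^sup>2" by (simp add: power_mult_distrib add.assoc)
  also have "\<dots> \<le> m\<^sup>2 * (4 * (a1\<^sup>2 + a2\<^sup>2 + a3\<^sup>2 + a4\<^sup>2))"
  proof (intro mult_left_mono)
    show "((a1 + a2) + (a3 + a4))\<^sup>2 \<le> 4 * (a1\<^sup>2 + a2\<^sup>2 + a3\<^sup>2 + a4\<^sup>2)"
      by (rule square_add4_le)
  qed auto
  finally have "\<tau> * I\<^sup>2 \<le> \<tau> * (m\<^sup>2 * (4 * (a1\<^sup>2 + a2\<^sup>2 + a3\<^sup>2 + a4\<^sup>2)))" using \<tau>0 by (intro mult_left_mono) auto
  also have "\<dots> = 4 * m\<^sup>2 * (\<tau> * a1\<^sup>2 + \<tau> * a2\<^sup>2 + \<tau> * a3\<^sup>2 + \<tau> * a4\<^sup>2)" by (simp add: algebra_simps)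
  also have "\<dots> \<le> 4 * m\<^sup>2 * (V * D ^ 4 * Y\<^sup>2 + V\<^sup>2 * P\<^sup>2 + K\<^sup>2 * W\<^sup>2 * V * D ^ 4 * P\<^sup>2 + K\<^sup>2 * Q * Y\<^sup>2)"
  proof (intro mult_left_mono add_mono)
    have "\<tau> * a1\<^sup>2 = V * (\<tau> * r ^ d) * Y\<^sup>2" by (simp add: a1_def power_mult_distrib s2)
    also have "\<dots> \<le> V * D ^ 4 * Y\<^sup>2" unfolding \<tau>r using V rD by (intro mult_right_mono mult_left_mono) auto
    finally show "\<tau> * a1\<^sup>2 \<le> V * D ^ 4 * Y\<^sup>2" .
    have "\<tau> * a2\<^sup>2 = V\<^sup>2 * P\<^sup>2"
      using r_pos by (simp add: a2_def \<tau>_def power_divide power_mult_distrib flip: power_mult)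
    then show "\<tau> * a2\<^sup>2 \<le> V\<^sup>2 * P\<^sup>2" by simp
    have "\<tau> * a3\<^sup>2 = K\<^sup>2 * W\<^sup>2 * (V * (\<tau> * r ^ d)) * P\<^sup>2" by (simp add: a3_def power_mult_distrib s2)
    also have "\<dots> \<le> K\<^sup>2 * W\<^sup>2 * (V * D ^ 4) * P\<^sup>2" unfolding \<tau>r using V rD by (intro mult_right_mono mult_left_mono) auto
    finally show "\<tau> * a3\<^sup>2 \<le> K\<^sup>2 * W\<^sup>2 * V * D ^ 4 * P\<^sup>2" by (simp add: mult.assoc)
    have "\<tau> * a4\<^sup>2 = K\<^sup>2 * (\<tau> * L\<^sup>2) * Y\<^sup>2" by (simp add: a4_def power_mult_distrib)
    also have "\<dots> \<le> K\<^sup>2 * Q * Y\<^sup>2" using QL by (intro mult_right_mono mult_left_mono) auto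
    finally show "\<tau> * a4\<^sup>2 \<le> K\<^sup>2 * Q * Y\<^sup>2" .
  qed auto
  also have "\<dots> \<le> 4 * m\<^sup>2 * ((V * D ^ 4 + V\<^sup>2 + K\<^sup>2 * W\<^sup>2 * V * D ^ 4 + K\<^sup>2 * Q) * (Y\<^sup>2 + P\<^sup>2))"
  proof (intro mult_left_mono)
    have "0 \<le> (V * D ^ 4 + K\<^sup>2 * Q) * P\<^sup>2" "0 \<le> (V\<^sup>2 + K\<^sup>2 * W\<^sup>2 * V * D ^ 4) * Y\<^sup>2"
      using V D Q0 by (auto intro!: mult_nonneg_nonneg add_nonneg_nonneg)
    then show "V * D ^ 4 * Y\<^sup>2 + V\<^sup>2 * P\<^sup>2 + K\<^sup>2 * W\<^sup>2 * V * D ^ 4 * P\<^sup>2 + K\<^sup>2 * Q * Y\<^sup>2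
        \<le> (V * D ^ 4 + V\<^sup>2 + K\<^sup>2 * W\<^sup>2 * V * D ^ 4 + K\<^sup>2 * Q) * (Y\<^sup>2 + P\<^sup>2)"
      by (simp add: algebra_simps)
  qed auto
  finally show ?thesis by (simp add: I_def \<tau>_def d_def mult.assoc)
qed

end

context bounded_domain
begin

text \<open>For \<open>d = 2\<close> the weight is 1 and the Poincare inequality suffices. For
  \<open>d = 3\<close> it is \<open>1 / r^2\<close>: on the ball the Hardy weight with
  \<open>\<epsilon> = r^2\<close> is at least \<open>1 / (2 * r^2)\<close>, whence the constant
  \<open>2 * 16\<close>.\<close>

lemma local_L2_bound:
  assumes dim: "DIM('a) \<in> {2, 3}"
  obtains C where "C > 0"
    "\<And>u p r. u \<in> H10_space \<Omega> \<Longrightarrow> r > 0 \<Longrightarrow> cball p r \<subseteq> \<Omega> \<Longrightarrow>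
      r ^ 4 / (r ^ DIM('a))\<^sup>2 * (LINT x|lebesgue_on (cball p r). (u x)\<^sup>2) \<le> C * (LINT x|M\<Omega>. (norm (grad \<Omega> u x))\<^sup>2)"
proof (cases "DIM('a) = 2")
  case True
  obtain C where C: "C > 0"
    "\<And>u. u \<in> H10_space \<Omega> \<Longrightarrow> (LINT x|M\<Omega>. (u x)\<^sup>2) \<le> C * (LINT x|M\<Omega>. (norm (grad \<Omega> u x))\<^sup>2)"
    by (rule Poincare_inequality) blast
  show ?thesis
  proof (rule that[OF C(1)])
    fix u p and r :: real assume u: "u \<in> H10_space \<Omega>" and r: "r > 0" "cball p r \<subseteq> \<Omega>"
    have "r ^ 4 / (r ^ DIM('a))\<^sup>2 = 1" using r True by (simp flip: power_mult)
    moreover have "(LINT x|lebesgue_on (cball p r). (u x)\<^sup>2) \<le> (LINT x|M\<Omega>. (u x)\<^sup>2)"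
      by (rule lebesgue_on_subset_mono(2)[OF r(2) _ domain_sets L2_spaceD(2)[OF H10_L2[OF u]]]) auto
    ultimately show "r ^ 4 / (r ^ DIM('a))\<^sup>2 * (LINT x|lebesgue_on (cball p r). (u x)\<^sup>2) \<le> C * (LINT x|M\<Omega>. (norm (grad \<Omega> u x))\<^sup>2)"
      using C(2)[OF u] by simp
  qed
next
  case False
  then have d3: "DIM('a) = 3" using dim by simp
  show ?thesis
  proof (rule that[of 32])
    fix u p and r :: real assume u: "u \<in> H10_space \<Omega>" and r: "r > 0" "cball p r \<subseteq> \<Omega>"
    define \<rho> where "\<rho> x = inverse ((norm (x - p))\<^sup>2 + r\<^sup>2)" for x
    have q: "(norm (x - p))\<^sup>2 + r\<^sup>2 \<ge> r\<^sup>2" "(norm (x - p))\<^sup>2 + r\<^sup>2 > 0" for x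
      using r by (auto simp: add_nonneg_pos)
    have \<rho>0: "\<rho> x \<ge> 0" for x unfolding \<rho>_def using q(2)[of x] by simp
    have \<rho>1: "\<rho> x \<le> inverse (r\<^sup>2)" for x unfolding \<rho>_def using q(1)[of x] r by (intro le_imp_inverse_le) auto
    have cont: "continuous_on UNIV \<rho>"
      unfolding \<rho>_def using q(2) by (intro continuous_intros) (metis less_irrefl)
    have i: "integrable M\<Omega> (\<lambda>x. \<rho> x * (u x)\<^sup>2)"
    proof (rule Bochner_Integration.integrable_bound)
      show "integrable M\<Omega> (\<lambda>x. inverse (r\<^sup>2) * (u x)\<^sup>2)" by (intro integrable_mult_right L2_spaceD(2) H10_L2 u)
      show "(\<lambda>x. \<rho> x * (u x)\<^sup>2) \<in> borel_measurable M\<Omega>"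
        using continuous_measurable_lebesgue_on[OF cont] L2_spaceD(1)[OF H10_L2[OF u]] by auto
      show "AE x in M\<Omega>. norm (\<rho> x * (u x)\<^sup>2) \<le> norm (inverse (r\<^sup>2) * (u x)\<^sup>2)"
        using \<rho>0 \<rho>1 by (intro AE_I2) (simp add: abs_mult mult_right_mono)
    qed
    have iB: "integrable (lebesgue_on (cball p r)) (\<lambda>x. \<rho> x * (u x)\<^sup>2)"
      by (rule lebesgue_on_subset_mono(1)[OF r(2) _ domain_sets i]) auto
    have "(LINT x|lebesgue_on (cball p r). (u x)\<^sup>2) \<le> (LINT x|lebesgue_on (cball p r). 2 * r\<^sup>2 * (\<rho> x * (u x)\<^sup>2))"
    proof (rule integral_mono)
      show "integrable (lebesgue_on (cball p r)) (\<lambda>x. (u x)\<^sup>2)"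
        by (rule lebesgue_on_subset_mono(1)[OF r(2) _ domain_sets L2_spaceD(2)[OF H10_L2[OF u]]]) auto
      show "integrable (lebesgue_on (cball p r)) (\<lambda>x. 2 * r\<^sup>2 * (\<rho> x * (u x)\<^sup>2))" using iB by (rule integrable_mult_right)
      fix x assume "x \<in> space (lebesgue_on (cball p r))"
      then have "norm (x - p) \<le> r" by (simp add: dist_norm norm_minus_commute)
      then have "(norm (x - p))\<^sup>2 \<le> r\<^sup>2" by (intro power_mono) auto
      then have "1 \<le> 2 * r\<^sup>2 * \<rho> x" unfolding \<rho>_def using q(2)[of x] by (simp add: divide_inverse[symmetric] le_divide_eq)
      then have "1 * (u x)\<^sup>2 \<le> (2 * r\<^sup>2 * \<rho> x) * (u x)\<^sup>2" by (intro mult_right_mono) auto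
      then show "(u x)\<^sup>2 \<le> 2 * r\<^sup>2 * (\<rho> x * (u x)\<^sup>2)" by (simp add: mult.assoc)
    qed
    also have "\<dots> = 2 * r\<^sup>2 * (LINT x|lebesgue_on (cball p r). \<rho> x * (u x)\<^sup>2)" by simp
    also have "\<dots> \<le> 2 * r\<^sup>2 * (LINT x|M\<Omega>. \<rho> x * (u x)\<^sup>2)"
      using \<rho>0 by (intro mult_left_mono lebesgue_on_subset_mono(2)[OF r(2) _ domain_sets i]) auto
    also have "\<dots> \<le> 2 * r\<^sup>2 * (16 * (LINT x|M\<Omega>. (norm (grad \<Omega> u x))\<^sup>2))"
      unfolding \<rho>_def using r d3 by (intro mult_left_mono Hardy_inequality u) auto
    finally have "r ^ 4 / (r ^ DIM('a))\<^sup>2 * (LINT x|lebesgue_on (cball p r). (u x)\<^sup>2)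
        \<le> r ^ 4 / (r ^ DIM('a))\<^sup>2 * (2 * r\<^sup>2 * (16 * (LINT x|M\<Omega>. (norm (grad \<Omega> u x))\<^sup>2)))"
      using r by (intro mult_left_mono) auto
    also have "\<dots> = 32 * (LINT x|M\<Omega>. (norm (grad \<Omega> u x))\<^sup>2)"
      using r d3 by (simp add: field_simps flip: power_mult power_add)
    finally show "r ^ 4 / (r ^ DIM('a))\<^sup>2 * (LINT x|lebesgue_on (cball p r). (u x)\<^sup>2) \<le> 32 * (LINT x|M\<Omega>. (norm (grad \<Omega> u x))\<^sup>2)" .
  qed auto
qed

end


subsection \<open>Local lower bounds for the two indicators\<close>

lemma fe_spaceD:
  assumes "v \<in> fe_space \<Omega> \<T>"
  shows "v \<in> H10_space \<Omega>" "continuous_on (closure \<Omega>) v" "\<And>S. S \<in> \<T> \<Longrightarrow> \<exists>A b. \<forall>x\<in>S. v x = A \<bullet> x + b"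
  using assms by (auto simp: fe_space_def)

lemma mesh_ratio_le_1: "\<sigma> \<ge> 1 \<Longrightarrow> mesh_ratio TYPE('a::euclidean_space) \<sigma> \<le> 1"
proof -
  assume "\<sigma> \<ge> 1"
  then have "1 \<le> \<sigma>\<^sup>2" by (rule one_le_power)
  moreover have "1 \<le> 8 * real DIM('a)" using DIM_ge_Suc0[where 'a='a] by linarith
  ultimately have "1 * 1 \<le> (8 * real DIM('a)) * \<sigma>\<^sup>2" by (intro mult_mono) auto
  then show ?thesis by (simp add: mesh_ratio_def)
qed

context semilinear
begin

text \<open>The added 1 makes powers increase with the exponent and absorbs the \<open>h + 1\<close>
  that stems from prisms of height one.\<close>

definition "domain_diameter = diameter (closure \<Omega>) + 1"

lemma domain_diameter_ge_1: "domain_diameter \<ge> 1"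
  using diameter_ge_0[OF bounded_closure[OF bounded_domain]] by (simp add: domain_diameter_def)

lemma element_diameter_le:
  assumes "S \<subseteq> closure \<Omega>" shows "diameter S + 1 \<le> domain_diameter"
  unfolding domain_diameter_def
  by (intro add_right_mono diameter_subset assms bounded_closure bounded_domain)

lemma patch_subset:
  assumes "regular_mesh \<Omega> \<T> \<sigma>" "T \<in> \<T>"
  shows "\<Union>(neighbours \<T> T) \<subseteq> closure \<Omega>" "\<Union>(neighbours \<T> T) \<in> sets lebesgue" "finite (neighbours \<T> T)"
    "S \<in> neighbours \<T> T \<Longrightarrow> S \<in> \<T>"
proof -
  interpret regular_mesh \<Omega> \<T> \<sigma> by (rule assms(1))
  have NT: "neighbours \<T> T \<subseteq> \<T>" by (rule neighbours_subset[OF assms(2)])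
  then show "S \<in> neighbours \<T> T \<Longrightarrow> S \<in> \<T>" by blast
  show fin: "finite (neighbours \<T> T)"
    using NT mesh by (auto simp: conforming_mesh_def triangulation_def intro: finite_subset)
  show "\<Union>(neighbours \<T> T) \<subseteq> closure \<Omega>" using NT element_subset by blast
  have "compact (\<Union>(neighbours \<T> T))"
    using NT simplex_compact[OF element_simplex] by (intro compact_Union fin) auto
  then show "\<Union>(neighbours \<T> T) \<in> sets lebesgue" by (simp add: lmeasurable_compact fmeasurableD)
qed

lemma discrete_test_rescale:
  assumes "discrete_approximation \<Omega> f y\<^sub>\<Omega> K ub yb pb ul yl pl W" "regular_mesh \<Omega> \<T> \<sigma>" "T \<in> \<T>"
    and m: "bump_bound TYPE('a) m" and \<psi>: "\<psi> \<in> profiles" and r: "r > 0" "cball p r \<subseteq> \<Omega>" "cball p r \<subseteq> \<Union>(neighbours \<T> T)"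
  shows "discrete_test \<Omega> f y\<^sub>\<Omega> K ub yb pb ul yl pl W (rescale p r \<psi>) p r m (\<Union>(neighbours \<T> T))"
proof -
  interpret discrete_approximation \<Omega> f y\<^sub>\<Omega> K ub yb pb ul yl pl W by (rule assms(1))
  have b: "\<bar>\<psi> z\<bar> \<le> m" "\<bar>laplacian \<psi> z\<bar> \<le> m" for z using m \<psi> by (auto simp: bump_bound_def)
  show ?thesis
  proof unfold_locales
    show "rescale p r \<psi> \<in> test_functions \<Omega>" by (rule rescale_test[OF \<psi> r(1,2)])
    show "rescale p r \<psi> x = 0" if "x \<notin> cball p r" for x by (rule rescale_support[OF \<psi> r(1) that])
    show "\<bar>rescale p r \<psi> x\<bar> \<le> m" for x unfolding rescale_def by (rule b(1))
    show "\<bar>laplacian (rescale p r \<psi>) x\<bar> \<le> m / r\<^sup>2" for x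
      unfolding rescale_laplacian[OF profiles_test[OF \<psi>]] abs_divide abs_power2
      using b(2) by (intro divide_right_mono) auto
  qed (use r patch_subset[OF assms(2,3)] in auto)
qed

lemma oscillation_sq: "(oscillation S h)\<^sup>2 = (LINT x|lebesgue_on S. (h x - element_mean S h)\<^sup>2)"
  by (simp add: oscillation_def L2_norm_sq)

text \<open>The general indicator bound with weight \<open>r ^ (4 - d)\<close>, followed by the
  change from \<open>r\<close> to \<open>h = r / \<kappa>\<close>. The jump is constant on a side,
  so its norm there only needs that the surface measure is of order h^(d-1).\<close>

lemma state_indicator_bound:
  assumes dim: "DIM('a) \<in> {2, 3}"
  obtains C where "C > 0"
    "\<And>\<T> T ub yb pb ul yl pl. discrete_approximation \<Omega> f y\<^sub>\<Omega> K ub yb pb ul yl pl W \<Longrightarrow> regular_mesh \<Omega> \<T> \<sigma> \<Longrightarrow>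
      T \<in> \<T> \<Longrightarrow> yl \<in> fe_space \<Omega> \<T> \<Longrightarrow>
      (eta_st \<T> f ul yl T)\<^sup>2 \<le> C * ((L2_norm (lebesgue_on (\<Union>(neighbours \<T> T))) (\<lambda>x. yb x - yl x))\<^sup>2 +
        diameter T ^ (4 - DIM('a)) * (L1_norm (lebesgue_on (\<Union>(neighbours \<T> T))) (\<lambda>x. ub x - ul x))\<^sup>2 +
        (\<Sum>S\<in>neighbours \<T> T. diameter T ^ 4 * (oscillation S (\<lambda>x. ul x - f x (yl x)))\<^sup>2))"
proof -
  obtain m where m: "bump_bound TYPE('a) m" using ex_bump_bound by blast
  obtain Ci where Ci: "Ci > 0"
    "\<And>\<T> T R z \<tau> e0 g c r osc. regular_mesh \<Omega> \<T> \<sigma> \<Longrightarrow> T \<in> \<T> \<Longrightarrow> R \<in> L2_space M\<Omega> \<Longrightarrow> \<tau> > 0 \<Longrightarrow> e0 \<ge> 0 \<Longrightarrow>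
      (\<And>S. S \<in> \<T> \<Longrightarrow> \<exists>A b. \<forall>x\<in>S. z x = A \<bullet> x + b) \<Longrightarrow>
      r = mesh_ratio TYPE('a) \<sigma> * diameter T \<Longrightarrow>
      osc = (\<Sum>S\<in>neighbours \<T> T. LINT x|lebesgue_on S. (R x - (g S \<bullet> x + c S))\<^sup>2) \<Longrightarrow>
      (\<And>p \<psi>. \<psi> \<in> profiles \<Longrightarrow> cball p r \<subseteq> \<Omega> \<Longrightarrow> cball p r \<subseteq> \<Union>(neighbours \<T> T) \<Longrightarrow>
        \<tau> * ((LINT x|M\<Omega>. R x * rescale p r \<psi> x) + (LINT x|M\<Omega>. z x * laplacian (rescale p r \<psi>) x))\<^sup>2 \<le> e0) \<Longrightarrow>
      \<tau> * (r ^ DIM('a) * (LINT x|lebesgue_on T. (R x)\<^sup>2)) \<le> Ci * (e0 + \<tau> * (r ^ DIM('a) * osc)) \<and>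
      (\<forall>e\<in>sides_of \<T> T. \<tau> * ((normal_jump \<T> z e)\<^sup>2 * (r ^ DIM('a))\<^sup>2) \<le> Ci * (r\<^sup>2 * (e0 + \<tau> * (r ^ DIM('a) * osc))))"
    using indicator_bound[OF convex_domain] by blast
  define d where "d = DIM('a)"
  define V where "V = unit_volume TYPE('a)"
  define D where "D = domain_diameter"
  define \<kappa> where "\<kappa> = mesh_ratio TYPE('a) \<sigma>"
  define C0 where "C0 = 2 * m\<^sup>2 * (1 + 2 * K\<^sup>2 * W\<^sup>2 * D ^ 4 + 2 * V)"
  \<comment> \<open>The first summand belongs to the element term, the second to at most
    \<open>d + 1\<close> sides, each with the constant of the prism estimate.\<close>
  define N where "N = 1 / \<kappa> ^ 4 + (real d + 1) * (D * V * 2 ^ d / \<kappa> ^ (d + 2))"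
  have V: "V > 0" unfolding V_def by (rule unit_volume_pos)
  have D: "D \<ge> 1" unfolding D_def by (rule domain_diameter_ge_1)
  have C0: "C0 \<ge> 0" using V D by (simp add: C0_def)
  have \<kappa>0: "\<kappa> \<ge> 0" by (simp add: \<kappa>_def mesh_ratio_def)
  have N: "N \<ge> 0" using V D \<kappa>0 by (simp add: N_def)
  show ?thesis
  proof (rule that[of "N * Ci * (C0 + 1) + 1"])
    show "N * Ci * (C0 + 1) + 1 > 0" using N Ci(1) C0 by (intro add_nonneg_pos mult_nonneg_nonneg) auto
    fix \<T> T ub yb pb ul yl pl
    assume appr: "discrete_approximation \<Omega> f y\<^sub>\<Omega> K ub yb pb ul yl pl W" and mesh: "regular_mesh \<Omega> \<T> \<sigma>"
      and T: "T \<in> \<T>" and yl: "yl \<in> fe_space \<Omega> \<T>"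
    interpret discrete_approximation \<Omega> f y\<^sub>\<Omega> K ub yb pb ul yl pl W by (rule appr)
    interpret mesh: regular_mesh \<Omega> \<T> \<sigma> by (rule mesh)
    define \<omega> where "\<omega> = \<Union>(neighbours \<T> T)"
    define h where "h = diameter T"
    define r where "r = \<kappa> * h"
    define R where "R x = ul x - f x (yl x)" for x
    define U where "U = L1_norm (lebesgue_on \<omega>) (\<lambda>x. ub x - ul x)"
    define Y where "Y = L2_norm (lebesgue_on \<omega>) (\<lambda>x. yb x - yl x)"
    define osc where "osc = (\<Sum>S\<in>neighbours \<T> T. (oscillation S R)\<^sup>2)"
    define J where "J e = normal_jump \<T> yl e" for e
    have h: "h > 0" unfolding h_def by (rule simplex_diameter_pos[OF mesh.element_simplex[OF T]])
    have \<kappa>: "\<kappa> > 0" "\<kappa> \<le> 1" unfolding \<kappa>_def using mesh.ball_ratio_pos mesh_ratio_le_1[OF mesh.\<sigma>] by auto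
    have r: "r > 0" using \<kappa> h by (simp add: r_def)
    have rh: "r \<le> h" using \<kappa> h by (simp add: r_def mult_left_le_one_le)
    have hD: "h + 1 \<le> D" unfolding h_def D_def by (rule element_diameter_le[OF mesh.element_subset[OF T]])
    have d4: "d \<le> 4" "d \<ge> 2" using dim by (auto simp: d_def)
    have osc0: "osc \<ge> 0" by (simp add: osc_def sum_nonneg)
    define e0 where "e0 = C0 * (r ^ (4 - d) * U\<^sup>2 + Y\<^sup>2)"
    have e0: "e0 \<ge> 0" using C0 r by (simp add: e0_def)
    have RL: "R \<in> L2_space M\<Omega>" unfolding R_def[abs_def] by (rule state_residual_L2)
    have test: "r ^ (4 - d) * ((LINT x|M\<Omega>. R x * rescale p r \<psi> x) + (LINT x|M\<Omega>. yl x * laplacian (rescale p r \<psi>) x))\<^sup>2 \<le> e0"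
      if "\<psi> \<in> profiles" "cball p r \<subseteq> \<Omega>" "cball p r \<subseteq> \<Union>(neighbours \<T> T)" for p \<psi>
    proof -
      interpret t: discrete_test \<Omega> f y\<^sub>\<Omega> K ub yb pb ul yl pl W "rescale p r \<psi>" p r m "\<Union>(neighbours \<T> T)"
        by (rule discrete_test_rescale[OF appr mesh T m that(1) r that(2,3)])
      have "r \<le> D" using rh hD by linarith
      from t.state_residual_scaled[OF d4(1)[unfolded d_def] this D]
      show ?thesis by (simp add: e0_def C0_def U_def Y_def t.U_def t.Y_def \<omega>_def R_def d_def V_def)
    qed
    \<comment> \<open>The state residual is compared with its mean on each element, that is, with an
      affine function of slope 0.\<close>
    have osc_eq: "osc = (\<Sum>S\<in>neighbours \<T> T. LINT x|lebesgue_on S. (R x - (0 \<bullet> x + element_mean S R))\<^sup>2)"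
      unfolding osc_def oscillation_sq by simp
    have rpos: "r ^ (4 - d) > 0" using r by simp
    define X where "X = e0 + r ^ 4 * osc"
    have r4: "r ^ (4 - d) * r ^ d = r ^ 4" using d4 by (simp flip: power_add)
    have X_eq: "e0 + r ^ (4 - d) * (r ^ d * osc) = X" by (simp add: X_def r4 mult.assoc[symmetric])
    have X0: "X \<ge> 0" using e0 osc0 r by (simp add: X_def)
    note ib = Ci(2)[OF mesh T RL rpos e0 fe_spaceD(3)[OF yl] r_def[unfolded \<kappa>_def h_def] osc_eq test, folded d_def, unfolded X_eq]
    have elem: "r ^ 4 * (LINT x|lebesgue_on T. (R x)\<^sup>2) \<le> Ci * X"
      using conjunct1[OF ib] by (simp add: r4 mult.assoc[symmetric])
    have jump: "r ^ (d + 2) * (J e)\<^sup>2 \<le> Ci * X" if "e \<in> sides_of \<T> T" for e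
    proof -
      have "r ^ (4 - d) * ((J e)\<^sup>2 * (r ^ d)\<^sup>2) \<le> Ci * (r\<^sup>2 * X)"
        using conjunct2[OF ib] that unfolding J_def by blast
      moreover have "r ^ (4 - d) * ((J e)\<^sup>2 * (r ^ d)\<^sup>2) = r\<^sup>2 * (r ^ (d + 2) * (J e)\<^sup>2)"
      proof -
        have "r ^ (4 - d) * (r ^ d)\<^sup>2 = (r ^ (4 - d) * r ^ d) * r ^ d" by (simp add: power2_eq_square)
        also have "\<dots> = r\<^sup>2 * r ^ (d + 2)" unfolding r4 by (simp add: power_add eval_nat_numeral)
        finally have eq: "r ^ (4 - d) * (r ^ d)\<^sup>2 = r\<^sup>2 * r ^ (d + 2)" .
        have "r ^ (4 - d) * ((J e)\<^sup>2 * (r ^ d)\<^sup>2) = (J e)\<^sup>2 * (r ^ (4 - d) * (r ^ d)\<^sup>2)" by (simp only: mult_ac)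
        then show ?thesis unfolding eq by (simp only: mult_ac)
      qed
      ultimately have "r\<^sup>2 * (r ^ (d + 2) * (J e)\<^sup>2) \<le> r\<^sup>2 * (Ci * X)" by (simp only: mult.left_commute)
      then show ?thesis using r by simp
    qed
    have hr: "h ^ k = r ^ k / \<kappa> ^ k" for k using \<kappa> by (simp add: r_def power_mult_distrib)
    have 1: "h ^ 4 * (L2_norm (lebesgue_on T) R)\<^sup>2 \<le> 1 / \<kappa> ^ 4 * (Ci * X)"
      using divide_right_mono[OF elem, of "\<kappa> ^ 4"] \<kappa> by (simp add: hr L2_norm_sq)
    have 2: "h ^ 3 * (L2_norm (side_measure e) (\<lambda>x. J e))\<^sup>2 \<le> D * V * 2 ^ d / \<kappa> ^ (d + 2) * (Ci * X)"
      if e: "e \<in> sides_of \<T> T" for e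
    proof -
      have eT: "e facet_of T" using e by (simp add: sides_of_def)
      note cpt = facet_compact[OF mesh.element_simplex[OF T] eT]
      obtain n where n: "inner_normal T e n" by (rule inner_normal_exists[OF mesh.element_simplex[OF T] eT])
      obtain x0 where "x0 \<in> e" using cpt(3) by blast
      have sub: "e \<subseteq> cball x0 h"
      proof
        fix x assume "x \<in> e"
        then have "x \<in> T" "x0 \<in> T" using \<open>x0 \<in> e\<close> facet_of_imp_subset[OF eT] by auto
        then show "x \<in> cball x0 h" unfolding h_def
          using diameter_bounded_bound[OF mesh.element_bounded[OF T], of x0 x] by simp
      qed
      have "(L2_norm (side_measure e) (\<lambda>x. J e))\<^sup>2 = (J e)\<^sup>2 * measure (side_measure e) (space (side_measure e))"
        by (rule L2_norm_const_sq)
      also have "\<dots> \<le> (J e)\<^sup>2 * ((1 / h + 1) * (V * (2 * h) ^ d))"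
        unfolding V_def d_def by (intro mult_left_mono side_measure_le[OF cpt sub h side_normal_norm[OF n]]) auto
      finally have "h ^ 3 * (L2_norm (side_measure e) (\<lambda>x. J e))\<^sup>2 \<le> h ^ 3 * ((J e)\<^sup>2 * ((1 / h + 1) * (V * (2 * h) ^ d)))"
        using h by (intro mult_left_mono) auto
      \<comment> \<open>The surface bound has the factor \<open>1 / h + 1\<close>, and one power of
        \<open>h\<close> turns it into \<open>h + 1\<close>.\<close>
      also have "\<dots> = (h + 1) * (V * 2 ^ d * (h ^ (d + 2) * (J e)\<^sup>2))"
        using h by (simp add: field_simps power_mult_distrib eval_nat_numeral)
      also have "\<dots> \<le> D * (V * 2 ^ d * (h ^ (d + 2) * (J e)\<^sup>2))"
        using hD V h by (intro mult_right_mono) auto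
      also have "\<dots> = D * (V * 2 ^ d * ((r ^ (d + 2) * (J e)\<^sup>2) / \<kappa> ^ (d + 2)))" unfolding hr by simp
      also have "\<dots> \<le> D * (V * 2 ^ d * ((Ci * X) / \<kappa> ^ (d + 2)))"
        using D V \<kappa> jump[OF e] by (intro mult_left_mono divide_right_mono) auto
      finally show ?thesis by simp
    qed
    have cardS: "real (card (sides_of \<T> T)) \<le> real d + 1"
    proof -
      have "sides_of \<T> T \<subseteq> {e. e facet_of T}" by (auto simp: sides_of_def)
      then have "card (sides_of \<T> T) \<le> card {e. e facet_of T}"
        by (intro card_mono finite_card_facets(1)[OF mesh.element_simplex[OF T]])
      also have "\<dots> \<le> Suc d" unfolding d_def by (rule finite_card_facets(2)[OF mesh.element_simplex[OF T]])
      finally show ?thesis by simp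
    qed
    have c0: "0 \<le> D * V * 2 ^ d / \<kappa> ^ (d + 2) * (Ci * X)" using D V \<kappa> Ci(1) X0 by simp
    have "(\<Sum>e\<in>sides_of \<T> T. h ^ 3 * (L2_norm (side_measure e) (\<lambda>x. J e))\<^sup>2)
        \<le> (\<Sum>e\<in>sides_of \<T> T. D * V * 2 ^ d / \<kappa> ^ (d + 2) * (Ci * X))"
      by (intro sum_mono 2)
    also have "\<dots> = real (card (sides_of \<T> T)) * (D * V * 2 ^ d / \<kappa> ^ (d + 2) * (Ci * X))" by simp
    also have "\<dots> \<le> (real d + 1) * (D * V * 2 ^ d / \<kappa> ^ (d + 2) * (Ci * X))"
      by (intro mult_right_mono cardS c0)
    finally have 3: "(\<Sum>e\<in>sides_of \<T> T. h ^ 3 * (L2_norm (side_measure e) (\<lambda>x. J e))\<^sup>2)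
        \<le> (real d + 1) * (D * V * 2 ^ d / \<kappa> ^ (d + 2) * (Ci * X))" .
    have "(eta_st \<T> f ul yl T)\<^sup>2 = h ^ 4 * (L2_norm (lebesgue_on T) R)\<^sup>2 +
        (\<Sum>e\<in>sides_of \<T> T. h ^ 3 * (L2_norm (side_measure e) (\<lambda>x. J e))\<^sup>2)"
      using h by (simp add: eta_st_def R_def[abs_def] J_def[symmetric] h_def[symmetric] sum_nonneg)
    also have "\<dots> \<le> N * (Ci * X)" using 1 3 by (simp add: N_def distrib_right mult.assoc)
    also have "\<dots> \<le> N * (Ci * ((C0 + 1) * (Y\<^sup>2 + h ^ (4 - d) * U\<^sup>2 + h ^ 4 * osc)))"
    proof (intro mult_left_mono)
      have "r ^ (4 - d) \<le> h ^ (4 - d)" "r ^ 4 \<le> h ^ 4" using r rh by (auto intro!: power_mono)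
      then have "X \<le> C0 * (h ^ (4 - d) * U\<^sup>2 + Y\<^sup>2) + h ^ 4 * osc"
        unfolding X_def e0_def using C0 osc0 by (intro add_mono mult_left_mono mult_right_mono) auto
      also have "\<dots> \<le> (C0 + 1) * (Y\<^sup>2 + h ^ (4 - d) * U\<^sup>2 + h ^ 4 * osc)"
      proof -
        have "0 \<le> C0 * (h ^ 4 * osc)" "0 \<le> h ^ (4 - d) * U\<^sup>2" "0 \<le> Y\<^sup>2" using C0 h osc0 by auto
        then show ?thesis by (simp add: algebra_simps)
      qed
      finally show "X \<le> (C0 + 1) * (Y\<^sup>2 + h ^ (4 - d) * U\<^sup>2 + h ^ 4 * osc)" .
    qed (use N Ci(1) in auto)
    also have "\<dots> = N * Ci * (C0 + 1) * (Y\<^sup>2 + h ^ (4 - d) * U\<^sup>2 + h ^ 4 * osc)" by simp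
    also have "\<dots> \<le> (N * Ci * (C0 + 1) + 1) * (Y\<^sup>2 + h ^ (4 - d) * U\<^sup>2 + h ^ 4 * osc)"
      using h osc0 by (intro mult_right_mono) auto
    finally show "(eta_st \<T> f ul yl T)\<^sup>2 \<le> (N * Ci * (C0 + 1) + 1) *
        ((L2_norm (lebesgue_on (\<Union>(neighbours \<T> T))) (\<lambda>x. yb x - yl x))\<^sup>2 +
        diameter T ^ (4 - DIM('a)) * (L1_norm (lebesgue_on (\<Union>(neighbours \<T> T))) (\<lambda>x. ub x - ul x))\<^sup>2 +
        (\<Sum>S\<in>neighbours \<T> T. diameter T ^ 4 * (oscillation S (\<lambda>x. ul x - f x (yl x)))\<^sup>2))"
      by (simp add: Y_def U_def osc_def h_def d_def \<omega>_def R_def[abs_def] sum_distrib_left)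
  qed
qed

text \<open>The indicator is an extended real number; a real upper bound \<open>X\<close> carries
  the estimate, so that squares and sums are handled in the reals. Passing to it uses the bound
  \<open>P\<close> for the adjoint error, which is available when that error is essentially
  bounded.\<close>

lemma adjoint_indicator_bound:
  assumes dim: "DIM('a) \<in> {2, 3}" and Q0: "Q \<ge> 0"
  obtains C where "C > 0"
    "\<And>\<T> T ub yb pb ul yl pl P. discrete_approximation \<Omega> f y\<^sub>\<Omega> K ub yb pb ul yl pl W \<Longrightarrow> regular_mesh \<Omega> \<T> \<sigma> \<Longrightarrow>
      T \<in> \<T> \<Longrightarrow> yl \<in> fe_space \<Omega> \<T> \<Longrightarrow> pl \<in> fe_space \<Omega> \<T> \<Longrightarrow>
      (\<And>p r. r > 0 \<Longrightarrow> cball p r \<subseteq> \<Omega> \<Longrightarrow> r ^ 4 / (r ^ DIM('a))\<^sup>2 * (LINT x|lebesgue_on (cball p r). (pl x)\<^sup>2) \<le> Q) \<Longrightarrow>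
      P \<ge> 0 \<Longrightarrow> AE x in lebesgue_on (\<Union>(neighbours \<T> T)). \<bar>pb x - pl x\<bar> \<le> P \<Longrightarrow>
      \<exists>X\<ge>0. eta_adj \<T> f y\<^sub>\<Omega> yl pl T \<le> ennreal X \<and>
        X\<^sup>2 \<le> C * ((L2_norm (lebesgue_on (\<Union>(neighbours \<T> T))) (\<lambda>x. yb x - yl x))\<^sup>2 + P\<^sup>2 +
        (\<Sum>S\<in>neighbours \<T> T. diameter T ^ (4 - DIM('a)) * (oscillation S (\<lambda>x. y\<^sub>\<Omega> x + dy f x (yl x) * pl x))\<^sup>2))"
proof -
  obtain m where m: "bump_bound TYPE('a) m" using ex_bump_bound by blast
  obtain Ci where Ci: "Ci > 0"
    "\<And>\<T> T R z \<tau> e0 g c r osc. regular_mesh \<Omega> \<T> \<sigma> \<Longrightarrow> T \<in> \<T> \<Longrightarrow> R \<in> L2_space M\<Omega> \<Longrightarrow> \<tau> > 0 \<Longrightarrow> e0 \<ge> 0 \<Longrightarrow>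
      (\<And>S. S \<in> \<T> \<Longrightarrow> \<exists>A b. \<forall>x\<in>S. z x = A \<bullet> x + b) \<Longrightarrow>
      r = mesh_ratio TYPE('a) \<sigma> * diameter T \<Longrightarrow>
      osc = (\<Sum>S\<in>neighbours \<T> T. LINT x|lebesgue_on S. (R x - (g S \<bullet> x + c S))\<^sup>2) \<Longrightarrow>
      (\<And>p \<psi>. \<psi> \<in> profiles \<Longrightarrow> cball p r \<subseteq> \<Omega> \<Longrightarrow> cball p r \<subseteq> \<Union>(neighbours \<T> T) \<Longrightarrow>
        \<tau> * ((LINT x|M\<Omega>. R x * rescale p r \<psi> x) + (LINT x|M\<Omega>. z x * laplacian (rescale p r \<psi>) x))\<^sup>2 \<le> e0) \<Longrightarrow>
      \<tau> * (r ^ DIM('a) * (LINT x|lebesgue_on T. (R x)\<^sup>2)) \<le> Ci * (e0 + \<tau> * (r ^ DIM('a) * osc)) \<and>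
      (\<forall>e\<in>sides_of \<T> T. \<tau> * ((normal_jump \<T> z e)\<^sup>2 * (r ^ DIM('a))\<^sup>2) \<le> Ci * (r\<^sup>2 * (e0 + \<tau> * (r ^ DIM('a) * osc))))"
    using indicator_bound[OF convex_domain] by blast
  define d where "d = DIM('a)"
  define V where "V = unit_volume TYPE('a)"
  define D where "D = domain_diameter"
  define \<kappa> where "\<kappa> = mesh_ratio TYPE('a) \<sigma>"
  define C0 where "C0 = 4 * m\<^sup>2 * (V * D ^ 4 + V\<^sup>2 + K\<^sup>2 * W\<^sup>2 * V * D ^ 4 + K\<^sup>2 * Q)"
  define N where "N = 2 * (1 / \<kappa> ^ (4 - d)) + 2 * (1 / \<kappa>\<^sup>2)"
  have V: "V > 0" unfolding V_def by (rule unit_volume_pos)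
  have D: "D \<ge> 1" unfolding D_def by (rule domain_diameter_ge_1)
  have C0: "C0 \<ge> 0" using V D Q0 by (simp add: C0_def)
  have \<kappa>0: "\<kappa> \<ge> 0" by (simp add: \<kappa>_def mesh_ratio_def)
  have N: "N \<ge> 0" using \<kappa>0 by (simp add: N_def)
  show ?thesis
  proof (rule that[of "N * Ci * (C0 + 1) + 1"])
    show "N * Ci * (C0 + 1) + 1 > 0" using N Ci(1) C0 by (intro add_nonneg_pos mult_nonneg_nonneg) auto
    fix \<T> T ub yb pb ul yl pl P
    assume appr: "discrete_approximation \<Omega> f y\<^sub>\<Omega> K ub yb pb ul yl pl W" and mesh: "regular_mesh \<Omega> \<T> \<sigma>"
      and T: "T \<in> \<T>" and yl: "yl \<in> fe_space \<Omega> \<T>" and pl: "pl \<in> fe_space \<Omega> \<T>"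
      and Q: "\<And>p r. r > 0 \<Longrightarrow> cball p r \<subseteq> \<Omega> \<Longrightarrow> r ^ 4 / (r ^ DIM('a))\<^sup>2 * (LINT x|lebesgue_on (cball p r). (pl x)\<^sup>2) \<le> Q"
      and P: "P \<ge> 0" "AE x in lebesgue_on (\<Union>(neighbours \<T> T)). \<bar>pb x - pl x\<bar> \<le> P"
    interpret discrete_approximation \<Omega> f y\<^sub>\<Omega> K ub yb pb ul yl pl W by (rule appr)
    interpret mesh: regular_mesh \<Omega> \<T> \<sigma> by (rule mesh)
    define \<omega> where "\<omega> = \<Union>(neighbours \<T> T)"
    define h where "h = diameter T"
    define r where "r = \<kappa> * h"
    define Z where "Z x = y\<^sub>\<Omega> x + dy f x (yl x) * pl x" for x
    define R where "R x = yl x - y\<^sub>\<Omega> x - dy f x (yl x) * pl x" for x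
    have RZ: "R x = yl x - Z x" for x by (simp add: R_def Z_def)
    define Y where "Y = L2_norm (lebesgue_on \<omega>) (\<lambda>x. yb x - yl x)"
    define osc where "osc = (\<Sum>S\<in>neighbours \<T> T. (oscillation S Z)\<^sup>2)"
    define J where "J e = normal_jump \<T> pl e" for e
    have h: "h > 0" unfolding h_def by (rule simplex_diameter_pos[OF mesh.element_simplex[OF T]])
    have \<kappa>: "\<kappa> > 0" "\<kappa> \<le> 1" unfolding \<kappa>_def using mesh.ball_ratio_pos mesh_ratio_le_1[OF mesh.\<sigma>] by auto
    have r: "r > 0" using \<kappa> h by (simp add: r_def)
    have rh: "r \<le> h" using \<kappa> h by (simp add: r_def mult_left_le_one_le)
    have hD: "h + 1 \<le> D" unfolding h_def D_def by (rule element_diameter_le[OF mesh.element_subset[OF T]])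
    have d4: "d \<le> 4" using dim by (auto simp: d_def)
    have osc0: "osc \<ge> 0" by (simp add: osc_def sum_nonneg)
    define \<tau> where "\<tau> = r ^ 4 / (r ^ d)\<^sup>2"
    have \<tau>: "\<tau> > 0" using r by (simp add: \<tau>_def)
    define e0 where "e0 = C0 * (Y\<^sup>2 + P\<^sup>2)"
    have e0: "e0 \<ge> 0" using C0 by (simp add: e0_def)
    have RL: "R \<in> L2_space M\<Omega>"
      unfolding RZ[abs_def] Z_def by (intro L2_space_diff L2_facts data_L2)
    have test: "\<tau> * ((LINT x|M\<Omega>. R x * rescale p r \<psi> x) + (LINT x|M\<Omega>. pl x * laplacian (rescale p r \<psi>) x))\<^sup>2 \<le> e0"
      if "\<psi> \<in> profiles" "cball p r \<subseteq> \<Omega>" "cball p r \<subseteq> \<Union>(neighbours \<T> T)" for p \<psi>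
    proof -
      interpret t: discrete_test \<Omega> f y\<^sub>\<Omega> K ub yb pb ul yl pl W "rescale p r \<psi>" p r m "\<Union>(neighbours \<T> T)"
        by (rule discrete_test_rescale[OF appr mesh T m that(1) r that(2,3)])
      have "r \<le> D" using rh hD by linarith
      from t.adjoint_residual_scaled[OF d4[unfolded d_def] this D P(2,1) Q[OF r that(2)]]
      show ?thesis by (simp add: e0_def C0_def Y_def t.Y_def \<omega>_def R_def d_def V_def \<tau>_def)
    qed
    obtain g c where gc: "\<And>S x. S \<in> \<T> \<Longrightarrow> x \<in> S \<Longrightarrow> yl x = g S \<bullet> x + c S"
      using fe_spaceD(3)[OF yl] by metis
    \<comment> \<open>On \<open>S\<close> the residual is \<open>yl - Z\<close> with
      \<open>yl\<close> affine; taking \<open>yl\<close> minus the mean of \<open>Z\<close> as the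
      affine comparison leaves the oscillation of \<open>Z\<close> up to sign.\<close>
    have osc_eq: "osc = (\<Sum>S\<in>neighbours \<T> T. LINT x|lebesgue_on S. (R x - (g S \<bullet> x + (c S - element_mean S Z)))\<^sup>2)"
      unfolding osc_def oscillation_sq
    proof (intro sum.cong refl Bochner_Integration.integral_cong)
      fix S x assume S: "S \<in> neighbours \<T> T" and "x \<in> space (lebesgue_on S)"
      then have x: "x \<in> S" "S \<in> \<T>" using patch_subset(4)[OF mesh T S] by auto
      have "R x - (g S \<bullet> x + (c S - element_mean S Z)) = - (Z x - element_mean S Z)"
        using gc[OF x(2,1)] by (simp add: RZ)
      then show "(Z x - element_mean S Z)\<^sup>2 = (R x - (g S \<bullet> x + (c S - element_mean S Z)))\<^sup>2" by (metis power2_minus)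
    qed
    define X where "X = e0 + r ^ (4 - d) * osc"
    have r4: "r ^ (4 - d) * r ^ d = r ^ 4" using d4 by (simp flip: power_add)
    have \<tau>r: "\<tau> * r ^ d = r ^ (4 - d)" using r unfolding \<tau>_def r4[symmetric] by (simp add: power2_eq_square)
    have X_eq: "e0 + \<tau> * (r ^ d * osc) = X" by (simp add: X_def \<tau>r mult.assoc[symmetric])
    have X0: "X \<ge> 0" using e0 osc0 r by (simp add: X_def)
    note ib = Ci(2)[OF mesh T RL \<tau> e0 fe_spaceD(3)[OF pl] r_def[unfolded \<kappa>_def h_def] osc_eq test, folded d_def, unfolded X_eq]
    have elem: "r ^ (4 - d) * (LINT x|lebesgue_on T. (R x)\<^sup>2) \<le> Ci * X"
      using conjunct1[OF ib] by (simp add: \<tau>r mult.assoc[symmetric])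
    define Jm where "Jm = sqrt (Ci * X) / r"
    have CX0: "Ci * X \<ge> 0" using Ci(1) X0 by simp
    have jump: "\<bar>J e\<bar> \<le> Jm" if "e \<in> sides_of \<T> T" for e
    proof -
      have "\<tau> * ((J e)\<^sup>2 * (r ^ d)\<^sup>2) \<le> Ci * (r\<^sup>2 * X)"
        using conjunct2[OF ib] that unfolding J_def by blast
      \<comment> \<open>The weight times \<open>(r ^ d)^2\<close> is \<open>r ^ 4\<close>, so the
        jump is bounded pointwise after multiplication by \<open>r\<close>; no surface measure
        enters, in accordance with the maximum norm in the indicator.\<close>
      moreover have "\<tau> * ((J e)\<^sup>2 * (r ^ d)\<^sup>2) = r\<^sup>2 * (r * J e)\<^sup>2"
        using r by (simp add: \<tau>_def power_mult_distrib flip: power_add)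
      ultimately have "r\<^sup>2 * (r * J e)\<^sup>2 \<le> r\<^sup>2 * (Ci * X)" by (simp add: mult.left_commute)
      then have "(r * J e)\<^sup>2 \<le> Ci * X" using r by simp
      then have "\<bar>r * J e\<bar> \<le> sqrt (Ci * X)" by (metis real_sqrt_abs real_sqrt_le_mono)
      then show ?thesis using r by (simp add: Jm_def abs_mult le_divide_eq mult.commute)
    qed
    define A where "A = h powr (2 - real d / 2) * L2_norm (lebesgue_on T) R"
    have A0: "A \<ge> 0" by (simp add: A_def L2_norm_nonneg)
    have Jm0: "Jm \<ge> 0" using CX0 r by (simp add: Jm_def)
    have hr: "h ^ k = r ^ k / \<kappa> ^ k" for k using \<kappa> by (simp add: r_def power_mult_distrib)
    have A2: "A\<^sup>2 \<le> 1 / \<kappa> ^ (4 - d) * (Ci * X)"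
    proof -
      have "(h powr (2 - real d / 2))\<^sup>2 = h powr (real (4 - d))"
        using h d4 by (simp add: powr_powr flip: powr_numeral)
      then have "(h powr (2 - real d / 2))\<^sup>2 = h ^ (4 - d)" using h by (simp add: powr_realpow)
      then have "A\<^sup>2 = (r ^ (4 - d) * (LINT x|lebesgue_on T. (R x)\<^sup>2)) / \<kappa> ^ (4 - d)"
        by (simp add: A_def power_mult_distrib L2_norm_sq hr)
      then show ?thesis using divide_right_mono[OF elem, of "\<kappa> ^ (4 - d)"] \<kappa> by simp
    qed
    have J2: "(h * Jm)\<^sup>2 = 1 / \<kappa>\<^sup>2 * (Ci * X)"
      using CX0 \<kappa> h by (simp add: Jm_def r_def power_mult_distrib power_divide)
    have "eta_adj \<T> f y\<^sub>\<Omega> yl pl T \<le> ennreal (A + h * Jm)"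
    proof -
      have "(SUP e\<in>sides_of \<T> T. Linf_norm (side_measure e) (\<lambda>x. normal_jump \<T> pl e)) \<le> ennreal Jm"
      proof (rule SUP_least)
        fix e assume e: "e \<in> sides_of \<T> T"
        have "Linf_norm (side_measure e) (\<lambda>x. J e) \<le> ennreal \<bar>J e\<bar>" by (rule Linf_norm_const_le)
        also have "\<dots> \<le> ennreal Jm" using jump[OF e] by (rule ennreal_leI)
        finally show "Linf_norm (side_measure e) (\<lambda>x. normal_jump \<T> pl e) \<le> ennreal Jm" by (simp add: J_def)
      qed
      then have "eta_adj \<T> f y\<^sub>\<Omega> yl pl T \<le> ennreal A + ennreal h * ennreal Jm"
        unfolding eta_adj_def A_def R_def[abs_def] h_def d_def by (intro add_mono mult_left_mono) auto
      also have "\<dots> = ennreal (A + h * Jm)" 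
        using A0 h Jm0 by (simp add: ennreal_mult ennreal_plus)
      finally show ?thesis .
    qed
    moreover have "(A + h * Jm)\<^sup>2 \<le> (N * Ci * (C0 + 1) + 1) * (Y\<^sup>2 + P\<^sup>2 + h ^ (4 - d) * osc)"
    proof -
      have "(A + h * Jm)\<^sup>2 \<le> 2 * A\<^sup>2 + 2 * (h * Jm)\<^sup>2" by (rule square_add_le)
      also have "\<dots> \<le> N * (Ci * X)" using A2 unfolding J2 by (simp add: N_def distrib_right)
      also have "\<dots> \<le> N * (Ci * ((C0 + 1) * (Y\<^sup>2 + P\<^sup>2 + h ^ (4 - d) * osc)))"
      proof (intro mult_left_mono)
        have "r ^ (4 - d) \<le> h ^ (4 - d)" using r rh by (auto intro!: power_mono)
        then have "X \<le> C0 * (Y\<^sup>2 + P\<^sup>2) + h ^ (4 - d) * osc"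
          unfolding X_def e0_def using osc0 by (intro add_left_mono mult_right_mono) auto
        also have "\<dots> \<le> (C0 + 1) * (Y\<^sup>2 + P\<^sup>2 + h ^ (4 - d) * osc)"
        proof -
          have "0 \<le> C0 * (h ^ (4 - d) * osc)" "0 \<le> P\<^sup>2" "0 \<le> Y\<^sup>2" using C0 h osc0 by auto
          then show ?thesis by (simp add: algebra_simps)
        qed
        finally show "X \<le> (C0 + 1) * (Y\<^sup>2 + P\<^sup>2 + h ^ (4 - d) * osc)" .
      qed (use N Ci(1) in auto)
      also have "\<dots> = N * Ci * (C0 + 1) * (Y\<^sup>2 + P\<^sup>2 + h ^ (4 - d) * osc)" by simp
      also have "\<dots> \<le> (N * Ci * (C0 + 1) + 1) * (Y\<^sup>2 + P\<^sup>2 + h ^ (4 - d) * osc)"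
        using h osc0 by (intro mult_right_mono) auto
      finally show ?thesis .
    qed
    moreover have "A + h * Jm \<ge> 0" using A0 h Jm0 by simp
    ultimately show "\<exists>X\<ge>0. eta_adj \<T> f y\<^sub>\<Omega> yl pl T \<le> ennreal X \<and>
        X\<^sup>2 \<le> (N * Ci * (C0 + 1) + 1) * ((L2_norm (lebesgue_on (\<Union>(neighbours \<T> T))) (\<lambda>x. yb x - yl x))\<^sup>2 + P\<^sup>2 +
        (\<Sum>S\<in>neighbours \<T> T. diameter T ^ (4 - DIM('a)) * (oscillation S (\<lambda>x. y\<^sub>\<Omega> x + dy f x (yl x) * pl x))\<^sup>2))"
      by (intro exI[of _ "A + h * Jm"]) (simp add: Y_def osc_def h_def d_def \<omega>_def Z_def[abs_def] sum_distrib_left)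
  qed
qed

lemma weight_bound:
  assumes "y \<in> L2_space M\<Omega>" "y' \<in> L2_space M\<Omega>" "(LINT x|M\<Omega>. (y x)\<^sup>2) \<le> E" "(LINT x|M\<Omega>. (y' x)\<^sup>2) \<le> E"
  shows "L2_norm M\<Omega> (\<lambda>x. 1 + \<bar>y x\<bar> + \<bar>y' x\<bar>) \<le> sqrt (4 * (measure lebesgue \<Omega> + 2 * E))"
proof -
  interpret finite_measure M\<Omega> by (rule finite_measure_domain)
  have i: "integrable M\<Omega> (\<lambda>x. (y x)\<^sup>2)" "integrable M\<Omega> (\<lambda>x. (y' x)\<^sup>2)" using assms(1,2) by (auto intro: L2_spaceD)
  have "(\<lambda>x. 1 + \<bar>y x\<bar> + \<bar>y' x\<bar>) \<in> L2_space M\<Omega>"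
    by (intro L2_space_add L2_space_abs L2_space_const finite_measure_axioms assms)
  then have "(LINT x|M\<Omega>. (1 + \<bar>y x\<bar> + \<bar>y' x\<bar>)\<^sup>2) \<le> (LINT x|M\<Omega>. 4 * (1 + (y x)\<^sup>2 + (y' x)\<^sup>2))"
  proof (intro integral_mono L2_spaceD(2))
    show "integrable M\<Omega> (\<lambda>x. 4 * (1 + (y x)\<^sup>2 + (y' x)\<^sup>2))"
      by (intro integrable_mult_right Bochner_Integration.integrable_add integrable_const i)
    show "(1 + \<bar>y x\<bar> + \<bar>y' x\<bar>)\<^sup>2 \<le> 4 * (1 + (y x)\<^sup>2 + (y' x)\<^sup>2)" for x
      using square_add4_le[of 1 "\<bar>y x\<bar>" "\<bar>y' x\<bar>" 0] by simp
  qed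
  also have "\<dots> = 4 * (measure lebesgue \<Omega> + (LINT x|M\<Omega>. (y x)\<^sup>2) + (LINT x|M\<Omega>. (y' x)\<^sup>2))"
    using i by (simp add: measure_restrict_space)
  also have "\<dots> \<le> 4 * (measure lebesgue \<Omega> + 2 * E)" using assms(3,4) by simp
  finally show ?thesis unfolding L2_norm_def by (rule real_sqrt_le_mono)
qed

end

lemma bounded_on_closure:
  fixes v :: "'a::euclidean_space \<Rightarrow> real"
  assumes "bounded \<Omega>" "continuous_on (closure \<Omega>) v" shows "\<exists>M. \<forall>x\<in>\<Omega>. \<bar>v x\<bar> \<le> M"
proof -
  have "compact (closure \<Omega>)" using assms(1) by (simp add: compact_closure)
  then have "bounded (v ` closure \<Omega>)" by (intro compact_imp_bounded compact_continuous_image assms(2))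
  then show ?thesis unfolding bounded_iff using closure_subset[of \<Omega>] by (metis imageI real_norm_def subsetD)
qed

theorem theorem4p8:
  fixes \<Omega> :: "(real^'n) set"
    and y\<^sub>\<Omega> :: "real^'n \<Rightarrow> real"
    and a b :: real
    and f :: "real^'n \<Rightarrow> real \<Rightarrow> real"
    and \<TT> :: "(real^'n) set set set"
  assumes dim: "CARD('n) \<in> {2, 3}"
    and domain: "open \<Omega>" "bounded \<Omega>" "convex \<Omega>" "\<Omega> \<noteq> {}" "polytope (closure \<Omega>)"
    and desired_state: "y\<^sub>\<Omega> \<in> L2_space (lebesgue_on \<Omega>)"
    and bounds: "a < b"
    and nonlinearity: "admissible_nonlinearity \<Omega> f"
    and meshes: "mesh_collection \<Omega> \<TT>"
    and dy_L2: "\<forall>y\<in>H10_space \<Omega>. (\<lambda>x. dy f x (y x)) \<in> L2_space (lebesgue_on \<Omega>)"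
    and dy_lipschitz: "\<exists>L. AE x in lebesgue_on \<Omega>. L-lipschitz_on UNIV (dy f x)"
  shows "\<exists>C>0. \<forall>\<T>\<in>\<TT>. \<forall>ubar ybar pbar ul yl pl.
    is_optimal_control (H10_space \<Omega>) \<Omega> f y\<^sub>\<Omega> a b ubar \<and>
    is_state (H10_space \<Omega>) \<Omega> f ubar ybar \<and>
    is_adjoint_state (H10_space \<Omega>) \<Omega> f y\<^sub>\<Omega> ybar pbar \<and>
    is_optimal_control (fe_space \<Omega> \<T>) \<Omega> f y\<^sub>\<Omega> a b ul \<and>
    is_state (fe_space \<Omega> \<T>) \<Omega> f ul yl \<and>
    is_adjoint_state (fe_space \<Omega> \<T>) \<Omega> f y\<^sub>\<Omega> yl pl \<longrightarrow>
    (\<forall>T\<in>\<T>.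
      ennreal ((eta_st \<T> f ul yl T)\<^sup>2) + (eta_adj \<T> f y\<^sub>\<Omega> yl pl T)\<^sup>2
      \<le> ennreal C * (
          ennreal ((L2_norm (lebesgue_on (\<Union>(neighbours \<T> T))) (\<lambda>x. ybar x - yl x))\<^sup>2) +
          (Linf_norm (lebesgue_on (\<Union>(neighbours \<T> T))) (\<lambda>x. pbar x - pl x))\<^sup>2 +
          ennreal (diameter T powr (4 - real CARD('n)) *
            (L1_norm (lebesgue_on (\<Union>(neighbours \<T> T))) (\<lambda>x. ubar x - ul x))\<^sup>2) +
          ennreal (\<Sum>T'\<in>neighbours \<T> T.
            diameter T ^ 4 * (oscillation T' (\<lambda>x. ul x - f x (yl x)))\<^sup>2 +
            diameter T powr (4 - real CARD('n)) *
              (oscillation T' (\<lambda>x. y\<^sub>\<Omega> x + dy f x (yl x) * pl x))\<^sup>2)))"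
proof -
  obtain K where K: "growth_constant \<Omega> f K"
    by (rule growth_constant_exists[OF nonlinearity dy_lipschitz])
  interpret semilinear \<Omega> f y\<^sub>\<Omega> K
    using domain K desired_state nonlinearity dy_L2
    by unfold_locales (auto simp: admissible_nonlinearity_def)
  have dimn: "DIM(real^'n) = CARD('n)" by simp
  have dim': "DIM(real^'n) \<in> {2, 3}" using dim by simp
  obtain \<sigma>\<^sub>0 where \<sigma>\<^sub>0: "\<And>\<T>. \<T> \<in> \<TT> \<Longrightarrow> shape_regular \<sigma>\<^sub>0 \<T>" and conf: "\<And>\<T>. \<T> \<in> \<TT> \<Longrightarrow> conforming_mesh \<Omega> \<T>"
    using meshes unfolding mesh_collection_def by blast
  \<comment> \<open>With a constant of at least 1, \<open>\<sigma>^2\<close> dominates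
    \<open>\<sigma>\<close>, and one estimate covers an element and its neighbours.\<close>
  define \<sigma> where "\<sigma> = max 1 \<sigma>\<^sub>0"
  have mesh: "regular_mesh \<Omega> \<T> \<sigma>" if \<T>: "\<T> \<in> \<TT>" for \<T>
  proof unfold_locales
    show "shape_regular \<sigma> \<T>"
      unfolding shape_regular_def
    proof
      fix T assume T: "T \<in> \<T>"
      have "diameter T \<le> \<sigma>\<^sub>0 * inball_diameter T" using \<sigma>\<^sub>0[OF \<T>] T by (simp add: shape_regular_def)
      also have "\<dots> \<le> \<sigma> * inball_diameter T"
        using simplex_inball_pos[OF conforming_mesh_simplex[OF conf[OF \<T>] T]]
        by (intro mult_right_mono) (auto simp: \<sigma>_def)
      finally show "diameter T \<le> \<sigma> * inball_diameter T" .
    qed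
    show "2 \<le> DIM(real^'n)" using dim by auto
  qed (use domain conf[OF \<T>] in \<open>auto simp: \<sigma>_def\<close>)
  \<comment> \<open>The bound is uniform in the subspace, so one \<open>E\<close> serves
    \<open>H10_space\<close> and the finite element space of every mesh.\<close>
  obtain E where E: "E > 0" "\<And>W u y. W \<subseteq> H10_space \<Omega> \<Longrightarrow> u \<in> admissible_controls \<Omega> a b \<Longrightarrow>
    is_state W \<Omega> f u y \<Longrightarrow> (LINT x|M\<Omega>. (y x)\<^sup>2) \<le> E"
    by (rule state_bound[of a b]) blast
  obtain E' where E': "E' > 0" "\<And>W y p. W \<subseteq> H10_space \<Omega> \<Longrightarrow> y \<in> L2_space M\<Omega> \<Longrightarrow> (LINT x|M\<Omega>. (y x)\<^sup>2) \<le> E \<Longrightarrow>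
    is_adjoint_state W \<Omega> f y\<^sub>\<Omega> y p \<Longrightarrow> (LINT x|M\<Omega>. (norm (grad \<Omega> p x))\<^sup>2) \<le> E'"
    by (rule adjoint_bound[of E]) blast
  obtain Cl where Cl: "Cl > 0" "\<And>u p r. u \<in> H10_space \<Omega> \<Longrightarrow> r > 0 \<Longrightarrow> cball p r \<subseteq> \<Omega> \<Longrightarrow>
      r ^ 4 / (r ^ DIM(real^'n))\<^sup>2 * (LINT x|lebesgue_on (cball p r). (u x)\<^sup>2) \<le> Cl * (LINT x|M\<Omega>. (norm (grad \<Omega> u x))\<^sup>2)"
    by (rule local_L2_bound[OF dim']) blast
  \<comment> \<open>By the energy bound the weight of the growth condition is controlled by the
    data, so constants obtained with this \<open>W\<close> depend neither on the mesh nor on the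
    optimal variables.\<close>
  define W where "W = sqrt (4 * (measure lebesgue \<Omega> + 2 * E))"
  have Q: "Cl * E' \<ge> 0" using Cl(1) E'(1) by simp
  obtain C1 where C1: "C1 > 0"
    "\<And>\<T> T ub yb pb ul yl pl. discrete_approximation \<Omega> f y\<^sub>\<Omega> K ub yb pb ul yl pl W \<Longrightarrow> regular_mesh \<Omega> \<T> \<sigma> \<Longrightarrow>
      T \<in> \<T> \<Longrightarrow> yl \<in> fe_space \<Omega> \<T> \<Longrightarrow>
      (eta_st \<T> f ul yl T)\<^sup>2 \<le> C1 * ((L2_norm (lebesgue_on (\<Union>(neighbours \<T> T))) (\<lambda>x. yb x - yl x))\<^sup>2 +
        diameter T ^ (4 - DIM(real^'n)) * (L1_norm (lebesgue_on (\<Union>(neighbours \<T> T))) (\<lambda>x. ub x - ul x))\<^sup>2 +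
        (\<Sum>S\<in>neighbours \<T> T. diameter T ^ 4 * (oscillation S (\<lambda>x. ul x - f x (yl x)))\<^sup>2))"
    using state_indicator_bound[OF dim', of W \<sigma>] by blast
  obtain C2 where C2: "C2 > 0"
    "\<And>\<T> T ub yb pb ul yl pl P. discrete_approximation \<Omega> f y\<^sub>\<Omega> K ub yb pb ul yl pl W \<Longrightarrow> regular_mesh \<Omega> \<T> \<sigma> \<Longrightarrow>
      T \<in> \<T> \<Longrightarrow> yl \<in> fe_space \<Omega> \<T> \<Longrightarrow> pl \<in> fe_space \<Omega> \<T> \<Longrightarrow>
      (\<And>p r. r > 0 \<Longrightarrow> cball p r \<subseteq> \<Omega> \<Longrightarrow> r ^ 4 / (r ^ DIM(real^'n))\<^sup>2 * (LINT x|lebesgue_on (cball p r). (pl x)\<^sup>2) \<le> Cl * E') \<Longrightarrow>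
      P \<ge> 0 \<Longrightarrow> AE x in lebesgue_on (\<Union>(neighbours \<T> T)). \<bar>pb x - pl x\<bar> \<le> P \<Longrightarrow>
      \<exists>X\<ge>0. eta_adj \<T> f y\<^sub>\<Omega> yl pl T \<le> ennreal X \<and>
        X\<^sup>2 \<le> C2 * ((L2_norm (lebesgue_on (\<Union>(neighbours \<T> T))) (\<lambda>x. yb x - yl x))\<^sup>2 + P\<^sup>2 +
        (\<Sum>S\<in>neighbours \<T> T. diameter T ^ (4 - DIM(real^'n)) * (oscillation S (\<lambda>x. y\<^sub>\<Omega> x + dy f x (yl x) * pl x))\<^sup>2))"
    using adjoint_indicator_bound[OF dim' Q, of W \<sigma>] by blast
  show ?thesis
  proof (intro exI[of _ "C1 + C2"] conjI ballI allI impI)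
    show "C1 + C2 > 0" using C1(1) C2(1) by simp
    fix \<T> ubar ybar pbar ul yl pl T
    assume \<T>: "\<T> \<in> \<TT>" and T: "T \<in> \<T>"
    assume "is_optimal_control (H10_space \<Omega>) \<Omega> f y\<^sub>\<Omega> a b ubar \<and>
      is_state (H10_space \<Omega>) \<Omega> f ubar ybar \<and>
      is_adjoint_state (H10_space \<Omega>) \<Omega> f y\<^sub>\<Omega> ybar pbar \<and>
      is_optimal_control (fe_space \<Omega> \<T>) \<Omega> f y\<^sub>\<Omega> a b ul \<and>
      is_state (fe_space \<Omega> \<T>) \<Omega> f ul yl \<and>
      is_adjoint_state (fe_space \<Omega> \<T>) \<Omega> f y\<^sub>\<Omega> yl pl"
    then have adm: "ubar \<in> admissible_controls \<Omega> a b" "ul \<in> admissible_controls \<Omega> a b"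
      and st: "is_state (H10_space \<Omega>) \<Omega> f ubar ybar" "is_state (fe_space \<Omega> \<T>) \<Omega> f ul yl"
      and adj: "is_adjoint_state (H10_space \<Omega>) \<Omega> f y\<^sub>\<Omega> ybar pbar" "is_adjoint_state (fe_space \<Omega> \<T>) \<Omega> f y\<^sub>\<Omega> yl pl"
      by (auto simp: is_optimal_control_def)
    have fe: "yl \<in> fe_space \<Omega> \<T>" "pl \<in> fe_space \<Omega> \<T>"
      using st(2) adj(2) by (auto simp: is_state_def is_adjoint_state_def)
    have sub: "fe_space \<Omega> \<T> \<subseteq> H10_space \<Omega>" by (auto simp: fe_space_def)
    have H10: "yl \<in> H10_space \<Omega>" "pl \<in> H10_space \<Omega>" "ybar \<in> H10_space \<Omega>"
      using fe sub st(1) by (auto simp: is_state_def)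
    have yE: "(LINT x|M\<Omega>. (ybar x)\<^sup>2) \<le> E" "(LINT x|M\<Omega>. (yl x)\<^sup>2) \<le> E"
      using E(2)[OF order_refl adm(1) st(1)] E(2)[OF sub adm(2) st(2)] .
    have gE: "(LINT x|M\<Omega>. (norm (grad \<Omega> pl x))\<^sup>2) \<le> E'"
      by (rule E'(2)[OF sub H10_L2[OF H10(1)] yE(2) adj(2)])
    have appr: "discrete_approximation \<Omega> f y\<^sub>\<Omega> K ubar ybar pbar ul yl pl W"
    proof unfold_locales
      show "ubar \<in> L2_space M\<Omega>" "ul \<in> L2_space M\<Omega>" using adm by (auto simp: admissible_controls_def)
      show "L2_norm M\<Omega> (\<lambda>x. 1 + \<bar>ybar x\<bar> + \<bar>yl x\<bar>) \<le> W"
        unfolding W_def by (rule weight_bound[OF H10_L2[OF H10(3)] H10_L2[OF H10(1)] yE])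
      show "\<exists>M. \<forall>x\<in>\<Omega>. \<bar>yl x\<bar> \<le> M" "\<exists>M. \<forall>x\<in>\<Omega>. \<bar>pl x\<bar> \<le> M"
        using bounded_on_closure[OF domain(2)] fe_spaceD(2) fe by blast+
    qed (use st(1) adj(1) H10 in auto)
    have plQ: "r ^ 4 / (r ^ DIM(real^'n))\<^sup>2 * (LINT x|lebesgue_on (cball p r). (pl x)\<^sup>2) \<le> Cl * E'"
      if "r > 0" "cball p r \<subseteq> \<Omega>" for p r
      using Cl(2)[OF H10(2) that] mult_left_mono[OF gE, of Cl] Cl(1) by linarith
    define h where "h = diameter T"
    define \<omega> where "\<omega> = \<Union>(neighbours \<T> T)"
    define Y where "Y = (L2_norm (lebesgue_on \<omega>) (\<lambda>x. ybar x - yl x))\<^sup>2"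
    define U where "U = h powr (4 - real CARD('n)) * (L1_norm (lebesgue_on \<omega>) (\<lambda>x. ubar x - ul x))\<^sup>2"
    define O1 where "O1 = (\<Sum>S\<in>neighbours \<T> T. h ^ 4 * (oscillation S (\<lambda>x. ul x - f x (yl x)))\<^sup>2)"
    define O2 where "O2 = (\<Sum>S\<in>neighbours \<T> T. h powr (4 - real CARD('n)) * (oscillation S (\<lambda>x. y\<^sub>\<Omega> x + dy f x (yl x) * pl x))\<^sup>2)"
    define L where "L = Linf_norm (lebesgue_on \<omega>) (\<lambda>x. pbar x - pl x)"
    have h: "h > 0" unfolding h_def by (rule simplex_diameter_pos[OF conforming_mesh_simplex[OF conf[OF \<T>] T]])
    \<comment> \<open>Truncated subtraction agrees with real subtraction because the dimension is at
      most 3.\<close>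
    have "h powr (4 - real CARD('n)) = h powr real (4 - CARD('n))"
      using dim by auto
    also have "\<dots> = h ^ (4 - CARD('n))" using h by (rule powr_realpow)
    finally have hp: "h ^ (4 - CARD('n)) = h powr (4 - real CARD('n))" by simp
    have nn: "Y \<ge> 0" "U \<ge> 0" "O1 \<ge> 0" "O2 \<ge> 0" by (auto simp: Y_def U_def O1_def O2_def intro!: sum_nonneg)
    have b1: "(eta_st \<T> f ul yl T)\<^sup>2 \<le> C1 * (Y + U + O1)"
      using C1(2)[OF appr mesh[OF \<T>] T fe(1)] by (simp only: dimn h_def[symmetric] hp Y_def U_def O1_def \<omega>_def)
    have "ennreal ((eta_st \<T> f ul yl T)\<^sup>2) + (eta_adj \<T> f y\<^sub>\<Omega> yl pl T)\<^sup>2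
      \<le> ennreal (C1 + C2) * (ennreal Y + L\<^sup>2 + ennreal U + ennreal (O1 + O2))"
    proof (cases "L = \<infinity>")
      \<comment> \<open>An infinite adjoint error makes the right-hand side infinite, as the
        constant is positive; in the other case all quantities are real.\<close>
      case True
      then have "ennreal (C1 + C2) * (ennreal Y + L\<^sup>2 + ennreal U + ennreal (O1 + O2)) = \<infinity>"
        using C1(1) C2(1) by (simp add: ennreal_mult_eq_top_iff power2_eq_square)
      then show ?thesis by simp
    next
      case False
      define P where "P = enn2real L"
      have P0: "P \<ge> 0" by (simp add: P_def)
      have LP: "L = ennreal P" using False by (simp add: P_def less_top)
      have "AE x in lebesgue_on \<omega>. ennreal \<bar>pbar x - pl x\<bar> \<le> L"
        unfolding L_def Linf_norm_def by (rule esssup_AE)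
      then have PA: "AE x in lebesgue_on \<omega>. \<bar>pbar x - pl x\<bar> \<le> P"
        unfolding LP using P0 by simp
      obtain X where X: "X \<ge> 0" "eta_adj \<T> f y\<^sub>\<Omega> yl pl T \<le> ennreal X" "X\<^sup>2 \<le> C2 * (Y + P\<^sup>2 + O2)"
        using C2(2)[OF appr mesh[OF \<T>] T fe plQ P0 PA[unfolded \<omega>_def]]
        by (auto simp only: dimn h_def[symmetric] hp Y_def O2_def \<omega>_def)
      have "(eta_adj \<T> f y\<^sub>\<Omega> yl pl T)\<^sup>2 \<le> (ennreal X)\<^sup>2" by (intro power_mono X(2)) simp
      also have "\<dots> = ennreal (X\<^sup>2)" using X(1) by (simp add: ennreal_power)
      finally have "ennreal ((eta_st \<T> f ul yl T)\<^sup>2) + (eta_adj \<T> f y\<^sub>\<Omega> yl pl T)\<^sup>2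
          \<le> ennreal ((eta_st \<T> f ul yl T)\<^sup>2) + ennreal (X\<^sup>2)" by (rule add_left_mono)
      also have "\<dots> = ennreal ((eta_st \<T> f ul yl T)\<^sup>2 + X\<^sup>2)" by simp
      also have "\<dots> \<le> ennreal ((C1 + C2) * (Y + P\<^sup>2 + U + (O1 + O2)))"
      proof (rule ennreal_leI)
        have "0 \<le> C1 * (P\<^sup>2 + O2)" "0 \<le> C2 * (U + O1)" using C1(1) C2(1) nn by auto
        then show "(eta_st \<T> f ul yl T)\<^sup>2 + X\<^sup>2 \<le> (C1 + C2) * (Y + P\<^sup>2 + U + (O1 + O2))"
          using b1 X(3) by (simp add: algebra_simps)
      qed
      also have "\<dots> = ennreal (C1 + C2) * (ennreal Y + L\<^sup>2 + ennreal U + ennreal (O1 + O2))"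
        using C1(1) C2(1) nn P0 by (simp add: LP ennreal_mult ennreal_power ennreal_plus)
      finally show ?thesis .
    qed
    then show "ennreal ((eta_st \<T> f ul yl T)\<^sup>2) + (eta_adj \<T> f y\<^sub>\<Omega> yl pl T)\<^sup>2
      \<le> ennreal (C1 + C2) * (
          ennreal ((L2_norm (lebesgue_on (\<Union>(neighbours \<T> T))) (\<lambda>x. ybar x - yl x))\<^sup>2) +
          (Linf_norm (lebesgue_on (\<Union>(neighbours \<T> T))) (\<lambda>x. pbar x - pl x))\<^sup>2 +
          ennreal (diameter T powr (4 - real CARD('n)) *
            (L1_norm (lebesgue_on (\<Union>(neighbours \<T> T))) (\<lambda>x. ubar x - ul x))\<^sup>2) +
          ennreal (\<Sum>T'\<in>neighbours \<T> T.
            diameter T ^ 4 * (oscillation T' (\<lambda>x. ul x - f x (yl x)))\<^sup>2 +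
            diameter T powr (4 - real CARD('n)) *
              (oscillation T' (\<lambda>x. y\<^sub>\<Omega> x + dy f x (yl x) * pl x))\<^sup>2))"
      unfolding Y_def U_def O1_def O2_def L_def \<omega>_def h_def sum.distrib .
  qed
qed

end
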